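(* Let $N \ge 2$, let $\Omega \subset \mathbb{R}^N$ be a bounded domain, and let $R = \sup_{x \in \Omega} |x|$. For $r \in (0,R)$ let $m(r) = \mathcal{H}^{N-1}(\{x \in \Omega : |x| = r\})$. If $$m_0 := \limsup_{r \to 0} \frac{m(r)}{r^{N-1}} < \omega_{N-1}$$ and $$m_R := \limsup_{r \to R} \frac{m(r)}{(R-r)^{N-1}} = 0,$$ then $$C_N(\Omega) > \left( \frac{N-1}{N} \right)^N$$ and $C_N(\Omega)$ is attained by some $u \in W^{1,N}_0(\Omega)$, $u \not\equiv 0$.
   Context: A domain is a nonempty connected open set. $\mathcal{H}^{N-1}$ is the $(N-1)$-dimensional Hausdorff measure, and $\omega_{N-1}$ is the surface area of the unit sphere $S^{N-1} \subset \mathbb{R}^N$. For a bounded domain $\Omega \subset \mathbb{R}^N$ with $R = \sup_{x \in \Omega}|x|$, define $$C_N(\Omega) = \inf_{u \in W^{1,N}_0(\Omega),\ u \not\equiv 0} \frac{\int_\Omega |\nabla u|^N\,dx}{\int_\Omega \frac{|u(x)|^N}{|x|^N \left( \log \frac{R}{|x|} \right)^N}\,dx}.$$ The infimum is said to be attained if some $u \in W^{1,N}_0(\Omega)$, $u \not\equiv 0$, realizes equality in the quotient. It is not assumed that $0 \in \Omega$. *)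

theory Defs
  imports "HOL-Analysis.Analysis"
begin

section \<open>Hausdorff measure\<close>

text \<open>The factor \<open>unit_ball_vol d * (diam / 2) ^ d\<close> is the usual normalisation, for which the
  \<open>d\<close>-dimensional measure agrees with Lebesgue measure on \<open>d\<close>-dimensional space. Boundedness of
  the covering sets is explicit because \<^term>\<open>diameter\<close> is only meaningful for bounded sets; the
  empty set is treated separately because of \<open>0 ^ 0 = 1\<close>.\<close>

definition hausdorff_premeasure :: "nat \<Rightarrow> real \<Rightarrow> 'a::metric_space set \<Rightarrow> ennreal" where
  "hausdorff_premeasure d \<delta> A =
     (INF U\<in>{U :: nat \<Rightarrow> 'a set. A \<subseteq> (\<Union>i. U i) \<and> (\<forall>i. bounded (U i) \<and> diameter (U i) \<le> \<delta>)}.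
        \<Sum>i. if U i = {} then 0 else ennreal (unit_ball_vol (real d) * (diameter (U i) / 2) ^ d))"

definition hausdorff_measure :: "nat \<Rightarrow> 'a::metric_space set \<Rightarrow> ennreal" where
  "hausdorff_measure d A = (SUP \<delta>\<in>{0<..}. hausdorff_premeasure d \<delta> A)"


section \<open>Test functions\<close>

primrec C_k :: "nat \<Rightarrow> ('a::euclidean_space \<Rightarrow> real) \<Rightarrow> bool" where
  "C_k 0 f \<longleftrightarrow> continuous_on UNIV f"
| "C_k (Suc k) f \<longleftrightarrow>
     f differentiable_on UNIV \<and> (\<forall>v. C_k k (\<lambda>x. frechet_derivative f (at x) v))"

definition test_functions :: "'a::euclidean_space set \<Rightarrow> ('a \<Rightarrow> real) set" where
  "test_functions \<Omega> =
     {\<phi>. (\<forall>k. C_k k \<phi>) \<and> compact (closure {x. \<phi> x \<noteq> 0}) \<and> closure {x. \<phi> x \<noteq> 0} \<subseteq> \<Omega>}"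

definition gradient :: "('a::euclidean_space \<Rightarrow> real) \<Rightarrow> 'a \<Rightarrow> 'a" where
  "gradient f x = (\<Sum>b\<in>Basis. frechet_derivative f (at x) b *\<^sub>R b)"


section \<open>Sobolev spaces\<close>

text \<open>Elements of \<open>L\<^sup>p\<close> and Sobolev spaces are represented by functions on the whole space, of which
  only the values almost everywhere on \<open>\<Omega>\<close> matter. The exponent is a natural number \<open>p \<ge> 1\<close>.\<close>

definition Lp_integral :: "nat \<Rightarrow> 'a::euclidean_space set \<Rightarrow> ('a \<Rightarrow> 'b::euclidean_space) \<Rightarrow> ennreal"
  where "Lp_integral p \<Omega> f = (\<integral>\<^sup>+x. ennreal (norm (f x) ^ p) \<partial>lebesgue_on \<Omega>)"

definition Lp :: "nat \<Rightarrow> 'a::euclidean_space set \<Rightarrow> ('a \<Rightarrow> 'b::euclidean_space) set" where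
  "Lp p \<Omega> = {f \<in> borel_measurable (lebesgue_on \<Omega>). Lp_integral p \<Omega> f < \<infinity>}"

definition has_weak_gradient ::
    "'a::euclidean_space set \<Rightarrow> ('a \<Rightarrow> real) \<Rightarrow> ('a \<Rightarrow> 'a) \<Rightarrow> bool" where
  "has_weak_gradient \<Omega> u g \<longleftrightarrow>
     (\<forall>K. compact K \<and> K \<subseteq> \<Omega> \<longrightarrow> u absolutely_integrable_on K \<and> g absolutely_integrable_on K) \<and>
     (\<forall>\<phi>\<in>test_functions \<Omega>.
        (\<integral>x. u x *\<^sub>R gradient \<phi> x \<partial>lebesgue_on \<Omega>) = - (\<integral>x. \<phi> x *\<^sub>R g x \<partial>lebesgue_on \<Omega>))"

definition W1 :: "nat \<Rightarrow> 'a::euclidean_space set \<Rightarrow> ('a \<Rightarrow> real) set" where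
  "W1 p \<Omega> = {u \<in> Lp p \<Omega>. \<exists>g\<in>Lp p \<Omega>. has_weak_gradient \<Omega> u g}"

text \<open>The closure of the test functions in \<open>W\<^sup>1\<^sup>,\<^sup>p(\<Omega>)\<close>. Weak gradients are unique almost everywhere,
  so it does not matter which representative \<open>g\<close> is used, here and below.\<close>

definition W1_0 :: "nat \<Rightarrow> 'a::euclidean_space set \<Rightarrow> ('a \<Rightarrow> real) set" where
  "W1_0 p \<Omega> =
     {u \<in> W1 p \<Omega>. \<exists>g\<in>Lp p \<Omega>. has_weak_gradient \<Omega> u g \<and>
        (\<exists>\<phi> :: nat \<Rightarrow> 'a \<Rightarrow> real.
           (\<forall>k. \<phi> k \<in> test_functions \<Omega>) \<and>
           (\<lambda>k. Lp_integral p \<Omega> (\<lambda>x. \<phi> k x - u x)) \<longlonglongrightarrow> 0 \<and>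
           (\<lambda>k. Lp_integral p \<Omega> (\<lambda>x. gradient (\<phi> k) x - g x)) \<longlonglongrightarrow> 0)}"

definition nonzero_on :: "'a::euclidean_space set \<Rightarrow> ('a \<Rightarrow> real) \<Rightarrow> bool" where
  "nonzero_on \<Omega> u \<longleftrightarrow> \<not> (AE x in lebesgue_on \<Omega>. u x = 0)"


section \<open>The critical Hardy inequality\<close>

definition outer_radius :: "'a::real_normed_vector set \<Rightarrow> real" where
  "outer_radius \<Omega> = (SUP x\<in>\<Omega>. norm x)"

definition hardy_integral :: "(real^'n) set \<Rightarrow> (real^'n \<Rightarrow> real) \<Rightarrow> ennreal" where
  "hardy_integral \<Omega> u =
     (\<integral>\<^sup>+x. ennreal (\<bar>u x\<bar> ^ CARD('n) /
                (norm x ^ CARD('n) * ln (outer_radius \<Omega> / norm x) ^ CARD('n))) \<partial>lebesgue_on \<Omega>)"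

text \<open>The quotient of a function \<open>u\<close> with weak gradient \<open>g\<close>; both integrals are extended
  nonnegative numbers.\<close>

definition hardy_quotient ::
    "(real^'n) set \<Rightarrow> (real^'n \<Rightarrow> real) \<Rightarrow> (real^'n \<Rightarrow> real^'n) \<Rightarrow> ennreal" where
  "hardy_quotient \<Omega> u g = Lp_integral CARD('n) \<Omega> g / hardy_integral \<Omega> u"

definition hardy_constant :: "(real^'n) set \<Rightarrow> ennreal" where
  "hardy_constant \<Omega> =
     Inf {hardy_quotient \<Omega> u g | u g.
            u \<in> W1_0 CARD('n) \<Omega> \<and> nonzero_on \<Omega> u \<and> has_weak_gradient \<Omega> u g}"

definition hardy_constant_attained_by :: "(real^'n) set \<Rightarrow> (real^'n \<Rightarrow> real) \<Rightarrow> bool" where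
  "hardy_constant_attained_by \<Omega> u \<longleftrightarrow>
     (\<exists>g. has_weak_gradient \<Omega> u g \<and> hardy_quotient \<Omega> u g = hardy_constant \<Omega>)"

definition slice_measure :: "(real^'n) set \<Rightarrow> real \<Rightarrow> ennreal" where
  "slice_measure \<Omega> r = hausdorff_measure (CARD('n) - 1) {x \<in> \<Omega>. norm x = r}"

end

theory Submission
  imports Defs "HOL-Complex_Analysis.Great_Picard" "HOL-Real_Asymp.Real_Asymp"
begin

text \<open>
  Let \<open>N\<close> be the dimension. The quotient has the constant \<open>((N - 1) / N) ^ N\<close> as a lower bound on every
  domain in the ball of radius \<open>R\<close>. It may be approached along functions that concentrate at the origin
  or at the outer sphere. The two conditions on slices exclude both: what is left of a minimising
  sequence is compact, so a minimiser exists, and the Hardy inequality is strict by a uniform margin.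

  \<^emph>\<open>No loss of mass at the ends.\<close> The condition at the origin says that the complement of \<open>\<Omega>\<close> occupies a
  fixed fraction of every small ball (\<open>hole_of_slices\<close>); there functions of the Sobolev space vanish, and
  a Poincare inequality (\<open>poincare_zero_set\<close>) on dyadic annuli bounds the Hardy integral over the annulus
  of radius \<open>R / 2 ^ j\<close> by \<open>j powi (- N)\<close> times the energy, which is summable
  (\<open>hardy_integral_near_origin\<close>). The condition at the outer sphere says that slices at distance \<open>d\<close> are
  \<open>o (d ^ (N - 1))\<close>; hence balls of radius \<open>\<kappa> * d\<close> lie at least half outside \<open>\<Omega>\<close>, for \<open>\<kappa>\<close> as small as
  desired, and the Poincare constant \<open>(\<kappa> * d) ^ N\<close> beats the weight \<open>d powi (- N)\<close>
  (\<open>hardy_integral_near_rim\<close>). Passing between slices and volumes uses two crude coarea inequalities,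
  \<open>slices_coarea_le\<close> and \<open>shell_measure_le_slices\<close>. In both regions the Hardy integral is thus at most a
  small multiple of the energy; in between the weight is bounded and \<open>rellich\<close> applies. So the embedding
  into the weighted space is compact (\<open>hardy_mass_compact\<close>).

  \<^emph>\<open>Strictness.\<close> The improved tangent inequality \<open>norm_power_add_ge\<close>, together with the divergence identity
  for a radial field (\<open>integral_dilation_eq\<close>), proves the Hardy inequality with a remainder
  (\<open>hardy_remainder\<close>): the energy exceeds \<open>((N - 1) / N) ^ N\<close> times the Hardy integral by a multiple of the
  energy of \<open>\<phi> / ln (R / norm x) powr ((N - 1) / N)\<close>, suitably weighted. That function vanishes on the hole at the
  origin, so Poincare's inequality bounds it, and with it the Hardy integral over the middle region, by
  the remainder. Since the ends carry little mass, the remainder of a normalised function is bounded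
  below (\<open>hardy_improvement\<close>).

  \<^emph>\<open>Attainment.\<close> Everything so far concerns test functions. Along a minimising sequence of test
  functions the masses of differences tend to zero by compactness, and Clarkson's inequality makes the
  gradients a Cauchy sequence (\<open>minimising_sequence_gradient_cauchy\<close>). The limit is a minimiser in the
  Sobolev space (\<open>minimiser_exists\<close>). Density and the uniqueness of weak gradients extend the lower bound
  to all admissible functions (\<open>least_quotient_le_sobolev\<close>).
\<close>

section \<open>Inequalities for powers of norms\<close>

text \<open>Raising the parallelogram identity to the power \<open>n / 2\<close>: superadditivity of \<open>s \<mapsto> s powr (n / 2)\<close>
  bounds the left-hand side, convexity the right-hand side. This is Clarkson's inequality pointwise;
  integrated, it measures how far two almost minimising gradients can be apart.\<close>

lemma norm_power_clarkson:
  fixes a b :: "'a::real_inner"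
  assumes "2 \<le> n"
  shows "norm ((1/2) *\<^sub>R (a + b)) ^ n + norm ((1/2) *\<^sub>R (a - b)) ^ n \<le> (norm a ^ n + norm b ^ n) / 2"
proof -
  define x where "x = norm ((1/2) *\<^sub>R (a + b))"
  define y where "y = norm ((1/2) *\<^sub>R (a - b))"
  have nn: "x \<ge> 0" "y \<ge> 0" by (auto simp: x_def y_def)
  have par: "x\<^sup>2 + y\<^sup>2 = ((norm a)\<^sup>2 + (norm b)\<^sup>2) / 2"
    unfolding x_def y_def power2_norm_eq_inner
    by (simp add: inner_simps inner_commute algebra_simps)
  define p where "p = real n / 2"
  have p: "p \<ge> 1" using assms by (simp add: p_def)
  have pw: "(z\<^sup>2) powr p = z ^ n" if "z \<ge> 0" for z :: real
  proof (cases "z = 0")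
    case False
    then have "z > 0" using that by simp
    then have "(z\<^sup>2) powr p = (z powr 2) powr p" by (simp add: powr_numeral)
    also have "\<dots> = z powr n" by (simp add: powr_powr p_def)
    finally show ?thesis using \<open>z > 0\<close> by (simp add: powr_realpow)
  qed (use assms in \<open>auto simp: p_def\<close>)
  have super: "u powr p + v powr p \<le> (u + v) powr p" if "u \<ge> 0" "v \<ge> 0" for u v :: real
  proof (cases "u + v = 0")
    case True
    then have "u = 0" "v = 0" using that by auto
    then show ?thesis by simp
  next
    case False
    then have s: "u + v > 0" using that by simp
    have le: "(w / (u+v)) powr p \<le> w / (u+v)" if "0 \<le> w" "w \<le> u+v" for w
    proof (cases "w = 0")
      case False
      have "(w / (u+v)) powr p \<le> (w/(u+v)) powr 1"
        using p that s False by (intro powr_mono') (auto simp: field_simps)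
      then show ?thesis using that s by simp
    qed auto
    have "u powr p + v powr p = ((u/(u+v)) powr p + (v/(u+v)) powr p) * (u+v) powr p"
      using s that by (simp add: powr_divide field_simps)
    also have "\<dots> \<le> (u/(u+v) + v/(u+v)) * (u+v) powr p"
      using le[of u] le[of v] that by (intro mult_right_mono add_mono) auto
    also have "\<dots> = (u+v) powr p" using s by (simp add: add_divide_distrib[symmetric])
    finally show ?thesis .
  qed
  have conv: "((1/2) * u + (1/2) * v) powr p \<le> (1/2) * u powr p + (1/2) * v powr p" if "u \<ge> 0" "v \<ge> 0" for u v :: real
  proof (cases "u = 0 \<or> v = 0")
    case True
    then show ?thesis using super[of "u/2" "u/2"] super[of "v/2" "v/2"] that by auto
  next
    case False
    then show ?thesis using convex_onD[OF powr_convex[OF p], of "1/2" u v] that by simp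
  qed
  have "x ^ n + y ^ n = (x\<^sup>2) powr p + (y\<^sup>2) powr p" using nn by (simp add: pw)
  also have "\<dots> \<le> (x\<^sup>2 + y\<^sup>2) powr p" by (intro super) auto
  also have "\<dots> = ((1/2) * (norm a)\<^sup>2 + (1/2) * (norm b)\<^sup>2) powr p" unfolding par by (simp add: field_simps)
  also have "\<dots> \<le> (1/2) * ((norm a)\<^sup>2) powr p + (1/2) * ((norm b)\<^sup>2) powr p"
    by (intro conv) auto
  also have "\<dots> = (norm a ^ n + norm b ^ n) / 2" by (simp add: pw)
  finally show ?thesis unfolding x_def y_def .
qed

text \<open>Convexity of \<open>s \<mapsto> s ^ n\<close> in the form of a tangent line.\<close>

lemma power_tangent_le:
  fixes a s :: real
  assumes "a \<ge> 0" "s \<ge> 0" "n \<ge> 1"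
  shows "a ^ n + real n * a ^ (n - 1) * (s - a) \<le> s ^ n"
proof (cases "a = 0")
  case True
  then show ?thesis using assms by (cases "n = 1") (auto simp: power_0_left)
next
  case False
  then have a: "a > 0" using assms by simp
  have "1 + real n * (s / a - 1) \<le> (1 + (s/a - 1)) ^ n"
    using assms a by (intro Bernoulli_inequality) (auto simp: field_simps)
  then have "a ^ n * (1 + real n * (s / a - 1)) \<le> a ^ n * (s / a) ^ n"
    using a by (intro mult_left_mono) auto
  moreover have "a ^ n * (s / a) ^ n = s ^ n" using a by (simp add: power_divide)
  moreover have "a ^ n * (1 + real n * (s / a - 1)) = a ^ n + real n * a ^ (n - 1) * (s - a)"
    using a assms(3) by (cases n) (auto simp: field_simps)
  ultimately show ?thesis by simp
qed

text \<open>Convexity applied to \<open>x = t *\<^sub>R (y /\<^sub>R t) + (1 - t) *\<^sub>R ((x - y) /\<^sub>R (1 - t))\<close>. The point is that the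
  coefficient of \<open>norm y ^ n\<close> tends to \<open>1\<close> for \<open>t\<close> near \<open>1\<close>, so that limits of norms can be compared
  by a pointwise inequality even where Minkowski's inequality is not at hand.\<close>

lemma norm_power_split:
  fixes x y :: "'a::real_normed_vector"
  assumes "0 < t" "t < 1" "n \<ge> 1"
  shows "norm x ^ n \<le> norm y ^ n / t ^ (n - 1) + norm (x - y) ^ n / (1 - t) ^ (n - 1)"
proof -
  define a where "a = norm y / t"
  define b where "b = norm (x - y) / (1 - t)"
  have ab: "a \<ge> 0" "b \<ge> 0" using assms by (auto simp: a_def b_def)
  have e: "norm y = t * a" "norm (x - y) = (1 - t) * b" using assms by (auto simp: a_def b_def)
  define m where "m = t * a + (1 - t) * b"
  have m: "m \<ge> 0" using ab assms by (simp add: m_def)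
  have "norm x \<le> m"
    unfolding m_def e[symmetric] using norm_triangle_sub[of x y] by simp
  then have "norm x ^ n \<le> m ^ n" by (intro power_mono) auto
  also have "m ^ n = t * (m ^ n + real n * m ^ (n - 1) * (a - m)) + (1 - t) * (m ^ n + real n * m ^ (n - 1) * (b - m))"
  proof -
    have "t * (a - m) + (1 - t) * (b - m) = 0" by (simp add: m_def algebra_simps)
    then have "real n * m ^ (n - 1) * (t * (a - m) + (1 - t) * (b - m)) = 0" by simp
    then show ?thesis by (simp add: algebra_simps)
  qed
  also have "\<dots> \<le> t * a ^ n + (1 - t) * b ^ n"
    using assms by (intro add_mono mult_left_mono power_tangent_le m ab) auto
  also have "t * a ^ n = norm y ^ n / t ^ (n - 1)"
    using assms by (cases n) (auto simp: a_def power_divide field_simps)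
  also have "(1 - t) * b ^ n = norm (x - y) ^ n / (1 - t) ^ (n - 1)"
    using assms by (cases n) (auto simp: b_def power_divide field_simps)
  finally show ?thesis .
qed

lemma norm_power_split_half:
  fixes x y :: "'a::real_normed_vector"
  assumes "n \<ge> 1"
  shows "norm x ^ n \<le> 2 ^ (n - 1) * (norm y ^ n + norm (x - y) ^ n)"
  using norm_power_split[of "1/2" n x y] assms by (simp add: power_divide field_simps)

text \<open>The tangent inequality for \<open>norm (A + B) ^ n\<close>, improved by a positive power of \<open>B\<close>. Clarkson's
  inequality for \<open>A + B\<close> and \<open>A\<close> produces the gain; the tangent inequality, taken from \<open>A\<close> to the
  midpoint, produces the first two terms. The gain is what later turns the Hardy inequality into a
  strict one.\<close>

lemma norm_power_add_ge:
  fixes A B :: "'a::real_inner"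
  assumes "2 \<le> n"
  shows "norm A ^ n + real n * norm A ^ (n - 2) * (A \<bullet> B) + norm B ^ n / 2 ^ (n - 1) \<le> norm (A + B) ^ n"
proof -
  \<comment> \<open>The midpoint of \<open>A\<close> and \<open>A + B\<close>.\<close>
  define M where "M = A + (1/2) *\<^sub>R B"
  have cl: "norm M ^ n + norm ((1/2) *\<^sub>R B) ^ n \<le> (norm (A + B) ^ n + norm A ^ n) / 2"
  proof -
    have "(1/2) *\<^sub>R (A + B + A) = M"
      by (simp add: M_def algebra_simps scaleR_left_distrib[symmetric])
    then show ?thesis using norm_power_clarkson[OF assms, of "A + B" A] by simp
  qed
  have tan: "norm A ^ n + real n * norm A ^ (n - 2) * (A \<bullet> B) / 2 \<le> norm M ^ n"
  proof -
    have "A \<bullet> M \<le> norm A * norm M" by (rule norm_cauchy_schwarz)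
    then have "(norm A)\<^sup>2 + (A \<bullet> B) / 2 \<le> norm A * norm M"
      by (simp add: M_def inner_simps power2_norm_eq_inner)
    then have "real n * norm A ^ (n - 2) * ((A \<bullet> B) / 2) \<le> real n * norm A ^ (n - 2) * (norm A * (norm M - norm A))"
      by (intro mult_left_mono) (auto simp: algebra_simps power2_eq_square)
    also have "\<dots> = real n * norm A ^ (n - 1) * (norm M - norm A)"
    proof -
      have "norm A ^ (n - 1) = norm A ^ (n - 2) * norm A"
        using assms by (metis One_nat_def Suc_1 Suc_diff_le diff_Suc_Suc power_Suc2)
      then show ?thesis by simp
    qed
    also have "\<dots> \<le> norm M ^ n - norm A ^ n"
      using power_tangent_le[of "norm A" "norm M" n] assms by simp
    finally show ?thesis by (simp add: field_simps)
  qed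
  have h: "norm ((1/2) *\<^sub>R B) ^ n = norm B ^ n / 2 ^ n" by (simp add: power_divide)
  have "2 * (norm B ^ n / 2 ^ n) = norm B ^ n / 2 ^ (n - 1)"
    using assms by (cases n) auto
  moreover have "2 * norm M ^ n + 2 * (norm B ^ n / 2 ^ n) \<le> norm (A + B) ^ n + norm A ^ n"
  proof -
    have "x + y \<le> z / 2 \<Longrightarrow> 2 * x + 2 * y \<le> z" for x y z :: real by simp
    then show ?thesis using cl unfolding h by blast
  qed
  moreover have "2 * m + 2 * q \<le> z + w \<Longrightarrow> w + y / 2 \<le> m \<Longrightarrow> 2 * q = v \<Longrightarrow> w + y + v \<le> z" for m q z w y v :: real
    by simp
  ultimately show ?thesis using tan by blast
qed

section \<open>Completeness of Lebesgue spaces\<close>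

lemma AE_tendsto_0_of_summable_nn_integral:
  fixes h :: "nat \<Rightarrow> 'x \<Rightarrow> real"
  assumes [measurable]: "\<And>k. h k \<in> borel_measurable M"
    and nn: "\<And>k x. h k x \<ge> 0"
    and le: "\<And>k. (\<integral>\<^sup>+x. ennreal (h k x) \<partial>M) \<le> ennreal ((1/2) ^ k)"
  shows "AE x in M. (\<lambda>k. h k x) \<longlonglongrightarrow> 0"
proof -
  have "(\<integral>\<^sup>+x. (\<Sum>k. ennreal (h k x)) \<partial>M) = (\<Sum>k. \<integral>\<^sup>+x. ennreal (h k x) \<partial>M)"
    by (intro nn_integral_suminf) auto
  also have "\<dots> \<le> (\<Sum>k. ennreal ((1/2) ^ k))"
    by (intro suminf_le le) auto
  also have "\<dots> = ennreal (\<Sum>k. (1/2) ^ k)"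
    by (intro suminf_ennreal_eq summable_sums) (auto simp: summable_geometric)
  finally have "(\<integral>\<^sup>+x. (\<Sum>k. ennreal (h k x)) \<partial>M) \<noteq> \<infinity>"
    using ennreal_less_top top.extremum_strict neq_top_trans by (metis infinity_ennreal_def)
  then have "AE x in M. (\<Sum>k. ennreal (h k x)) \<noteq> \<infinity>"
    by (intro nn_integral_PInf_AE) auto
  then show ?thesis
  proof (rule AE_mp, intro AE_I2 impI)
    fix x assume "(\<Sum>k. ennreal (h k x)) \<noteq> \<infinity>"
    then have "summable (\<lambda>k. h k x)"
      by (intro summable_suminf_not_top nn) auto
    then show "(\<lambda>k. h k x) \<longlonglongrightarrow> 0" by (rule summable_LIMSEQ_zero)
  qed
qed

lemma strict_mono_choice:
  assumes "\<And>k::nat. \<exists>K::nat. \<forall>j\<ge>K. P k j"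
  obtains s where "strict_mono (s :: nat \<Rightarrow> nat)" "\<And>k. \<forall>j\<ge>s k. P k j"
proof -
  from assms obtain K where K: "\<And>k j. j \<ge> K k \<Longrightarrow> P k j" by metis
  define s where "s k = (\<Sum>i\<le>k. Suc (K i))" for k
  have "strict_mono s" by (intro strict_monoI_Suc) (auto simp: s_def)
  moreover have "s k \<ge> K k" for k
    unfolding s_def using member_le_sum[of k "{..k}" "\<lambda>i. Suc (K i)"] by auto
  ultimately show ?thesis using K by (intro that[of s]) (auto intro: le_trans)
qed

lemma AE_convergent_subseq_of_Lp_limit:
  fixes f :: "nat \<Rightarrow> 'x \<Rightarrow> 'b::euclidean_space"
  assumes [measurable]: "\<And>k. f k \<in> borel_measurable M" "g \<in> borel_measurable M"
    and n: "n \<ge> 1"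
    and lim: "(\<lambda>k. \<integral>\<^sup>+x. ennreal (norm (f k x - g x) ^ n) \<partial>M) \<longlonglongrightarrow> 0"
  obtains s where "strict_mono (s :: nat \<Rightarrow> nat)" "AE x in M. (\<lambda>k. f (s k) x) \<longlonglongrightarrow> g x"
proof -
  have "\<exists>K. \<forall>j\<ge>K. (\<integral>\<^sup>+x. ennreal (norm (f j x - g x) ^ n) \<partial>M) < ennreal ((1/2) ^ k)" for k
    using order_tendstoD(2)[OF lim, of "ennreal ((1/2)^k)"] by (auto simp: eventually_sequentially)
  then obtain s where s: "strict_mono s"
    and le: "\<And>k. \<forall>j\<ge>s k. (\<integral>\<^sup>+x. ennreal (norm (f j x - g x) ^ n) \<partial>M) < ennreal ((1/2) ^ k)"
    by (rule strict_mono_choice[of "\<lambda>k j. (\<integral>\<^sup>+x. ennreal (norm (f j x - g x) ^ n) \<partial>M) < ennreal ((1/2) ^ k)"]) blast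
  have "AE x in M. (\<lambda>k. norm (f (s k) x - g x) ^ n) \<longlonglongrightarrow> 0"
    using le by (intro AE_tendsto_0_of_summable_nn_integral) (auto intro: less_imp_le)
  then have "AE x in M. (\<lambda>k. f (s k) x) \<longlonglongrightarrow> g x"
  proof (rule AE_mp, intro AE_I2 impI)
    fix x assume "(\<lambda>k. norm (f (s k) x - g x) ^ n) \<longlonglongrightarrow> 0"
    then have "(\<lambda>k. root n (norm (f (s k) x - g x) ^ n)) \<longlonglongrightarrow> root n 0"
      by (intro tendsto_intros)
    then have "(\<lambda>k. norm (f (s k) x - g x)) \<longlonglongrightarrow> 0"
      using n by (simp add: real_root_power_cancel)
    then show "(\<lambda>k. f (s k) x) \<longlonglongrightarrow> g x" by (simp add: LIM_zero_iff tendsto_norm_zero_iff)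
  qed
  with s show ?thesis by (rule that)
qed

text \<open>The Riesz-Fischer argument: along a suitable subsequence the consecutive differences, even multiplied
  by \<open>2 ^ k\<close>, tend to zero almost everywhere, so it converges almost everywhere; Fatou's lemma then
  bounds the distance of the whole sequence to that limit.\<close>

lemma Lp_complete:
  fixes f :: "nat \<Rightarrow> 'x \<Rightarrow> 'b::euclidean_space"
  assumes [measurable]: "\<And>k. f k \<in> borel_measurable M"
    and n: "n \<ge> 1"
    and cauchy: "\<And>e. e > 0 \<Longrightarrow>
       \<exists>K. \<forall>j\<ge>K. \<forall>k\<ge>K. (\<integral>\<^sup>+x. ennreal (norm (f j x - f k x) ^ n) \<partial>M) \<le> ennreal e"
  obtains g where "g \<in> borel_measurable M"
    "(\<lambda>k. \<integral>\<^sup>+x. ennreal (norm (f k x - g x) ^ n) \<partial>M) \<longlonglongrightarrow> 0"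
proof -
  define e where "e k = (1/2::real) ^ k / 2 ^ (k * n)" for k
  have "\<exists>K. \<forall>j\<ge>K. \<forall>i\<ge>K. (\<integral>\<^sup>+x. ennreal (norm (f j x - f i x) ^ n) \<partial>M) \<le> ennreal (e k)" for k
    by (intro cauchy) (auto simp: e_def)
  then have "\<exists>K. \<forall>j\<ge>K. \<forall>i\<ge>j. (\<integral>\<^sup>+x. ennreal (norm (f j x - f i x) ^ n) \<partial>M) \<le> ennreal (e k)" for k
    by (meson order_trans)
  then obtain s where s: "strict_mono s"
    and le: "\<And>k. \<forall>j\<ge>s k. \<forall>i\<ge>j. (\<integral>\<^sup>+x. ennreal (norm (f j x - f i x) ^ n) \<partial>M) \<le> ennreal (e k)"
    by (rule strict_mono_choice[of "\<lambda>k j. \<forall>i\<ge>j. (\<integral>\<^sup>+x. ennreal (norm (f j x - f i x) ^ n) \<partial>M) \<le> ennreal (e k)"]) blast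
  define d where "d k x = 2 ^ k * norm (f (s k) x - f (s (Suc k)) x)" for k x
  have dm [measurable]: "d k \<in> borel_measurable M" for k by (simp add: d_def[abs_def])
  have "AE x in M. (\<lambda>k. d k x ^ n) \<longlonglongrightarrow> 0"
  proof (rule AE_tendsto_0_of_summable_nn_integral)
    fix k
    have "(\<integral>\<^sup>+x. ennreal (d k x ^ n) \<partial>M) = (\<integral>\<^sup>+x. ennreal (2 ^ (k * n)) * ennreal (norm (f (s k) x - f (s (Suc k)) x) ^ n) \<partial>M)"
      by (intro nn_integral_cong) (simp add: d_def power_mult_distrib power_mult ennreal_mult[symmetric])
    also have "\<dots> = ennreal (2 ^ (k * n)) * (\<integral>\<^sup>+x. ennreal (norm (f (s k) x - f (s (Suc k)) x) ^ n) \<partial>M)"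
      by (intro nn_integral_cmult) auto
    also have "\<dots> \<le> ennreal (2 ^ (k * n)) * ennreal (e k)"
      using le[of k] strict_mono_less_eq[OF s, of k "Suc k"] by (intro mult_left_mono) auto
    also have "\<dots> = ennreal ((1/2) ^ k)"
      by (simp add: e_def ennreal_mult[symmetric])
    finally show "(\<integral>\<^sup>+x. ennreal (d k x ^ n) \<partial>M) \<le> ennreal ((1/2) ^ k)" .
  qed (auto simp: d_def)
  then have conv: "AE x in M. convergent (\<lambda>k. f (s k) x)"
  proof (rule AE_mp, intro AE_I2 impI)
    fix x assume "(\<lambda>k. d k x ^ n) \<longlonglongrightarrow> 0"
    then have "eventually (\<lambda>k. d k x ^ n < 1) sequentially"
      by (rule order_tendstoD) auto
    then have ev: "eventually (\<lambda>k. norm (f (s (Suc k)) x - f (s k) x) \<le> (1/2) ^ k) sequentially"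
    proof eventually_elim
      case (elim k)
      have "d k x \<le> 1"
      proof (rule ccontr)
        assume "\<not> d k x \<le> 1"
        then have "1 ^ n \<le> d k x ^ n" by (intro power_mono) auto
        with elim show False by simp
      qed
      then show ?case by (simp add: d_def norm_minus_commute field_simps)
    qed
    have "summable (\<lambda>k. f (s (Suc k)) x - f (s k) x)"
      by (rule summable_comparison_test_ev[OF ev]) (simp add: summable_geometric)
    then have "convergent (\<lambda>m. \<Sum>k<m. f (s (Suc k)) x - f (s k) x)"
      by (simp add: summable_iff_convergent)
    then have "convergent (\<lambda>m. f (s m) x - f (s 0) x)"
      by (simp add: sum_lessThan_telescope[of "\<lambda>k. f (s k) x"])
    then have "convergent (\<lambda>m. (f (s m) x - f (s 0) x) + f (s 0) x)"
      by (intro convergent_add convergent_const)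
    then show "convergent (\<lambda>k. f (s k) x)" by simp
  qed
  define g where "g x = lim (\<lambda>k. f (s k) x)" for x
  have g [measurable]: "g \<in> borel_measurable M"
    unfolding g_def[abs_def] by measurable
  have lim: "AE x in M. (\<lambda>k. f (s k) x) \<longlonglongrightarrow> g x"
    using conv by (auto simp: g_def convergent_LIMSEQ_iff)
  have "(\<lambda>k. \<integral>\<^sup>+x. ennreal (norm (f k x - g x) ^ n) \<partial>M) \<longlonglongrightarrow> 0"
  proof (rule order_tendstoI)
    fix a :: ennreal assume a: "0 < a"
    obtain e where e: "0 < e" "ennreal e < a"
      using a by (metis dense ennreal_0 ennreal_less_iff ennreal_cases neq_top_trans less_imp_le order_refl top.not_eq_extremum)
    obtain K where K: "\<And>j k. j \<ge> K \<Longrightarrow> k \<ge> K \<Longrightarrow> (\<integral>\<^sup>+x. ennreal (norm (f j x - f k x) ^ n) \<partial>M) \<le> ennreal e"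
      using cauchy[OF e(1)] by blast
    have "(\<integral>\<^sup>+x. ennreal (norm (f j x - g x) ^ n) \<partial>M) < a" if j: "j \<ge> K" for j
    proof -
      have "(\<integral>\<^sup>+x. ennreal (norm (f j x - g x) ^ n) \<partial>M) =
            (\<integral>\<^sup>+x. liminf (\<lambda>k. ennreal (norm (f j x - f (s k) x) ^ n)) \<partial>M)"
      proof (rule nn_integral_cong_AE, rule AE_mp[OF lim], intro AE_I2 impI)
        fix x assume "(\<lambda>k. f (s k) x) \<longlonglongrightarrow> g x"
        then have "(\<lambda>k. ennreal (norm (f j x - f (s k) x) ^ n)) \<longlonglongrightarrow> ennreal (norm (f j x - g x) ^ n)"
          by (intro tendsto_intros)
        from lim_imp_Liminf[OF trivial_limit_sequentially this]
        show "ennreal (norm (f j x - g x) ^ n) = liminf (\<lambda>k. ennreal (norm (f j x - f (s k) x) ^ n))"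
          by simp
      qed
      also have "\<dots> \<le> liminf (\<lambda>k. \<integral>\<^sup>+x. ennreal (norm (f j x - f (s k) x) ^ n) \<partial>M)"
        by (intro nn_integral_liminf) auto
      also have "\<dots> \<le> ennreal e"
      proof (rule Liminf_le)
        show "eventually (\<lambda>k. (\<integral>\<^sup>+x. ennreal (norm (f j x - f (s k) x) ^ n) \<partial>M) \<le> ennreal e) sequentially"
          using K[OF j] seq_suble[OF s] by (intro eventually_sequentiallyI[of K]) (meson le_trans)
      qed auto
      finally show ?thesis using e by auto
    qed
    then show "eventually (\<lambda>k. (\<integral>\<^sup>+x. ennreal (norm (f k x - g x) ^ n) \<partial>M) < a) sequentially"
      by (auto simp: eventually_sequentially)
  qed auto
  with g show ?thesis by (rule that)
qed

section \<open>Calculus of smooth functions\<close>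

lemma has_derivative_gradient:
  fixes f :: "'a::euclidean_space \<Rightarrow> real"
  assumes "f differentiable (at x)"
  shows "(f has_derivative (\<lambda>v. gradient f x \<bullet> v)) (at x)"
proof -
  have d: "(f has_derivative frechet_derivative f (at x)) (at x)"
    using assms frechet_derivative_works by blast
  then have lin: "linear (frechet_derivative f (at x))"
    using has_derivative_linear by blast
  have "frechet_derivative f (at x) v = gradient f x \<bullet> v" for v
  proof -
    have "frechet_derivative f (at x) v = frechet_derivative f (at x) (\<Sum>b\<in>Basis. (v \<bullet> b) *\<^sub>R b)"
      by (simp add: euclidean_representation)
    also have "\<dots> = (\<Sum>b\<in>Basis. (v \<bullet> b) * frechet_derivative f (at x) b)"
      by (simp add: linear_sum[OF lin] linear_cmul[OF lin])
    also have "\<dots> = gradient f x \<bullet> v"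
      by (simp add: gradient_def inner_sum_left inner_sum_right inner_commute[of v] mult.commute)
    finally show ?thesis .
  qed
  then have "frechet_derivative f (at x) = (\<lambda>v. gradient f x \<bullet> v)" by blast
  with d show ?thesis by simp
qed

lemma gradient_eqI:
  fixes f :: "'a::euclidean_space \<Rightarrow> real"
  assumes "(f has_derivative (\<lambda>v. g \<bullet> v)) (at x)"
  shows "gradient f x = g"
proof -
  have "frechet_derivative f (at x) = (\<lambda>v. g \<bullet> v)"
    using frechet_derivative_at[OF assms] by simp
  then show ?thesis by (simp add: gradient_def euclidean_representation)
qed

lemma C_k_const [simp]: "C_k k (\<lambda>x::'a::euclidean_space. c)"
  by (induction k arbitrary: c) auto

lemma frechet_derivative_inner_const:
  "frechet_derivative (\<lambda>x::'a::euclidean_space. x \<bullet> a) (at x) = (\<lambda>v. v \<bullet> a)"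
  by (rule frechet_derivative_at[symmetric]) (auto intro!: derivative_eq_intros)

lemma C_k_inner [simp]: "C_k k (\<lambda>x::'a::euclidean_space. x \<bullet> a)"
  by (cases k) (auto simp: frechet_derivative_inner_const differentiable_on_def
      intro!: continuous_intros derivative_intros)

lemma C_k_imp_differentiable:
  assumes "C_k (Suc k) f" shows "f differentiable (at x)"
  using assms by (simp add: differentiable_on_def)

lemma C_k_SucD: "C_k (Suc k) f \<Longrightarrow> C_k k f"
proof (induction k arbitrary: f)
  case 0
  then show ?case by (auto intro: differentiable_imp_continuous_on)
next
  case (Suc k)
  then show ?case by (metis C_k.simps(2))
qed

lemma C_k_add: "C_k k f \<Longrightarrow> C_k k g \<Longrightarrow> C_k k (\<lambda>x. f x + g x)"
proof (induction k arbitrary: f g)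
  case 0
  then show ?case by (auto intro: continuous_intros)
next
  case (Suc k)
  note df = C_k_imp_differentiable[OF Suc.prems(1)] and dg = C_k_imp_differentiable[OF Suc.prems(2)]
  have "frechet_derivative (\<lambda>x. f x + g x) (at x) v = frechet_derivative f (at x) v + frechet_derivative g (at x) v" for x v
    using frechet_derivative_at[OF has_derivative_add[OF df[unfolded frechet_derivative_works] dg[unfolded frechet_derivative_works]], of x]
    by (metis (no_types, lifting))
  then show ?case using Suc by (auto intro: differentiable_on_add)
qed

lemma C_k_mult: "C_k k f \<Longrightarrow> C_k k g \<Longrightarrow> C_k k (\<lambda>x. f x * g x)"
proof (induction k arbitrary: f g)
  case 0
  then show ?case by (auto intro: continuous_intros)
next
  case (Suc k)
  note df = C_k_imp_differentiable[OF Suc.prems(1)] and dg = C_k_imp_differentiable[OF Suc.prems(2)]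
  have "frechet_derivative (\<lambda>x. f x * g x) (at x) v
      = f x * frechet_derivative g (at x) v + frechet_derivative f (at x) v * g x" for x v
    using frechet_derivative_at[OF has_derivative_mult[OF df[unfolded frechet_derivative_works] dg[unfolded frechet_derivative_works]], of x]
    by (metis (no_types, lifting))
  moreover have "(\<lambda>x. f x * g x) differentiable_on UNIV"
    using df dg by (simp add: differentiable_on_def differentiable_mult)
  moreover have "C_k k (\<lambda>x. f x * frechet_derivative g (at x) v + frechet_derivative f (at x) v * g x)" for v
    using Suc.prems C_k_SucD[OF Suc.prems(1)] C_k_SucD[OF Suc.prems(2)]
    by (intro C_k_add Suc.IH) auto
  ultimately show ?case by simp
qed

definition smooth :: "('a::euclidean_space \<Rightarrow> real) \<Rightarrow> bool" where
  "smooth f \<longleftrightarrow> (\<forall>k. C_k k f)"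

lemma smooth_intros:
  "smooth (\<lambda>x::'a::euclidean_space. c)"
  "smooth (\<lambda>x::'a::euclidean_space. x \<bullet> a)"
  "smooth f \<Longrightarrow> smooth g \<Longrightarrow> smooth (\<lambda>x::'a::euclidean_space. f x + g x)"
  "smooth f \<Longrightarrow> smooth g \<Longrightarrow> smooth (\<lambda>x::'a::euclidean_space. f x * g x)"
  by (auto simp: smooth_def C_k_add C_k_mult)

lemma smooth_diff:
  assumes "smooth f" "smooth g" shows "smooth (\<lambda>x::'a::euclidean_space. f x - g x)"
  using smooth_intros(3)[OF assms(1) smooth_intros(4)[OF smooth_intros(1)[of "-1"] assms(2)]] by simp

lemma smooth_prod:
  assumes "finite I" "\<And>i. i \<in> I \<Longrightarrow> smooth (f i)"
  shows "smooth (\<lambda>x::'a::euclidean_space. \<Prod>i\<in>I. f i x)"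
  using assms by (induction I) (auto intro: smooth_intros)

text \<open>The standard flat function \<open>exp (- 1 / t)\<close>, together with its quotients by powers of \<open>t\<close>: the family is
  closed under differentiation up to linear combinations, so all derivatives can be handled by one
  induction over the whole family.\<close>

definition flat_exp :: "nat \<Rightarrow> real \<Rightarrow> real" where
  "flat_exp m t = (if t > 0 then exp (- 1 / t) / t ^ m else 0)"

lemma flat_exp_has_derivative:
  "(flat_exp m has_real_derivative (- real m * flat_exp (Suc m) t + flat_exp (Suc (Suc m)) t)) (at t)"
proof (cases t "0::real" rule: linorder_cases)
  case greater
  have "((\<lambda>t. exp (- 1 / t) / t ^ m) has_real_derivative
      (- real m * (exp (-1/t) / t ^ Suc m) + exp (-1/t) / t ^ Suc (Suc m))) (at t)"
    using greater
    by (auto intro!: derivative_eq_intros simp: field_simps power2_eq_square) (cases m; simp add: field_simps)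
  then have "(flat_exp m has_real_derivative
      (- real m * (exp (-1/t) / t ^ Suc m) + exp (-1/t) / t ^ Suc (Suc m))) (at t)"
    by (rule has_field_derivative_transform_within_open[where S = "{0<..}"]) (use greater in \<open>auto simp: flat_exp_def\<close>)
  then show ?thesis using greater by (simp add: flat_exp_def)
next
  case less
  have "((\<lambda>t. 0) has_real_derivative 0) (at t)" by simp
  then have "(flat_exp m has_real_derivative 0) (at t)"
    by (rule has_field_derivative_transform_within_open[where S = "{..<0}"]) (use less in \<open>auto simp: flat_exp_def\<close>)
  then show ?thesis using less by (simp add: flat_exp_def)
next
  case equal
  have r: "((\<lambda>h::real. exp (- 1 / h) / h ^ Suc m) \<longlongrightarrow> 0) (at_right 0)"
  proof -
    have "exp (- 1 / h) = 1 / exp (1 / h)" for h :: real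
      by (metis exp_minus inverse_eq_divide minus_divide_left)
    then have "exp (- 1 / h) / h ^ Suc m = inverse h ^ Suc m / exp (inverse h)" for h :: real
      by (simp only: inverse_eq_divide) (simp add: power_divide)
    then have "(\<lambda>h. exp (- 1 / h) / h ^ Suc m) = (\<lambda>h::real. inverse h ^ Suc m / exp (inverse h))"
      by (intro ext)
    then show ?thesis
      using filterlim_compose[OF tendsto_power_div_exp_0[of "Suc m"] filterlim_inverse_at_top_right]
      by (simp only:)
  qed
  have "((\<lambda>h. flat_exp m h / h) \<longlongrightarrow> 0) (at_right 0)"
    by (rule Lim_transform_eventually[OF r])
       (auto simp: eventually_at_right_less flat_exp_def eventually_at_filter)
  moreover have "((\<lambda>h. flat_exp m h / h) \<longlongrightarrow> 0) (at_left 0)"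
    by (rule Lim_transform_eventually[OF tendsto_const])
       (auto simp: flat_exp_def eventually_at_filter)
  ultimately have "((\<lambda>h. flat_exp m h / h) \<longlongrightarrow> 0) (at 0)"
    by (simp add: filterlim_at_split)
  then show ?thesis using equal by (simp add: DERIV_def flat_exp_def)
qed

text \<open>By induction on \<open>k\<close> for all \<open>m\<close> at once: the derivative of \<open>flat_exp m\<close> is a combination of
  \<open>flat_exp (Suc m)\<close> and \<open>flat_exp (Suc (Suc m))\<close>, multiplied by a derivative of \<open>h\<close>, and these are
  covered by the hypothesis.\<close>

lemma C_k_flat_exp:
  assumes h: "smooth (h :: 'a::euclidean_space \<Rightarrow> real)"
  shows "C_k k (\<lambda>x. flat_exp m (h x))"
proof (induction k arbitrary: m)
  case 0
  have "continuous_on UNIV (flat_exp m)"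
    by (meson DERIV_continuous_on DERIV_subset flat_exp_has_derivative subset_UNIV)
  moreover have "continuous_on UNIV h" using h by (metis smooth_def C_k.simps(1))
  ultimately show ?case by (auto intro: continuous_on_compose2)
next
  case (Suc k)
  have dh: "h differentiable (at x)" for x using h C_k_imp_differentiable[of 0 h] by (auto simp: smooth_def)
  have *: "((\<lambda>x. flat_exp m (h x)) has_derivative
      (\<lambda>v. (- real m * flat_exp (Suc m) (h x) + flat_exp (Suc (Suc m)) (h x)) * frechet_derivative h (at x) v)) (at x)" for x
    using has_derivative_compose[OF dh[unfolded frechet_derivative_works, of x] flat_exp_has_derivative[THEN has_field_derivative_imp_has_derivative]]
    by (simp add: o_def)
  have eq: "frechet_derivative (\<lambda>x. flat_exp m (h x)) (at x) v =
     (- real m * flat_exp (Suc m) (h x) + flat_exp (Suc (Suc m)) (h x)) * frechet_derivative h (at x) v" for x v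
    using frechet_derivative_at[OF *[of x]] by metis
  have "C_k k (\<lambda>x. frechet_derivative h (at x) v)" for v
    using h by (metis C_k.simps(2) smooth_def)
  then have "C_k k (\<lambda>x. (- real m * flat_exp (Suc m) (h x) + flat_exp (Suc (Suc m)) (h x)) * frechet_derivative h (at x) v)" for v
    by (intro C_k_mult C_k_add Suc.IH C_k_const)
  moreover have "(\<lambda>x. flat_exp m (h x)) differentiable_on UNIV"
    using * by (auto simp: differentiable_on_def differentiable_def)
  ultimately show ?case by (simp add: eq)
qed

lemma smooth_flat_exp: "smooth h \<Longrightarrow> smooth (\<lambda>x. flat_exp m (h x))"
  using C_k_flat_exp by (auto simp: smooth_def)

subsection \<open>Test functions\<close>

lemma test_functions_iff:
  "\<phi> \<in> test_functions \<Omega> \<longleftrightarrow>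
     smooth \<phi> \<and> compact (closure {x. \<phi> x \<noteq> 0}) \<and> closure {x. \<phi> x \<noteq> 0} \<subseteq> \<Omega>"
  by (auto simp: test_functions_def smooth_def)

lemma test_functions_smooth: "\<phi> \<in> test_functions \<Omega> \<Longrightarrow> smooth \<phi>"
  by (simp add: test_functions_iff)

lemma smooth_has_derivative: "smooth f \<Longrightarrow> (f has_derivative (\<lambda>v. gradient f x \<bullet> v)) (at x)"
  using C_k_imp_differentiable[of 0] has_derivative_gradient by (metis smooth_def)

lemma smooth_continuous: "smooth f \<Longrightarrow> continuous_on A f"
  by (metis C_k.simps(1) continuous_on_subset smooth_def subset_UNIV)

lemma smooth_continuous_gradient:
  assumes "smooth f" shows "continuous_on A (gradient f)"
proof -
  have "continuous_on UNIV (\<lambda>x. frechet_derivative f (at x) v)" for v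
    using assms by (metis C_k.simps smooth_def)
  then have "continuous_on A (\<lambda>x. frechet_derivative f (at x) v)" for v
    using continuous_on_subset by blast
  then show ?thesis unfolding gradient_def[abs_def] by (intro continuous_intros)
qed

lemma gradient_mult:
  assumes "smooth f" "smooth g"
  shows "gradient (\<lambda>x. f x * g x) x = f x *\<^sub>R gradient g x + g x *\<^sub>R gradient f x"
  by (rule gradient_eqI, rule has_derivative_eq_rhs[OF has_derivative_mult[OF smooth_has_derivative smooth_has_derivative]])
     (use assms in \<open>auto simp: inner_simps\<close>)

lemma gradient_add:
  assumes "smooth f" "smooth g"
  shows "gradient (\<lambda>x. f x + g x) x = gradient f x + gradient g x"
  by (rule gradient_eqI, rule has_derivative_eq_rhs[OF has_derivative_add[OF smooth_has_derivative smooth_has_derivative]])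
     (use assms in \<open>auto simp: inner_simps\<close>)

lemma gradient_diff:
  assumes "smooth f" "smooth g"
  shows "gradient (\<lambda>x. f x - g x) x = gradient f x - gradient g x"
  by (rule gradient_eqI, rule has_derivative_eq_rhs[OF has_derivative_diff[OF smooth_has_derivative smooth_has_derivative]])
     (use assms in \<open>auto simp: inner_simps\<close>)

lemma gradient_cmult:
  assumes "smooth f"
  shows "gradient (\<lambda>x. c * f x) x = c *\<^sub>R gradient f x"
  by (rule gradient_eqI, rule has_derivative_eq_rhs[OF has_derivative_mult_right[OF smooth_has_derivative]])
     (use assms in \<open>auto simp: inner_simps\<close>)

lemma gradient_eq_0:
  assumes "x \<notin> closure {x. f x \<noteq> 0}"
  shows "gradient f x = 0"
proof (rule gradient_eqI)
  have "((\<lambda>x. 0) has_derivative (\<lambda>v. 0 \<bullet> v)) (at x)" by simp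
  then show "(f has_derivative (\<lambda>v. 0 \<bullet> v)) (at x)"
    by (rule has_derivative_transform_within_open[where s = "- closure {x. f x \<noteq> 0}"])
       (use assms closure_subset[of "{x. f x \<noteq> 0}"] in \<open>auto simp: open_Compl\<close>)
qed

lemma test_functions_gradient_support:
  assumes "\<phi> \<in> test_functions \<Omega>" "x \<notin> \<Omega>"
  shows "\<phi> x = 0" "gradient \<phi> x = 0"
  using assms closure_subset[of "{x. \<phi> x \<noteq> 0}"] gradient_eq_0[of x \<phi>] by (auto simp: test_functions_iff)

lemma test_functions_subsetI:
  assumes "smooth f" "compact K" "K \<subseteq> \<Omega>" "\<And>x. x \<notin> K \<Longrightarrow> f x = 0"
  shows "f \<in> test_functions \<Omega>"
proof -
  have "closure {x. f x \<noteq> 0} \<subseteq> K"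
    using assms by (intro closure_minimal compact_imp_closed) auto
  moreover from this have "compact (closure {x. f x \<noteq> 0})"
    using assms(2) by (metis bounded_closed_imp_seq_compact bounded_subset closed_closure compact_eq_bounded_closed)
  ultimately show ?thesis
    using assms by (auto simp: test_functions_iff)
qed

lemma test_functions_supportE:
  assumes "\<phi> \<in> test_functions \<Omega>"
  obtains K where "compact K" "K \<subseteq> \<Omega>" "\<And>x. x \<notin> K \<Longrightarrow> \<phi> x = 0" "\<And>x. x \<notin> K \<Longrightarrow> gradient \<phi> x = 0"
proof (rule that)
  show "compact (closure {x. \<phi> x \<noteq> 0})" "closure {x. \<phi> x \<noteq> 0} \<subseteq> \<Omega>"
    using assms by (auto simp: test_functions_iff)
qed (use gradient_eq_0 closure_subset[of "{x. \<phi> x \<noteq> 0}"] in auto)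

lemma test_functions_diff:
  assumes "\<phi> \<in> test_functions \<Omega>" "\<psi> \<in> test_functions \<Omega>"
  shows "(\<lambda>x. \<phi> x - \<psi> x) \<in> test_functions \<Omega>"
proof -
  obtain K L where "compact K" "K \<subseteq> \<Omega>" "\<And>x. x \<notin> K \<Longrightarrow> \<phi> x = 0" "compact L" "L \<subseteq> \<Omega>" "\<And>x. x \<notin> L \<Longrightarrow> \<psi> x = 0"
    using assms by (metis test_functions_supportE)
  then show ?thesis
    using assms by (intro test_functions_subsetI[where K = "K \<union> L"] smooth_diff) (auto simp: test_functions_smooth)
qed

lemma test_functions_add:
  assumes "\<phi> \<in> test_functions \<Omega>" "\<psi> \<in> test_functions \<Omega>"
  shows "(\<lambda>x. \<phi> x + \<psi> x) \<in> test_functions \<Omega>"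
proof -
  obtain K L where "compact K" "K \<subseteq> \<Omega>" "\<And>x. x \<notin> K \<Longrightarrow> \<phi> x = 0" "compact L" "L \<subseteq> \<Omega>" "\<And>x. x \<notin> L \<Longrightarrow> \<psi> x = 0"
    using assms by (metis test_functions_supportE)
  then show ?thesis
    using assms by (intro test_functions_subsetI[where K = "K \<union> L"] smooth_intros) (auto simp: test_functions_smooth)
qed

lemma test_functions_cmult:
  assumes "\<phi> \<in> test_functions \<Omega>"
  shows "(\<lambda>x. c * \<phi> x) \<in> test_functions \<Omega>"
proof -
  obtain K where "compact K" "K \<subseteq> \<Omega>" "\<And>x. x \<notin> K \<Longrightarrow> \<phi> x = 0"
    using assms by (metis test_functions_supportE)
  then show ?thesis
    using assms by (intro test_functions_subsetI[where K = "K"] smooth_intros) (auto simp: test_functions_smooth)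
qed

text \<open>If \<open>a\<close> is componentwise at most \<open>b\<close>, a smooth function that is positive exactly on
  \<open>box a b\<close>. The factor \<open>Suc n\<close> stretches the argument of \<open>exp (- 1 / t)\<close>, so that these functions increase to the indicator of the box.\<close>

definition box_bump :: "nat \<Rightarrow> 'a::euclidean_space \<Rightarrow> 'a \<Rightarrow> 'a \<Rightarrow> real" where
  "box_bump n a b x = (\<Prod>i\<in>Basis. flat_exp 0 (real (Suc n) * ((x \<bullet> i - a \<bullet> i) * (b \<bullet> i - x \<bullet> i))))"

lemma flat_exp_0_bounds: "0 \<le> flat_exp 0 t" "flat_exp 0 t \<le> 1"
  by (auto simp: flat_exp_def)

lemma box_bump_bounds: "0 \<le> box_bump n a b x" "box_bump n a b x \<le> 1"
  unfolding box_bump_def by (auto intro!: prod_nonneg prod_le_1 simp: flat_exp_0_bounds)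

lemma box_bump_eq_0:
  assumes "x \<notin> box a b" "\<And>i. i \<in> Basis \<Longrightarrow> a \<bullet> i \<le> b \<bullet> i"
  shows "box_bump n a b x = 0"
proof -
  obtain i where i: "i \<in> Basis" "x \<bullet> i \<le> a \<bullet> i \<or> b \<bullet> i \<le> x \<bullet> i"
    using assms(1) by (auto simp: box_def not_less)
  from i(2) have "(x \<bullet> i - a \<bullet> i) * (b \<bullet> i - x \<bullet> i) \<le> 0"
  proof
    assume "x \<bullet> i \<le> a \<bullet> i"
    then show ?thesis using assms(2)[OF i(1)] by (intro mult_nonpos_nonneg) auto
  next
    assume "b \<bullet> i \<le> x \<bullet> i"
    then show ?thesis using assms(2)[OF i(1)] by (intro mult_nonneg_nonpos) auto
  qed
  then have "real (Suc n) * ((x \<bullet> i - a \<bullet> i) * (b \<bullet> i - x \<bullet> i)) \<le> 0"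
    by (rule mult_nonneg_nonpos[OF of_nat_0_le_iff])
  then have "flat_exp 0 (real (Suc n) * ((x \<bullet> i - a \<bullet> i) * (b \<bullet> i - x \<bullet> i))) = 0"
    unfolding flat_exp_def by (simp only: not_less[symmetric] if_False)
  then show ?thesis unfolding box_bump_def using i by (intro prod_zero) auto
qed

lemma smooth_box_bump: "smooth (box_bump n a b)"
  unfolding box_bump_def[abs_def]
  by (intro smooth_prod smooth_flat_exp smooth_intros smooth_diff) auto

lemma box_bump_tendsto:
  assumes "\<And>i. i \<in> Basis \<Longrightarrow> a \<bullet> i \<le> b \<bullet> i"
  shows "(\<lambda>n. box_bump n a b x) \<longlonglongrightarrow> indicator (box a b) x"
proof (cases "x \<in> box a b")
  case True
  have "(\<lambda>n. box_bump n a b x) \<longlonglongrightarrow> (\<Prod>i\<in>(Basis::'a set). 1)"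
    unfolding box_bump_def
  proof (rule tendsto_prod)
    fix i :: 'a assume "i \<in> Basis"
    define c where "c = (x \<bullet> i - a \<bullet> i) * (b \<bullet> i - x \<bullet> i)"
    have c: "c > 0" using True \<open>i \<in> Basis\<close> by (auto simp: c_def box_def)
    have "(\<lambda>n. exp (- 1 / (real (Suc n) * c))) \<longlonglongrightarrow> exp 0"
      using c by (intro tendsto_exp) real_asymp
    then show "(\<lambda>n. flat_exp 0 (real (Suc n) * ((x \<bullet> i - a \<bullet> i) * (b \<bullet> i - x \<bullet> i)))) \<longlonglongrightarrow> 1"
      using c by (simp add: flat_exp_def c_def[symmetric] del: of_nat_Suc)
  qed
  then show ?thesis using True by simp
qed (use box_bump_eq_0[OF _ assms] in auto)

lemma box_bump_test_function:
  assumes "\<And>i. i \<in> Basis \<Longrightarrow> a \<bullet> i \<le> b \<bullet> i" "cbox a b \<subseteq> \<Omega>"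
  shows "box_bump n a b \<in> test_functions \<Omega>"
  using assms box_subset_cbox[of a b]
  by (intro test_functions_subsetI[where K = "cbox a b"] smooth_box_bump) (auto intro!: box_bump_eq_0)

lemma exists_cbox_subset_open:
  fixes x :: "'a::euclidean_space"
  assumes "open \<Omega>" "x \<in> \<Omega>"
  obtains e where "e > 0" "\<And>h. 0 < h \<Longrightarrow> h < e \<Longrightarrow> cbox x (x + h *\<^sub>R One) \<subseteq> \<Omega>"
proof -
  obtain d where d: "d > 0" "ball x d \<subseteq> \<Omega>" using assms openE by blast
  have D: "real DIM('a) > 0" by simp
  show ?thesis
  proof (rule that[of "d / real DIM('a)"])
    fix h :: real assume h: "0 < h" "h < d / real DIM('a)"
    show "cbox x (x + h *\<^sub>R One) \<subseteq> \<Omega>"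
    proof
      fix y assume y: "y \<in> cbox x (x + h *\<^sub>R One)"
      have "norm (y - x) \<le> (\<Sum>i\<in>Basis. \<bar>(y - x) \<bullet> i\<bar>)" by (rule norm_le_l1)
      also have "\<dots> \<le> (\<Sum>i\<in>(Basis::'a set). h)"
        using y by (intro sum_mono) (auto simp: mem_box inner_simps abs_le_iff)
      also have "\<dots> < d" using h D by (simp add: field_simps)
      finally show "y \<in> \<Omega>" using d by (auto simp: dist_norm norm_minus_commute)
    qed
  qed (use d D in auto)
qed

lemma exists_nonzero_test_function:
  fixes \<Omega> :: "'a::euclidean_space set"
  assumes "open \<Omega>" "\<Omega> \<noteq> {}"
  obtains \<phi> where "\<phi> \<in> test_functions \<Omega>" "\<exists>x. \<phi> x \<noteq> 0"
proof -
  obtain x where x: "x \<in> \<Omega>" using assms by auto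
  obtain e where e: "e > 0" "\<And>h. 0 < h \<Longrightarrow> h < e \<Longrightarrow> cbox x (x + h *\<^sub>R One) \<subseteq> \<Omega>"
    using exists_cbox_subset_open[OF assms(1) x] by blast
  define b where "b = x + (e/2) *\<^sub>R One"
  show ?thesis
  proof (rule that)
    show "box_bump 0 x b \<in> test_functions \<Omega>"
      using e(1) e(2)[of "e/2"] by (intro box_bump_test_function) (auto simp: b_def inner_simps)
    have "box_bump 0 x b (x + (e/4) *\<^sub>R One) \<noteq> 0"
      using e(1) by (auto simp: box_bump_def b_def inner_simps flat_exp_def)
    then show "\<exists>y. box_bump 0 x b y \<noteq> 0" by blast
  qed
qed

text \<open>The fundamental lemma of the calculus of variations. Testing with \<open>box_bump\<close> and passing to the limit
  shows that the integral of \<open>h\<close> over every box inside \<open>\<Omega>\<close> is zero; by Lebesgue's differentiation theorem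
  for small cubes \<open>h\<close> then vanishes almost everywhere.\<close>

lemma fundamental_lemma_real:
  fixes h :: "'a::euclidean_space \<Rightarrow> real"
  assumes op: "open \<Omega>"
    and int: "\<And>K. compact K \<Longrightarrow> K \<subseteq> \<Omega> \<Longrightarrow> h absolutely_integrable_on K"
    and zero: "\<And>\<phi>. \<phi> \<in> test_functions \<Omega> \<Longrightarrow> (\<integral>x. \<phi> x * h x \<partial>lebesgue_on \<Omega>) = 0"
  shows "negligible {x \<in> \<Omega>. h x \<noteq> 0}"
proof -
  have small: "integral (cbox a b) h = 0"
    if ab: "\<And>i. i \<in> Basis \<Longrightarrow> a \<bullet> i \<le> b \<bullet> i" "cbox a b \<subseteq> \<Omega>" for a b
  proof -
    let ?F = "\<lambda>x. indicator (cbox a b) x * h x"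
    have hint: "integrable lebesgue ?F"
      using int[OF compact_cbox ab(2)] by (simp add: set_integrable_def)
    have lim: "(\<lambda>n. \<integral>x. box_bump n a b x * ?F x \<partial>lebesgue) \<longlonglongrightarrow> (\<integral>x. indicator (box a b) x * ?F x \<partial>lebesgue)"
    proof (rule integral_dominated_convergence[where w = "\<lambda>x. norm (?F x)"])
      show "(\<lambda>x. indicator (box a b) x * ?F x) \<in> borel_measurable lebesgue"
        by (intro borel_measurable_times[OF _ borel_measurable_integrable[OF hint]] borel_measurable_indicator) auto
      show "(\<lambda>x. box_bump n a b x * ?F x) \<in> borel_measurable lebesgue" for n
        by (intro borel_measurable_times[OF _ borel_measurable_integrable[OF hint]]) (rule measurable_completion, simp add: borel_measurable_continuous_onI smooth_continuous smooth_box_bump)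
      show "AE x in lebesgue. (\<lambda>n. box_bump n a b x * ?F x) \<longlonglongrightarrow> indicator (box a b) x * ?F x"
        by (intro AE_I2 tendsto_intros box_bump_tendsto ab)
      show "AE x in lebesgue. norm (box_bump n a b x * ?F x) \<le> norm (?F x)" for n
        using box_bump_bounds[of n a b] by (intro AE_I2) (auto simp: abs_mult intro!: mult_left_le_one_le)
      show "integrable lebesgue (\<lambda>x. norm (?F x))" using hint by (rule integrable_norm)
    qed
    have "(\<integral>x. box_bump n a b x * ?F x \<partial>lebesgue) = 0" for n
    proof -
      have "(\<integral>x. box_bump n a b x * ?F x \<partial>lebesgue) = (\<integral>x. indicator \<Omega> x *\<^sub>R (box_bump n a b x * h x) \<partial>lebesgue)"
        using box_bump_eq_0[OF _ ab(1), of _ n] ab(2) box_subset_cbox[of a b]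
        by (intro Bochner_Integration.integral_cong) (auto simp: indicator_def)
      also have "\<dots> = (\<integral>x. box_bump n a b x * h x \<partial>lebesgue_on \<Omega>)"
        using op by (subst integral_restrict_space) auto
      finally show ?thesis using zero[OF box_bump_test_function[OF ab]] by simp
    qed
    then have "(\<integral>x. indicator (box a b) x * ?F x \<partial>lebesgue) = 0"
      using lim by (simp add: LIMSEQ_const_iff)
    moreover have "AE x in lebesgue. indicator (box a b) x * ?F x = ?F x"
    proof -
      have "negligible (cbox a b - box a b)" by (simp add: negligible_frontier_interval)
      then have "AE x in lebesgue. x \<notin> cbox a b - box a b"
        using negligible_iff_null_sets AE_not_in by blast
      then show ?thesis by (rule AE_mp) (auto simp: indicator_def)
    qed
    ultimately have "(\<integral>x. ?F x \<partial>lebesgue) = 0"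
      using hint integral_cong_AE[OF borel_measurable_times[OF borel_measurable_indicator borel_measurable_integrable[OF hint]] borel_measurable_integrable[OF hint], of "box a b"]
      by simp
    moreover have "(\<integral>x. ?F x \<partial>lebesgue) = integral (cbox a b) h"
      using set_lebesgue_integral_eq_integral(2)[OF int[OF compact_cbox ab(2)]]
      by (simp add: set_lebesgue_integral_def)
    ultimately show ?thesis by simp
  qed
  have local: "negligible {x \<in> ball y d. h x \<noteq> 0}" if y: "y \<in> \<Omega>" and d: "d > 0" "cball y d \<subseteq> \<Omega>" for y d
  proof -
    define F where "F x = (if x \<in> cball y d then h x else 0)" for x
    have "F integrable_on cbox a b" for a b
    proof -
      have "h absolutely_integrable_on cball y d" by (rule int) (use d in auto)
      then have "F absolutely_integrable_on UNIV"
        unfolding F_def absolutely_integrable_restrict_UNIV .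
      then have "F integrable_on UNIV" by (rule set_lebesgue_integral_eq_integral(1))
      then show ?thesis by (rule integrable_on_subcbox) auto
    qed
    then obtain N where N: "negligible N"
      "\<And>x e. \<lbrakk>x \<notin> N; 0 < e\<rbrakk> \<Longrightarrow> \<exists>d>0. \<forall>h. 0 < h \<and> h < d \<longrightarrow>
            norm (integral (cbox x (x + h *\<^sub>R One)) F /\<^sub>R h ^ DIM('a) - F x) < e"
      using integrable_ccontinuous_explicit by metis
    have "{x \<in> ball y d. h x \<noteq> 0} \<subseteq> N"
    proof (rule subsetI, rule ccontr)
      fix x assume x: "x \<in> {x \<in> ball y d. h x \<noteq> 0}" "x \<notin> N"
      then have Fx: "F x = h x" "\<bar>h x\<bar> > 0" by (auto simp: F_def)
      obtain d1 where d1: "d1 > 0" "\<And>k. 0 < k \<Longrightarrow> k < d1 \<Longrightarrow> norm (integral (cbox x (x + k *\<^sub>R One)) F /\<^sub>R k ^ DIM('a) - F x) < \<bar>h x\<bar>"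
        using N(2)[OF x(2) Fx(2)] by blast
      obtain e where e: "e > 0" "\<And>k. 0 < k \<Longrightarrow> k < e \<Longrightarrow> cbox x (x + k *\<^sub>R One) \<subseteq> ball y d"
        using exists_cbox_subset_open[of "ball y d" x] x by auto
      define k where "k = min d1 e / 2"
      have k: "0 < k" "k < d1" "k < e" using d1 e by (auto simp: k_def)
      have "integral (cbox x (x + k *\<^sub>R One)) F = integral (cbox x (x + k *\<^sub>R One)) h"
        using e(2)[OF k(1,3)] by (intro integral_cong) (auto simp: F_def subset_iff less_imp_le)
      also have "\<dots> = 0"
        using k by (intro small order_trans[OF e(2)[OF k(1,3)] order_trans[OF ball_subset_cball d(2)]]) (auto simp: inner_simps)
      finally show False using d1(2)[OF k(1,2)] Fx by simp
    qed
    then show ?thesis using N negligible_subset by blast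
  qed
  show ?thesis
  proof (rule locally_negligible_alt[THEN iffD2], intro ballI)
    fix x assume x: "x \<in> {x \<in> \<Omega>. h x \<noteq> 0}"
    then obtain d where d: "d > 0" "cball x d \<subseteq> \<Omega>" using op by (auto simp: open_contains_cball)
    show "\<exists>U. openin (top_of_set {x \<in> \<Omega>. h x \<noteq> 0}) U \<and> x \<in> U \<and> negligible U"
    proof (intro exI conjI)
      show "openin (top_of_set {x \<in> \<Omega>. h x \<noteq> 0}) ({x \<in> \<Omega>. h x \<noteq> 0} \<inter> ball x d)"
        by (simp add: openin_open_Int)
      show "negligible ({x \<in> \<Omega>. h x \<noteq> 0} \<inter> ball x d)"
        using local[of x d] d x by (auto elim: negligible_subset)
    qed (use x d in auto)
  qed
qed

section \<open>Translations and Poincare inequalities\<close>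

lemma nn_integral_lborel_translation:
  fixes z :: "'a::euclidean_space"
  assumes [measurable]: "f \<in> borel_measurable borel"
  shows "(\<integral>\<^sup>+x. f (x + z) \<partial>lborel) = (\<integral>\<^sup>+x. f x \<partial>lborel)"
proof -
  have "(\<integral>\<^sup>+x. f x \<partial>lborel) = (\<integral>\<^sup>+x. f x \<partial>distr lborel borel ((+) z))"
    by (simp add: lborel_distr_plus)
  also have "\<dots> = (\<integral>\<^sup>+x. f (z + x) \<partial>lborel)" by (intro nn_integral_distr) auto
  finally show ?thesis by (simp add: add.commute)
qed

lemma nn_integral_lborel_scale:
  fixes f :: "'a::euclidean_space \<Rightarrow> ennreal"
  assumes [measurable]: "f \<in> borel_measurable borel" and "t > 0"
  shows "(\<integral>\<^sup>+x. f x \<partial>lborel) = ennreal (t ^ DIM('a)) * (\<integral>\<^sup>+x. f (t *\<^sub>R x) \<partial>lborel)"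
proof -
  have "(\<integral>\<^sup>+x. f x \<partial>lborel) = (\<integral>\<^sup>+x. f x \<partial>density (distr lborel borel (\<lambda>x. 0 + t *\<^sub>R x)) (\<lambda>_. \<bar>t\<bar>^DIM('a)))"
    by (rule arg_cong[where f = "\<lambda>M. integral\<^sup>N M f"], rule lborel_affine) (use assms in auto)
  also have "\<dots> = (\<integral>\<^sup>+x. ennreal (\<bar>t\<bar>^DIM('a)) * f x \<partial>distr lborel borel (\<lambda>x. 0 + t *\<^sub>R x))"
    by (intro nn_integral_density) auto
  also have "\<dots> = (\<integral>\<^sup>+x. ennreal (\<bar>t\<bar>^DIM('a)) * f (t *\<^sub>R x) \<partial>lborel)"
    by (subst nn_integral_distr) auto
  finally show ?thesis using assms by (simp add: nn_integral_cmult)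
qed

lemma integral_power_ge_power_integral:
  fixes h :: "real \<Rightarrow> real"
  assumes h: "continuous_on {0..1} h" "\<And>t. t \<in> {0..1} \<Longrightarrow> h t \<ge> 0" and n: "n \<ge> 1"
  shows "(integral {0..1} h) ^ n \<le> integral {0..1} (\<lambda>t. h t ^ n)"
proof -
  define m where "m = integral {0..1} h"
  have m: "m \<ge> 0" unfolding m_def using h by (intro integral_nonneg integrable_continuous_interval) auto
  have hi: "(h has_integral m) {0..1}"
    unfolding m_def using h(1) integrable_continuous_interval integrable_integral by blast
  have "((\<lambda>t. m ^ n + real n * m ^ (n - 1) * (h t - m)) has_integral (m ^ n + real n * m ^ (n - 1) * (m - m))) {0..1}"
    using has_integral_const_real[of "m ^ n" 0 1] has_integral_const_real[of "m" 0 1]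
    by (intro has_integral_add has_integral_mult_right has_integral_diff hi) auto
  moreover have "((\<lambda>t. h t ^ n) has_integral integral {0..1} (\<lambda>t. h t ^ n)) {0..1}"
    using h(1) by (intro integrable_integral integrable_continuous_interval continuous_intros)
  ultimately have "m ^ n + real n * m ^ (n - 1) * (m - m) \<le> integral {0..1} (\<lambda>t. h t ^ n)"
    by (rule has_integral_le) (rule power_tangent_le, use h m n in auto)
  then show ?thesis by (simp add: m_def)
qed

lemma power_increment_le_nn_integral:
  fixes f f' :: "real \<Rightarrow> real"
  assumes f: "\<And>t. t \<in> {0..1} \<Longrightarrow> (f has_real_derivative f' t) (at t within {0..1})"
    and c: "continuous_on {0..1} f'" and n: "n \<ge> 1"
  shows "ennreal (\<bar>f 1 - f 0\<bar> ^ n) \<le> (\<integral>\<^sup>+t. ennreal (\<bar>f' t\<bar> ^ n) * indicator {0..1} t \<partial>lborel)"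
proof -
  have "(f' has_integral (f 1 - f 0)) {0..1}"
    using f by (intro fundamental_theorem_of_calculus) (auto simp: has_real_derivative_iff_has_vector_derivative)
  then have eq: "integral {0..1} f' = f 1 - f 0" by (rule integral_unique)
  have "norm (integral {0..1} f') \<le> integral {0..1} (\<lambda>t. \<bar>f' t\<bar>)"
    by (rule integral_norm_bound_integral) (auto intro!: integrable_continuous_interval continuous_intros c)
  then have "\<bar>f 1 - f 0\<bar> \<le> integral {0..1} (\<lambda>t. \<bar>f' t\<bar>)"
    unfolding eq by simp
  then have "\<bar>f 1 - f 0\<bar> ^ n \<le> (integral {0..1} (\<lambda>t. \<bar>f' t\<bar>)) ^ n" by (intro power_mono) auto
  also have "\<dots> \<le> integral {0..1} (\<lambda>t. \<bar>f' t\<bar> ^ n)"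
    using c n by (intro integral_power_ge_power_integral continuous_intros) auto
  finally have le: "\<bar>f 1 - f 0\<bar> ^ n \<le> integral {0..1} (\<lambda>t. \<bar>f' t\<bar> ^ n)" .
  have "((\<lambda>t. \<bar>f' t\<bar> ^ n) has_integral integral {0..1} (\<lambda>t. \<bar>f' t\<bar> ^ n)) {0..1}"
    using c by (intro integrable_integral integrable_continuous_interval continuous_intros)
  then have "(\<integral>\<^sup>+t. ennreal (\<bar>f' t\<bar> ^ n) * indicator {0..1} t \<partial>lborel) = ennreal (integral {0..1} (\<lambda>t. \<bar>f' t\<bar> ^ n))"
    by (intro nn_integral_has_integral_lebesgue') auto
  then show ?thesis using le by (simp add: ennreal_leI)
qed

text \<open>The estimate of an increment of \<open>\<psi>\<close> by the mean of \<open>G\<close> along the segment from \<open>x\<close> to \<open>x + z\<close>. For a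
  smooth function \<open>G\<close> is the \<open>n\<close>-th power of the norm of its gradient. The predicate is separate because the
  Poincare inequality below is also applied to a function that is singular at the origin, where the
  estimate only holds for almost all segments.\<close>

definition segment_bound :: "nat \<Rightarrow> ('a::euclidean_space \<Rightarrow> real) \<Rightarrow> ('a \<Rightarrow> ennreal) \<Rightarrow> 'a \<Rightarrow> 'a \<Rightarrow> bool" where
  "segment_bound n \<psi> G x z \<longleftrightarrow>
     ennreal (\<bar>\<psi> (x + z) - \<psi> x\<bar> ^ n) \<le> ennreal (norm z ^ n) * (\<integral>\<^sup>+t. G (x + t *\<^sub>R z) * indicator {0..1} t \<partial>lborel)"

lemma segment_boundI:
  fixes \<psi> :: "'a::euclidean_space \<Rightarrow> real"
  assumes d: "\<And>t. t \<in> {0..1} \<Longrightarrow> (\<psi> has_derivative (\<lambda>v. g (x + t *\<^sub>R z) \<bullet> v)) (at (x + t *\<^sub>R z))"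
    and c: "continuous_on {0..1} (\<lambda>t. g (x + t *\<^sub>R z))" and n: "n \<ge> 1"
    and G: "\<And>t. t \<in> {0..1} \<Longrightarrow> ennreal (norm (g (x + t *\<^sub>R z)) ^ n) \<le> G (x + t *\<^sub>R z)"
    and Gm [measurable]: "G \<in> borel_measurable borel"
  shows "segment_bound n \<psi> G x z"
proof -
  define f where "f t = \<psi> (x + t *\<^sub>R z)" for t
  define f' where "f' t = g (x + t *\<^sub>R z) \<bullet> z" for t
  have "ennreal (\<bar>f 1 - f 0\<bar> ^ n) \<le> (\<integral>\<^sup>+t. ennreal (\<bar>f' t\<bar> ^ n) * indicator {0..1} t \<partial>lborel)"
  proof (rule power_increment_le_nn_integral)
    fix t :: real assume t: "t \<in> {0..1}"
    have "((\<lambda>t. x + t *\<^sub>R z) has_derivative (\<lambda>s. s *\<^sub>R z)) (at t within {0..1})"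
      by (auto intro!: derivative_eq_intros)
    from has_derivative_compose[OF this d[OF t]]
    show "(f has_real_derivative f' t) (at t within {0..1})"
      by (simp add: f_def[abs_def] f'_def has_field_derivative_def mult_commute_abs)
  qed (use c n in \<open>auto simp: f'_def intro!: continuous_intros\<close>)
  also have "\<dots> \<le> (\<integral>\<^sup>+t. ennreal (norm z ^ n) * (G (x + t *\<^sub>R z) * indicator {0..1} t) \<partial>lborel)"
  proof (rule nn_integral_mono)
    fix t :: real
    show "ennreal (\<bar>f' t\<bar> ^ n) * indicator {0..1} t \<le> ennreal (norm z ^ n) * (G (x + t *\<^sub>R z) * indicator {0..1} t)"
    proof (cases "t \<in> {0..1}")
      case True
      have "\<bar>f' t\<bar> ^ n \<le> (norm (g (x + t *\<^sub>R z)) * norm z) ^ n"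
        unfolding f'_def by (intro power_mono Cauchy_Schwarz_ineq2) auto
      then have "ennreal (\<bar>f' t\<bar> ^ n) \<le> ennreal (norm z ^ n) * ennreal (norm (g (x + t *\<^sub>R z)) ^ n)"
        by (simp add: ennreal_mult[symmetric] ennreal_leI power_mult_distrib mult.commute)
      also have "\<dots> \<le> ennreal (norm z ^ n) * G (x + t *\<^sub>R z)"
        by (intro mult_left_mono G True) auto
      finally show ?thesis using True by simp
    qed auto
  qed
  also have "\<dots> = ennreal (norm z ^ n) * (\<integral>\<^sup>+t. (G (x + t *\<^sub>R z) * indicator {0..1} t) \<partial>lborel)"
    by (intro nn_integral_cmult) auto
  finally show ?thesis by (simp add: segment_bound_def f_def)
qed

lemma segment_bound_smooth:
  fixes \<phi> :: "'a::euclidean_space \<Rightarrow> real"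
  assumes "smooth \<phi>" "n \<ge> 1"
  shows "segment_bound n \<phi> (\<lambda>x. ennreal (norm (gradient \<phi> x) ^ n)) x z"
proof (rule segment_boundI[where g = "gradient \<phi>"])
  have [measurable]: "gradient \<phi> \<in> borel_measurable borel"
    by (intro borel_measurable_continuous_onI smooth_continuous_gradient assms)
  show "(\<lambda>x. ennreal (norm (gradient \<phi> x) ^ n)) \<in> borel_measurable borel" by measurable
  show "continuous_on {0..1} (\<lambda>t. gradient \<phi> (x + t *\<^sub>R z))"
    by (rule continuous_on_compose2[OF smooth_continuous_gradient[OF assms(1), of UNIV]]) (auto intro!: continuous_intros)
qed (use assms smooth_has_derivative in auto)

text \<open>Integrate the estimate over the starting points and exchange the integrals: for each fixed \<open>t\<close> the
  integral of \<open>G (x + t *\<^sub>R z)\<close> over \<open>x\<close> does not depend on \<open>t\<close>.\<close>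

lemma translation_estimate:
  fixes \<psi> :: "'a::euclidean_space \<Rightarrow> real"
  assumes S [measurable]: "S \<in> sets borel" and W [measurable]: "W \<in> sets borel"
    and \<psi> [measurable]: "\<psi> \<in> borel_measurable borel" and G [measurable]: "G \<in> borel_measurable borel"
    and seg: "AE x in lborel. x \<in> S \<longrightarrow> segment_bound n \<psi> G x z"
    and SW: "\<And>x t. x \<in> S \<Longrightarrow> t \<in> {0..1} \<Longrightarrow> x + t *\<^sub>R z \<in> W"
  shows "(\<integral>\<^sup>+x. ennreal (\<bar>\<psi> (x + z) - \<psi> x\<bar> ^ n) * indicator S x \<partial>lborel)
    \<le> ennreal (norm z ^ n) * (\<integral>\<^sup>+x. G x * indicator W x \<partial>lborel)"
proof -
  have "(\<integral>\<^sup>+x. ennreal (\<bar>\<psi> (x + z) - \<psi> x\<bar> ^ n) * indicator S x \<partial>lborel)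
     \<le> (\<integral>\<^sup>+x. ennreal (norm z ^ n) * (\<integral>\<^sup>+t. (G (x + t *\<^sub>R z) * indicator W (x + t *\<^sub>R z)) * indicator {0..1} t \<partial>lborel) \<partial>lborel)"
  proof (rule nn_integral_mono_AE, rule AE_mp[OF seg], intro AE_I2 impI)
    fix x assume x: "x \<in> S \<longrightarrow> segment_bound n \<psi> G x z"
    show "ennreal (\<bar>\<psi> (x + z) - \<psi> x\<bar> ^ n) * indicator S x
      \<le> ennreal (norm z ^ n) * (\<integral>\<^sup>+t. (G (x + t *\<^sub>R z) * indicator W (x + t *\<^sub>R z)) * indicator {0..1} t \<partial>lborel)"
    proof (cases "x \<in> S")
      case True
      have "(\<integral>\<^sup>+t. (G (x + t *\<^sub>R z) * indicator W (x + t *\<^sub>R z)) * indicator {0..1} t \<partial>lborel)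
          = (\<integral>\<^sup>+t. G (x + t *\<^sub>R z) * indicator {0..1} t \<partial>lborel)"
        using SW[OF True] by (intro nn_integral_cong) (auto simp: indicator_def)
      then show ?thesis using x True by (simp add: segment_bound_def)
    qed auto
  qed
  also have "\<dots> = ennreal (norm z ^ n) * (\<integral>\<^sup>+x. \<integral>\<^sup>+t. (G (x + t *\<^sub>R z) * indicator W (x + t *\<^sub>R z)) * indicator {0..1} t \<partial>lborel \<partial>lborel)"
    by (intro nn_integral_cmult) measurable
  also have "(\<integral>\<^sup>+x. \<integral>\<^sup>+t. (G (x + t *\<^sub>R z) * indicator W (x + t *\<^sub>R z)) * indicator {0..1} t \<partial>lborel \<partial>lborel)
     = (\<integral>\<^sup>+t. \<integral>\<^sup>+x. (G (x + t *\<^sub>R z) * indicator W (x + t *\<^sub>R z)) * indicator {0..1::real} t \<partial>lborel \<partial>lborel)"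
    by (rule lborel_pair.Fubini') measurable
  also have "\<dots> = (\<integral>\<^sup>+t. (\<integral>\<^sup>+x. G x * indicator W x \<partial>lborel) * indicator {0..1::real} t \<partial>lborel)"
  proof (rule nn_integral_cong)
    fix t :: real
    have "(\<integral>\<^sup>+x. (G (x + t *\<^sub>R z) * indicator W (x + t *\<^sub>R z)) * indicator {0..1::real} t \<partial>lborel)
      = (\<integral>\<^sup>+x. (G (x + t *\<^sub>R z) * indicator W (x + t *\<^sub>R z)) \<partial>lborel) * indicator {0..1::real} t"
      by (intro nn_integral_multc) measurable
    also have "(\<integral>\<^sup>+x. (G (x + t *\<^sub>R z) * indicator W (x + t *\<^sub>R z)) \<partial>lborel) = (\<integral>\<^sup>+x. G x * indicator W x \<partial>lborel)"
      by (rule nn_integral_lborel_translation[of "\<lambda>x. G x * indicator W x"]) measurable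
    finally show "(\<integral>\<^sup>+x. (G (x + t *\<^sub>R z) * indicator W (x + t *\<^sub>R z)) * indicator {0..1::real} t \<partial>lborel)
      = (\<integral>\<^sup>+x. G x * indicator W x \<partial>lborel) * indicator {0..1::real} t" .
  qed
  also have "\<dots> = (\<integral>\<^sup>+x. G x * indicator W x \<partial>lborel)"
    by (simp add: nn_integral_cmult_indicator)
  finally show ?thesis .
qed

text \<open>A Poincare inequality for functions with many zeros. Seen from each point of \<open>L\<close>, within distance \<open>\<rho>\<close>, the
  zeros have measure at least \<open>m\<close>. Hence \<open>m * \<bar>\<psi> x\<bar> ^ n\<close> is at most the integral of
  \<open>\<bar>\<psi> (x + z) - \<psi> x\<bar> ^ n\<close> over the \<open>z\<close> in the ball, and for each \<open>z\<close> the estimate for translations applies. It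
  is the common source of all Poincare inequalities in this proof: the zeros lie outside \<open>\<Omega>\<close>, near
  the origin, near the rim, or beyond the support.\<close>

lemma poincare_zero_set:
  fixes \<psi> :: "'a::euclidean_space \<Rightarrow> real"
  assumes L [measurable]: "L \<in> sets borel" and Y [measurable]: "Y \<in> sets borel" and W [measurable]: "W \<in> sets borel"
    and \<psi> [measurable]: "\<psi> \<in> borel_measurable borel" and G [measurable]: "G \<in> borel_measurable borel"
    and n: "n \<ge> 1" and rho: "\<rho> > 0" and m: "m > 0"
    and seg: "\<And>z. z \<in> ball 0 \<rho> \<Longrightarrow> z \<noteq> 0 \<Longrightarrow> AE x in lborel. x \<in> L \<and> x + z \<in> Y \<longrightarrow> segment_bound n \<psi> G x z"
    and sub: "\<And>x z t. x \<in> L \<Longrightarrow> x + z \<in> Y \<Longrightarrow> z \<in> ball 0 \<rho> \<Longrightarrow> t \<in> {0..1} \<Longrightarrow> x + t *\<^sub>R z \<in> W"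
    and zero: "\<And>x. x \<in> L \<Longrightarrow> ennreal m \<le> emeasure lborel {z \<in> ball 0 \<rho>. x + z \<in> Y \<and> \<psi> (x + z) = 0}"
  shows "(\<integral>\<^sup>+x. ennreal (\<bar>\<psi> x\<bar> ^ n) * indicator L x \<partial>lborel)
    \<le> ennreal (measure lborel (ball (0::'a) \<rho>) * \<rho> ^ n / m) * (\<integral>\<^sup>+x. G x * indicator W x \<partial>lborel)"
proof -
  define B where "B = ball (0::'a) \<rho>"
  have [measurable]: "B \<in> sets borel" by (simp add: B_def)
  let ?I = "\<integral>\<^sup>+x. G x * indicator W x \<partial>lborel"
  let ?h = "\<lambda>x z. ennreal (\<bar>\<psi> (x + z) - \<psi> x\<bar> ^ n) * indicator {x \<in> L. x + z \<in> Y} x * indicator B z"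
  have Bm: "ennreal (measure lborel B) = emeasure lborel B"
    using emeasure_lborel_ball_finite[of "0::'a" \<rho>] unfolding B_def by (intro emeasure_eq_ennreal_measure[symmetric]) auto
  have "ennreal m * (\<integral>\<^sup>+x. ennreal (\<bar>\<psi> x\<bar> ^ n) * indicator L x \<partial>lborel)
      = (\<integral>\<^sup>+x. ennreal m * (ennreal (\<bar>\<psi> x\<bar> ^ n) * indicator L x) \<partial>lborel)"
    by (intro nn_integral_cmult[symmetric]) measurable
  also have "\<dots> \<le> (\<integral>\<^sup>+x. \<integral>\<^sup>+z. ?h x z \<partial>lborel \<partial>lborel)"
  proof (rule nn_integral_mono)
    fix x
    show "ennreal m * (ennreal (\<bar>\<psi> x\<bar> ^ n) * indicator L x) \<le> (\<integral>\<^sup>+z. ?h x z \<partial>lborel)"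
    proof (cases "x \<in> L")
      case True
      let ?Z = "{z \<in> B. x + z \<in> Y \<and> \<psi> (x + z) = 0}"
      have "ennreal m * ennreal (\<bar>\<psi> x\<bar> ^ n) \<le> ennreal (\<bar>\<psi> x\<bar> ^ n) * emeasure lborel ?Z"
        using mult_right_mono[OF zero[OF True], of "ennreal (\<bar>\<psi> x\<bar> ^ n)"] by (simp add: mult.commute B_def)
      also have "\<dots> = (\<integral>\<^sup>+z. ennreal (\<bar>\<psi> x\<bar> ^ n) * indicator ?Z z \<partial>lborel)"
        by (intro nn_integral_cmult_indicator[symmetric]) measurable
      also have "\<dots> \<le> (\<integral>\<^sup>+z. ?h x z \<partial>lborel)"
        using True by (intro nn_integral_mono) (auto simp: indicator_def)
      finally show ?thesis using True by simp
    qed auto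
  qed
  also have "\<dots> = (\<integral>\<^sup>+z. \<integral>\<^sup>+x. ?h x z \<partial>lborel \<partial>lborel)"
    by (rule lborel_pair.Fubini') measurable
  also have "\<dots> \<le> (\<integral>\<^sup>+z. (ennreal (\<rho> ^ n) * ?I) * indicator B z \<partial>lborel)"
  proof (rule nn_integral_mono)
    fix z :: 'a
    have "(\<integral>\<^sup>+x. ?h x z \<partial>lborel) = (\<integral>\<^sup>+x. ennreal (\<bar>\<psi> (x + z) - \<psi> x\<bar> ^ n) * indicator {x \<in> L. x + z \<in> Y} x \<partial>lborel) * indicator B z"
      by (intro nn_integral_multc) measurable
    also have "\<dots> \<le> (ennreal (\<rho> ^ n) * ?I) * indicator B z"
    proof (cases "z \<in> B")
      case z: True
      show ?thesis
      proof (cases "z = 0")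
        case True then show ?thesis using n by (simp add: power_0_left)
      next
        case False
        have "(\<integral>\<^sup>+x. ennreal (\<bar>\<psi> (x + z) - \<psi> x\<bar> ^ n) * indicator {x \<in> L. x + z \<in> Y} x \<partial>lborel) \<le> ennreal (norm z ^ n) * ?I"
        proof (rule translation_estimate[OF _ W \<psi> G])
          show "{x \<in> L. x + z \<in> Y} \<in> sets borel" by measurable
          show "AE x in lborel. x \<in> {x \<in> L. x + z \<in> Y} \<longrightarrow> segment_bound n \<psi> G x z"
            using seg[OF z[unfolded B_def] False] by simp
          show "x + t *\<^sub>R z \<in> W" if "x \<in> {x \<in> L. x + z \<in> Y}" "t \<in> {0..1}" for x t
            using that z[unfolded B_def] by (intro sub) blast+
        qed
        also have "\<dots> \<le> ennreal (\<rho> ^ n) * ?I"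
          using z by (intro mult_right_mono ennreal_leI power_mono) (auto simp: B_def)
        finally show ?thesis using z by simp
      qed
    qed auto
    finally show "(\<integral>\<^sup>+x. ?h x z \<partial>lborel) \<le> (ennreal (\<rho> ^ n) * ?I) * indicator B z" .
  qed
  also have "\<dots> = ennreal (\<rho> ^ n) * ?I * emeasure lborel B"
    by (rule nn_integral_cmult_indicator) auto
  finally have le: "ennreal m * (\<integral>\<^sup>+x. ennreal (\<bar>\<psi> x\<bar> ^ n) * indicator L x \<partial>lborel) \<le> ennreal (\<rho> ^ n) * ?I * emeasure lborel B" .
  have "(\<integral>\<^sup>+x. ennreal (\<bar>\<psi> x\<bar> ^ n) * indicator L x \<partial>lborel)
     = ennreal (1 / m) * (ennreal m * (\<integral>\<^sup>+x. ennreal (\<bar>\<psi> x\<bar> ^ n) * indicator L x \<partial>lborel))"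
  proof -
    have "ennreal (1 / m) * ennreal m = 1" using m by (simp add: ennreal_mult[symmetric])
    then have "ennreal (1 / m) * (ennreal m * x) = x" for x by (subst mult.assoc[symmetric]) simp
    then show ?thesis by (rule sym)
  qed
  also have "\<dots> \<le> ennreal (1 / m) * (ennreal (\<rho> ^ n) * ?I * emeasure lborel B)"
    using le by (intro mult_left_mono) auto
  also have "\<dots> = (ennreal (1/m) * (ennreal (\<rho> ^ n) * ennreal (measure lborel B))) * ?I"
  proof -
    have "a * (r * i * b) = (a * (r * b)) * i" for a r i b :: ennreal by (simp only: mult_ac)
    then show ?thesis unfolding Bm .
  qed
  also have "ennreal (1/m) * (ennreal (\<rho> ^ n) * ennreal (measure lborel B)) = ennreal (measure lborel B * \<rho> ^ n / m)"
    using m rho by (simp add: ennreal_mult[symmetric] mult.commute)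
  finally show ?thesis unfolding B_def .
qed

section \<open>Hausdorff measure of spherical slices\<close>

lemma hausdorff_premeasure_le:
  assumes "A \<subseteq> (\<Union>i. U i)" "\<And>i. bounded (U i)" "\<And>i. diameter (U i) \<le> \<delta>"
  shows "hausdorff_premeasure d \<delta> A
    \<le> (\<Sum>i. if U i = {} then 0 else ennreal (unit_ball_vol (real d) * (diameter (U i) / 2) ^ d))"
  unfolding hausdorff_premeasure_def by (rule INF_lower) (use assms in auto)

lemma hausdorff_premeasure_mono:
  assumes "A \<subseteq> B" "\<delta> \<le> \<delta>'"
  shows "hausdorff_premeasure d \<delta>' A \<le> hausdorff_premeasure d \<delta> B"
  unfolding hausdorff_premeasure_def
proof (rule INF_superset_mono)
  show "{U::nat \<Rightarrow> _. B \<subseteq> (\<Union>i. U i) \<and> (\<forall>i. bounded (U i) \<and> diameter (U i) \<le> \<delta>)}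
      \<subseteq> {U. A \<subseteq> (\<Union>i. U i) \<and> (\<forall>i. bounded (U i) \<and> diameter (U i) \<le> \<delta>')}"
    using assms by (blast intro: order_trans)
qed (rule order_refl)

lemma hausdorff_premeasure_le_measure: "\<delta> > 0 \<Longrightarrow> hausdorff_premeasure d \<delta> A \<le> hausdorff_measure d A"
  unfolding hausdorff_measure_def by (rule SUP_upper) auto

lemma hausdorff_measure_mono: "A \<subseteq> B \<Longrightarrow> hausdorff_measure d A \<le> hausdorff_measure d B"
  unfolding hausdorff_measure_def by (intro SUP_mono') (rule hausdorff_premeasure_mono, auto)

lemma hausdorff_measure_empty [simp]: "hausdorff_measure d {} = 0"
proof -
  have "hausdorff_premeasure d \<delta> {} \<le> 0" if "\<delta> > 0" for \<delta>
    using hausdorff_premeasure_le[of "{}" "\<lambda>_. {}" \<delta> d] that by simp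
  then show ?thesis unfolding hausdorff_measure_def by (intro antisym SUP_least) auto
qed

lemma hausdorff_premeasure_cover:
  fixes A :: "'a::metric_space set"
  assumes "hausdorff_premeasure d \<delta> A < c"
  obtains U :: "nat \<Rightarrow> 'a set" where "A \<subseteq> (\<Union>i. U i)" "\<And>i. bounded (U i)" "\<And>i. diameter (U i) \<le> \<delta>"
    "(\<Sum>i. if U i = {} then 0 else ennreal (unit_ball_vol (real d) * (diameter (U i) / 2) ^ d)) < c"
  using assms unfolding hausdorff_premeasure_def INF_less_iff by auto

lemma hausdorff_premeasure_Un:
  fixes A B :: "'a::metric_space set"
  shows "hausdorff_premeasure d \<delta> (A \<union> B) \<le> hausdorff_premeasure d \<delta> A + hausdorff_premeasure d \<delta> B"
proof (rule ennreal_le_epsilon)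
  fix e :: real
  assume fin: "hausdorff_premeasure d \<delta> A + hausdorff_premeasure d \<delta> B < top" and e: "0 < e"
  define cost :: "'a set \<Rightarrow> ennreal"
    where "cost V = (if V = {} then 0 else ennreal (unit_ball_vol (real d) * (diameter V / 2) ^ d))" for V
  have finA: "hausdorff_premeasure d \<delta> A < hausdorff_premeasure d \<delta> A + ennreal (e/2)"
    and finB: "hausdorff_premeasure d \<delta> B < hausdorff_premeasure d \<delta> B + ennreal (e/2)"
  proof -
    have lt: "x < x + ennreal (e/2)" if "x < top" for x
      using that e ennreal_add_left_cancel_less[of x 0 "ennreal (e/2)"] by (simp add: less_top)
    have "hausdorff_premeasure d \<delta> A < top" "hausdorff_premeasure d \<delta> B < top"
      using fin by (simp_all only: ennreal_add_less_top)
    from this[THEN lt]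
    show "hausdorff_premeasure d \<delta> A < hausdorff_premeasure d \<delta> A + ennreal (e/2)"
      "hausdorff_premeasure d \<delta> B < hausdorff_premeasure d \<delta> B + ennreal (e/2)" .
  qed
  obtain U where U: "A \<subseteq> (\<Union>i. U i)" "\<And>i. bounded (U i)" "\<And>i. diameter (U i) \<le> \<delta>"
    and U_sum: "(\<Sum>i. if U i = {} then 0 else ennreal (unit_ball_vol (real d) * (diameter (U i) / 2) ^ d))
      < hausdorff_premeasure d \<delta> A + ennreal (e/2)"
    using hausdorff_premeasure_cover[OF finA] by blast
  obtain W where W: "B \<subseteq> (\<Union>i. W i)" "\<And>i. bounded (W i)" "\<And>i. diameter (W i) \<le> \<delta>"
    and W_sum: "(\<Sum>i. if W i = {} then 0 else ennreal (unit_ball_vol (real d) * (diameter (W i) / 2) ^ d))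
      < hausdorff_premeasure d \<delta> B + ennreal (e/2)"
    using hausdorff_premeasure_cover[OF finB] by blast
  define X where "X i = (if even i then U (i div 2) else W (i div 2))" for i :: nat
  have X2: "X (2 * i) = U i" "X (Suc (2 * i)) = W i" for i by (auto simp: X_def)
  have "hausdorff_premeasure d \<delta> (A \<union> B) \<le> (\<Sum>i. cost (X i))"
    unfolding cost_def
  proof (rule hausdorff_premeasure_le)
    have "U i \<subseteq> (\<Union>i. X i)" "W i \<subseteq> (\<Union>i. X i)" for i
      using UN_upper[of "2 * i" UNIV X] UN_upper[of "Suc (2 * i)" UNIV X] by (simp_all only: X2 UNIV_I)
    then show "A \<union> B \<subseteq> (\<Union>i. X i)" by (meson U(1) W(1) UN_least Un_least order_trans)
  qed (auto simp: X_def U W)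
  also have "\<dots> \<le> (\<Sum>i. cost (U i)) + (\<Sum>i. cost (W i))"
  proof -
    have eq: "(\<Sum>i<2*n. cost (X i)) = (\<Sum>i<n. cost (U i)) + (\<Sum>i<n. cost (W i))" for n
      by (induction n) (simp_all add: X2 add_ac)
    have "(\<Sum>i<n. cost (X i)) \<le> (\<Sum>i. cost (U i)) + (\<Sum>i. cost (W i))" for n
    proof -
      have "(\<Sum>i<n. cost (X i)) \<le> (\<Sum>i<2*n. cost (X i))" by (intro sum_mono2) auto
      also have "\<dots> \<le> (\<Sum>i. cost (U i)) + (\<Sum>i. cost (W i))"
        unfolding eq by (intro add_mono sum_le_suminf) auto
      finally show ?thesis .
    qed
    then show ?thesis by (intro suminf_le_const) auto
  qed
  also have "\<dots> \<le> (hausdorff_premeasure d \<delta> A + ennreal (e/2)) + (hausdorff_premeasure d \<delta> B + ennreal (e/2))"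
    using U_sum W_sum unfolding cost_def by (intro add_mono less_imp_le)
  also have "\<dots> = hausdorff_premeasure d \<delta> A + hausdorff_premeasure d \<delta> B + (ennreal (e/2) + ennreal (e/2))"
    by (simp only: add_ac)
  also have "ennreal (e/2) + ennreal (e/2) = ennreal e" using e by (simp add: ennreal_plus[symmetric] del: ennreal_plus)
  finally show "hausdorff_premeasure d \<delta> (A \<union> B) \<le> hausdorff_premeasure d \<delta> A + hausdorff_premeasure d \<delta> B + ennreal e" .
qed

lemma hausdorff_measure_Un:
  "hausdorff_measure d (A \<union> B) \<le> hausdorff_measure d A + hausdorff_measure d (B :: 'a::metric_space set)"
  unfolding hausdorff_measure_def[of d "A \<union> B"]
proof (rule SUP_least)
  fix \<delta> :: real assume "\<delta> \<in> {0<..}"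
  then show "hausdorff_premeasure d \<delta> (A \<union> B) \<le> hausdorff_measure d A + hausdorff_measure d B"
    by (intro order_trans[OF hausdorff_premeasure_Un] add_mono hausdorff_premeasure_le_measure) auto
qed

lemma hausdorff_measure_scale:
  fixes A :: "'a::real_normed_vector set"
  assumes c: "c > 0"
  shows "hausdorff_measure d ((*\<^sub>R) c ` A) \<le> ennreal (c ^ d) * hausdorff_measure d A"
  unfolding hausdorff_measure_def[of d "(*\<^sub>R) c ` A"]
proof (rule SUP_least)
  fix \<delta> :: real assume "\<delta> \<in> {0<..}"
  then have \<delta>: "\<delta> > 0" by simp
  let ?P = "hausdorff_premeasure d \<delta> ((*\<^sub>R) c ` A)"
  have "ennreal (1 / c ^ d) * ?P \<le> hausdorff_premeasure d (\<delta> / c) A"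
    unfolding hausdorff_premeasure_def[of d "\<delta> / c"]
  proof (rule INF_greatest)
    fix U :: "nat \<Rightarrow> 'a set" assume "U \<in> {U. A \<subseteq> (\<Union>i. U i) \<and> (\<forall>i. bounded (U i) \<and> diameter (U i) \<le> \<delta> / c)}"
    then have U: "A \<subseteq> (\<Union>i. U i)" "\<And>i. bounded (U i)" "\<And>i. diameter (U i) \<le> \<delta> / c" by auto
    have diam: "diameter ((*\<^sub>R) c ` U i) \<le> c * diameter (U i)" for i
    proof (rule diameter_le)
      show "(*\<^sub>R) c ` U i \<noteq> {} \<or> 0 \<le> c * diameter (U i)"
        using c U(2) by (simp add: diameter_ge_0)
      fix x y assume "x \<in> (*\<^sub>R) c ` U i" "y \<in> (*\<^sub>R) c ` U i"
      then obtain x' y' where "x = c *\<^sub>R x'" "y = c *\<^sub>R y'" "x' \<in> U i" "y' \<in> U i" by auto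
      then show "norm (x - y) \<le> c * diameter (U i)"
        using diameter_bounded_bound[OF U(2), of x' i y'] c by (simp add: dist_norm scaleR_diff_right[symmetric])
    qed
    have "?P \<le> (\<Sum>i. if (*\<^sub>R) c ` U i = {} then 0 else ennreal (unit_ball_vol (real d) * (diameter ((*\<^sub>R) c ` U i) / 2) ^ d))"
    proof (rule hausdorff_premeasure_le)
      show "(*\<^sub>R) c ` A \<subseteq> (\<Union>i. (*\<^sub>R) c ` U i)" using U(1) by blast
      show "bounded ((*\<^sub>R) c ` U i)" for i using U(2) by (rule bounded_scaling)
      show "diameter ((*\<^sub>R) c ` U i) \<le> \<delta>" for i
        using diam[of i] U(3)[of i] c by (simp add: field_simps)
    qed
    also have "\<dots> \<le> (\<Sum>i. ennreal (c ^ d) * (if U i = {} then 0 else ennreal (unit_ball_vol (real d) * (diameter (U i) / 2) ^ d)))"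
    proof (intro suminf_le)
      fix i
      have "(diameter ((*\<^sub>R) c ` U i) / 2) ^ d \<le> (c * diameter (U i) / 2) ^ d"
        using diam[of i] U(2)[of i] bounded_scaling[OF U(2)[of i], of c]
        by (intro power_mono divide_right_mono) (auto simp: diameter_ge_0)
      then have "unit_ball_vol (real d) * (diameter ((*\<^sub>R) c ` U i) / 2) ^ d \<le> unit_ball_vol (real d) * (c * diameter (U i) / 2) ^ d"
        by (rule mult_left_mono) simp
      then have "unit_ball_vol (real d) * (diameter ((*\<^sub>R) c ` U i) / 2) ^ d \<le> c ^ d * (unit_ball_vol (real d) * (diameter (U i) / 2) ^ d)"
        by (simp add: power_mult_distrib power_divide mult_ac)
      then show "(if (*\<^sub>R) c ` U i = {} then 0 else ennreal (unit_ball_vol (real d) * (diameter ((*\<^sub>R) c ` U i) / 2) ^ d))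
        \<le> ennreal (c ^ d) * (if U i = {} then 0 else ennreal (unit_ball_vol (real d) * (diameter (U i) / 2) ^ d))"
        using c U(2)[of i] by (auto simp: ennreal_mult[symmetric] diameter_ge_0 intro!: ennreal_leI)
    qed auto
    also have "\<dots> = ennreal (c ^ d) * (\<Sum>i. (if U i = {} then 0 else ennreal (unit_ball_vol (real d) * (diameter (U i) / 2) ^ d)))"
      by (rule ennreal_suminf_cmult)
    finally have "ennreal (1 / c ^ d) * ?P \<le> ennreal (1 / c ^ d) * (ennreal (c ^ d) * (\<Sum>i. (if U i = {} then 0 else ennreal (unit_ball_vol (real d) * (diameter (U i) / 2) ^ d))))"
      by (rule mult_left_mono) auto
    also have "ennreal (1 / c ^ d) * (ennreal (c ^ d) * x) = x" for x
      using c by (subst mult.assoc[symmetric]) (simp add: ennreal_mult[symmetric])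
    finally show "ennreal (1 / c ^ d) * ?P \<le> (\<Sum>i. (if U i = {} then 0 else ennreal (unit_ball_vol (real d) * (diameter (U i) / 2) ^ d)))" .
  qed
  then have "ennreal (c ^ d) * (ennreal (1 / c ^ d) * ?P) \<le> ennreal (c ^ d) * hausdorff_premeasure d (\<delta> / c) A"
    by (rule mult_left_mono) auto
  also have "ennreal (c ^ d) * (ennreal (1 / c ^ d) * ?P) = ?P"
    using c by (subst mult.assoc[symmetric]) (simp add: ennreal_mult[symmetric])
  also have "ennreal (c ^ d) * hausdorff_premeasure d (\<delta> / c) A \<le> ennreal (c ^ d) * hausdorff_measure d A"
    using c \<delta> by (intro mult_left_mono hausdorff_premeasure_le_measure) auto
  finally show "?P \<le> ennreal (c ^ d) * hausdorff_measure d A" .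
qed

lemma hausdorff_premeasure_finite_cballs:
  fixes A :: "'a::euclidean_space set"
  assumes F: "finite F" "A \<subseteq> (\<Union>x\<in>F. cball x r)" and r: "r \<ge> 0"
  shows "hausdorff_premeasure d (2 * r) A \<le> ennreal (real (card F) * (unit_ball_vol (real d) * r ^ d))"
proof -
  obtain xs where xs: "set xs = F" "distinct xs" using finite_distinct_list[OF F(1)] by auto
  define U where "U i = (if i < length xs then cball (xs ! i) r else {})" for i
  have diam: "diameter (cball x r) = 2 * r" for x :: 'a using r by (simp add: diameter_cball)
  have "hausdorff_premeasure d (2 * r) A
    \<le> (\<Sum>i. if U i = {} then 0 else ennreal (unit_ball_vol (real d) * (diameter (U i) / 2) ^ d))"
  proof (rule hausdorff_premeasure_le)
    show "A \<subseteq> (\<Union>i. U i)"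
    proof
      fix a assume "a \<in> A"
      then obtain x where x: "x \<in> F" "a \<in> cball x r" using F(2) by auto
      then obtain i where "i < length xs" "xs ! i = x" using xs(1) by (metis in_set_conv_nth)
      then have "a \<in> U i" using x by (simp add: U_def)
      then show "a \<in> (\<Union>i. U i)" by blast
    qed
  qed (use r in \<open>auto simp: U_def diam\<close>)
  also have "\<dots> = (\<Sum>i<length xs. if U i = {} then 0 else ennreal (unit_ball_vol (real d) * (diameter (U i) / 2) ^ d))"
    by (rule suminf_finite) (auto simp: U_def)
  also have "\<dots> = (\<Sum>i<length xs. ennreal (unit_ball_vol (real d) * r ^ d))"
    using r by (intro sum.cong) (auto simp: U_def diam)
  also have "\<dots> = ennreal (real (card F) * (unit_ball_vol (real d) * r ^ d))"
    using xs r distinct_card[OF xs(2)] by (simp add: ennreal_mult ennreal_of_nat_eq_real_of_nat)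
  finally show ?thesis .
qed

lemma card_separated_le:
  fixes C T :: "'a::euclidean_space set"
  assumes disj: "pairwise (\<lambda>i j. disjnt (cball i \<rho>) (cball j \<rho>)) C" and sub: "\<And>x. x \<in> C \<Longrightarrow> cball x \<rho> \<subseteq> T"
    and T: "compact T" and rho: "\<rho> > 0"
  shows "finite C" "ennreal (real (card C) * (unit_ball_vol (real DIM('a)) * \<rho> ^ DIM('a))) \<le> emeasure lborel T"
proof -
  have Tfin: "emeasure lborel T < \<infinity>" using emeasure_compact_finite[OF T] by simp
  define w where "w = unit_ball_vol (real DIM('a)) * \<rho> ^ DIM('a)"
  have w: "w > 0" using rho by (simp add: w_def)
  have le: "ennreal (real (card F) * w) \<le> emeasure lborel T" if F: "F \<subseteq> C" "finite F" for F
  proof -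
    have "ennreal (real (card F) * w) = (\<Sum>x\<in>F. emeasure lborel (cball x \<rho>))"
      using rho w by (simp add: emeasure_cball w_def ennreal_mult ennreal_of_nat_eq_real_of_nat)
    also have "\<dots> = emeasure lborel (\<Union>x\<in>F. cball x \<rho>)"
    proof (rule sum_emeasure)
      show "disjoint_family_on (\<lambda>x. cball x \<rho>) F"
        using disj F unfolding disjoint_family_on_def pairwise_def disjnt_def by blast
    qed (use F in auto)
    also have "\<dots> \<le> emeasure lborel T"
      using sub F T by (intro emeasure_mono) (auto simp: compact_imp_closed dest: compact_imp_closed)
    finally show ?thesis .
  qed
  have bound: "card F \<le> nat \<lceil>measure lborel T / w\<rceil>" if F: "F \<subseteq> C" "finite F" for F
  proof -
    have "real (card F) * w \<le> measure lborel T"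
      using le[OF F] Tfin w by (simp add: emeasure_eq_ennreal_measure less_top[symmetric])
    then have "real (card F) \<le> measure lborel T / w" using w by (simp add: field_simps)
    then show ?thesis by linarith
  qed
  show fin: "finite C" using finite_if_finite_subsets_card_bdd[of C] bound by blast
  show "ennreal (real (card C) * (unit_ball_vol (real DIM('a)) * \<rho> ^ DIM('a))) \<le> emeasure lborel T"
    using le[OF order_refl fin] by (simp add: w_def)
qed

text \<open>The easy half of the coarea formula for the distance to the origin, up to a constant (Eilenberg's
  inequality): a set with large slices has large volume. A maximal family of disjoint balls of small
  radius \<open>\<rho>\<close> centred in \<open>E\<close> gives, after enlarging them five times, a cover of each slice. Integrated
  over the radius \<open>s\<close>, the cost of these covers is at most a constant times the volume of a neighbourhood of \<open>E\<close>;
  Fatou's lemma and compactness let \<open>\<rho>\<close> tend to zero.\<close>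

lemma slices_coarea_le:
  fixes E :: "'a::euclidean_space set"
  assumes E: "compact E" and ab: "a < b" and h: "h \<ge> 0"
    and slice: "\<And>s. a < s \<Longrightarrow> s < b \<Longrightarrow> ennreal h \<le> hausdorff_measure (DIM('a) - 1) {x \<in> E. norm x = s}"
  shows "ennreal (h * (b - a)) \<le>
    ennreal (10 * 5 ^ (DIM('a) - 1) * unit_ball_vol (real (DIM('a) - 1)) / unit_ball_vol (real DIM('a))) * emeasure lborel E"
proof (cases "E = {}")
  case True
  have "ennreal h \<le> hausdorff_measure (DIM('a) - 1) ({} :: 'a set)"
    using slice[of "(a+b)/2"] ab True by simp
  then have "h = 0" using h by (simp add: ennreal_eq_0_iff)
  then show ?thesis by simp
next
  case False
  define N where "N = DIM('a)"
  define d where "d = DIM('a) - 1"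
  have Nd: "N = Suc d" by (simp add: N_def d_def)
  define v where "v = unit_ball_vol (real d)"
  define w where "w = unit_ball_vol (real N)"
  have vw: "v > 0" "w > 0" by (auto simp: v_def w_def)
  \<comment> \<open>Each ball of radius \<open>\<rho>\<close> is charged for its five-fold enlargement, on an interval of length \<open>10 * \<rho>\<close>.\<close>
  define K where "K = 10 * 5 ^ d * v / w"
  define \<rho> where "\<rho> m = 1 / real (Suc m)" for m
  have rho: "\<rho> m > 0" "\<rho> m \<le> 1" for m by (auto simp: \<rho>_def)
  have rho0: "\<rho> \<longlonglongrightarrow> 0" unfolding \<rho>_def[abs_def] by (rule LIMSEQ_Suc[OF lim_1_over_n])
  define T where "T m = {x. infdist x E \<le> \<rho> m}" for m
  have Tcl: "closed (T m)" for m unfolding T_def by (intro closed_Collect_le continuous_intros)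
  have Tc: "compact (T m)" for m
  proof -
    obtain B where B: "\<And>x. x \<in> E \<Longrightarrow> norm x \<le> B" using compact_imp_bounded[OF E] by (auto simp: bounded_iff)
    have "norm x \<le> B + 1" if "x \<in> T m" for x
    proof -
      obtain y where y: "y \<in> E" "infdist x E = dist x y"
        using infdist_attains_inf[OF compact_imp_closed[OF E] False] by metis
      then have "dist x y \<le> 1" using that rho(2)[of m] by (simp add: T_def)
      then show ?thesis using B[OF y(1)] norm_triangle_sub[of x y] by (simp add: dist_norm)
    qed
    then have "bounded (T m)" unfolding bounded_iff by blast
    then show ?thesis using Tcl by (simp add: compact_eq_bounded_closed)
  qed
  have "\<exists>C. finite C \<and> C \<subseteq> E \<and> E \<subseteq> (\<Union>x\<in>C. cball x (5 * \<rho> m)) \<and> ennreal (real (card C) * (w * \<rho> m ^ N)) \<le> emeasure lborel (T m)" for m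
  proof -
    have "E \<subseteq> (\<Union>i\<in>E. cball i (\<rho> m))" using rho(1)[of m] by force
    then obtain C where C: "countable C" "C \<subseteq> E" "pairwise (\<lambda>i j. disjnt (cball i (\<rho> m)) (cball j (\<rho> m))) C"
      "E \<subseteq> (\<Union>i\<in>C. cball i (5 * \<rho> m))"
      by (rule Vitali_covering_lemma_cballs[where S = E and K = E and a = "\<lambda>x. x" and r = "\<lambda>_. \<rho> m" and B = "\<rho> m"]) (use rho in auto)
    have "cball x (\<rho> m) \<subseteq> T m" if "x \<in> C" for x
    proof
      fix y assume "y \<in> cball x (\<rho> m)"
      then have "dist y x \<le> \<rho> m" by (simp add: dist_commute)
      moreover have "infdist y E \<le> dist y x" using C(2) that by (intro infdist_le) auto
      ultimately show "y \<in> T m" by (simp add: T_def)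
    qed
    from card_separated_le[OF C(3) this Tc rho(1)] C show ?thesis
      by (auto simp: w_def N_def)
  qed
  then obtain C where C: "\<And>m. finite (C m)" "\<And>m. C m \<subseteq> E" "\<And>m. E \<subseteq> (\<Union>x\<in>C m. cball x (5 * \<rho> m))"
    "\<And>m. ennreal (real (card (C m)) * (w * \<rho> m ^ N)) \<le> emeasure lborel (T m)"
    by metis
  define I where "I m x = {norm x - 5 * \<rho> m..norm x + 5 * \<rho> m}" for m and x :: 'a
  define g where "g m s = (\<Sum>x\<in>C m. ennreal (v * (5 * \<rho> m) ^ d) * indicator (I m x) s)" for m and s :: real
  have [measurable]: "I m x \<in> sets borel" for m x by (simp add: I_def)
  have [measurable]: "g m \<in> borel_measurable borel" for m unfolding g_def[abs_def] by measurable
  have cover: "hausdorff_premeasure d (10 * \<rho> m) {x \<in> E. norm x = s} \<le> g m s" for m s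
  proof -
    define F where "F = {x \<in> C m. s \<in> I m x}"
    have F: "finite F" using C(1)[of m] by (simp add: F_def)
    have "{x \<in> E. norm x = s} \<subseteq> (\<Union>x\<in>F. cball x (5 * \<rho> m))"
    proof safe
      fix y assume y: "y \<in> E" "s = norm y"
      then obtain x where x: "x \<in> C m" "dist x y \<le> 5 * \<rho> m" using C(3)[of m] by auto
      then have "\<bar>norm x - norm y\<bar> \<le> 5 * \<rho> m"
        using norm_triangle_ineq3[of x y] by (simp add: dist_norm)
      then have "x \<in> F" using x y by (auto simp: F_def I_def)
      then show "y \<in> (\<Union>x\<in>F. cball x (5 * \<rho> m))" using x by auto
    qed
    from hausdorff_premeasure_finite_cballs[OF F this, of d] rho(1)[of m]
    have "hausdorff_premeasure d (10 * \<rho> m) {x \<in> E. norm x = s} \<le> ennreal (real (card F) * (v * (5 * \<rho> m) ^ d))"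
      by (simp add: v_def mult.assoc[symmetric])
    also have "\<dots> = (\<Sum>x\<in>F. ennreal (v * (5 * \<rho> m) ^ d))"
      using rho(1)[of m] vw by (simp add: ennreal_mult ennreal_of_nat_eq_real_of_nat less_imp_le)
    also have "\<dots> = g m s"
      unfolding g_def F_def using C(1)[of m] by (intro sum.mono_neutral_cong_left) (auto simp: indicator_def)
    finally show ?thesis .
  qed
  have Kw: "v * (5 * \<rho> m) ^ d * (10 * \<rho> m) = K * (w * \<rho> m ^ N)" for m
    using vw by (simp add: K_def Nd power_mult_distrib field_simps)
  have intg: "(\<integral>\<^sup>+s. g m s \<partial>lborel) \<le> ennreal K * emeasure lborel (T m)" for m
  proof -
    have nn: "0 \<le> v * (5 * \<rho> m) ^ d" "0 \<le> K" "0 \<le> w * \<rho> m ^ N" using vw rho(1)[of m] by (auto simp: K_def)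
    have "(\<integral>\<^sup>+s. g m s \<partial>lborel) = (\<Sum>x\<in>C m. ennreal (v * (5 * \<rho> m) ^ d) * emeasure lborel (I m x))"
      unfolding g_def by (subst nn_integral_sum) (auto simp: nn_integral_cmult_indicator)
    also have "\<dots> = (\<Sum>x\<in>C m. ennreal (K * (w * \<rho> m ^ N)))"
      using rho(1)[of m] nn by (intro sum.cong) (auto simp: I_def ennreal_mult[symmetric] Kw[symmetric])
    also have "\<dots> = ennreal K * ennreal (real (card (C m)) * (w * \<rho> m ^ N))"
    proof -
      have "(\<Sum>x\<in>C m. ennreal (K * W)) = ennreal K * ennreal (real (card (C m)) * W)" if "W \<ge> 0" for W
        using nn that by (simp add: ennreal_mult ennreal_of_nat_eq_real_of_nat mult.left_commute)
      then show ?thesis using nn(3) .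
    qed
    also have "\<dots> \<le> ennreal K * emeasure lborel (T m)" by (intro mult_left_mono C(4)) auto
    finally show ?thesis .
  qed
  have low: "ennreal h \<le> liminf (\<lambda>m. g m s)" if s: "a < s" "s < b" for s
  proof -
    have "hausdorff_measure d {x \<in> E. norm x = s} \<le> liminf (\<lambda>m. g m s)"
      unfolding hausdorff_measure_def
    proof (intro SUP_least Liminf_bounded)
      fix \<delta> :: real assume "\<delta> \<in> {0<..}"
      then have "\<delta> / 10 > 0" by simp
      then have "eventually (\<lambda>m. \<rho> m < \<delta> / 10) sequentially" by (rule order_tendstoD[OF rho0])
      then show "eventually (\<lambda>m. hausdorff_premeasure d \<delta> {x \<in> E. norm x = s} \<le> g m s) sequentially"
      proof eventually_elim
        case (elim m)
        then show ?case
          by (intro order_trans[OF hausdorff_premeasure_mono[OF order_refl, of "10 * \<rho> m" \<delta>] cover]) auto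
      qed
    qed
    then show ?thesis using slice[OF s] unfolding d_def[symmetric] by (rule order_trans[rotated])
  qed
  have lim: "(\<lambda>m. emeasure lborel (T m)) \<longlonglongrightarrow> emeasure lborel (\<Inter>m. T m)"
  proof (rule Lim_emeasure_decseq)
    have "\<rho> n \<le> \<rho> m" if "m \<le> n" for m n using that by (simp add: \<rho>_def frac_le)
    then show "decseq T" unfolding decseq_def T_def by (blast intro: order_trans)
    show "emeasure lborel (T m) \<noteq> \<infinity>" for m
      using emeasure_compact_finite[OF Tc] by (simp add: less_top[symmetric])
  qed (use Tcl in auto)
  have TE: "(\<Inter>m. T m) = E"
  proof safe
    fix x assume x: "x \<in> (\<Inter>m. T m)"
    then have "infdist x E \<le> \<rho> m" for m by (auto simp: T_def)
    then have "infdist x E \<le> 0" using LIMSEQ_le_const[OF rho0] by blast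
    then have "infdist x E = 0" using infdist_nonneg[of x E] by simp
    then show "x \<in> E" using in_closed_iff_infdist_zero[OF compact_imp_closed[OF E] False] by simp
  next
    fix x m assume "x \<in> E" then show "x \<in> T m" using rho(1)[of m] by (simp add: T_def less_imp_le)
  qed
  have "ennreal (h * (b - a)) = (\<integral>\<^sup>+s. ennreal h * indicator {a<..<b} s \<partial>lborel)"
    using ab h by (simp add: nn_integral_cmult_indicator ennreal_mult)
  also have "\<dots> \<le> (\<integral>\<^sup>+s. liminf (\<lambda>m. g m s) \<partial>lborel)"
    using low by (intro nn_integral_mono) (auto simp: indicator_def)
  also have "\<dots> \<le> liminf (\<lambda>m. \<integral>\<^sup>+s. g m s \<partial>lborel)" by (intro nn_integral_liminf) auto
  also have "\<dots> \<le> liminf (\<lambda>m. ennreal K * emeasure lborel (T m))"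
    by (intro Liminf_mono always_eventually allI intg)
  also have "\<dots> = ennreal K * emeasure lborel E"
    using lim unfolding TE by (intro lim_imp_Liminf ennreal_tendsto_cmult) auto
  finally show ?thesis by (simp add: K_def v_def w_def d_def N_def)
qed

text \<open>A thin spherical shell meets a ball of radius \<open>e\<close> in volume of order \<open>e ^ (DIM('a) - 1)\<close> times the
  thickness: about \<open>e / (v - u)\<close> successive dilates of the intersection
  are pairwise disjoint, none has smaller volume, and all fit into the ball of radius \<open>2 * e\<close>.\<close>

lemma emeasure_ball_thin_shell_le:
  fixes p :: "'a::euclidean_space"
  assumes uv: "0 < u" "u < v" "v \<le> 2 * u" and e: "e \<le> v" "4 * (v - u) \<le> e"
  shows "emeasure lborel (ball p e \<inter> {x. u < norm x \<and> norm x \<le> v}) \<le>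
    ennreal (8 * 2 ^ DIM('a) * unit_ball_vol (real DIM('a)) * e ^ (DIM('a) - 1) * (v - u))"
proof -
  define N where "N = DIM('a)"
  have N: "N = Suc (N - 1)" by (simp add: N_def)
  define T where "T = ball p e \<inter> {x. u < norm x \<and> norm x \<le> v}"
  have T [measurable]: "T \<in> sets borel" unfolding T_def by measurable
  have epos: "e > 0" using uv e by simp
  \<comment> \<open>Dilation by a further \<open>\<tau>\<close> moves the shell off itself, even if it was already doubled.\<close>
  define \<tau> where "\<tau> = 2 * (v - u) / u"
  have tau: "\<tau> > 0" using uv by (simp add: \<tau>_def)
  define n where "n = nat \<lfloor>e / (v * \<tau>)\<rfloor>"
  have q: "e / (v * \<tau>) \<ge> 1" 
  proof -
    have "v * \<tau> = (v / u) * (2 * (v - u))" by (simp add: \<tau>_def)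
    also have "\<dots> \<le> 2 * (2 * (v - u))" using uv by (intro mult_right_mono) (auto simp: field_simps)
    finally show ?thesis using e tau uv by (simp add: field_simps)
  qed
  have n1: "real n \<le> e / (v * \<tau>)" using q by (simp add: n_def)
  have n2: "real n \<ge> e / (2 * (v * \<tau>))"
  proof -
    have "real n \<ge> e / (v * \<tau>) - 1" "real n \<ge> 1" using q by (simp_all add: n_def)
    then have "2 * real n \<ge> e / (v * \<tau>)" by linarith
    then show ?thesis by (simp add: field_simps)
  qed
  have ntau: "real n * \<tau> * v \<le> e" using n1 tau uv by (simp add: field_simps)
  define c where "c k = 1 + real k * \<tau>" for k
  have c1: "c k \<ge> 1" for k using tau by (simp add: c_def)
  have cpos: "c k > 0" for k using c1[of k] by linarith
  define D where "D k = {y. (1 / c k) *\<^sub>R y \<in> T}" for k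
  have D [measurable]: "D k \<in> sets borel" for k unfolding D_def by measurable
  have De: "emeasure lborel T \<le> emeasure lborel (D k)" for k
  proof -
    have "emeasure lborel (D k) = ennreal (c k ^ DIM('a)) * (\<integral>\<^sup>+x. indicator (D k) (c k *\<^sub>R x) \<partial>lborel)"
      using cpos[of k] nn_integral_lborel_scale[of "indicator (D k)" "c k"] by simp
    also have "(\<integral>\<^sup>+x. indicator (D k) (c k *\<^sub>R x) \<partial>lborel) = (\<integral>\<^sup>+x. indicator T x \<partial>lborel)"
      using cpos[of k] by (intro nn_integral_cong) (auto simp: D_def indicator_def)
    also have "\<dots> = emeasure lborel T" by simp
    finally have eq: "emeasure lborel (D k) = ennreal (c k ^ DIM('a)) * emeasure lborel T" .
    have "1 \<le> c k ^ DIM('a)" using c1 by simp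
    then have "1 * emeasure lborel T \<le> ennreal (c k ^ DIM('a)) * emeasure lborel T"
      by (intro mult_right_mono) auto
    then show ?thesis unfolding eq by simp
  qed
  have Dsub: "D k \<subseteq> ball p (2 * e)" if k: "k < n" for k
  proof
    fix y assume y: "y \<in> D k"
    define x where "x = (1 / c k) *\<^sub>R y"
    have x: "x \<in> T" using y by (simp add: D_def x_def)
    have yx: "y = x + (real k * \<tau>) *\<^sub>R x"
      using cpos[of k] by (simp add: x_def c_def scaleR_left_distrib[symmetric] divide_simps)
    have "norm (y - p) \<le> norm (x - p) + norm ((real k * \<tau>) *\<^sub>R x)"
      unfolding yx by (metis add_diff_eq add.commute diff_add_eq norm_triangle_ineq)
    also have "norm ((real k * \<tau>) *\<^sub>R x) \<le> real k * \<tau> * v"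
      using x tau by (auto simp: T_def intro!: mult_left_mono)
    also have "\<dots> \<le> real n * \<tau> * v" using k tau uv by (intro mult_right_mono) auto
    also have "\<dots> \<le> e" by (rule ntau)
    finally show "y \<in> ball p (2 * e)" using x by (auto simp: T_def dist_norm norm_minus_commute)
  qed
  have sep: "v * c k \<le> u * c l" if kl: "k < l" "l < n" for k l
  proof -
    have "real k * \<tau> * v \<le> e" using ntau kl tau uv by (intro order_trans[OF _ ntau] mult_right_mono) auto
    then have "real k * \<tau> * v \<le> v" using e by simp
    then have "real k * \<tau> \<le> 1" using uv by simp
    then have "c k \<le> 2" by (simp add: c_def)
    then have "(v - u) * c k \<le> (v - u) * 2" using uv by (intro mult_left_mono) auto
    also have "\<dots> = u * \<tau>" using uv by (simp add: \<tau>_def)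
    finally have "v * c k \<le> u * (c k + \<tau>)" by (simp add: algebra_simps)
    also have "c k + \<tau> \<le> c l" using mult_right_mono[of "real (Suc k)" "real l" \<tau>] kl tau by (simp add: c_def algebra_simps)
    finally show ?thesis using uv by simp
  qed
  have nD: "norm y > u * c k \<and> norm y \<le> v * c k" if "y \<in> D k" for y k
    using that cpos[of k] by (auto simp: D_def T_def field_simps)
  have disj: "disjoint_family_on D {..<n}"
    unfolding disjoint_family_on_def
  proof (intro ballI impI)
    fix k l assume kl: "k \<in> {..<n}" "l \<in> {..<n}" "k \<noteq> l"
    show "D k \<inter> D l = {}"
    proof (rule equals0I)
      fix y assume "y \<in> D k \<inter> D l"
      then have "norm y > u * c k \<and> norm y \<le> v * c k" "norm y > u * c l \<and> norm y \<le> v * c l" using nD by auto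
      moreover have "v * c k \<le> u * c l \<or> v * c l \<le> u * c k" using sep[of k l] sep[of l k] kl by (cases k l rule: linorder_cases) auto
      ultimately show False by linarith
    qed
  qed
  have "ennreal (real n) * emeasure lborel T = (\<Sum>k<n. emeasure lborel T)" by (simp add: ennreal_of_nat_eq_real_of_nat)
  also have "\<dots> \<le> (\<Sum>k<n. emeasure lborel (D k))" by (intro sum_mono De)
  also have "\<dots> = emeasure lborel (\<Union>k<n. D k)" by (intro sum_emeasure disj) auto
  also have "\<dots> \<le> emeasure lborel (ball p (2 * e))" using Dsub by (intro emeasure_mono) auto
  also have "\<dots> = ennreal (unit_ball_vol (real N) * (2 * e) ^ N)" using epos by (simp add: emeasure_ball N_def)
  finally have le: "ennreal (real n) * emeasure lborel T \<le> ennreal (unit_ball_vol (real N) * (2 * e) ^ N)" .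
  have Tfin: "emeasure lborel T = ennreal (measure lborel T)"
    using emeasure_lborel_ball_finite[of p e] emeasure_mono[of T "ball p e" lborel]
    by (intro emeasure_eq_ennreal_measure) (auto simp: T_def less_top[symmetric] top_unique)
  define m where "m = measure lborel T"
  have "real n * m \<le> unit_ball_vol (real N) * (2 * e) ^ N"
    using le epos unfolding Tfin m_def[symmetric]
    by (subst (asm) ennreal_mult[symmetric]) (auto simp: m_def intro: ennreal_le_iff[THEN iffD1])
  moreover have "e / (2 * (v * \<tau>)) * m \<le> real n * m" using n2 by (intro mult_right_mono) (auto simp: m_def)
  ultimately have "e / (2 * (v * \<tau>)) * m \<le> unit_ball_vol (real N) * (2 * e) ^ N" by linarith
  then have "m \<le> unit_ball_vol (real N) * (2 * e) ^ N * (2 * (v * \<tau>)) / e"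
    using epos uv tau by (simp add: field_simps)
  also have "\<dots> = unit_ball_vol (real N) * 2 ^ N * e ^ (N - 1) * (2 * (v * \<tau>))"
    using epos by (subst N, subst (3) N) (simp add: power_mult_distrib)
  also have "\<dots> \<le> unit_ball_vol (real N) * 2 ^ N * e ^ (N - 1) * (8 * (v - u))"
  proof (rule mult_left_mono)
    have "v * \<tau> = (v / u) * (2 * (v - u))" by (simp add: \<tau>_def)
    also have "\<dots> \<le> 2 * (2 * (v - u))" using uv by (intro mult_right_mono) (auto simp: field_simps)
    finally show "2 * (v * \<tau>) \<le> 8 * (v - u)" by simp
  qed (use epos in auto)
  finally have "m \<le> 8 * 2 ^ N * unit_ball_vol (real N) * e ^ (N - 1) * (v - u)" by (simp only: mult_ac)
  then show ?thesis unfolding T_def[symmetric] Tfin m_def[symmetric] by (simp add: N_def ennreal_leI)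
qed

lemma exists_larger_power_le:
  fixes x \<epsilon> \<gamma> v :: real
  assumes "x \<ge> 0" "\<epsilon> > 0" "\<gamma> > 0"
  obtains e where "x < e" "e \<le> x + \<gamma>" "v * (e / 2) ^ d \<le> v * (x / 2) ^ d + \<epsilon>"
proof -
  have "((\<lambda>e. v * (e / 2) ^ d) \<longlongrightarrow> v * (x / 2) ^ d) (at_right x)"
    by (intro tendsto_intros) auto
  then have "eventually (\<lambda>e. v * (e / 2) ^ d < v * (x / 2) ^ d + \<epsilon>) (at_right x)"
    by (rule order_tendstoD) (use assms in auto)
  moreover have "eventually (\<lambda>e. e \<in> {x<..<x + \<gamma>}) (at_right x)"
    by (rule eventually_at_right_real) (use assms in auto)
  ultimately have "eventually (\<lambda>e. x < e \<and> e \<le> x + \<gamma> \<and> v * (e / 2) ^ d \<le> v * (x / 2) ^ d + \<epsilon>) (at_right x)"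
    by eventually_elim auto
  then show ?thesis using that eventually_happens[of _ "at_right x"] trivial_limit_at_right_real[of x] by blast
qed

text \<open>A set of diameter \<open>\<delta>\<close> lies in the open ball about any of its points whose radius is slightly larger than
  \<open>\<delta>\<close>. Open covers are wanted in order to use compactness; the finite partial sums in the conclusion
  are what remains after a finite subcover is chosen.\<close>

lemma hausdorff_premeasure_open_cover:
  fixes A :: "'a::euclidean_space set"
  assumes less: "hausdorff_premeasure d \<delta> A < ennreal M" and M: "M > 0" and gam: "\<gamma> > 0"
  shows "\<exists>(p :: nat \<Rightarrow> 'a) e J. A \<subseteq> (\<Union>i\<in>J. ball (p i) (e i)) \<and>
    (\<forall>i\<in>J. 0 < e i \<and> e i \<le> \<delta> + \<gamma>) \<and>
    (\<forall>I. finite I \<and> I \<subseteq> J \<longrightarrow> (\<Sum>i\<in>I. unit_ball_vol (real d) * (e i / 2) ^ d) \<le> M)"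
proof -
  define v where "v = unit_ball_vol (real d)"
  have v: "v > 0" by (simp add: v_def)
  obtain U :: "nat \<Rightarrow> 'a set" where U: "A \<subseteq> (\<Union>i. U i)" "\<And>i. bounded (U i)" "\<And>i. diameter (U i) \<le> \<delta>"
    and Usum: "(\<Sum>i. if U i = {} then 0 else ennreal (v * (diameter (U i) / 2) ^ d)) < ennreal M"
    using hausdorff_premeasure_cover[OF less] unfolding v_def by blast
  define J where "J = {i. U i \<noteq> {}}"
  define cst where "cst i = (if U i = {} then 0 else v * (diameter (U i) / 2) ^ d)" for i
  have cst0: "cst i \<ge> 0" for i using v U(2)[of i] by (simp add: cst_def diameter_ge_0)
  have Usum': "(\<Sum>i. ennreal (cst i)) < ennreal M"
    using Usum unfolding cst_def by (simp add: if_distrib[of ennreal] cong: if_cong)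
  obtain m where m: "m \<ge> 0" "(\<Sum>i. ennreal (cst i)) = ennreal m" "m < M"
    using Usum' M by (cases "\<Sum>i. ennreal (cst i)" rule: ennreal_cases) (auto simp: ennreal_less_iff)
  define \<epsilon> where "\<epsilon> i = (M - m) * (1/2) ^ Suc i" for i :: nat
  have eps: "\<epsilon> i > 0" for i using m by (simp add: \<epsilon>_def)
  have "\<exists>e. diameter (U i) < e \<and> e \<le> diameter (U i) + \<gamma> \<and> v * (e / 2) ^ d \<le> v * (diameter (U i) / 2) ^ d + \<epsilon> i" for i
    using exists_larger_power_le[OF diameter_ge_0[OF U(2)] eps gam] by metis
  then obtain e where e: "\<And>i. diameter (U i) < e i" "\<And>i. e i \<le> diameter (U i) + \<gamma>"
    "\<And>i. v * (e i / 2) ^ d \<le> v * (diameter (U i) / 2) ^ d + \<epsilon> i" by metis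
  have "\<exists>p. i \<in> J \<longrightarrow> p \<in> U i" for i by (auto simp: J_def)
  then obtain p where p: "\<And>i. i \<in> J \<Longrightarrow> p i \<in> U i" by metis
  show ?thesis
  proof (rule exI[of _ p], rule exI[of _ e], rule exI[of _ J], intro conjI ballI allI impI)
    show "A \<subseteq> (\<Union>i\<in>J. ball (p i) (e i))"
    proof
      fix x assume "x \<in> A"
      then obtain i where i: "x \<in> U i" using U(1) by blast
      then have "i \<in> J" by (auto simp: J_def)
      then have "dist (p i) x \<le> diameter (U i)" using i by (intro diameter_bounded_bound U p)
      then show "x \<in> (\<Union>i\<in>J. ball (p i) (e i))" using e(1)[of i] \<open>i \<in> J\<close> by (intro UN_I[of i]) auto
    qed
    show "0 < e i" "e i \<le> \<delta> + \<gamma>" if "i \<in> J" for i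
      using e(1)[of i] e(2)[of i] U(3)[of i] diameter_ge_0[OF U(2)[of i]] by auto
    fix I :: "nat set" assume "finite I \<and> I \<subseteq> J"
    then have I: "finite I" "I \<subseteq> J" by auto
    have "(\<Sum>i\<in>I. v * (e i / 2) ^ d) \<le> (\<Sum>i\<in>I. cst i + \<epsilon> i)"
      using I e(3) by (intro sum_mono) (auto simp: cst_def J_def)
    also have "\<dots> = (\<Sum>i\<in>I. cst i) + (\<Sum>i\<in>I. \<epsilon> i)" by (rule sum.distrib)
    also have "(\<Sum>i\<in>I. cst i) \<le> m"
    proof -
      have "ennreal (\<Sum>i\<in>I. cst i) = (\<Sum>i\<in>I. ennreal (cst i))" using cst0 by simp
      also have "\<dots> \<le> (\<Sum>i. ennreal (cst i))" by (rule sum_le_suminf) (use I in auto)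
      finally show ?thesis using m by simp
    qed
    also have "(\<Sum>i\<in>I. \<epsilon> i) \<le> M - m"
    proof -
      have "\<epsilon> sums ((M - m) * 1)" unfolding \<epsilon>_def[abs_def] by (intro sums_mult power_half_series)
      then show ?thesis using sum_le_suminf[of \<epsilon> I] I eps by (simp add: sums_iff less_imp_le)
    qed
    finally show "(\<Sum>i\<in>I. unit_ball_vol (real d) * (e i / 2) ^ d) \<le> M" by (simp add: v_def)
  qed
qed

text \<open>The converse direction for compact sets: if all slices are small, so is the volume of the shell.
  Near a radius \<open>s\<close> a finite open cover of the slice still covers the neighbouring slices, so the estimate holds for thin shells around \<open>s\<close> by
  \<open>emeasure_ball_thin_shell_le\<close>; Bolzano's bisection principle adds these up to the whole shell.\<close>

lemma shell_measure_le_slices: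
  fixes K :: "'a::euclidean_space set"
  assumes K: "compact K" and ab: "0 < a" "a \<le> b"
    and M: "M \<ge> 0"
    and slice: "\<And>s. a \<le> s \<Longrightarrow> s \<le> b \<Longrightarrow> hausdorff_measure (DIM('a) - 1) {x \<in> K. norm x = s} \<le> ennreal M"
  shows "emeasure lborel {x \<in> K. a < norm x \<and> norm x \<le> b} \<le>
     ennreal (8 * 4 ^ DIM('a) * unit_ball_vol (real DIM('a)) / unit_ball_vol (real (DIM('a) - 1)) * M * (b - a))"
proof -
  define d where "d = DIM('a) - 1"
  define v where "v = unit_ball_vol (real d)"
  define w where "w = unit_ball_vol (real DIM('a))"
  have vw: "v > 0" "w > 0" by (simp_all add: v_def w_def)
  define C where "C = 8 * 4 ^ DIM('a) * w / v"
  have C: "C > 0" using vw by (simp add: C_def)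
  have [measurable]: "K \<in> sets borel" using compact_imp_closed[OF K] by auto
  have main: "emeasure lborel {x \<in> K. a < norm x \<and> norm x \<le> b} \<le> ennreal (C * M' * (b - a))" if M': "M' > M" for M'
  proof -
    define P where "P u v \<longleftrightarrow> emeasure lborel {x \<in> K. u < norm x \<and> norm x \<le> v} \<le> ennreal (C * M' * (v - u))" for u v
    have M'0: "M' > 0" using M M' by simp
    from ab(2) have "P a b"
    proof (induction rule: Bolzano)
      case (trans u v z)
      have "emeasure lborel {x \<in> K. u < norm x \<and> norm x \<le> z} \<le>
         emeasure lborel ({x \<in> K. u < norm x \<and> norm x \<le> v} \<union> {x \<in> K. v < norm x \<and> norm x \<le> z})"
        by (intro emeasure_mono) auto
      also have "\<dots> \<le> emeasure lborel {x \<in> K. u < norm x \<and> norm x \<le> v} + emeasure lborel {x \<in> K. v < norm x \<and> norm x \<le> z}"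
        by (intro emeasure_subadditive) auto
      also have "\<dots> \<le> ennreal (C * M' * (v - u)) + ennreal (C * M' * (z - v))"
        using trans unfolding P_def by (intro add_mono)
      also have "\<dots> = ennreal (C * M' * (z - u))"
        using trans C M'0 by (subst ennreal_plus[symmetric]) (auto simp: algebra_simps)
      finally show ?case by (simp add: P_def)
    next
      case (local s)
      have "hausdorff_premeasure d (a/4) {x \<in> K. norm x = s} \<le> ennreal M"
        using slice[OF local] ab(1) hausdorff_premeasure_le_measure[of "a/4" d "{x \<in> K. norm x = s}"] by (auto simp: d_def)
      also have "\<dots> < ennreal M'" using M M' by (simp add: ennreal_lessI)
      finally have less: "hausdorff_premeasure d (a/4) {x \<in> K. norm x = s} < ennreal M'" .
      have a4: "a / 4 > 0" using ab(1) by simp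
      obtain p :: "nat \<Rightarrow> 'a" and e J where cov: "{x \<in> K. norm x = s} \<subseteq> (\<Union>i\<in>J. ball (p i) (e i))"
        and e': "\<forall>i\<in>J. 0 < e i \<and> e i \<le> a/4 + a/4"
        and sum': "\<forall>I. finite I \<and> I \<subseteq> J \<longrightarrow> (\<Sum>i\<in>I. unit_ball_vol (real d) * (e i / 2) ^ d) \<le> M'"
        using hausdorff_premeasure_open_cover[OF less M'0 a4] by (elim exE conjE)
      have e: "\<And>i. i \<in> J \<Longrightarrow> 0 < e i \<and> e i \<le> a/4 + a/4"
        and sum: "\<And>I. finite I \<Longrightarrow> I \<subseteq> J \<Longrightarrow> (\<Sum>i\<in>I. v * (e i / 2) ^ d) \<le> M'"
        using e' sum' by (auto simp: v_def)
      have "compact (K \<inter> {x. norm x = s})"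
        by (intro compact_Int_closed K closed_Collect_eq continuous_intros)
      moreover have "K \<inter> {x. norm x = s} = {x \<in> K. norm x = s}" by auto
      ultimately have "compact {x \<in> K. norm x = s}" by simp
      then obtain I where I: "I \<subseteq> J" "finite I" "{x \<in> K. norm x = s} \<subseteq> (\<Union>i\<in>I. ball (p i) (e i))"
        by (rule compactE_image[where C = J and f = "\<lambda>i. ball (p i) (e i)"]) (use cov in auto)
      define Q where "Q = K - (\<Union>i\<in>I. ball (p i) (e i))"
      have "compact Q" unfolding Q_def by (intro compact_diff K) auto
      then have "closed (norm ` Q)" by (intro compact_imp_closed compact_continuous_image continuous_intros)
      moreover have "s \<notin> norm ` Q" using I(3) by (auto simp: Q_def)
      ultimately obtain r where r: "r > 0" "ball s r \<subseteq> - norm ` Q"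
        by (metis ComplI open_Compl openE)
      define E where "E = Min (insert 1 (e ` I))"
      have E: "E > 0" "\<And>i. i \<in> I \<Longrightarrow> E \<le> e i" using I e by (auto simp: E_def)
      \<comment> \<open>Thin enough for the finite cover to persist, and for the hypotheses of \<open>emeasure_ball_thin_shell_le\<close>.\<close>
      define t where "t = min r (min (a / 8) (E / 4))"
      have t: "t > 0" "t \<le> r" "t \<le> a / 8" "t \<le> E / 4" using r ab(1) E by (auto simp: t_def)
      show ?case
      proof (intro exI[of _ t] conjI t(1) allI impI)
        fix u z assume uz: "u \<le> s \<and> s \<le> z \<and> z - u < t"
        then have zu: "z - u < t" by simp
        show "P u z"
        proof (cases "u = z")
          case True
          then have empty: "{x \<in> K. u < norm x \<and> norm x \<le> z} = {}" by auto
          show ?thesis unfolding P_def empty by simp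
        next
          case False
          then have uz': "u < z" "u \<ge> 7 * a / 8" "z \<le> 2 * u" using uz t local(1) by auto
          have sub: "{x \<in> K. u < norm x \<and> norm x \<le> z} \<subseteq> (\<Union>i\<in>I. ball (p i) (e i) \<inter> {x. u < norm x \<and> norm x \<le> z})"
          proof
            fix x assume x: "x \<in> {x \<in> K. u < norm x \<and> norm x \<le> z}"
            then have "norm x \<in> ball s r" using uz t(2) by (auto simp: dist_real_def)
            then have "x \<notin> Q" using r(2) by auto
            then show "x \<in> (\<Union>i\<in>I. ball (p i) (e i) \<inter> {x. u < norm x \<and> norm x \<le> z})" using x by (auto simp: Q_def)
          qed
          have "emeasure lborel {x \<in> K. u < norm x \<and> norm x \<le> z}
            \<le> emeasure lborel (\<Union>i\<in>I. ball (p i) (e i) \<inter> {x. u < norm x \<and> norm x \<le> z})"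
            using I(2) by (intro emeasure_mono sub) measurable
          also have "\<dots> \<le> (\<Sum>i\<in>I. emeasure lborel (ball (p i) (e i) \<inter> {x. u < norm x \<and> norm x \<le> z}))"
            using I(2) by (intro emeasure_subadditive_finite) (auto, measurable)
          also have "\<dots> \<le> (\<Sum>i\<in>I. ennreal (8 * 2 ^ DIM('a) * w * e i ^ d * (z - u)))"
          proof (rule sum_mono)
            fix i assume i: "i \<in> I"
            show "emeasure lborel (ball (p i) (e i) \<inter> {x. u < norm x \<and> norm x \<le> z}) \<le> ennreal (8 * 2 ^ DIM('a) * w * e i ^ d * (z - u))"
              unfolding w_def d_def
            proof (rule emeasure_ball_thin_shell_le)
              have "e i \<le> a / 2" using e[of i] i I(1) by auto
              then show "e i \<le> z" using uz' ab(1) by linarith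
              show "4 * (z - u) \<le> e i" using E(2)[OF i] t(4) zu by (simp add: field_simps)
            qed (use uz' ab(1) in auto)
          qed
          also have "\<dots> = ennreal (\<Sum>i\<in>I. 8 * 2 ^ DIM('a) * w * e i ^ d * (z - u))"
            using uz' vw e I(1) by (intro sum_ennreal) (auto simp: subset_iff less_imp_le)
          also have "(\<Sum>i\<in>I. 8 * 2 ^ DIM('a) * w * e i ^ d * (z - u)) = (8 * 2 ^ DIM('a) * 2 ^ d * w / v * (z - u)) * (\<Sum>i\<in>I. v * (e i / 2) ^ d)"
            using vw unfolding sum_distrib_left by (intro sum.cong) (auto simp: power_divide)
          also have "\<dots> \<le> (8 * 2 ^ DIM('a) * 2 ^ d * w / v * (z - u)) * M'"
            using uz' vw by (intro mult_left_mono sum I) auto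
          also have "\<dots> \<le> (8 * 2 ^ DIM('a) * 2 ^ DIM('a) * w / v * (z - u)) * M'"
            using uz' vw M'0 by (intro mult_right_mono divide_right_mono mult_left_mono power_increasing) (auto simp: d_def)
          also have "\<dots> = C * M' * (z - u)"
            by (simp add: C_def power_mult_distrib[symmetric])
          finally show ?thesis by (simp add: P_def ennreal_leI)
        qed
      qed
    qed
    then show ?thesis by (simp add: P_def)
  qed
  have "((\<lambda>M'. ennreal (C * M' * (b - a))) \<longlongrightarrow> ennreal (C * M * (b - a))) (at_right M)"
    by (intro tendsto_intros)
  moreover have "eventually (\<lambda>M'. emeasure lborel {x \<in> K. a < norm x \<and> norm x \<le> b} \<le> ennreal (C * M' * (b - a))) (at_right M)"
    using eventually_at_right_less by (rule eventually_mono) (rule main)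
  ultimately have "emeasure lborel {x \<in> K. a < norm x \<and> norm x \<le> b} \<le> ennreal (C * M * (b - a))"
    by (intro tendsto_lowerbound) auto
  then show ?thesis by (simp add: C_def v_def w_def d_def)
qed

section \<open>Differentiation along flows and integration by parts\<close>

text \<open>Differentiation under the integral sign at \<open>t = 0\<close>, along the sequence \<open>1 / Suc n\<close>. Applied to
  translations and to dilations it gives the two divergence identities that follow without any
  boundary integrals.\<close>

lemma integral_flow_derivative:
  fixes F F' :: "real \<Rightarrow> 'x \<Rightarrow> real"
  assumes int: "\<And>t. t \<in> {0..1} \<Longrightarrow> integrable M (F t)"
    and der: "\<And>t x. t \<in> {0..1} \<Longrightarrow> ((\<lambda>t. F t x) has_real_derivative F' t x) (at t within {0..1})"
    and bd: "\<And>t x. t \<in> {0..1} \<Longrightarrow> \<bar>F' t x\<bar> \<le> w x" and w: "integrable M w"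
  shows "(\<lambda>n. ((\<integral>x. F (1 / real (Suc n)) x \<partial>M) - (\<integral>x. F 0 x \<partial>M)) * real (Suc n)) \<longlonglongrightarrow> (\<integral>x. F' 0 x \<partial>M)"
proof -
  define t where "t n = 1 / real (Suc n)" for n
  have t: "0 < t n" "t n \<le> 1" "t n \<in> {0..1}" for n by (auto simp: t_def)
  have tn: "t n \<noteq> 0" for n using t(1)[of n] by simp
  have t0: "t \<longlonglongrightarrow> 0" unfolding t_def[abs_def] by (rule LIMSEQ_Suc[OF lim_1_over_n])
  define Q where "Q n x = (F (t n) x - F 0 x) / t n" for n x
  have lim: "(\<lambda>n. Q n x) \<longlonglongrightarrow> F' 0 x" for x
  proof -
    have "((\<lambda>s. (F s x - F 0 x) / (s - 0)) \<longlongrightarrow> F' 0 x) (at 0 within {0..1})"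
      using der[of 0 x] by (simp add: has_field_derivative_iff)
    then have "(\<lambda>n. (F (t n) x - F 0 x) / (t n - 0)) \<longlonglongrightarrow> F' 0 x"
    proof (rule filterlim_compose)
      show "filterlim t (at 0 within {0..1}) sequentially"
        unfolding filterlim_at using t(3) tn t0 by simp
    qed
    then show ?thesis by (simp add: Q_def)
  qed
  have Qb: "\<bar>Q n x\<bar> \<le> w x" for n x
  proof -
    have d: "((\<lambda>t. F t x) has_derivative (\<lambda>h. h * F' s x)) (at s within {0..t n})" if "0 \<le> s" "s \<le> t n" for s
    proof -
      have "((\<lambda>t. F t x) has_real_derivative F' s x) (at s within {0..t n})"
        by (rule DERIV_subset[OF der]) (use that t[of n] in auto)
      then show ?thesis by (simp add: has_field_derivative_def mult_commute_abs)
    qed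
    obtain s where s: "s \<in> {0<..<t n}" "F (t n) x - F 0 x = (t n - 0) * F' s x"
      using mvt_simple[OF t(1) d] by blast
    then have "Q n x = F' s x" using t(1)[of n] by (simp add: Q_def)
    then show ?thesis using bd[of s x] s t(2)[of n] by auto
  qed
  have Qi: "integrable M (Q n)" for n
    unfolding Q_def[abs_def] using int t by (intro integrable_divide Bochner_Integration.integrable_diff) auto
  have "(\<lambda>n. \<integral>x. Q n x \<partial>M) \<longlonglongrightarrow> (\<integral>x. F' 0 x \<partial>M)"
  proof (rule integral_dominated_convergence[OF _ _ w])
    show "Q n \<in> borel_measurable M" for n using Qi by auto
    show "F' 0 \<in> borel_measurable M"
      by (rule borel_measurable_LIMSEQ_real[OF lim]) (use Qi in auto)
    show "AE x in M. (\<lambda>n. Q n x) \<longlonglongrightarrow> F' 0 x" using lim by auto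
    show "AE x in M. norm (Q n x) \<le> w x" for n using Qb by auto
  qed
  moreover have "(\<integral>x. Q n x \<partial>M) = ((\<integral>x. F (1 / real (Suc n)) x \<partial>M) - (\<integral>x. F 0 x \<partial>M)) * real (Suc n)" for n
  proof -
    have "(\<integral>x. Q n x \<partial>M) = ((\<integral>x. F (t n) x \<partial>M) - (\<integral>x. F 0 x \<partial>M)) / t n"
      unfolding Q_def using int t by (subst integral_divide_zero, subst Bochner_Integration.integral_diff) auto
    then show ?thesis by (simp add: t_def)
  qed
  ultimately show ?thesis by simp
qed

lemma integral_lborel_translation:
  fixes f :: "'a::euclidean_space \<Rightarrow> 'b::euclidean_space"
  assumes [measurable]: "f \<in> borel_measurable borel"
  shows "(\<integral>x. f (x + z) \<partial>lborel) = (\<integral>x. f x \<partial>lborel)"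
proof -
  have "(\<integral>x. f x \<partial>lborel) = (\<integral>x. f x \<partial>distr lborel borel ((+) z))"
    by (simp add: lborel_distr_plus)
  also have "\<dots> = (\<integral>x. f (z + x) \<partial>lborel)" by (intro integral_distr) auto
  finally show ?thesis by (simp add: add.commute)
qed

lemma integral_lborel_scale:
  fixes f :: "'a::euclidean_space \<Rightarrow> real"
  assumes [measurable]: "f \<in> borel_measurable borel" and t: "t > 0"
  shows "(\<integral>x. f (t *\<^sub>R x) \<partial>lborel) = (\<integral>x. f x \<partial>lborel) / t ^ DIM('a)"
proof -
  have "(\<integral>x. f x \<partial>lborel) = (\<integral>x. f x \<partial>density (distr lborel borel (\<lambda>x. 0 + t *\<^sub>R x)) (\<lambda>_. \<bar>t\<bar>^DIM('a)))"
    by (rule arg_cong[where f = "\<lambda>M. integral\<^sup>L M f"], rule lborel_affine) (use assms in auto)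
  also have "\<dots> = (\<integral>x. \<bar>t\<bar>^DIM('a) *\<^sub>R f x \<partial>distr lborel borel (\<lambda>x. 0 + t *\<^sub>R x))"
    by (intro integral_density) auto
  also have "\<dots> = (\<integral>x. \<bar>t\<bar>^DIM('a) *\<^sub>R f (t *\<^sub>R x) \<partial>lborel)"
    by (subst integral_distr) auto
  finally show ?thesis using t by simp
qed

lemma integrable_bounded_support:
  fixes f :: "'a::euclidean_space \<Rightarrow> 'b::euclidean_space"
  assumes [measurable]: "f \<in> borel_measurable borel" and "\<And>x. norm (f x) \<le> B" "\<And>x. norm x > r \<Longrightarrow> f x = 0"
  shows "integrable lborel f"
proof (rule Bochner_Integration.integrable_bound)
  show "integrable lborel (\<lambda>x. B * indicator (cball (0::'a) r) x)"
    using emeasure_lborel_cball_finite[of "0::'a" r] by (intro integrable_mult_right integrable_real_indicator) auto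
  show "AE x in lborel. norm (f x) \<le> norm (B * indicator (cball 0 r) x)"
  proof (rule AE_I2)
    fix x
    have "0 \<le> B" using assms(2)[of x] norm_ge_zero order_trans by blast
    then show "norm (f x) \<le> norm (B * indicator (cball 0 r) x)"
      using assms(2)[of x] assms(3)[of x] by (auto simp: indicator_def)
  qed
qed auto

lemma continuous_support_bounded:
  fixes f :: "'a::euclidean_space \<Rightarrow> 'b::real_normed_vector"
  assumes "continuous_on UNIV f" "compact K" "\<And>x. x \<notin> K \<Longrightarrow> f x = 0"
  obtains B where "B > 0" "\<And>x. norm (f x) \<le> B"
proof -
  have "bounded (f ` K)"
    using assms by (meson compact_continuous_image compact_imp_bounded continuous_on_subset subset_UNIV)
  then obtain B where B: "B > 0" "\<And>x. x \<in> K \<Longrightarrow> norm (f x) \<le> B" by (auto simp: bounded_pos)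
  have "norm (f x) \<le> B" for x using B assms(3)[of x] by (cases "x \<in> K") auto
  with B(1) show ?thesis by (rule that)
qed

lemma compact_norm_le:
  assumes "compact (K :: 'a::euclidean_space set)"
  obtains r where "r > 0" "\<And>x. x \<in> K \<Longrightarrow> norm x \<le> r"
  using compact_imp_bounded[OF assms] by (auto simp: bounded_pos)

lemma integrable_compact_support:
  fixes f :: "'a::euclidean_space \<Rightarrow> 'b::euclidean_space"
  assumes "continuous_on UNIV f" "compact K" "\<And>x. x \<notin> K \<Longrightarrow> f x = 0"
  shows "integrable lborel f"
proof -
  obtain B where B: "\<And>x. norm (f x) \<le> B" using continuous_support_bounded[OF assms] by metis
  obtain r where "\<And>x. x \<in> K \<Longrightarrow> norm x \<le> r" using compact_norm_le[OF assms(2)] by metis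
  then show ?thesis
    using assms B by (intro integrable_bounded_support[where B = B and r = r]) (auto intro: borel_measurable_continuous_onI simp: not_le[symmetric])
qed

text \<open>The integral of \<open>\<phi> (x + t *\<^sub>R v)\<close> does not depend on \<open>t\<close>.\<close>

lemma integral_gradient_eq_0:
  fixes \<phi> :: "'a::euclidean_space \<Rightarrow> real"
  assumes \<phi>: "\<phi> \<in> test_functions \<Omega>"
  shows "(\<integral>x. gradient \<phi> x \<partial>lborel) = 0"
proof -
  obtain K where K: "compact K" "K \<subseteq> \<Omega>" "\<And>x. x \<notin> K \<Longrightarrow> \<phi> x = 0" "\<And>x. x \<notin> K \<Longrightarrow> gradient \<phi> x = 0"
    using test_functions_supportE[OF \<phi>] by metis
  have sm: "smooth \<phi>" using \<phi> by (rule test_functions_smooth)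
  have gc: "continuous_on UNIV (gradient \<phi>)" by (rule smooth_continuous_gradient[OF sm])
  have gi: "integrable lborel (gradient \<phi>)" by (rule integrable_compact_support[OF gc K(1,4)])
  obtain B where B: "B > 0" "\<And>x. norm (gradient \<phi> x) \<le> B" using continuous_support_bounded[OF gc K(1,4)] by metis
  obtain r where r: "r > 0" "\<And>x. x \<in> K \<Longrightarrow> norm x \<le> r" using compact_norm_le[OF K(1)] by metis
  have [measurable]: "\<phi> \<in> borel_measurable borel" by (intro borel_measurable_continuous_onI smooth_continuous sm)
  have \<phi>i: "integrable lborel \<phi>" by (rule integrable_compact_support[OF smooth_continuous[OF sm] K(1,3)])
  have "(\<integral>x. gradient \<phi> x \<bullet> v \<partial>lborel) = 0" for v
  proof -
    have "(\<lambda>n. ((\<integral>x. \<phi> (x + (1 / real (Suc n)) *\<^sub>R v) \<partial>lborel) - (\<integral>x. \<phi> (x + 0 *\<^sub>R v) \<partial>lborel)) * real (Suc n))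
      \<longlonglongrightarrow> (\<integral>x. gradient \<phi> (x + 0 *\<^sub>R v) \<bullet> v \<partial>lborel)"
    proof (rule integral_flow_derivative[where w = "\<lambda>x. (B * norm v) * indicator (cball 0 (r + norm v)) x"])
      fix t :: real and x assume t: "t \<in> {0..1}"
      have "((\<lambda>t. x + t *\<^sub>R v) has_derivative (\<lambda>s. s *\<^sub>R v)) (at t within {0..1})"
        by (auto intro!: derivative_eq_intros)
      from has_derivative_compose[OF this smooth_has_derivative[OF sm]]
      show "((\<lambda>t. \<phi> (x + t *\<^sub>R v)) has_real_derivative (gradient \<phi> (x + t *\<^sub>R v) \<bullet> v)) (at t within {0..1})"
        by (simp add: has_field_derivative_def mult_commute_abs)
      show "\<bar>gradient \<phi> (x + t *\<^sub>R v) \<bullet> v\<bar> \<le> (B * norm v) * indicator (cball 0 (r + norm v)) x"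
      proof (cases "x \<in> cball 0 (r + norm v)")
        case True
        have "\<bar>gradient \<phi> (x + t *\<^sub>R v) \<bullet> v\<bar> \<le> norm (gradient \<phi> (x + t *\<^sub>R v)) * norm v" by (rule Cauchy_Schwarz_ineq2)
        also have "\<dots> \<le> B * norm v" by (intro mult_right_mono B) auto
        finally show ?thesis using True by simp
      next
        case False
        have "norm (t *\<^sub>R v) \<le> norm v" using t by (simp add: mult_left_le_one_le)
        then have "norm (x + t *\<^sub>R v) > r" using False norm_triangle_ineq2[of x "- (t *\<^sub>R v)"] by simp
        then have "x + t *\<^sub>R v \<notin> K" using r(2)[of "x + t *\<^sub>R v"] by auto
        then show ?thesis using False K(4) by simp
      qed
    next
      fix t :: real
      show "integrable lborel (\<lambda>x. \<phi> (x + t *\<^sub>R v))"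
      proof (rule integrable_compact_support)
        show "continuous_on UNIV (\<lambda>x. \<phi> (x + t *\<^sub>R v))"
          by (rule continuous_on_compose2[OF smooth_continuous[OF sm, of UNIV]]) (auto intro!: continuous_intros)
        show "compact ((\<lambda>x. - (t *\<^sub>R v) + x) ` K)" using K(1) by (rule compact_translation)
        show "\<phi> (x + t *\<^sub>R v) = 0" if "x \<notin> (\<lambda>x. - (t *\<^sub>R v) + x) ` K" for x
        proof (rule K(3), rule notI)
          assume "x + t *\<^sub>R v \<in> K"
          then have "- (t *\<^sub>R v) + (x + t *\<^sub>R v) \<in> (\<lambda>x. - (t *\<^sub>R v) + x) ` K" by (rule imageI)
          then show False using that by simp
        qed
      qed
    qed (use emeasure_lborel_cball_finite[of "0::'a"] in \<open>auto intro!: integrable_mult_right integrable_real_indicator\<close>)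
    then have "(\<lambda>n. 0) \<longlonglongrightarrow> (\<integral>x. gradient \<phi> x \<bullet> v \<partial>lborel)"
      by (simp add: integral_lborel_translation)
    then show ?thesis by (simp add: LIMSEQ_const_iff)
  qed
  then have "(\<integral>x. gradient \<phi> x \<partial>lborel) \<bullet> v = 0" for v
    using integral_inner_left[OF gi, of v] by simp
  then show ?thesis by (metis inner_eq_zero_iff)
qed

lemma integral_by_parts_test:
  fixes \<phi> \<psi> :: "'a::euclidean_space \<Rightarrow> real"
  assumes \<phi>: "\<phi> \<in> test_functions \<Omega>" and \<psi>: "\<psi> \<in> test_functions \<Omega>"
  shows "(\<integral>x. \<psi> x *\<^sub>R gradient \<phi> x \<partial>lborel) = - (\<integral>x. \<phi> x *\<^sub>R gradient \<psi> x \<partial>lborel)"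
proof -
  note sm = test_functions_smooth[OF \<phi>] test_functions_smooth[OF \<psi>]
  obtain K where K: "compact K" "K \<subseteq> \<Omega>" "\<And>x. x \<notin> K \<Longrightarrow> \<phi> x = 0" "\<And>x. x \<notin> K \<Longrightarrow> gradient \<phi> x = 0"
    using test_functions_supportE[OF \<phi>] by metis
  have pm: "(\<lambda>x. \<phi> x * \<psi> x) \<in> test_functions \<Omega>"
    using K sm by (intro test_functions_subsetI[where K = K] smooth_intros) auto
  have i1: "integrable lborel (\<lambda>x. \<psi> x *\<^sub>R gradient \<phi> x)"
    using K by (intro integrable_compact_support[where K = K] continuous_intros smooth_continuous smooth_continuous_gradient sm) auto
  have i2: "integrable lborel (\<lambda>x. \<phi> x *\<^sub>R gradient \<psi> x)"
    using K by (intro integrable_compact_support[where K = K] continuous_intros smooth_continuous smooth_continuous_gradient sm) auto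
  have "0 = (\<integral>x. \<phi> x *\<^sub>R gradient \<psi> x + \<psi> x *\<^sub>R gradient \<phi> x \<partial>lborel)"
    using integral_gradient_eq_0[OF pm] gradient_mult[OF sm] by simp
  also have "\<dots> = (\<integral>x. \<phi> x *\<^sub>R gradient \<psi> x \<partial>lborel) + (\<integral>x. \<psi> x *\<^sub>R gradient \<phi> x \<partial>lborel)"
    by (rule Bochner_Integration.integral_add[OF i2 i1])
  finally show ?thesis by (simp add: eq_neg_iff_add_eq_0 add.commute)
qed

text \<open>The divergence theorem for the radial field \<open>G x *\<^sub>R x\<close>: the integral of \<open>G (t *\<^sub>R x)\<close> over \<open>x\<close> is a
  multiple of \<open>t powi (- DIM('a))\<close>, and \<open>D x\<close> is the derivative of \<open>G\<close> in the radial direction, multiplied by \<open>norm x\<close>.\<close>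

lemma integral_dilation_eq:
  fixes G D :: "'a::euclidean_space \<Rightarrow> real"
  assumes [measurable]: "G \<in> borel_measurable borel"
    and Gb: "\<And>x. \<bar>G x\<bar> \<le> B" and Db: "\<And>x. \<bar>D x\<bar> \<le> B" and r: "\<And>x. norm x > r \<Longrightarrow> G x = 0 \<and> D x = 0"
    and der: "\<And>x t. t > 0 \<Longrightarrow> ((\<lambda>t. G (t *\<^sub>R x)) has_real_derivative (D (t *\<^sub>R x) / t)) (at t)"
  shows "(\<integral>x. D x \<partial>lborel) = - real DIM('a) * (\<integral>x. G x \<partial>lborel)"
proof -
  have Gi: "integrable lborel (\<lambda>x. G (t *\<^sub>R x))" if t: "t \<ge> 1" for t
  proof (rule integrable_bounded_support[where r = r and B = B])
    fix x :: 'a assume "norm x > r"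
    also have "norm x \<le> norm (t *\<^sub>R x)" using t mult_right_mono[of 1 t "norm x"] by simp
    finally show "G (t *\<^sub>R x) = 0" using r by simp
  qed (use Gb in auto)
  have "(\<lambda>n. ((\<integral>x. G ((1 + 1 / real (Suc n)) *\<^sub>R x) \<partial>lborel) - (\<integral>x. G ((1 + 0) *\<^sub>R x) \<partial>lborel)) * real (Suc n))
      \<longlonglongrightarrow> (\<integral>x. D ((1 + 0) *\<^sub>R x) / (1 + 0) \<partial>lborel)"
  proof (rule integral_flow_derivative[where w = "\<lambda>x. B * indicator (cball 0 r) x"])
    fix t :: real and x :: 'a assume t: "t \<in> {0..1}"
    have "((\<lambda>t. G ((1 + t) *\<^sub>R x)) has_real_derivative (D ((1 + t) *\<^sub>R x) / (1 + t)) * 1) (at t within {0..1})"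
      by (rule DERIV_chain2[where f = "\<lambda>t. G (t *\<^sub>R x)" and g = "\<lambda>t. 1 + t"])
         (use t der in \<open>auto intro!: derivative_eq_intros\<close>)
    then show "((\<lambda>t. G ((1 + t) *\<^sub>R x)) has_real_derivative (D ((1 + t) *\<^sub>R x) / (1 + t))) (at t within {0..1})" by simp
    have "0 \<le> B" using Gb[of x] by linarith
    show "\<bar>D ((1 + t) *\<^sub>R x) / (1 + t)\<bar> \<le> B * indicator (cball 0 r) x"
    proof (cases "norm x \<le> r")
      case True
      have "\<bar>D ((1 + t) *\<^sub>R x)\<bar> / (1 + t) \<le> B / 1" using t Db \<open>0 \<le> B\<close> by (intro frac_le) auto
      then show ?thesis using True t by simp
    next
      case False
      have "norm x \<le> norm ((1 + t) *\<^sub>R x)" using t mult_right_mono[of 1 "1 + t" "norm x"] by simp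
      then show ?thesis using False r[of "(1+t) *\<^sub>R x"] by simp
    qed
  qed (use Gi emeasure_lborel_cball_finite[of "0::'a"] in \<open>auto intro!: integrable_mult_right integrable_real_indicator\<close>)
  then have "(\<lambda>n. ((\<integral>x. G x \<partial>lborel) / (1 + 1 / real (Suc n)) ^ DIM('a) - (\<integral>x. G x \<partial>lborel)) * real (Suc n))
      \<longlonglongrightarrow> (\<integral>x. D x \<partial>lborel)"
    by (subst (asm) integral_lborel_scale) (auto simp: add_pos_pos)
  moreover have "(\<lambda>n. (I / (1 + 1 / real (Suc n)) ^ DIM('a) - I) * real (Suc n)) \<longlonglongrightarrow> - real DIM('a) * I" for I :: real
  proof -
    have "((\<lambda>t. I / (1 + t) ^ DIM('a)) has_real_derivative (- real DIM('a) * I)) (at 0)"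
      by (auto intro!: derivative_eq_intros)
    then have "((\<lambda>t. (I / (1 + t) ^ DIM('a) - I) / t) \<longlongrightarrow> - real DIM('a) * I) (at 0)"
      by (simp add: has_field_derivative_iff)
    moreover have "filterlim (\<lambda>n. 1 / real (Suc n)) (at 0) sequentially"
      unfolding filterlim_at using LIMSEQ_Suc[OF lim_1_over_n[where 'a = real]] by auto
    ultimately have "(\<lambda>n. (I / (1 + 1 / real (Suc n)) ^ DIM('a) - I) / (1 / real (Suc n))) \<longlonglongrightarrow> - real DIM('a) * I"
      by (rule filterlim_compose)
    then show ?thesis by simp
  qed
  ultimately show ?thesis using LIMSEQ_unique by blast
qed

section \<open>Compactness in Lebesgue spaces\<close>

lemma (in finite_measure) power_integral_le:
  fixes g :: "'a \<Rightarrow> real"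
  assumes g: "integrable M g" "\<And>x. g x \<ge> 0" and gn: "integrable M (\<lambda>x. g x ^ n)" and n: "n \<ge> 1"
    and V: "measure M (space M) = V" "V > 0"
  shows "((\<integral>x. g x \<partial>M) / V) ^ n \<le> (\<integral>x. g x ^ n \<partial>M) / V"
proof -
  define m where "m = (\<integral>x. g x \<partial>M) / V"
  have m: "m \<ge> 0" unfolding m_def using g V by (intro divide_nonneg_pos integral_nonneg_AE) auto
  have "(\<integral>x. m ^ n + real n * m ^ (n - 1) * (g x - m) \<partial>M) \<le> (\<integral>x. g x ^ n \<partial>M)"
  proof (rule integral_mono)
    show "integrable M (\<lambda>x. m ^ n + real n * m ^ (n - 1) * (g x - m))"
      using g by (intro Bochner_Integration.integrable_add integrable_mult_right Bochner_Integration.integrable_diff integrable_const)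
    show "m ^ n + real n * m ^ (n - 1) * (g x - m) \<le> g x ^ n" for x
      by (rule power_tangent_le[OF m g(2) n])
  qed (rule gn)
  also have "(\<integral>x. m ^ n + real n * m ^ (n - 1) * (g x - m) \<partial>M) = V * m ^ n + real n * m ^ (n - 1) * ((\<integral>x. g x \<partial>M) - V * m)"
  proof -
    have "integrable M (\<lambda>x. g x - m)" using g by (intro Bochner_Integration.integrable_diff integrable_const)
    then have "(\<integral>x. m ^ n + real n * m ^ (n - 1) * (g x - m) \<partial>M) = (\<integral>x. m ^ n \<partial>M) + (\<integral>x. real n * m ^ (n - 1) * (g x - m) \<partial>M)"
      by (intro Bochner_Integration.integral_add integrable_mult_right integrable_const)
    also have "(\<integral>x. real n * m ^ (n - 1) * (g x - m) \<partial>M) = real n * m ^ (n - 1) * (\<integral>x. g x - m \<partial>M)"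
      by (rule integral_mult_right_zero)
    also have "(\<integral>x. g x - m \<partial>M) = (\<integral>x. g x \<partial>M) - (\<integral>x. m \<partial>M)"
      using g by (intro Bochner_Integration.integral_diff integrable_const)
    finally show ?thesis by (simp add: V)
  qed
  also have "(\<integral>x. g x \<partial>M) - V * m = 0" using V by (simp add: m_def)
  finally show ?thesis using V by (simp add: m_def field_simps)
qed

text \<open>Jensen's inequality; the ball about \<open>c\<close> lies in the ball of twice the radius about \<open>x\<close>.\<close>

lemma continuous_ball_average:
  fixes f :: "'a::euclidean_space \<Rightarrow> real"
  assumes f: "continuous_on UNIV f" and h: "h > 0" and n: "n \<ge> 1" and x: "dist c x < h"
  defines "V \<equiv> measure lborel (ball c h)"
  shows "ennreal (\<bar>f x - (\<integral>y. indicator (ball c h) y * f y \<partial>lborel) / V\<bar> ^ n)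
    \<le> ennreal (1 / V) * (\<integral>\<^sup>+z. ennreal (\<bar>f (x + z) - f x\<bar> ^ n) * indicator (ball 0 (2 * h)) z \<partial>lborel)"
proof -
  define B where "B = ball c h"
  define M where "M = restrict_space lborel B"
  have [measurable]: "B \<in> sets borel" by (simp add: B_def)
  have [measurable]: "f \<in> borel_measurable borel" using f by (rule borel_measurable_continuous_onI)
  have Vpos: "V > 0" using h by (simp add: V_def content_ball)
  have eV: "emeasure lborel B = ennreal V"
    using emeasure_lborel_ball_finite[of c h] unfolding V_def B_def by (intro emeasure_eq_ennreal_measure) auto
  have ball: "space M = B" by (simp add: M_def space_restrict_space)
  interpret M: finite_measure M
    by standard (use eV in \<open>simp add: M_def emeasure_restrict_space space_restrict_space\<close>)
  have MV: "measure M (space M) = V" unfolding ball by (simp add: M_def measure_restrict_space V_def B_def)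
  have int: "integrable M g" if "continuous_on UNIV g" for g :: "'a \<Rightarrow> real"
  proof -
    have "bounded (g ` cball c h)"
      using that by (meson compact_cball compact_continuous_image compact_imp_bounded continuous_on_subset subset_UNIV)
    then obtain b where "\<forall>y\<in>g ` cball c h. norm y \<le> b" unfolding bounded_iff by blast
    then have b: "norm (g y) \<le> b" if "y \<in> cball c h" for y using that by blast
    have "g \<in> borel_measurable borel" using that by (rule borel_measurable_continuous_onI)
    then have "g \<in> borel_measurable M" unfolding M_def by (intro measurable_restrict_space1) simp
    then show ?thesis
      by (rule M.integrable_const_bound[where B = b, rotated])
         (use b ball B_def in \<open>auto intro!: AE_I2\<close>)
  qed
  have intM: "(\<integral>y. indicator B y * g y \<partial>lborel) = (\<integral>y. g y \<partial>M)" for g :: "'a \<Rightarrow> real"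
    unfolding M_def by (subst integral_restrict_space) auto
  have cont: "continuous_on UNIV (\<lambda>y. \<bar>f x - f y\<bar> ^ n)" "continuous_on UNIV (\<lambda>y. \<bar>f x - f y\<bar>)" "continuous_on UNIV (\<lambda>y. f x - f y)"
    using f by (intro continuous_intros; simp)+
  have "f x - (\<integral>y. f y \<partial>M) / V = (\<integral>y. f x - f y \<partial>M) / V"
    using Vpos MV by (subst Bochner_Integration.integral_diff) (auto intro: int f simp: diff_divide_distrib)
  then have "\<bar>f x - (\<integral>y. f y \<partial>M) / V\<bar> = \<bar>\<integral>y. f x - f y \<partial>M\<bar> / V" using Vpos by simp
  also have "\<dots> \<le> (\<integral>y. \<bar>f x - f y\<bar> \<partial>M) / V"
    using Vpos integral_norm_bound[of M "\<lambda>y. f x - f y"] by (intro divide_right_mono) auto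
  finally have "\<bar>f x - (\<integral>y. f y \<partial>M) / V\<bar> ^ n \<le> ((\<integral>y. \<bar>f x - f y\<bar> \<partial>M) / V) ^ n" by (intro power_mono) auto
  also have "\<dots> \<le> (\<integral>y. \<bar>f x - f y\<bar> ^ n \<partial>M) / V"
    by (intro M.power_integral_le int cont n MV Vpos) auto
  finally have "ennreal (\<bar>f x - (\<integral>y. f y \<partial>M) / V\<bar> ^ n) \<le> ennreal (1 / V) * ennreal (\<integral>y. \<bar>f x - f y\<bar> ^ n \<partial>M)"
    using Vpos by (subst ennreal_mult[symmetric]) (auto intro!: ennreal_leI integral_nonneg_AE)
  also have "ennreal (\<integral>y. \<bar>f x - f y\<bar> ^ n \<partial>M) = (\<integral>\<^sup>+y. ennreal (\<bar>f x - f y\<bar> ^ n) \<partial>M)"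
    by (intro nn_integral_eq_integral[symmetric] int cont) auto
  also have "\<dots> = (\<integral>\<^sup>+y. ennreal (\<bar>f x - f y\<bar> ^ n) * indicator B y \<partial>lborel)"
    unfolding M_def by (subst nn_integral_restrict_space) auto
  also have "\<dots> = (\<integral>\<^sup>+z. ennreal (\<bar>f x - f (z + x)\<bar> ^ n) * indicator B (z + x) \<partial>lborel)"
    by (rule nn_integral_lborel_translation[symmetric]) measurable
  also have "\<dots> \<le> (\<integral>\<^sup>+z. ennreal (\<bar>f (x + z) - f x\<bar> ^ n) * indicator (ball 0 (2 * h)) z \<partial>lborel)"
  proof (rule nn_integral_mono)
    fix z
    have "z \<in> ball 0 (2 * h)" if "z + x \<in> B"
    proof -
      have "norm z \<le> dist (z + x) c + dist c x" using dist_triangle[of "z + x" x c] by (simp add: dist_norm)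
      then show ?thesis using that x by (simp add: B_def dist_commute)
    qed
    then show "ennreal (\<bar>f x - f (z + x)\<bar> ^ n) * indicator B (z + x) \<le> ennreal (\<bar>f (x + z) - f x\<bar> ^ n) * indicator (ball 0 (2 * h)) z"
      by (auto simp: indicator_def add.commute abs_minus_commute)
  qed
  finally show ?thesis unfolding intM[symmetric] by (simp add: B_def mult_left_mono)
qed

text \<open>Fubini's theorem and the estimate for translations, one displacement \<open>z\<close> at a time.\<close>

lemma oscillation_le:
  fixes f :: "'a::euclidean_space \<Rightarrow> real"
  assumes f: "smooth f" and n: "n \<ge> 1" and r: "r > 0"
  shows "(\<integral>\<^sup>+x. (\<integral>\<^sup>+z. ennreal (\<bar>f (x + z) - f x\<bar> ^ n) * indicator (ball 0 r) z \<partial>lborel) \<partial>lborel)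
    \<le> ennreal (measure lborel (ball (0::'a) r) * r ^ n) * (\<integral>\<^sup>+x. ennreal (norm (gradient f x) ^ n) \<partial>lborel)"
proof -
  define B where "B = ball (0::'a) r"
  have [measurable]: "B \<in> sets borel" by (simp add: B_def)
  have [measurable]: "f \<in> borel_measurable borel" by (intro borel_measurable_continuous_onI smooth_continuous f)
  have [measurable]: "gradient f \<in> borel_measurable borel" by (intro borel_measurable_continuous_onI smooth_continuous_gradient f)
  let ?E = "\<integral>\<^sup>+x. ennreal (norm (gradient f x) ^ n) \<partial>lborel"
  have eB: "emeasure lborel B = ennreal (measure lborel B)"
    using emeasure_lborel_ball_finite[of "0::'a" r] unfolding B_def by (intro emeasure_eq_ennreal_measure) auto
  have "(\<integral>\<^sup>+x. (\<integral>\<^sup>+z. ennreal (\<bar>f (x + z) - f x\<bar> ^ n) * indicator B z \<partial>lborel) \<partial>lborel)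
    = (\<integral>\<^sup>+z. (\<integral>\<^sup>+x. ennreal (\<bar>f (x + z) - f x\<bar> ^ n) * indicator B z \<partial>lborel) \<partial>lborel)"
    by (rule lborel_pair.Fubini') measurable
  also have "\<dots> \<le> (\<integral>\<^sup>+z. (ennreal (r ^ n) * ?E) * indicator B z \<partial>lborel)"
  proof (rule nn_integral_mono)
    fix z :: 'a
    show "(\<integral>\<^sup>+x. ennreal (\<bar>f (x + z) - f x\<bar> ^ n) * indicator B z \<partial>lborel) \<le> (ennreal (r ^ n) * ?E) * indicator B z"
    proof (cases "z \<in> B")
      case True
      have "(\<integral>\<^sup>+x. ennreal (\<bar>f (x + z) - f x\<bar> ^ n) * indicator UNIV x \<partial>lborel) \<le> ennreal (norm z ^ n) * (\<integral>\<^sup>+x. ennreal (norm (gradient f x) ^ n) * indicator UNIV x \<partial>lborel)"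
        by (rule translation_estimate) (auto intro: segment_bound_smooth f n)
      also have "\<dots> \<le> ennreal (r ^ n) * (\<integral>\<^sup>+x. ennreal (norm (gradient f x) ^ n) * indicator UNIV x \<partial>lborel)"
        using True by (intro mult_right_mono ennreal_leI power_mono) (auto simp: B_def)
      finally show ?thesis using True by simp
    qed auto
  qed
  also have "\<dots> = ennreal (r ^ n) * ?E * ennreal (measure lborel B)"
    by (subst nn_integral_cmult_indicator) (auto simp: eB)
  also have "\<dots> = ennreal (measure lborel B * r ^ n) * ?E"
    using r by (simp add: ennreal_mult mult_ac)
  finally show ?thesis by (simp add: B_def)
qed

text \<open>Every point of \<open>cball 0 R\<close> sees the annulus \<open>ball 0 (2 * R) - cball 0 R\<close>, where \<open>f\<close> vanishes, within
  distance \<open>3 * R\<close>.\<close>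

lemma poincare_bounded_support:
  fixes f :: "'a::euclidean_space \<Rightarrow> real"
  assumes f: "smooth f" "\<And>x. norm x > R \<Longrightarrow> f x = 0" and n: "n \<ge> 1" and R: "R > 0"
  shows "(\<integral>\<^sup>+x. ennreal (\<bar>f x\<bar> ^ n) \<partial>lborel)
    \<le> ennreal (measure lborel (ball (0::'a) (3 * R)) * (3 * R) ^ n / measure lborel (ball (0::'a) (2 * R) - cball 0 R)) *
      (\<integral>\<^sup>+x. ennreal (norm (gradient f x) ^ n) \<partial>lborel)"
proof -
  define A where "A = ball (0::'a) (2 * R) - cball 0 R"
  have [measurable]: "A \<in> sets borel" by (simp add: A_def)
  have mA: "measure lborel A > 0"
  proof -
    have "measure lborel A = measure lborel (ball (0::'a) (2 * R)) - measure lborel (cball (0::'a) R)"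
      unfolding A_def using R emeasure_lborel_ball_finite[of "0::'a" "2 * R"] by (intro measure_Diff) auto
    also have "\<dots> = unit_ball_vol (real DIM('a)) * (2 ^ DIM('a) - 1) * R ^ DIM('a)"
      using R by (simp add: content_ball content_cball power_mult_distrib algebra_simps)
    also have "\<dots> > 0" using R by (intro mult_pos_pos) (auto simp: one_less_power)
    finally show ?thesis .
  qed
  have eA: "emeasure lborel A = ennreal (measure lborel A)"
    using emeasure_mono[of A "ball 0 (2 * R)" lborel] emeasure_lborel_ball_finite[of "0::'a" "2 * R"]
    by (intro emeasure_eq_ennreal_measure) (auto simp: A_def top_unique)
  have "(\<integral>\<^sup>+x. ennreal (\<bar>f x\<bar> ^ n) * indicator (cball 0 R) x \<partial>lborel)
    \<le> ennreal (measure lborel (ball (0::'a) (3 * R)) * (3 * R) ^ n / measure lborel A) *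
      (\<integral>\<^sup>+x. ennreal (norm (gradient f x) ^ n) * indicator UNIV x \<partial>lborel)"
  proof (rule poincare_zero_set[where Y = UNIV])
    show "f \<in> borel_measurable borel" by (intro borel_measurable_continuous_onI smooth_continuous f)
    have [measurable]: "gradient f \<in> borel_measurable borel" by (intro borel_measurable_continuous_onI smooth_continuous_gradient f)
    show "(\<lambda>x. ennreal (norm (gradient f x) ^ n)) \<in> borel_measurable borel" by measurable
    show "AE x in lborel. x \<in> cball 0 R \<and> x + z \<in> UNIV \<longrightarrow> segment_bound n f (\<lambda>x. ennreal (norm (gradient f x) ^ n)) x z" for z
      by (intro AE_I2 impI segment_bound_smooth f n)
    fix x :: 'a assume x: "x \<in> cball 0 R"
    have [measurable]: "f \<in> borel_measurable borel" by (intro borel_measurable_continuous_onI smooth_continuous f)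
    have "emeasure lborel {z. z + x \<in> A} = (\<integral>\<^sup>+z. indicator {z. z + x \<in> A} z \<partial>lborel)"
      by (rule nn_integral_indicator[symmetric]) measurable
    also have "\<dots> = (\<integral>\<^sup>+z. indicator A (z + x) \<partial>lborel)"
      by (intro nn_integral_cong) (simp add: indicator_def)
    also have "\<dots> = (\<integral>\<^sup>+z. indicator A z \<partial>lborel)" by (rule nn_integral_lborel_translation) measurable
    also have "\<dots> = ennreal (measure lborel A)" by (simp add: eA)
    finally have "ennreal (measure lborel A) = emeasure lborel {z. z + x \<in> A}" by simp
    also have "\<dots> \<le> emeasure lborel {z \<in> ball 0 (3 * R). x + z \<in> UNIV \<and> f (x + z) = 0}"
    proof (rule emeasure_mono)
      show "{z. z + x \<in> A} \<subseteq> {z \<in> ball 0 (3 * R). x + z \<in> UNIV \<and> f (x + z) = 0}"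
      proof safe
        fix z assume z: "z + x \<in> A"
        then show "f (x + z) = 0" by (intro f) (auto simp: A_def add.commute)
        have "norm z \<le> norm (z + x) + norm x" using norm_triangle_ineq4[of "z + x" x] by simp
        then show "z \<in> ball 0 (3 * R)" using z x by (auto simp: A_def)
      qed auto
    qed measurable
    finally show "ennreal (measure lborel A) \<le> emeasure lborel {z \<in> ball 0 (3 * R). x + z \<in> UNIV \<and> f (x + z) = 0}" .
  qed (use R n mA in auto)
  moreover have "(\<integral>\<^sup>+x. ennreal (\<bar>f x\<bar> ^ n) * indicator (cball 0 R) x \<partial>lborel) = (\<integral>\<^sup>+x. ennreal (\<bar>f x\<bar> ^ n) \<partial>lborel)"
    using f(2) n by (intro nn_integral_cong) (auto simp: indicator_def power_0_left not_le)
  ultimately show ?thesis by (simp add: A_def)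
qed

text \<open>Rellich's theorem, by averaging. On each ball of a finite cover of mesh \<open>h m\<close> the functions are
  replaced by their means; the error is controlled by the oscillation, hence by \<open>h m ^ n\<close> times the
  energy, uniformly in the sequence. The countably many means are bounded numbers, so one
  subsequence makes all of them converge.\<close>

lemma rellich:
  fixes \<phi> :: "nat \<Rightarrow> 'a::euclidean_space \<Rightarrow> real"
  assumes sm: "\<And>k. smooth (\<phi> k)" and supp: "\<And>k x. norm x > R \<Longrightarrow> \<phi> k x = 0" and R: "R > 0"
    and n: "n \<ge> 1" and M: "M \<ge> 0"
    and E: "\<And>k. (\<integral>\<^sup>+x. ennreal (norm (gradient (\<phi> k) x) ^ n) \<partial>lborel) \<le> ennreal M"
  obtains s :: "nat \<Rightarrow> nat" where "strict_mono s"
    "\<And>e. e > 0 \<Longrightarrow> \<exists>K. \<forall>j\<ge>K. \<forall>k\<ge>K. (\<integral>\<^sup>+x. ennreal (\<bar>\<phi> (s j) x - \<phi> (s k) x\<bar> ^ n) \<partial>lborel) \<le> ennreal e"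
proof -
  define h where "h m = 1 / real (Suc m)" for m
  have h: "h m > 0" for m by (simp add: h_def)
  define V where "V m = measure lborel (ball (0::'a) (h m))" for m
  have Vc: "measure lborel (ball c (h m)) = V m" for c :: 'a and m
    using h[of m] by (simp add: V_def content_ball)
  have V: "V m > 0" for m using h[of m] by (simp add: V_def content_ball)
  have "\<exists>F. finite F \<and> cball (0::'a) R \<subseteq> (\<Union>c\<in>F. ball c (h m))" for m
    using compact_cball[of "0::'a" R] h[of m] unfolding compact_eq_totally_bounded by blast
  then obtain F where F: "\<And>m. finite (F m)" "\<And>m. cball (0::'a) R \<subseteq> (\<Union>c\<in>F m. ball c (h m))" by metis
  define a where "a k p = (\<integral>y. indicator (ball (fst p) (h (snd p))) y * \<phi> k y \<partial>lborel)" for k and p :: "'a \<times> nat"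
  have bm [measurable]: "\<phi> k \<in> borel_measurable borel" "gradient (\<phi> k) \<in> borel_measurable borel" for k
    using sm by (auto intro!: borel_measurable_continuous_onI smooth_continuous smooth_continuous_gradient)
  have \<phi>i: "integrable lborel (\<phi> k)" for k
  proof -
    have "bounded (\<phi> k ` cball 0 R)"
      by (intro compact_imp_bounded compact_continuous_image smooth_continuous sm compact_cball)
    then obtain b where "\<forall>y\<in>\<phi> k ` cball 0 R. norm y \<le> b" unfolding bounded_iff by blast
    then have b: "norm (\<phi> k y) \<le> b" if "norm y \<le> R" for y using that by auto
    have "integrable lborel (\<lambda>x. indicator (cball 0 R) x *\<^sub>R \<phi> k x)"
      by (intro borel_integrable_compact smooth_continuous sm compact_cball)
    also have "(\<lambda>x. indicator (cball 0 R) x *\<^sub>R \<phi> k x) = \<phi> k"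
      by (intro ext) (auto simp: indicator_def not_le supp)
    finally show ?thesis .
  qed
  define C where "C = measure lborel (ball (0::'a) (3 * R)) * (3 * R) ^ n / measure lborel (ball (0::'a) (2 * R) - cball 0 R)"
  have C: "C \<ge> 0" using R by (simp add: C_def)
  have [measurable]: "(indicator (cball 0 R) :: 'a \<Rightarrow> ennreal) \<in> borel_measurable borel"
    by (intro borel_measurable_indicator) auto
  define VR where "VR = measure lborel (cball (0::'a) R)"
  have VR: "emeasure lborel (cball (0::'a) R) = ennreal VR" "VR \<ge> 0"
    using emeasure_lborel_cball_finite[of "0::'a" R] unfolding VR_def by (auto intro!: emeasure_eq_ennreal_measure)
  have abound: "norm (a k p) \<le> VR + C * M" for k p
  proof -
    let ?B = "ball (fst p) (h (snd p))"
    have "ennreal (norm (a k p)) \<le> (\<integral>\<^sup>+y. norm (indicator ?B y * \<phi> k y) \<partial>lborel)"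
    proof -
      have "integrable lborel (\<lambda>y. indicator ?B y * \<phi> k y)"
        by (rule Bochner_Integration.integrable_bound[OF \<phi>i[of k]]) (auto simp: indicator_def)
      then show ?thesis unfolding a_def by (rule integral_norm_bound_ennreal)
    qed
    also have "\<dots> \<le> (\<integral>\<^sup>+y. indicator (cball 0 R) y + ennreal (\<bar>\<phi> k y\<bar> ^ n) \<partial>lborel)"
    proof (rule nn_integral_mono)
      fix y
      have "\<bar>\<phi> k y\<bar> \<le> 1 + \<bar>\<phi> k y\<bar> ^ n"
      proof (cases "\<bar>\<phi> k y\<bar> \<le> 1")
        case False
        then have "\<bar>\<phi> k y\<bar> ^ 1 \<le> \<bar>\<phi> k y\<bar> ^ n" using n by (intro power_increasing) auto
        then show ?thesis by simp
      qed (auto intro: add_increasing2)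
      then have "ennreal \<bar>\<phi> k y\<bar> \<le> 1 + ennreal (\<bar>\<phi> k y\<bar> ^ n)"
        by (metis abs_ge_zero ennreal_1 ennreal_leI ennreal_plus zero_le_one zero_le_power)
      then show "ennreal (norm (indicator ?B y * \<phi> k y)) \<le> indicator (cball 0 R) y + ennreal (\<bar>\<phi> k y\<bar> ^ n)"
        using supp[of y k] by (auto simp: indicator_def not_le)
    qed
    also have "\<dots> = ennreal VR + (\<integral>\<^sup>+y. ennreal (\<bar>\<phi> k y\<bar> ^ n) \<partial>lborel)"
      by (subst nn_integral_add) (auto simp: VR intro!: borel_measurable_indicator)
    also have "\<dots> \<le> ennreal VR + ennreal C * ennreal M"
    proof (rule add_left_mono)
      have "(\<integral>\<^sup>+y. ennreal (\<bar>\<phi> k y\<bar> ^ n) \<partial>lborel) \<le> ennreal C * (\<integral>\<^sup>+x. ennreal (norm (gradient (\<phi> k) x) ^ n) \<partial>lborel)"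
        unfolding C_def by (rule poincare_bounded_support[OF sm supp n R])
      also have "\<dots> \<le> ennreal C * ennreal M" by (intro mult_left_mono E) auto
      finally show "(\<integral>\<^sup>+y. ennreal (\<bar>\<phi> k y\<bar> ^ n) \<partial>lborel) \<le> ennreal C * ennreal M" .
    qed
    also have "\<dots> = ennreal (VR + C * M)" using C M VR by (simp add: ennreal_mult)
    finally show ?thesis using C M VR by (subst (asm) ennreal_le_iff) auto
  qed
  \<comment> \<open>All pairs of a centre and the index of its mesh: countably many means to control.\<close>
  define S where "S = (\<Union>m. F m \<times> {m})"
  have "countable S" unfolding S_def by (intro countable_UN countable_finite[of "_ \<times> _"] finite_cartesian_product F) auto
  then obtain s where s: "strict_mono (s :: nat \<Rightarrow> nat)" "\<And>p. p \<in> S \<Longrightarrow> \<exists>l. (\<lambda>i. a (s i) p) \<longlonglongrightarrow> l"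
    using function_convergent_subsequence[of S a "VR + C * M"] abound by blast
  define D where "D = (2::real) ^ (n - 1)"
  have D: "D > 0" by (simp add: D_def)
  define M2 where "M2 = D * (M + M)"
  have M2: "M2 \<ge> 0" using D M by (simp add: M2_def)
  define A where "A m j k = (\<Sum>c\<in>F m. (\<bar>a j (c, m) - a k (c, m)\<bar> / V m) ^ n)" for m j k
  have A0: "A m j k \<ge> 0" for m j k unfolding A_def using V[of m] by (intro sum_nonneg) auto
  define QR where "QR = cball (0::'a) R"
  have [measurable]: "QR \<in> sets borel" by (simp add: QR_def)
  have est: "(\<integral>\<^sup>+x. ennreal (\<bar>\<phi> j x - \<phi> k x\<bar> ^ n) \<partial>lborel) \<le> ennreal (D * (VR * A m j k + 2 ^ DIM('a) * (2 * h m) ^ n * M2))" for m j k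
  proof -
    define f where "f x = \<phi> j x - \<phi> k x" for x
    have fs: "smooth f" unfolding f_def[abs_def] by (intro smooth_diff sm)
    have [measurable]: "f \<in> borel_measurable borel" by (intro borel_measurable_continuous_onI smooth_continuous fs)
    define osc where "osc x = (\<integral>\<^sup>+z. ennreal (\<bar>f (x + z) - f x\<bar> ^ n) * indicator (ball 0 (2 * h m)) z \<partial>lborel)" for x
    have [measurable]: "osc \<in> borel_measurable borel"
    proof -
      define Q where "Q = ball (0::'a) (2 * h m)"
      have [measurable]: "Q \<in> sets borel" by (simp add: Q_def)
      show ?thesis unfolding osc_def[abs_def] Q_def[symmetric] by measurable
    qed
    have fa: "(\<integral>y. indicator (ball c (h m)) y * f y \<partial>lborel) = a j (c, m) - a k (c, m)" for c
    proof -
      have "integrable lborel (\<lambda>y. indicator (ball c (h m)) y * \<phi> i y)" for i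
        by (rule Bochner_Integration.integrable_bound[OF \<phi>i[of i]]) (auto simp: indicator_def)
      then show ?thesis unfolding a_def f_def
        by (subst Bochner_Integration.integral_diff[symmetric]) (auto simp: algebra_simps)
    qed
    have pt: "ennreal (\<bar>f x\<bar> ^ n) \<le> ennreal D * (ennreal (A m j k) * indicator QR x + ennreal (1 / V m) * osc x)" for x
    proof (cases "norm x \<le> R")
      case True
      then obtain c where c: "c \<in> F m" "dist c x < h m" using F(2)[of m] by auto
      define b where "b = (a j (c, m) - a k (c, m)) / V m"
      have o: "ennreal (\<bar>f x - b\<bar> ^ n) \<le> ennreal (1 / V m) * osc x"
        using continuous_ball_average[OF smooth_continuous[OF fs] h n c(2)] by (simp add: fa b_def osc_def Vc)
      have "\<bar>b\<bar> ^ n = (\<bar>a j (c, m) - a k (c, m)\<bar> / V m) ^ n" using V[of m] by (simp add: b_def)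
      also have "\<dots> \<le> A m j k" unfolding A_def using c(1) F(1) V[of m] by (intro member_le_sum) auto
      finally have bA: "\<bar>b\<bar> ^ n \<le> A m j k" .
      have "\<bar>f x\<bar> ^ n \<le> D * (\<bar>b\<bar> ^ n + \<bar>f x - b\<bar> ^ n)"
        using norm_power_split_half[OF n, of "f x" b] by (simp add: D_def)
      also have "\<dots> \<le> D * (A m j k + \<bar>f x - b\<bar> ^ n)" using bA D by (intro mult_left_mono add_right_mono) auto
      finally have "ennreal (\<bar>f x\<bar> ^ n) \<le> ennreal (D * (A m j k + \<bar>f x - b\<bar> ^ n))" by (rule ennreal_leI)
      also have "\<dots> = ennreal D * (ennreal (A m j k) + ennreal (\<bar>f x - b\<bar> ^ n))"
        using D A0 by (simp add: ennreal_mult)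
      also have "\<dots> \<le> ennreal D * (ennreal (A m j k) * indicator QR x + ennreal (1 / V m) * osc x)"
        using True o unfolding QR_def by (intro mult_left_mono add_mono) auto
      finally show ?thesis .
    next
      case False
      then have "f x = 0" using supp by (simp add: f_def)
      then show ?thesis using n by (simp add: power_0_left)
    qed
    have gE: "(\<integral>\<^sup>+x. ennreal (norm (gradient f x) ^ n) \<partial>lborel) \<le> ennreal M2"
    proof -
      have "(\<integral>\<^sup>+x. ennreal (norm (gradient f x) ^ n) \<partial>lborel)
        \<le> (\<integral>\<^sup>+x. ennreal D * (ennreal (norm (gradient (\<phi> j) x) ^ n) + ennreal (norm (gradient (\<phi> k) x) ^ n)) \<partial>lborel)"
      proof (rule nn_integral_mono)
        fix x
        have "norm (gradient f x) ^ n \<le> D * (norm (gradient (\<phi> j) x) ^ n + norm (gradient (\<phi> k) x) ^ n)"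
          using norm_power_split_half[OF n, of "gradient f x" "gradient (\<phi> j) x"]
          unfolding f_def[abs_def] gradient_diff[OF sm sm] by (simp add: D_def)
        then show "ennreal (norm (gradient f x) ^ n) \<le> ennreal D * (ennreal (norm (gradient (\<phi> j) x) ^ n) + ennreal (norm (gradient (\<phi> k) x) ^ n))"
          using D by (simp add: ennreal_mult[symmetric] ennreal_plus[symmetric] ennreal_leI del: ennreal_plus)
      qed
      also have "\<dots> = ennreal D * ((\<integral>\<^sup>+x. ennreal (norm (gradient (\<phi> j) x) ^ n) \<partial>lborel) + (\<integral>\<^sup>+x. ennreal (norm (gradient (\<phi> k) x) ^ n) \<partial>lborel))"
        by (subst nn_integral_cmult, measurable, subst nn_integral_add) auto
      also have "\<dots> \<le> ennreal D * (ennreal M + ennreal M)" by (intro mult_left_mono add_mono E) auto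
      also have "\<dots> = ennreal M2" using D M by (simp add: M2_def ennreal_mult[symmetric] ennreal_plus[symmetric] del: ennreal_plus)
      finally show ?thesis .
    qed
    have osc_le: "ennreal (1 / V m) * (\<integral>\<^sup>+x. osc x \<partial>lborel) \<le> ennreal (2 ^ DIM('a) * (2 * h m) ^ n * M2)"
    proof -
      have "ennreal (1 / V m) * (\<integral>\<^sup>+x. osc x \<partial>lborel) \<le> ennreal (1 / V m) * (ennreal (measure lborel (ball (0::'a) (2 * h m)) * (2 * h m) ^ n) * ennreal M2)"
        unfolding osc_def by (intro mult_left_mono order_trans[OF oscillation_le[OF fs n]] gE) (use h[of m] in auto)
      also have "\<dots> = ennreal (1 / V m * (measure lborel (ball (0::'a) (2 * h m)) * (2 * h m) ^ n * M2))"
        using V[of m] M2 h[of m] by (simp add: ennreal_mult[symmetric])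
      also have "1 / V m * (measure lborel (ball (0::'a) (2 * h m)) * (2 * h m) ^ n * M2) = 2 ^ DIM('a) * (2 * h m) ^ n * M2"
        using h[of m] less_imp_neq[OF unit_ball_vol_pos[of "real DIM('a)"]] by (simp add: V_def content_ball power_mult_distrib field_simps)
      finally show ?thesis .
    qed
    have "(\<integral>\<^sup>+x. ennreal (\<bar>f x\<bar> ^ n) \<partial>lborel) \<le> (\<integral>\<^sup>+x. ennreal D * (ennreal (A m j k) * indicator QR x + ennreal (1 / V m) * osc x) \<partial>lborel)"
      by (intro nn_integral_mono pt)
    also have "\<dots> = ennreal D * (ennreal (A m j k) * ennreal VR + ennreal (1 / V m) * (\<integral>\<^sup>+x. osc x \<partial>lborel))"
    proof -
      have "(\<integral>\<^sup>+x. ennreal (A m j k) * indicator QR x \<partial>(lborel :: 'a measure)) = ennreal (A m j k) * ennreal VR"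
        by (subst nn_integral_cmult_indicator) (auto simp: VR QR_def)
      moreover have "(\<integral>\<^sup>+x. ennreal (1 / V m) * osc x \<partial>lborel) = ennreal (1 / V m) * (\<integral>\<^sup>+x. osc x \<partial>lborel)"
        by (intro nn_integral_cmult) measurable
      moreover have "(\<integral>\<^sup>+x. ennreal D * (ennreal (A m j k) * indicator QR x + ennreal (1 / V m) * osc x) \<partial>lborel)
        = ennreal D * (\<integral>\<^sup>+x. ennreal (A m j k) * indicator QR x + ennreal (1 / V m) * osc x \<partial>lborel)"
        by (intro nn_integral_cmult) measurable
      moreover have "(\<integral>\<^sup>+x. ennreal (A m j k) * indicator QR x + ennreal (1 / V m) * osc x \<partial>lborel)
        = (\<integral>\<^sup>+x. ennreal (A m j k) * indicator QR x \<partial>lborel) + (\<integral>\<^sup>+x. ennreal (1 / V m) * osc x \<partial>lborel)"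
        by (intro nn_integral_add) measurable
      ultimately show ?thesis by simp
    qed
    also have "\<dots> \<le> ennreal D * (ennreal (A m j k) * ennreal VR + ennreal (2 ^ DIM('a) * (2 * h m) ^ n * M2))"
      by (intro mult_left_mono add_left_mono osc_le) auto
    also have "\<dots> = ennreal (D * (VR * A m j k + 2 ^ DIM('a) * (2 * h m) ^ n * M2))"
      using D A0[of m j k] VR M2 h[of m] by (simp add: ennreal_mult[symmetric] ennreal_plus[symmetric] mult.commute del: ennreal_plus)
    finally show ?thesis by (simp add: f_def)
  qed
  show ?thesis
  proof (rule that[OF s(1)])
    fix e :: real assume e: "e > 0"
    have "(\<lambda>m. D * (2 ^ DIM('a) * (2 * h m) ^ n * M2)) \<longlonglongrightarrow> D * (2 ^ DIM('a) * (2 * 0) ^ n * M2)"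
      unfolding h_def by (intro tendsto_intros LIMSEQ_Suc[OF lim_1_over_n])
    then have "(\<lambda>m. D * (2 ^ DIM('a) * (2 * h m) ^ n * M2)) \<longlonglongrightarrow> 0" using n by (simp add: power_0_left)
    then have "eventually (\<lambda>m. D * (2 ^ DIM('a) * (2 * h m) ^ n * M2) < e / 2) sequentially"
      by (rule order_tendstoD) (use e in auto)
    then obtain m where m: "D * (2 ^ DIM('a) * (2 * h m) ^ n * M2) < e / 2"
      using eventually_happens[OF _] trivial_limit_sequentially by blast
    define q where "q = min 1 (e / (2 * D * (VR + 1) * (real (card (F m)) + 1)))"
    have q: "q > 0" "q \<le> 1" using e D VR by (auto simp: q_def)
    have qe: "D * VR * (real (card (F m)) * q) \<le> e / 2"
    proof -
      have "D * VR * (real (card (F m)) * q) \<le> D * (VR + 1) * ((real (card (F m)) + 1) * q)"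
        using D VR q by (intro mult_mono) auto
      also have "\<dots> \<le> D * (VR + 1) * ((real (card (F m)) + 1) * (e / (2 * D * (VR + 1) * (real (card (F m)) + 1))))"
        using D VR by (intro mult_left_mono) (auto simp: q_def)
      also have "\<dots> = e / 2"
      proof -
        have "VR + 1 \<noteq> 0" "real (card (F m)) + 1 \<noteq> 0" using VR by auto
        then show ?thesis using D by (simp add: divide_simps)
      qed
      finally show ?thesis .
    qed
    have "\<forall>c\<in>F m. \<exists>l. eventually (\<lambda>j. \<bar>a (s j) (c, m) - l\<bar> < q * V m / 2) sequentially"
    proof
      fix c assume "c \<in> F m"
      then obtain l where "(\<lambda>i. a (s i) (c, m)) \<longlonglongrightarrow> l" using s(2)[of "(c, m)"] by (auto simp: S_def)
      then have "eventually (\<lambda>j. dist (a (s j) (c, m)) l < q * V m / 2) sequentially"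
        using q V[of m] by (intro tendstoD) auto
      then show "\<exists>l. eventually (\<lambda>j. \<bar>a (s j) (c, m) - l\<bar> < q * V m / 2) sequentially"
        by (auto simp: dist_real_def)
    qed
    then obtain l where "\<forall>c\<in>F m. eventually (\<lambda>j. \<bar>a (s j) (c, m) - l c\<bar> < q * V m / 2) sequentially" by metis
    then have "eventually (\<lambda>j. \<forall>c\<in>F m. \<bar>a (s j) (c, m) - l c\<bar> < q * V m / 2) sequentially"
      by (intro eventually_ball_finite F) auto
    then obtain K where K: "\<And>j c. j \<ge> K \<Longrightarrow> c \<in> F m \<Longrightarrow> \<bar>a (s j) (c, m) - l c\<bar> < q * V m / 2"
      by (auto simp: eventually_sequentially)
    show "\<exists>K. \<forall>j\<ge>K. \<forall>k\<ge>K. (\<integral>\<^sup>+x. ennreal (\<bar>\<phi> (s j) x - \<phi> (s k) x\<bar> ^ n) \<partial>lborel) \<le> ennreal e"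
    proof (intro exI allI impI)
      fix j k assume jk: "j \<ge> K" "k \<ge> K"
      have "A m (s j) (s k) \<le> (\<Sum>c\<in>F m. q)"
        unfolding A_def
      proof (rule sum_mono)
        fix c assume c: "c \<in> F m"
        define y where "y = \<bar>a (s j) (c, m) - a (s k) (c, m)\<bar> / V m"
        have "\<bar>a (s j) (c, m) - a (s k) (c, m)\<bar> \<le> q * V m"
          using K[OF jk(1) c] K[OF jk(2) c] by linarith
        then have y: "0 \<le> y" "y \<le> q" using V[of m] by (auto simp: y_def field_simps)
        have "y ^ n \<le> y ^ 1" using y q n by (intro power_decreasing) auto
        then show "(\<bar>a (s j) (c, m) - a (s k) (c, m)\<bar> / V m) ^ n \<le> q" using y by (simp add: y_def)
      qed
      then have "A m (s j) (s k) \<le> real (card (F m)) * q" by simp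
      then have "D * VR * A m (s j) (s k) \<le> D * VR * (real (card (F m)) * q)"
        by (rule mult_left_mono) (use D VR in auto)
      then have "D * VR * A m (s j) (s k) \<le> e / 2" using qe by (rule order_trans)
      then have "D * (VR * A m (s j) (s k) + 2 ^ DIM('a) * (2 * h m) ^ n * M2) \<le> e"
        using m unfolding distrib_left by (simp add: mult.assoc)
      then show "(\<integral>\<^sup>+x. ennreal (\<bar>\<phi> (s j) x - \<phi> (s k) x\<bar> ^ n) \<partial>lborel) \<le> ennreal e"
        by (intro order_trans[OF est[of "s j" "s k" m]] ennreal_leI)
    qed
  qed
qed

section \<open>Smallness of the Hardy integral near the origin and near the outer sphere\<close>

definition hardy_weight :: "real \<Rightarrow> 'a::euclidean_space \<Rightarrow> real" where
  "hardy_weight R x = 1 / (norm x ^ DIM('a) * ln (R / norm x) ^ DIM('a))"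

definition energy :: "('a::euclidean_space \<Rightarrow> real) \<Rightarrow> ennreal" where
  "energy \<phi> = (\<integral>\<^sup>+x. ennreal (norm (gradient \<phi> x) ^ DIM('a)) \<partial>lborel)"

lemma measurable_hardy_weight [measurable]: "hardy_weight R \<in> borel_measurable borel"
  unfolding hardy_weight_def[abs_def] by measurable

lemma ennreal_mult_assoc: "0 \<le> a \<Longrightarrow> 0 \<le> b \<Longrightarrow> ennreal a * (ennreal b * e) = ennreal (a * b) * e"
  by (simp add: ennreal_mult mult.assoc)

lemma dyadic_layer_exists:
  fixes c d :: real
  assumes "0 < d" "d < c / 2 ^ J"
  obtains i where "c / 2 ^ Suc (i + J) \<le> d" "d < c / 2 ^ (i + J)"
proof -
  have c: "c > 0" using assms by (smt (verit) divide_nonpos_pos zero_less_power)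
  have "(\<lambda>i. c * (1/2) ^ i) \<longlonglongrightarrow> c * 0" by (intro tendsto_intros LIMSEQ_power_zero) auto
  then have "eventually (\<lambda>i. c * (1/2) ^ i < d) sequentially" by (rule order_tendstoD) (use assms in auto)
  then obtain i where "c * (1/2) ^ i < d" by (auto simp: eventually_sequentially)
  moreover have "c * (1/2) ^ (i + J) \<le> c * (1/2) ^ i" using c by (intro mult_left_mono power_decreasing) auto
  ultimately have ex: "c / 2 ^ (i + J) \<le> d" by (simp add: power_divide)
  define m where "m = (LEAST i. c / 2 ^ (i + J) \<le> d)"
  have m: "c / 2 ^ (m + J) \<le> d" unfolding m_def by (rule LeastI[of "\<lambda>i. c / 2 ^ (i + J) \<le> d", OF ex])
  have "m \<noteq> 0" using m assms by (intro notI) simp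
  then obtain k where k: "m = Suc k" by (cases m) auto
  have "\<not> c / 2 ^ (k + J) \<le> d" using not_less_Least[of k "\<lambda>i. c / 2 ^ (i + J) \<le> d"] k by (simp add: m_def)
  then show ?thesis using m k by (intro that[of k]) auto
qed

text \<open>The two assumptions on slices enter only through \<open>hole\<close> and \<open>rim\<close>: a hole of positive density at
  every small scale around the origin, and slices near the outer sphere that are negligible
  compared with the sphere of radius \<open>R - s\<close>.\<close>

locale thin_domain =
  fixes \<Omega> :: "'a::euclidean_space set" and R :: real
  assumes dim2: "DIM('a) \<ge> 2" and op: "open \<Omega>" and ne: "\<Omega> \<noteq> {}"
    and inside: "\<And>x. x \<in> \<Omega> \<Longrightarrow> norm x < R" and R: "R > 0"
    and hole: "\<exists>\<theta>>0. \<exists>r0>0. \<forall>r. 0 < r \<and> r < r0 \<longrightarrow> ennreal (\<theta> * r ^ DIM('a)) \<le> emeasure lborel (cball 0 r - \<Omega>)"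
    and rim: "\<forall>\<eta>>0. \<exists>\<epsilon>>0. \<forall>s. R - \<epsilon> < s \<and> s < R \<longrightarrow>
       hausdorff_measure (DIM('a) - 1) {x \<in> \<Omega>. norm x = s} \<le> ennreal (\<eta> * (R - s) ^ (DIM('a) - 1))"
begin

lemma test_measurable:
  assumes "\<phi> \<in> test_functions \<Omega>"
  shows "\<phi> \<in> borel_measurable borel" "gradient \<phi> \<in> borel_measurable borel"
  using test_functions_smooth[OF assms]
  by (auto intro!: borel_measurable_continuous_onI smooth_continuous smooth_continuous_gradient)

lemma test_zero: "\<phi> \<in> test_functions \<Omega> \<Longrightarrow> norm x \<ge> R \<Longrightarrow> \<phi> x = 0"
  using test_functions_gradient_support(1)[of \<phi> \<Omega> x] inside[of x] by auto

text \<open>From each point of \<open>ball 0 r\<close> the hole \<open>cball 0 r - \<Omega>\<close> lies within distance \<open>2 * r\<close>, so the Poincare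
  inequality has a constant of order \<open>r ^ DIM('a)\<close>.\<close>

lemma origin_annulus_le:
  assumes \<theta>: "\<theta> > 0" and r: "r > 0" and hole: "ennreal (\<theta> * r ^ DIM('a)) \<le> emeasure lborel (cball 0 r - \<Omega>)"
    and \<phi>: "\<phi> \<in> test_functions \<Omega>" and A: "A \<in> sets borel" "A \<subseteq> ball 0 r"
  shows "(\<integral>\<^sup>+x. ennreal (\<bar>\<phi> x\<bar> ^ DIM('a)) * indicator A x \<partial>lborel)
    \<le> ennreal (unit_ball_vol (real DIM('a)) * 4 ^ DIM('a) * r ^ DIM('a) / \<theta>) * energy \<phi>"
proof -
  define Z where "Z = cball (0::'a) r - \<Omega>"
  have [measurable]: "Z \<in> sets borel" unfolding Z_def using op by auto
  note [measurable] = test_measurable[OF \<phi>] A(1)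
  have "(\<integral>\<^sup>+x. ennreal (\<bar>\<phi> x\<bar> ^ DIM('a)) * indicator A x \<partial>lborel)
    \<le> ennreal (measure lborel (ball (0::'a) (2 * r)) * (2 * r) ^ DIM('a) / (\<theta> * r ^ DIM('a))) *
      (\<integral>\<^sup>+x. ennreal (norm (gradient \<phi> x) ^ DIM('a)) * indicator UNIV x \<partial>lborel)"
  proof (rule poincare_zero_set[where Y = UNIV])
    show "AE x in lborel. x \<in> A \<and> x + z \<in> UNIV \<longrightarrow> segment_bound DIM('a) \<phi> (\<lambda>x. ennreal (norm (gradient \<phi> x) ^ DIM('a))) x z" for z
      by (intro AE_I2 impI segment_bound_smooth test_functions_smooth[OF \<phi>]) simp
    fix x assume x: "x \<in> A"
    have "ennreal (\<theta> * r ^ DIM('a)) \<le> (\<integral>\<^sup>+z. indicator Z z \<partial>lborel)" using hole by (simp add: nn_integral_indicator Z_def[symmetric])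
    also have "\<dots> = (\<integral>\<^sup>+z. indicator Z (z + x) \<partial>lborel)" by (rule nn_integral_lborel_translation[symmetric]) measurable
    also have "\<dots> = (\<integral>\<^sup>+z. indicator {z. z + x \<in> Z} z \<partial>lborel)" by (intro nn_integral_cong) (simp add: indicator_def)
    also have "\<dots> = emeasure lborel {z. z + x \<in> Z}" by (rule nn_integral_indicator) measurable
    also have "\<dots> \<le> emeasure lborel {z \<in> ball 0 (2 * r). x + z \<in> UNIV \<and> \<phi> (x + z) = 0}"
    proof (rule emeasure_mono)
      show "{z. z + x \<in> Z} \<subseteq> {z \<in> ball 0 (2 * r). x + z \<in> UNIV \<and> \<phi> (x + z) = 0}"
      proof safe
        fix z assume z: "z + x \<in> Z"
        show "\<phi> (x + z) = 0" by (rule test_functions_gradient_support[OF \<phi>]) (use z in \<open>simp add: Z_def add.commute\<close>)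
        have "norm z \<le> norm (z + x) + norm x" using norm_triangle_ineq4[of "z + x" x] by simp
        moreover have "norm x < r" using x A(2) by auto
        ultimately show "z \<in> ball 0 (2 * r)" using z by (auto simp: Z_def)
      qed auto
    qed measurable
    finally show "ennreal (\<theta> * r ^ DIM('a)) \<le> emeasure lborel {z \<in> ball 0 (2 * r). x + z \<in> UNIV \<and> \<phi> (x + z) = 0}" .
  qed (use r \<theta> A in auto)
  also have "measure lborel (ball (0::'a) (2 * r)) * (2 * r) ^ DIM('a) / (\<theta> * r ^ DIM('a)) = unit_ball_vol (real DIM('a)) * 4 ^ DIM('a) * r ^ DIM('a) / \<theta>"
  proof -
    have "(4::real) ^ DIM('a) = 2 ^ DIM('a) * 2 ^ DIM('a)" by (simp add: power_mult_distrib[symmetric])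
    then show ?thesis using r \<theta> by (simp add: content_ball power_mult_distrib)
  qed
  finally show ?thesis by (simp add: energy_def)
qed

text \<open>On the dyadic annulus of radii around \<open>R / 2 ^ j\<close> the Poincare constant \<open>R ^ N / 2 ^ (j * N)\<close> cancels
  the factor \<open>norm x ^ N\<close> of the weight, and the logarithm leaves \<open>1 / j ^ N\<close>. This is summable because
  \<open>N \<ge> 2\<close>, so the tail of the series makes the contribution of a small ball as small as desired.\<close>

lemma hardy_integral_near_origin:
  assumes \<tau>: "\<tau> > 0"
  obtains \<epsilon> where "\<epsilon> > 0" "\<epsilon> < R"
    "\<And>\<phi>. \<phi> \<in> test_functions \<Omega> \<Longrightarrow>
       (\<integral>\<^sup>+x. ennreal (\<bar>\<phi> x\<bar> ^ DIM('a) * hardy_weight R x) * indicator (ball 0 \<epsilon>) x \<partial>lborel) \<le> ennreal \<tau> * energy \<phi>"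
proof -
  define N where "N = DIM('a)"
  obtain \<theta> r0 where \<theta>: "\<theta> > 0" "r0 > 0"
    and hole: "\<And>r. 0 < r \<Longrightarrow> r < r0 \<Longrightarrow> ennreal (\<theta> * r ^ DIM('a)) \<le> emeasure lborel (cball 0 r - \<Omega>)"
    using hole by blast
  define w where "w = unit_ball_vol (real N)"
  have w: "w > 0" by (simp add: w_def)
  \<comment> \<open>The constant \<open>4 ^ N\<close> of the annulus estimate, times \<open>2 ^ N\<close> for the ratio of its two radii.\<close>
  define C where "C = w * 8 ^ N / (\<theta> * ln 2 ^ N)"
  have C: "C > 0" using w \<theta> by (simp add: C_def)
  define r where "r j = R / 2 ^ j" for j :: nat
  have r: "r j > 0" for j using R by (simp add: r_def)
  define A where "A j = {x::'a. r (Suc j) \<le> norm x \<and> norm x < r j}" for j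
  have A [measurable]: "A j \<in> sets borel" for j unfolding A_def by measurable
  have summ: "summable (\<lambda>j. C * (1 / real j ^ 2))"
    by (intro summable_mult) (use inverse_power_summable[of 2, where 'a = real] in \<open>simp add: inverse_eq_divide\<close>)
  have "\<exists>J0. \<forall>n\<ge>J0. norm (\<Sum>i. C * (1 / real (i + n) ^ 2)) < \<tau>"
    using suminf_exist_split[OF \<tau> summ] by blast
  then obtain J0 where J0: "\<And>n. n \<ge> J0 \<Longrightarrow> norm (\<Sum>i. C * (1 / real (i + n) ^ 2)) < \<tau>" by blast
  have "r \<longlonglongrightarrow> 0"
  proof -
    have "(\<lambda>j. R * (1/2) ^ j) \<longlonglongrightarrow> R * 0" by (intro tendsto_intros LIMSEQ_power_zero) auto
    then show ?thesis by (simp add: r_def[abs_def] power_divide)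
  qed
  then have "eventually (\<lambda>j. r j < r0) sequentially" by (rule order_tendstoD) (use \<theta> in auto)
  then obtain J1 where J1: "\<And>j. j \<ge> J1 \<Longrightarrow> r j < r0" by (auto simp: eventually_sequentially)
  define J where "J = max (max J0 J1) 1"
  have J: "J \<ge> J0" "J \<ge> J1" "J \<ge> 1" by (auto simp: J_def)
  show ?thesis
  proof (rule that[of "r J"])
    show "r J > 0" by (rule r)
    show "r J < R"
    proof -
      have "(2::real) ^ 1 \<le> 2 ^ J" using J by (intro power_increasing) auto
      then show ?thesis using R by (simp add: r_def field_simps)
    qed
    fix \<phi> assume \<phi>: "\<phi> \<in> test_functions \<Omega>"
    note [measurable] = test_measurable[OF \<phi>]
    have layer: "(\<integral>\<^sup>+x. ennreal (\<bar>\<phi> x\<bar> ^ N * hardy_weight R x) * indicator (A (i + J)) x \<partial>lborel) \<le> ennreal (C * (1 / real (i + J) ^ 2)) * energy \<phi>" for i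
    proof -
      define j where "j = i + J"
      have j: "j \<ge> 1" "j \<ge> J1" using J by (auto simp: j_def)
      define V where "V = 1 / (r (Suc j) ^ N * (real j * ln 2) ^ N)"
      have V: "V \<ge> 0" using r by (simp add: V_def less_imp_le)
      have pt: "ennreal (\<bar>\<phi> x\<bar> ^ N * hardy_weight R x) * indicator (A j) x \<le> ennreal V * (ennreal (\<bar>\<phi> x\<bar> ^ N) * indicator (A j) x)" for x
      proof (cases "x \<in> A j")
        case True
        then have x: "r (Suc j) \<le> norm x" "norm x < r j" by (auto simp: A_def)
        have nx: "norm x > 0" using x(1) r[of "Suc j"] by linarith
        have "2 ^ j \<le> R / norm x" using x(2) nx by (simp add: r_def field_simps)
        then have "ln (2 ^ j) \<le> ln (R / norm x)" by (intro ln_mono) auto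
        then have l: "real j * ln 2 \<le> ln (R / norm x)" by (simp add: ln_realpow)
        have "0 < real j * ln 2" using j by simp
        then have lp: "0 < ln (R / norm x)" using l by linarith
        have "hardy_weight R x \<le> V"
          unfolding hardy_weight_def V_def N_def[symmetric]
          using x(1) r[of "Suc j"] l lp j nx by (intro divide_left_mono mult_mono power_mono mult_pos_pos) auto
        then have "ennreal (\<bar>\<phi> x\<bar> ^ N * hardy_weight R x) \<le> ennreal (V * \<bar>\<phi> x\<bar> ^ N)"
          by (intro ennreal_leI) (simp add: mult.commute mult_right_mono)
        then show ?thesis using True V by (simp add: ennreal_mult)
      qed auto
      have "(\<integral>\<^sup>+x. ennreal (\<bar>\<phi> x\<bar> ^ N * hardy_weight R x) * indicator (A j) x \<partial>lborel)
        \<le> (\<integral>\<^sup>+x. ennreal V * (ennreal (\<bar>\<phi> x\<bar> ^ N) * indicator (A j) x) \<partial>lborel)" by (intro nn_integral_mono pt)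
      also have "\<dots> = ennreal V * (\<integral>\<^sup>+x. ennreal (\<bar>\<phi> x\<bar> ^ N) * indicator (A j) x \<partial>lborel)" by (intro nn_integral_cmult) measurable
      also have "\<dots> \<le> ennreal V * (ennreal (w * 4 ^ N * r j ^ N / \<theta>) * energy \<phi>)"
        unfolding N_def w_def
        by (intro mult_left_mono origin_annulus_le \<theta> r hole J1 j \<phi> A) (auto simp: A_def)
      also have "\<dots> = ennreal (V * (w * 4 ^ N * r j ^ N / \<theta>)) * energy \<phi>"
        by (rule ennreal_mult_assoc) (use V w r[of j] \<theta> in auto)
      also have "V * (w * 4 ^ N * r j ^ N / \<theta>) = C * (1 / real j ^ N)"
      proof -
        have "r j = 2 * r (Suc j)" by (simp add: r_def)
        moreover have "(8::real) ^ N = 4 ^ N * 2 ^ N" by (simp add: power_mult_distrib[symmetric])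
        ultimately show ?thesis using r[of "Suc j"] j \<theta> by (simp add: V_def C_def power_mult_distrib field_simps)
      qed
      also have "ennreal (C * (1 / real j ^ N)) * energy \<phi> \<le> ennreal (C * (1 / real j ^ 2)) * energy \<phi>"
        using j C dim2 by (intro mult_right_mono ennreal_leI mult_left_mono divide_left_mono power_increasing) (auto simp: N_def)
      finally show ?thesis by (simp add: j_def)
    qed
    have "(\<integral>\<^sup>+x. ennreal (\<bar>\<phi> x\<bar> ^ N * hardy_weight R x) * indicator (ball 0 (r J)) x \<partial>lborel)
      \<le> (\<integral>\<^sup>+x. (\<Sum>i. ennreal (\<bar>\<phi> x\<bar> ^ N * hardy_weight R x) * indicator (A (i + J)) x) \<partial>lborel)"
    proof (rule nn_integral_mono)
      fix x :: 'a
      show "ennreal (\<bar>\<phi> x\<bar> ^ N * hardy_weight R x) * indicator (ball 0 (r J)) x \<le> (\<Sum>i. ennreal (\<bar>\<phi> x\<bar> ^ N * hardy_weight R x) * indicator (A (i + J)) x)"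
      proof (cases "x \<in> ball 0 (r J) \<and> x \<noteq> 0")
        case True
        then obtain i where "r (Suc (i + J)) \<le> norm x" "norm x < r (i + J)"
          using dyadic_layer_exists[of "norm x" R J] by (auto simp: r_def)
        then have "x \<in> A (i + J)" by (simp add: A_def)
        then have "ennreal (\<bar>\<phi> x\<bar> ^ N * hardy_weight R x) * indicator (ball 0 (r J)) x = (\<Sum>i\<in>{i}. ennreal (\<bar>\<phi> x\<bar> ^ N * hardy_weight R x) * indicator (A (i + J)) x)"
          using True by simp
        also have "\<dots> \<le> (\<Sum>i. ennreal (\<bar>\<phi> x\<bar> ^ N * hardy_weight R x) * indicator (A (i + J)) x)"
          by (rule sum_le_suminf) auto
        finally show ?thesis .
      next
        case False
        then have "ennreal (\<bar>\<phi> x\<bar> ^ N * hardy_weight R x) * indicator (ball 0 (r J)) x = 0"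
          by (auto simp: hardy_weight_def indicator_def)
        then show ?thesis by (rule ord_eq_le_trans) simp
      qed
    qed
    also have "\<dots> = (\<Sum>i. \<integral>\<^sup>+x. ennreal (\<bar>\<phi> x\<bar> ^ N * hardy_weight R x) * indicator (A (i + J)) x \<partial>lborel)"
      by (intro nn_integral_suminf) measurable
    also have "\<dots> \<le> (\<Sum>i. ennreal (C * (1 / real (i + J) ^ 2)) * energy \<phi>)"
      by (intro suminf_le layer) auto
    also have "\<dots> = (\<Sum>i. ennreal (C * (1 / real (i + J) ^ 2))) * energy \<phi>" by (rule ennreal_suminf_multc)
    also have "(\<Sum>i. ennreal (C * (1 / real (i + J) ^ 2))) = ennreal (\<Sum>i. C * (1 / real (i + J) ^ 2))"
      using C summable_ignore_initial_segment[OF summ, of J] by (intro suminf_ennreal2) auto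
    also have "\<dots> * energy \<phi> \<le> ennreal \<tau> * energy \<phi>"
      using J0[OF J(1)] by (intro mult_right_mono ennreal_leI) auto
    finally show "(\<integral>\<^sup>+x. ennreal (\<bar>\<phi> x\<bar> ^ DIM('a) * hardy_weight R x) * indicator (ball 0 (r J)) x \<partial>lborel) \<le> ennreal \<tau> * energy \<phi>"
      by (simp add: N_def)
  qed
qed

text \<open>Near the rim the slices are so small that the part of the shell around \<open>x\<close> inside \<open>K\<close> has at most half
  the volume of a ball of radius \<open>\<rho>\<close>. The compact set \<open>K\<close> will be the support of a test function.\<close>

lemma half_ball_outside:
  assumes x: "R / 2 + \<rho> < norm x" and rho: "\<rho> > 0" and K: "compact K" "K \<subseteq> \<Omega>"
    and M: "M \<ge> 0" "\<And>s. norm x - \<rho> \<le> s \<Longrightarrow> s \<le> norm x + \<rho> \<Longrightarrow> hausdorff_measure (DIM('a) - 1) {x \<in> \<Omega>. norm x = s} \<le> ennreal M"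
    and small: "8 * 4 ^ DIM('a) * unit_ball_vol (real DIM('a)) / unit_ball_vol (real (DIM('a) - 1)) * M * (2 * \<rho>)
       \<le> unit_ball_vol (real DIM('a)) * \<rho> ^ DIM('a) / 2"
  shows "ennreal (unit_ball_vol (real DIM('a)) * \<rho> ^ DIM('a) / 2) \<le> emeasure lborel {z \<in> ball 0 \<rho>. x + z \<notin> K}"
proof -
  define wr where "wr = unit_ball_vol (real DIM('a)) * \<rho> ^ DIM('a)"
  have wr: "wr \<ge> 0" using rho by (simp add: wr_def)
  define B where "B = ball (0::'a) \<rho>"
  have [measurable]: "B \<in> sets borel" "K \<in> sets borel" using K(1) by (auto simp: B_def compact_imp_closed)
  define S where "S = {y \<in> K. norm x - \<rho> < norm y \<and> norm y \<le> norm x + \<rho>}"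
  have [measurable]: "S \<in> sets borel" unfolding S_def by measurable
  have "emeasure lborel S \<le> ennreal (8 * 4 ^ DIM('a) * unit_ball_vol (real DIM('a)) / unit_ball_vol (real (DIM('a) - 1)) * M * ((norm x + \<rho>) - (norm x - \<rho>)))"
    unfolding S_def
  proof (rule shell_measure_le_slices)
    fix s assume s: "norm x - \<rho> \<le> s" "s \<le> norm x + \<rho>"
    have "hausdorff_measure (DIM('a) - 1) {x \<in> K. norm x = s} \<le> hausdorff_measure (DIM('a) - 1) {x \<in> \<Omega>. norm x = s}"
      using K(2) by (intro hausdorff_measure_mono) auto
    also have "\<dots> \<le> ennreal M" by (rule M(2)[OF s])
    finally show "hausdorff_measure (DIM('a) - 1) {x \<in> K. norm x = s} \<le> ennreal M" .
  qed (use x rho R K M in auto)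
  also have "\<dots> \<le> ennreal (wr / 2)" using small by (intro ennreal_leI) (simp add: wr_def)
  finally have S: "emeasure lborel S \<le> ennreal (wr / 2)" .
  define T where "T = {z. z + x \<in> S}"
  have [measurable]: "T \<in> sets borel" unfolding T_def by measurable
  have "emeasure lborel T = (\<integral>\<^sup>+z. indicator T z \<partial>lborel)" by simp
  also have "\<dots> = (\<integral>\<^sup>+z. indicator S (z + x) \<partial>lborel)" by (intro nn_integral_cong) (simp add: T_def indicator_def)
  also have "\<dots> = emeasure lborel S" by (subst nn_integral_lborel_translation) auto
  finally have T: "emeasure lborel T \<le> ennreal (wr / 2)" using S by simp
  have "ennreal (wr / 2) + ennreal (wr / 2) = emeasure lborel B"
    using wr rho by (simp add: ennreal_plus[symmetric] emeasure_ball B_def wr_def del: ennreal_plus)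
  also have "\<dots> \<le> emeasure lborel ({z \<in> B. x + z \<notin> K} \<union> T)"
  proof (rule emeasure_mono)
    show "B \<subseteq> {z \<in> B. x + z \<notin> K} \<union> T"
    proof
      fix z assume z: "z \<in> B"
      have "\<bar>norm (z + x) - norm x\<bar> \<le> norm z" using norm_triangle_ineq3[of "z + x" x] by simp
      then show "z \<in> {z \<in> B. x + z \<notin> K} \<union> T" using z by (auto simp: T_def S_def B_def add.commute)
    qed
  qed measurable
  also have "\<dots> \<le> emeasure lborel {z \<in> B. x + z \<notin> K} + emeasure lborel T" by (intro emeasure_subadditive) measurable
  also have "\<dots> \<le> emeasure lborel {z \<in> B. x + z \<notin> K} + ennreal (wr / 2)" by (intro add_left_mono T)
  finally have "ennreal (wr / 2) + ennreal (wr / 2) \<le> ennreal (wr / 2) + emeasure lborel {z \<in> B. x + z \<notin> K}"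
    by (simp only: add.commute)
  then have "ennreal (wr / 2) \<le> emeasure lborel {z \<in> B. x + z \<notin> K}"
    unfolding ennreal_add_left_cancel_le by auto
  then show ?thesis by (simp add: wr_def B_def)
qed

text \<open>At distance \<open>d\<close> from the rim the weight is of order \<open>d powi (- N)\<close>. Because the slices are
  \<open>o (d ^ (N - 1))\<close>, a ball of radius \<open>\<kappa> * d\<close> is at least half outside \<open>\<Omega>\<close> for any prescribed \<open>\<kappa> > 0\<close>, once
  \<open>d\<close> is small; the Poincare inequality then gains \<open>(\<kappa> * d) ^ N\<close>. So each dyadic layer contributes at most
  a constant times \<open>\<kappa> ^ N\<close> times the energy of itself and its two neighbours, and each layer is counted
  three times.\<close>

lemma hardy_integral_near_rim:
  assumes \<tau>: "\<tau> > 0"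
  obtains r1 where "0 < r1" "r1 < R"
    "\<And>\<phi>. \<phi> \<in> test_functions \<Omega> \<Longrightarrow>
       (\<integral>\<^sup>+x. ennreal (\<bar>\<phi> x\<bar> ^ DIM('a) * hardy_weight R x) * indicator {x. r1 < norm x} x \<partial>lborel) \<le> ennreal \<tau> * energy \<phi>"
proof -
  define N where "N = DIM('a)"
  have N: "N = Suc (N - 1)" "N \<ge> 2" using dim2 by (auto simp: N_def)
  define w where "w = unit_ball_vol (real N)"
  have w: "w > 0" by (simp add: w_def)
  define C0 where "C0 = 8 * 4 ^ N * w / unit_ball_vol (real (N - 1))"
  have C0: "C0 > 0" using w by (simp add: C0_def)
  \<comment> \<open>Each layer costs \<open>2 * 4 ^ N * \<kappa> ^ N\<close> and is counted three times; \<open>\<kappa> \<le> 1/4\<close> keeps the balls within the neighbouring layers.\<close>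
  define \<kappa> where "\<kappa> = min (1/4) (\<tau> / (6 * 4 ^ N))"
  have \<kappa>: "\<kappa> > 0" "\<kappa> \<le> 1/4" using \<tau> by (auto simp: \<kappa>_def)
  have \<kappa>\<tau>: "3 * (2 * 4 ^ N * \<kappa> ^ N) \<le> \<tau>"
  proof -
    have "\<kappa> ^ N \<le> \<kappa> ^ 1" using \<kappa> N by (intro power_decreasing) auto
    also have "\<dots> \<le> \<tau> / (6 * 4 ^ N)" by (simp add: \<kappa>_def)
    finally show ?thesis by (simp add: field_simps)
  qed
  \<comment> \<open>With this value the bound for the part of \<open>\<Omega>\<close> in a shell of thickness \<open>2 * \<rho>\<close>, where \<open>\<rho> = \<kappa> * d\<close>, is exactly half the volume of a ball of radius \<open>\<rho>\<close>.\<close>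
  define \<eta> where "\<eta> = w * \<kappa> ^ (N - 1) / (C0 * 2 ^ (N + 1))"
  have \<eta>: "\<eta> > 0" using w \<kappa> C0 by (simp add: \<eta>_def)
  obtain \<epsilon> where \<epsilon>: "\<epsilon> > 0" and rim: "\<And>s. R - \<epsilon> < s \<Longrightarrow> s < R \<Longrightarrow>
       hausdorff_measure (N - 1) {x \<in> \<Omega>. norm x = s} \<le> ennreal (\<eta> * (R - s) ^ (N - 1))"
    using rim \<eta> unfolding N_def by blast
  define d where "d j = (1::real) / 2 ^ j" for j :: nat
  have d: "d j > 0" "d j = 2 * d (Suc j)" for j by (auto simp: d_def)
  have "d \<longlonglongrightarrow> 0"
    using LIMSEQ_power_zero[of "1/2::real"] by (simp add: d_def[abs_def] power_divide)
  then have "eventually (\<lambda>j. d j < min (R / 8) (\<epsilon> / 2)) sequentially" by (rule order_tendstoD) (use R \<epsilon> in auto)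
  then obtain J1 where J1: "\<And>j. j \<ge> J1 \<Longrightarrow> d j < min (R / 8) (\<epsilon> / 2)" by (auto simp: eventually_sequentially)
  define J where "J = Suc J1"
  define L where "L j = {x::'a. d (Suc j) \<le> R - norm x \<and> R - norm x < d j}" for j
  have L [measurable]: "L j \<in> sets borel" for j unfolding L_def by measurable
  have dmono: "d j \<le> d i" if "i \<le> j" for i j using that by (simp add: d_def frac_le power_increasing)
  have Ldisj: "disjoint_family L"
    unfolding disjoint_family_on_def
  proof (intro ballI impI)
    fix i j :: nat assume "i \<noteq> j"
    then have "Suc i \<le> j \<or> Suc j \<le> i" by linarith
    then show "L i \<inter> L j = {}" using dmono[of "Suc i" j] dmono[of "Suc j" i] by (auto simp: L_def)
  qed
  show ?thesis
  proof (rule that[of "R - d J"])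
    have dJ: "d J < R / 8" using J1[of J] by (simp add: J_def)
    then show "0 < R - d J" "R - d J < R" using R d(1)[of J] by auto
    fix \<phi> assume \<phi>: "\<phi> \<in> test_functions \<Omega>"
    note [measurable] = test_measurable[OF \<phi>]
    obtain K where K: "compact K" "K \<subseteq> \<Omega>" "\<And>x. x \<notin> K \<Longrightarrow> \<phi> x = 0"
      using test_functions_supportE[OF \<phi>] by metis
    define G where "G x = ennreal (norm (gradient \<phi> x) ^ N)" for x
    have [measurable]: "G \<in> borel_measurable borel" unfolding G_def[abs_def] by measurable
    define e where "e j = (\<integral>\<^sup>+x. G x * indicator (L j) x \<partial>lborel)" for j
    have esum: "(\<Sum>i. e (i + c)) \<le> energy \<phi>" for c
    proof -
      have "(\<Sum>i. e (i + c)) = (\<integral>\<^sup>+x. (\<Sum>i. G x * indicator (L (i + c)) x) \<partial>lborel)"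
        unfolding e_def by (rule nn_integral_suminf[symmetric]) measurable
      also have "\<dots> \<le> (\<integral>\<^sup>+x. G x \<partial>lborel)"
      proof (rule nn_integral_mono)
        fix x
        have "disjoint_family (\<lambda>i. L (i + c))" using Ldisj by (auto simp: disjoint_family_on_def)
        then have "(\<Sum>i. indicator (L (i + c)) x :: ennreal) = indicator (\<Union>i. L (i + c)) x" by (rule suminf_indicator)
        also have "\<dots> \<le> 1" by (simp add: indicator_def)
        finally have "G x * (\<Sum>i. indicator (L (i + c)) x) \<le> G x * 1" by (intro mult_left_mono) auto
        then show "(\<Sum>i. G x * indicator (L (i + c)) x) \<le> G x" by (simp add: ennreal_suminf_cmult)
      qed
      finally show ?thesis by (simp add: energy_def G_def N_def)
    qed
    define D where "D = 2 * 4 ^ N * \<kappa> ^ N"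
    have D: "D \<ge> 0" using \<kappa> by (simp add: D_def)
    have layer: "(\<integral>\<^sup>+x. ennreal (\<bar>\<phi> x\<bar> ^ N * hardy_weight R x) * indicator (L (i + J)) x \<partial>lborel)
      \<le> ennreal D * (e (i + J1) + e (i + J) + e (i + Suc J))" for i
    proof -
      define j where "j = i + J1"
      have jJ: "i + J = Suc j" "i + Suc J = Suc (Suc j)" by (auto simp: j_def J_def)
      have dj: "d j < R / 8" "d j < \<epsilon> / 2" using J1[of j] by (auto simp: j_def)
      define \<rho> where "\<rho> = \<kappa> * d (Suc j)"
      have \<rho>: "\<rho> > 0" "\<rho> \<le> d (Suc j) / 4" using \<kappa> d(1)[of "Suc j"] by (auto simp: \<rho>_def)
      note dd = d(2)[of j] d(2)[of "Suc j"] d(2)[of "Suc (Suc j)"] d(1)[of "Suc (Suc (Suc j))"]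
      define W where "W = L j \<union> L (Suc j) \<union> L (Suc (Suc j))"
      have [measurable]: "W \<in> sets borel" unfolding W_def by measurable
      define V where "V = (4 / d (Suc j)) ^ N"
      have V: "V \<ge> 0" using d(1)[of "Suc j"] by (simp add: V_def)
      have Ld: "d (Suc (Suc j)) \<le> R - norm x" "R - norm x < d (Suc j)" if "x \<in> L (Suc j)" for x
        using that by (auto simp: L_def)
      have pt: "ennreal (\<bar>\<phi> x\<bar> ^ N * hardy_weight R x) * indicator (L (Suc j)) x \<le> ennreal V * (ennreal (\<bar>\<phi> x\<bar> ^ N) * indicator (L (Suc j)) x)" for x
      proof (cases "x \<in> L (Suc j)")
        case True
        note x = Ld[OF True]
        have nx: "norm x \<ge> R / 2" using x dj dd R by linarith
        have nx0: "norm x > 0" using nx R by linarith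
        have "ln (norm x / R) \<le> norm x / R - 1" using nx0 R by (intro ln_le_minus_one) auto
        then have "ln (R / norm x) \<ge> 1 - norm x / R" using nx0 R by (simp add: ln_div)
        also have "1 - norm x / R = (R - norm x) / R" using R by (simp add: field_simps)
        finally have "(R - norm x) / R \<le> ln (R / norm x)" .
        moreover have "d (Suc (Suc j)) / R \<le> (R - norm x) / R" using x R by (intro divide_right_mono) auto
        ultimately have l: "d (Suc (Suc j)) / R \<le> ln (R / norm x)" by linarith
        have l0: "0 < d (Suc (Suc j)) / R" using R d(1) by simp
        then have lp: "0 < ln (R / norm x)" using l by linarith
        have "hardy_weight R x \<le> 1 / ((R / 2) ^ N * (d (Suc (Suc j)) / R) ^ N)"
          unfolding hardy_weight_def N_def[symmetric]
          using nx nx0 R l l0 lp by (intro divide_left_mono mult_mono power_mono mult_pos_pos) auto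
        also have "\<dots> = V"
        proof -
          have "(R / 2) ^ N * (d (Suc (Suc j)) / R) ^ N = (R / 2 * (d (Suc (Suc j)) / R)) ^ N" by (rule power_mult_distrib[symmetric])
          also have "R / 2 * (d (Suc (Suc j)) / R) = d (Suc j) / 4" using R d(2)[of "Suc j"] by simp
          finally show ?thesis by (simp add: V_def power_divide)
        qed
        finally have "ennreal (\<bar>\<phi> x\<bar> ^ N * hardy_weight R x) \<le> ennreal (V * \<bar>\<phi> x\<bar> ^ N)"
          by (intro ennreal_leI) (simp add: mult.commute mult_right_mono)
        then show ?thesis using True V by (simp add: ennreal_mult)
      qed auto
      define m where "m = w * \<rho> ^ N / 2"
      have m: "m > 0" using w \<rho> by (simp add: m_def)
      have "(\<integral>\<^sup>+x. ennreal (\<bar>\<phi> x\<bar> ^ N) * indicator (L (Suc j)) x \<partial>lborel)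
        \<le> ennreal (measure lborel (ball (0::'a) \<rho>) * \<rho> ^ N / m) * (\<integral>\<^sup>+x. G x * indicator W x \<partial>lborel)"
      proof (rule poincare_zero_set[where Y = UNIV])
        show "AE x in lborel. x \<in> L (Suc j) \<and> x + z \<in> UNIV \<longrightarrow> segment_bound N \<phi> G x z" for z
          unfolding G_def[abs_def] using N by (intro AE_I2 impI segment_bound_smooth test_functions_smooth[OF \<phi>]) simp
      next
        fix x z :: 'a and t :: real
        assume x: "x \<in> L (Suc j)" and z: "z \<in> ball 0 \<rho>" and t: "t \<in> {0..1}"
        have "norm (t *\<^sub>R z) \<le> norm z" using t by (simp add: mult_left_le_one_le)
        then have "norm (t *\<^sub>R z) < \<rho>" using z by simp
        then have "\<bar>norm (x + t *\<^sub>R z) - norm x\<bar> < \<rho>" using norm_triangle_ineq3[of "x + t *\<^sub>R z" x] by simp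
        then have "d (Suc (Suc (Suc j))) \<le> R - norm (x + t *\<^sub>R z)" "R - norm (x + t *\<^sub>R z) < d j"
          using Ld[OF x] \<rho> dd by linarith+
        then show "x + t *\<^sub>R z \<in> W" unfolding W_def L_def by auto
      next
        fix x assume x: "x \<in> L (Suc j)"
        have "ennreal m \<le> emeasure lborel {z \<in> ball 0 \<rho>. x + z \<notin> K}"
          unfolding m_def w_def N_def
        proof (rule half_ball_outside[OF _ \<rho>(1) K(1,2)])
          show "R / 2 + \<rho> < norm x" using Ld[OF x] \<rho> dd dj by linarith
          show "0 \<le> \<eta> * (2 * d (Suc j)) ^ (N - 1)" using \<eta> d(1)[of "Suc j"] by simp
          fix s assume s: "norm x - \<rho> \<le> s" "s \<le> norm x + \<rho>"
          have "R - \<epsilon> < s" "s < R" "R - s \<le> 2 * d (Suc j)" using s Ld[OF x] \<rho> dd dj by linarith+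
          then show "hausdorff_measure (DIM('a) - 1) {x \<in> \<Omega>. norm x = s} \<le> ennreal (\<eta> * (2 * d (Suc j)) ^ (N - 1))"
            using \<eta> unfolding N_def by (intro order_trans[OF rim[unfolded N_def]] ennreal_leI mult_left_mono power_mono) auto
        next
          have "C0 * (\<eta> * (2 * d (Suc j)) ^ (N - 1)) * (2 * \<rho>) = w * \<rho> ^ N / 2"
          proof -
            have "C0 * \<eta> = w * \<kappa> ^ (N - 1) / 2 ^ (N + 1)" using C0 by (simp add: \<eta>_def)
            then have "C0 * (\<eta> * (2 * d (Suc j)) ^ (N - 1)) * (2 * \<rho>) = w * \<kappa> ^ (N - 1) / 2 ^ (N + 1) * (2 * d (Suc j)) ^ (N - 1) * (2 * \<rho>)"
              by (simp add: mult.assoc[symmetric])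
            also have "\<dots> = w * (\<rho> ^ (N - 1) * \<rho>) * (2 ^ (N - 1) * 2) / 2 ^ (N + 1)"
              unfolding \<rho>_def power_mult_distrib by (simp add: mult_ac)
            also have "\<dots> = w * \<rho> ^ N * 2 ^ N / 2 ^ (N + 1)"
            proof -
              have "y ^ (N - 1) * y = y ^ N" for y :: real using N(1) by (metis power_Suc2)
              then show ?thesis by (simp only:)
            qed
            finally show ?thesis by simp
          qed
          then show "8 * 4 ^ DIM('a) * unit_ball_vol (real DIM('a)) / unit_ball_vol (real (DIM('a) - 1)) * (\<eta> * (2 * d (Suc j)) ^ (N - 1)) * (2 * \<rho>)
            \<le> unit_ball_vol (real DIM('a)) * \<rho> ^ DIM('a) / 2"
            by (simp add: C0_def w_def N_def)
        qed
        also have "\<dots> \<le> emeasure lborel {z \<in> ball 0 \<rho>. x + z \<in> UNIV \<and> \<phi> (x + z) = 0}"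
        proof (rule emeasure_mono)
          define B where "B = ball (0::'a) \<rho>"
          have [measurable]: "B \<in> sets borel" by (simp add: B_def)
          show "{z \<in> ball 0 \<rho>. x + z \<in> UNIV \<and> \<phi> (x + z) = 0} \<in> sets lborel" unfolding B_def[symmetric] by measurable
        qed (use K(3) in auto)
        finally show "ennreal m \<le> emeasure lborel {z \<in> ball 0 \<rho>. x + z \<in> UNIV \<and> \<phi> (x + z) = 0}" .
      qed (use \<rho> N m in auto)
      also have "measure lborel (ball (0::'a) \<rho>) * \<rho> ^ N / m = 2 * \<rho> ^ N"
        using \<rho> less_imp_neq[OF w, symmetric] by (simp add: content_ball m_def w_def N_def)
      finally have P: "(\<integral>\<^sup>+x. ennreal (\<bar>\<phi> x\<bar> ^ N) * indicator (L (Suc j)) x \<partial>lborel) \<le> ennreal (2 * \<rho> ^ N) * (\<integral>\<^sup>+x. G x * indicator W x \<partial>lborel)" .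
      have "(\<integral>\<^sup>+x. ennreal (\<bar>\<phi> x\<bar> ^ N * hardy_weight R x) * indicator (L (Suc j)) x \<partial>lborel)
        \<le> (\<integral>\<^sup>+x. ennreal V * (ennreal (\<bar>\<phi> x\<bar> ^ N) * indicator (L (Suc j)) x) \<partial>lborel)" by (intro nn_integral_mono pt)
      also have "\<dots> = ennreal V * (\<integral>\<^sup>+x. ennreal (\<bar>\<phi> x\<bar> ^ N) * indicator (L (Suc j)) x \<partial>lborel)" by (intro nn_integral_cmult) measurable
      also have "\<dots> \<le> ennreal V * (ennreal (2 * \<rho> ^ N) * (\<integral>\<^sup>+x. G x * indicator W x \<partial>lborel))" by (intro mult_left_mono P) auto
      also have "\<dots> = ennreal (V * (2 * \<rho> ^ N)) * (\<integral>\<^sup>+x. G x * indicator W x \<partial>lborel)"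
        by (rule ennreal_mult_assoc) (use V \<rho> in auto)
      also have "V * (2 * \<rho> ^ N) = D"
        using d(1)[of "Suc j"] by (simp add: V_def \<rho>_def D_def power_mult_distrib power_divide)
      also have "(\<integral>\<^sup>+x. G x * indicator W x \<partial>lborel) \<le> e j + e (Suc j) + e (Suc (Suc j))"
      proof -
        have "(\<integral>\<^sup>+x. G x * indicator W x \<partial>lborel) \<le> (\<integral>\<^sup>+x. G x * indicator (L j) x + G x * indicator (L (Suc j)) x + G x * indicator (L (Suc (Suc j))) x \<partial>lborel)"
          by (intro nn_integral_mono) (auto simp: W_def indicator_def)
        also have "\<dots> = e j + e (Suc j) + e (Suc (Suc j))"
          unfolding e_def by (subst nn_integral_add, measurable, subst nn_integral_add, measurable)
        finally show ?thesis .
      qed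
      finally show ?thesis unfolding jJ j_def[symmetric] by (simp add: mult_left_mono)
    qed
    have "(\<integral>\<^sup>+x. ennreal (\<bar>\<phi> x\<bar> ^ N * hardy_weight R x) * indicator {x. R - d J < norm x} x \<partial>lborel)
      \<le> (\<integral>\<^sup>+x. (\<Sum>i. ennreal (\<bar>\<phi> x\<bar> ^ N * hardy_weight R x) * indicator (L (i + J)) x) \<partial>lborel)"
    proof (rule nn_integral_mono)
      fix x :: 'a
      show "ennreal (\<bar>\<phi> x\<bar> ^ N * hardy_weight R x) * indicator {x. R - d J < norm x} x \<le> (\<Sum>i. ennreal (\<bar>\<phi> x\<bar> ^ N * hardy_weight R x) * indicator (L (i + J)) x)"
      proof (cases "R - d J < norm x \<and> norm x < R")
        case True
        then obtain i where "d (Suc (i + J)) \<le> R - norm x" "R - norm x < d (i + J)"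
          using dyadic_layer_exists[of "R - norm x" 1 J] by (auto simp: d_def)
        then have "x \<in> L (i + J)" by (simp add: L_def)
        then have "ennreal (\<bar>\<phi> x\<bar> ^ N * hardy_weight R x) * indicator {x. R - d J < norm x} x = (\<Sum>i\<in>{i}. ennreal (\<bar>\<phi> x\<bar> ^ N * hardy_weight R x) * indicator (L (i + J)) x)"
          using True by simp
        also have "\<dots> \<le> (\<Sum>i. ennreal (\<bar>\<phi> x\<bar> ^ N * hardy_weight R x) * indicator (L (i + J)) x)"
          by (rule sum_le_suminf) auto
        finally show ?thesis .
      next
        case False
        then have "ennreal (\<bar>\<phi> x\<bar> ^ N * hardy_weight R x) * indicator {x. R - d J < norm x} x = 0"
          using test_zero[OF \<phi>, of x] N by (auto simp: indicator_def power_0_left)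
        then show ?thesis by (rule ord_eq_le_trans) simp
      qed
    qed
    also have "\<dots> = (\<Sum>i. \<integral>\<^sup>+x. ennreal (\<bar>\<phi> x\<bar> ^ N * hardy_weight R x) * indicator (L (i + J)) x \<partial>lborel)"
      by (intro nn_integral_suminf) measurable
    also have "\<dots> \<le> (\<Sum>i. ennreal D * (e (i + J1) + e (i + J) + e (i + Suc J)))"
      by (intro suminf_le layer) auto
    also have "\<dots> = ennreal D * (\<Sum>i. e (i + J1) + e (i + J) + e (i + Suc J))" by (rule ennreal_suminf_cmult)
    also have "(\<Sum>i. e (i + J1) + e (i + J) + e (i + Suc J)) = (\<Sum>i. e (i + J1)) + (\<Sum>i. e (i + J)) + (\<Sum>i. e (i + Suc J))"
      by (subst suminf_add[symmetric], simp, simp, subst suminf_add[symmetric]) simp_all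
    also have "ennreal D * \<dots> \<le> ennreal D * (energy \<phi> + energy \<phi> + energy \<phi>)"
      by (intro mult_left_mono add_mono esum) auto
    also have "\<dots> = ennreal (3 * D) * energy \<phi>"
    proof -
      have "(3::ennreal) = 1 + 1 + 1" by simp
      then have "energy \<phi> + energy \<phi> + energy \<phi> = ennreal 3 * energy \<phi>" by (simp only: distrib_right mult_1 ennreal_numeral zero_le_numeral)
      then show ?thesis using D ennreal_mult_assoc[of D 3 "energy \<phi>"] by (simp add: mult.commute[of D])
    qed
    also have "\<dots> \<le> ennreal \<tau> * energy \<phi>"
      using \<kappa>\<tau> by (intro mult_right_mono ennreal_leI) (auto simp: D_def)
    finally show "(\<integral>\<^sup>+x. ennreal (\<bar>\<phi> x\<bar> ^ DIM('a) * hardy_weight R x) * indicator {x. R - d J < norm x} x \<partial>lborel) \<le> ennreal \<tau> * energy \<phi>"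
      by (simp add: N_def)
  qed
qed

end

section \<open>The Hardy inequality with a remainder\<close>

lemma has_derivative_abs_power:
  fixes s :: real
  assumes n: "n \<ge> 2"
  shows "((\<lambda>s. \<bar>s\<bar> ^ n) has_real_derivative (real n * \<bar>s\<bar> ^ (n - 2) * s)) (at s)"
proof (cases s "0::real" rule: linorder_cases)
  case greater
  have "((\<lambda>s. s ^ n) has_real_derivative (real n * \<bar>s\<bar> ^ (n - 2) * s)) (at s)"
  proof -
    have "s ^ (n - 2) * s = s ^ (n - 1)" using n by (metis Suc_1 Suc_diff_le diff_Suc_Suc diff_zero power_Suc2 One_nat_def numeral_2_eq_2)
    then show ?thesis using greater by (auto intro!: derivative_eq_intros)
  qed
  then show ?thesis
    by (rule has_field_derivative_transform_within_open[where S = "{0<..}"]) (use greater in auto)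
next
  case less
  have "((\<lambda>s. (- s) ^ n) has_real_derivative (real n * \<bar>s\<bar> ^ (n - 2) * s)) (at s)"
  proof -
    have "(- s) ^ (n - Suc 0) = - ((- s) ^ (n - 2) * s)" using n by (metis minus_mult_right Suc_1 Suc_diff_le diff_Suc_Suc diff_zero power_Suc2 One_nat_def numeral_2_eq_2)
    then show ?thesis using less by (auto intro!: derivative_eq_intros)
  qed
  then show ?thesis
    by (rule has_field_derivative_transform_within_open[where S = "{..<0}"]) (use less in auto)
next
  case equal
  have "((\<lambda>h::real. \<bar>h\<bar> ^ (n - 1)) \<longlongrightarrow> \<bar>0\<bar> ^ (n - 1)) (at 0)" by (intro tendsto_intros)
  then have t: "((\<lambda>h::real. \<bar>h\<bar> ^ (n - 1)) \<longlongrightarrow> 0) (at 0)" using n by (simp add: power_0_left)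
  have "((\<lambda>h::real. \<bar>h\<bar> ^ n / h) \<longlongrightarrow> 0) (at 0)"
  proof (rule Lim_null_comparison[OF _ t])
    show "\<forall>\<^sub>F h in at 0. norm (\<bar>h\<bar> ^ n / h) \<le> \<bar>h\<bar> ^ (n - 1)" for h
      using n by (intro always_eventually allI) (cases n; auto simp: abs_mult)
  qed
  then show ?thesis using equal n by (simp add: has_field_derivative_iff power_0_left)
qed

text \<open>With \<open>k = (N - 1) / N\<close> this is \<open>\<phi>\<close> times the logarithmic gradient of \<open>ln (R / norm x) powr k\<close>,
  the (non-admissible) extremal of the Hardy inequality on the ball.\<close>

definition hardy_field :: "real \<Rightarrow> ('a::euclidean_space \<Rightarrow> real) \<Rightarrow> 'a \<Rightarrow> 'a" where
  "hardy_field R \<phi> x = (- ((real DIM('a) - 1) / real DIM('a) * \<phi> x / ((norm x)\<^sup>2 * ln (R / norm x)))) *\<^sub>R x"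

text \<open>The radial profile behind the Hardy inequality, with the cutoff \<open>r\<^sup>2 / (r\<^sup>2 + \<epsilon>)\<close> that removes the
  singularity at the origin. The term \<open>- real N\<close> is the one that the dilation identity cancels.\<close>

lemma hardy_profile_has_derivative:
  fixes R \<epsilon> r :: real
  assumes r: "0 < r" "r < R" and \<epsilon>: "\<epsilon> > 0" and N: "N \<ge> 2"
  shows "((\<lambda>r. (r\<^sup>2 / (r\<^sup>2 + \<epsilon>) / ln (R / r)) ^ (N - 1) / r ^ N) has_real_derivative
    ((r\<^sup>2 / (r\<^sup>2 + \<epsilon>) / ln (R / r)) ^ (N - 1) / r ^ N * (- real N + real (N - 1) * (2 * (1 - r\<^sup>2 / (r\<^sup>2 + \<epsilon>)) + 1 / ln (R / r))) / r)) (at r)"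
proof -
  define L where "L = ln (R / r)"
  have L: "L > 0" unfolding L_def using r by (intro ln_gt_zero) simp
  have s: "r\<^sup>2 + \<epsilon> > 0" using \<epsilon> by (simp add: add_nonneg_pos)
  define P where "P r = r\<^sup>2 / (r\<^sup>2 + \<epsilon>) / ln (R / r)" for r
  have P0: "P r > 0" using r L s by (simp add: P_def L_def)
  have dL: "((\<lambda>r. ln (R / r)) has_real_derivative (- 1 / r)) (at r)"
    using r by (auto intro!: derivative_eq_intros simp: field_simps power2_eq_square)
  have dchi: "((\<lambda>r. r\<^sup>2 / (r\<^sup>2 + \<epsilon>)) has_real_derivative (2 * r * \<epsilon> / (r\<^sup>2 + \<epsilon>)\<^sup>2)) (at r)"
    using s by (auto intro!: derivative_eq_intros simp: field_simps power2_eq_square)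
  have dP: "(P has_real_derivative (P r * (2 * (1 - r\<^sup>2 / (r\<^sup>2 + \<epsilon>)) + 1 / L) / r)) (at r)"
  proof -
    have "(P has_real_derivative ((2 * r * \<epsilon> / (r\<^sup>2 + \<epsilon>)\<^sup>2) * ln (R / r) - r\<^sup>2 / (r\<^sup>2 + \<epsilon>) * (- 1 / r)) / (ln (R / r) * ln (R / r))) (at r)"
      unfolding P_def[abs_def] by (rule DERIV_divide[OF dchi dL]) (use L in \<open>simp add: L_def\<close>)
    also have "((2 * r * \<epsilon> / (r\<^sup>2 + \<epsilon>)\<^sup>2) * ln (R / r) - r\<^sup>2 / (r\<^sup>2 + \<epsilon>) * (- 1 / r)) / (ln (R / r) * ln (R / r))
      = P r * (2 * (1 - r\<^sup>2 / (r\<^sup>2 + \<epsilon>)) + 1 / L) / r"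
    proof -
      define S where "S = r\<^sup>2 + \<epsilon>"
      have e: "\<epsilon> = S - r\<^sup>2" "S > 0" using s by (auto simp: S_def)
      show ?thesis unfolding P_def L_def[symmetric] S_def[symmetric] unfolding e(1)
        using e(2) L r by (simp add: field_simps power2_eq_square)
    qed
    finally show ?thesis .
  qed
  have "((\<lambda>r. P r ^ (N - 1) / r ^ N) has_real_derivative
    ((real (N - 1) * P r ^ (N - 1 - 1) * (P r * (2 * (1 - r\<^sup>2 / (r\<^sup>2 + \<epsilon>)) + 1 / L) / r)) * r ^ N - P r ^ (N - 1) * (real N * r ^ (N - 1))) / (r ^ N * r ^ N)) (at r)"
    using r by (intro DERIV_divide) (auto intro!: derivative_eq_intros dP)
  also have "((real (N - 1) * P r ^ (N - 1 - 1) * (P r * (2 * (1 - r\<^sup>2 / (r\<^sup>2 + \<epsilon>)) + 1 / L) / r)) * r ^ N - P r ^ (N - 1) * (real N * r ^ (N - 1))) / (r ^ N * r ^ N)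
    = P r ^ (N - 1) / r ^ N * (- real N + real (N - 1) * (2 * (1 - r\<^sup>2 / (r\<^sup>2 + \<epsilon>)) + 1 / L)) / r"
  proof -
    define c where "c = 2 * (1 - r\<^sup>2 / (r\<^sup>2 + \<epsilon>)) + 1 / L"
    define p where "p = P r"
    obtain M where M: "N = Suc (Suc M)" using N by (metis add_2_eq_Suc le_Suc_ex)
    show ?thesis unfolding c_def[symmetric] p_def[symmetric] M using r by (simp add: field_simps)
  qed
  finally show ?thesis by (simp only: P_def L_def)
qed

context thin_domain
begin

text \<open>Apply \<open>norm_power_add_ge\<close> to \<open>gradient \<phi> = A + (gradient \<phi> - A)\<close>. The mixed term is, up to a
  favourable sign, a radial derivative of \<open>\<bar>\<phi> x\<bar> ^ N\<close> times the profile, and integrates to zero by the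
  dilation identity. The regularisation is needed because \<open>\<phi>\<close> need not vanish near the origin.\<close>

lemma hardy_remainder_regularised:
  assumes \<phi>: "\<phi> \<in> test_functions \<Omega>" and \<epsilon>: "\<epsilon> > 0"
  defines "A \<equiv> \<lambda>x. ((norm x)\<^sup>2 / ((norm x)\<^sup>2 + \<epsilon>)) *\<^sub>R hardy_field R \<phi> x"
  shows "(\<integral>\<^sup>+x. ennreal (norm (A x) ^ DIM('a) + norm (gradient \<phi> x - A x) ^ DIM('a) / 2 ^ (DIM('a) - 1)) \<partial>lborel) \<le> energy \<phi>"
proof -
  define N where "N = DIM('a)"
  have N: "N \<ge> 2" using dim2 by (simp add: N_def)
  define k where "k = (real N - 1) / real N"
  have k: "k > 0" "real N * k = real (N - 1)" using N by (auto simp: k_def of_nat_diff)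
  define \<zeta> where "\<zeta> r = r\<^sup>2 / (r\<^sup>2 + \<epsilon>)" for r :: real
  have \<zeta>: "0 \<le> \<zeta> r" "\<zeta> r \<le> 1" for r using \<epsilon> by (auto simp: \<zeta>_def add_nonneg_pos divide_le_eq)
  define p where "p r = \<zeta> r / ln (R / r)" for r
  define q where "q r = p r ^ (N - 1) / r ^ N" for r
  define c where "c r = real (N - 1) * (2 * (1 - \<zeta> r) + 1 / ln (R / r))" for r
  define F where "F x = real N * \<bar>\<phi> x\<bar> ^ (N - 2) * \<phi> x * (gradient \<phi> x \<bullet> x)" for x
  define G where "G x = \<bar>\<phi> x\<bar> ^ N * q (norm x)" for x
  define D where "D x = q (norm x) * (F x + \<bar>\<phi> x\<bar> ^ N * (- real N + c (norm x)))" for x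
  note sm = test_functions_smooth[OF \<phi>]
  note [measurable] = test_measurable[OF \<phi>]
  obtain K where K: "compact K" "K \<subseteq> \<Omega>" "\<And>x. x \<notin> K \<Longrightarrow> \<phi> x = 0" "\<And>x. x \<notin> K \<Longrightarrow> gradient \<phi> x = 0"
    using test_functions_supportE[OF \<phi>] by metis
  obtain B1 where B1: "B1 > 0" "\<And>x. norm (\<phi> x) \<le> B1"
    using continuous_support_bounded[OF smooth_continuous[OF sm] K(1,3)] by metis
  obtain B2 where B2: "B2 > 0" "\<And>x. norm (gradient \<phi> x) \<le> B2"
    using continuous_support_bounded[OF smooth_continuous_gradient[OF sm] K(1,4)] by metis
  obtain r0 where r0: "0 < r0" "r0 < R" "\<And>x. x \<in> K \<Longrightarrow> norm x \<le> r0"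
  proof (cases "K = {}")
    case True then show ?thesis using that[of "R/2"] R by auto
  next
    case False
    obtain y where y: "y \<in> K" "\<And>x. x \<in> K \<Longrightarrow> norm x \<le> norm y"
      using continuous_attains_sup[OF K(1) False, of norm] continuous_on_norm_id by blast
    then have "norm y < R" using inside K(2) by blast
    show ?thesis
    proof (rule that)
      show "0 < max (R/2) (norm y)" "max (R/2) (norm y) < R" using R \<open>norm y < R\<close> by auto
      show "norm x \<le> max (R/2) (norm y)" if "x \<in> K" for x using y(2)[OF that] by simp
    qed
  qed
  define L0 where "L0 = ln (R / r0)"
  have L0: "L0 > 0" unfolding L0_def using r0 by (intro ln_gt_zero) simp
  have Lx: "ln (R / norm x) \<ge> L0" if "x \<in> K" "x \<noteq> 0" for x
    unfolding L0_def using r0 that R by (intro ln_mono divide_left_mono) auto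
  have inK: "x \<in> K \<and> x \<noteq> 0" if "G x \<noteq> 0 \<or> D x \<noteq> 0" for x
  proof -
    have "x \<in> K"
    proof (rule ccontr)
      assume "x \<notin> K"
      then have "\<phi> x = 0" by (rule K)
      then have "G x = 0" "D x = 0" using N by (simp_all add: G_def D_def F_def power_0_left)
      then show False using that by simp
    qed
    moreover have "x \<noteq> 0" using that N by (auto simp: G_def D_def q_def p_def \<zeta>_def power_0_left)
    ultimately show ?thesis by simp
  qed
  define Bq where "Bq = R ^ (N - 2) / (\<epsilon> * L0) ^ (N - 1)"
  have Bq: "0 \<le> q (norm x)" "q (norm x) \<le> Bq" if x: "x \<in> K" "x \<noteq> 0" for x
  proof -
    have nx: "norm x > 0" "norm x \<le> R" using x r0 by (force)+
    have L: "ln (R / norm x) \<ge> L0" by (rule Lx[OF x])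
    have p: "0 \<le> p (norm x)" unfolding p_def using \<zeta> L L0 by (intro divide_nonneg_nonneg) auto
    then show "0 \<le> q (norm x)" using nx by (simp add: q_def)
    have "\<zeta> (norm x) \<le> (norm x)\<^sup>2 / \<epsilon>" unfolding \<zeta>_def using \<epsilon> by (intro divide_left_mono) (auto intro!: mult_pos_pos add_nonneg_pos)
    then have "p (norm x) \<le> ((norm x)\<^sup>2 / \<epsilon>) / L0"
      unfolding p_def using L L0 \<epsilon> by (intro frac_le) auto
    then have "p (norm x) ^ (N - 1) \<le> ((norm x)\<^sup>2 / (\<epsilon> * L0)) ^ (N - 1)" using p by (intro power_mono) auto
    then have "q (norm x) \<le> ((norm x)\<^sup>2 / (\<epsilon> * L0)) ^ (N - 1) / norm x ^ N"
      unfolding q_def by (rule divide_right_mono) simp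
    also have "\<dots> = norm x ^ (N - 2) / (\<epsilon> * L0) ^ (N - 1)"
    proof -
      obtain M where M: "N = Suc (Suc M)" using N by (metis add_2_eq_Suc le_Suc_ex)
      show ?thesis unfolding M using nx(1) by (simp add: power_divide power2_eq_square power_mult_distrib)
    qed
    also have "\<dots> \<le> Bq" unfolding Bq_def using nx \<epsilon> L0 by (intro divide_right_mono power_mono) auto
    finally show "q (norm x) \<le> Bq" .
  qed
  have BF: "\<bar>F x\<bar> \<le> real N * B1 ^ (N - 2) * B1 * (B2 * R)" if "x \<in> K" for x
  proof -
    have nx: "norm x \<le> R" using r0(3)[OF that] r0(2) by simp
    have "\<bar>gradient \<phi> x \<bullet> x\<bar> \<le> norm (gradient \<phi> x) * norm x" by (rule Cauchy_Schwarz_ineq2)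
    also have "\<dots> \<le> B2 * R" using B2 nx by (intro mult_mono) auto
    finally have "\<bar>gradient \<phi> x \<bullet> x\<bar> \<le> B2 * R" .
    then show ?thesis unfolding F_def abs_mult using B1(2)[of x] B1(1) B2(1) R
      by (intro mult_mono) (auto intro!: power_mono)
  qed
  define BB where "BB = Bq * (real N * B1 ^ (N - 2) * B1 * (B2 * R) + B1 ^ N * (real N + real (N - 1) * (2 + 1 / L0)))"
  have Bq0: "Bq \<ge> 0" using R \<epsilon> L0 by (simp add: Bq_def)
  have bounds: "\<bar>G x\<bar> \<le> max (B1 ^ N * Bq) BB \<and> \<bar>D x\<bar> \<le> max (B1 ^ N * Bq) BB" for x
  proof (cases "x \<in> K \<and> x \<noteq> 0")
    case True
    then have x: "x \<in> K" "x \<noteq> 0" by auto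
    have \<phi>N: "\<bar>\<phi> x\<bar> ^ N \<le> B1 ^ N" using B1(2)[of x] by (intro power_mono) auto
    have "\<bar>G x\<bar> = \<bar>\<phi> x\<bar> ^ N * q (norm x)" using Bq[OF x] by (simp add: G_def abs_mult power_abs)
    also have "\<dots> \<le> B1 ^ N * Bq" using Bq[OF x] \<phi>N B1(1) by (intro mult_mono) auto
    finally have g: "\<bar>G x\<bar> \<le> B1 ^ N * Bq" .
    have "0 \<le> c (norm x)" "c (norm x) \<le> real (N - 1) * (2 + 1 / L0)"
    proof -
      have l: "0 \<le> 1 / ln (R / norm x)" "1 / ln (R / norm x) \<le> 1 / L0" using Lx[OF x] L0 by (auto intro!: divide_left_mono mult_pos_pos)
      then show "0 \<le> c (norm x)" "c (norm x) \<le> real (N - 1) * (2 + 1 / L0)"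
        unfolding c_def using \<zeta>[of "norm x"] by (auto intro!: mult_left_mono mult_nonneg_nonneg)
    qed
    then have "\<bar>- real N + c (norm x)\<bar> \<le> real N + real (N - 1) * (2 + 1 / L0)" by simp
    then have "\<bar>\<phi> x\<bar> ^ N * \<bar>- real N + c (norm x)\<bar> \<le> B1 ^ N * (real N + real (N - 1) * (2 + 1 / L0))"
      using \<phi>N B1(1) by (intro mult_mono) auto
    then have "\<bar>F x + \<bar>\<phi> x\<bar> ^ N * (- real N + c (norm x))\<bar> \<le> real N * B1 ^ (N - 2) * B1 * (B2 * R) + B1 ^ N * (real N + real (N - 1) * (2 + 1 / L0))"
      using BF[OF x(1)] by (intro order_trans[OF abs_triangle_ineq] add_mono) (auto simp: abs_mult power_abs)
    then have "\<bar>D x\<bar> \<le> BB"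
      unfolding D_def BB_def abs_mult using Bq[OF x] by (intro mult_mono) auto
    with g show ?thesis by auto
  next
    case False
    then have "G x = 0" "D x = 0" using inK[of x] by auto
    then show ?thesis using B1(1) Bq0 by (auto simp: le_max_iff_disj)
  qed
  have [measurable]: "G \<in> borel_measurable borel" "D \<in> borel_measurable borel"
    unfolding G_def[abs_def] D_def[abs_def] F_def q_def p_def c_def \<zeta>_def by measurable
  have der: "((\<lambda>t. G (t *\<^sub>R x)) has_real_derivative (D (t *\<^sub>R x) / t)) (at t)" if t: "t > 0" for x t
  proof (cases "x = 0")
    case True
    have "G 0 = 0" "D 0 = 0" using inK[of 0] by auto
    then show ?thesis using True by simp
  next
    case x0: False
    show ?thesis
    proof (cases "norm (t *\<^sub>R x) < R")
      case True
      define \<rho> where "\<rho> = norm x"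
      have \<rho>: "\<rho> > 0" using x0 by (simp add: \<rho>_def)
      have tr: "0 < t * \<rho>" "t * \<rho> < R" using True t \<rho> by (auto simp: \<rho>_def)
      have nt: "norm (t *\<^sub>R x) = t * \<rho>" using t by (simp add: \<rho>_def)
      have "((\<lambda>t. t *\<^sub>R x) has_derivative (\<lambda>s. s *\<^sub>R x)) (at t)" by (auto intro!: derivative_eq_intros)
      from has_derivative_compose[OF this smooth_has_derivative[OF sm]]
      have d\<phi>: "((\<lambda>t. \<phi> (t *\<^sub>R x)) has_real_derivative (gradient \<phi> (t *\<^sub>R x) \<bullet> x)) (at t)"
        by (simp add: has_field_derivative_def mult_commute_abs)
      have d1: "((\<lambda>t. \<bar>\<phi> (t *\<^sub>R x)\<bar> ^ N) has_real_derivative (real N * \<bar>\<phi> (t *\<^sub>R x)\<bar> ^ (N - 2) * \<phi> (t *\<^sub>R x)) * (gradient \<phi> (t *\<^sub>R x) \<bullet> x)) (at t)"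
        by (rule DERIV_chain2[where f = "\<lambda>s. \<bar>s\<bar> ^ N", OF has_derivative_abs_power[OF N] d\<phi>])
      have dq: "(q has_real_derivative (q (t * \<rho>) * (- real N + c (t * \<rho>)) / (t * \<rho>))) (at (t * \<rho>))"
        using hardy_profile_has_derivative[OF tr \<epsilon> N] unfolding q_def[abs_def] p_def \<zeta>_def c_def .
      have d2: "((\<lambda>t. q (t * \<rho>)) has_real_derivative (q (t * \<rho>) * (- real N + c (t * \<rho>)) / (t * \<rho>)) * \<rho>) (at t)"
        by (rule DERIV_chain2[where f = q and g = "\<lambda>t. t * \<rho>", OF dq]) (auto intro!: derivative_eq_intros)
      have d12: "((\<lambda>t. \<bar>\<phi> (t *\<^sub>R x)\<bar> ^ N * q (t * \<rho>)) has_real_derivative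
          ((real N * \<bar>\<phi> (t *\<^sub>R x)\<bar> ^ (N - 2) * \<phi> (t *\<^sub>R x)) * (gradient \<phi> (t *\<^sub>R x) \<bullet> x)) * q (t * \<rho>)
          + ((q (t * \<rho>) * (- real N + c (t * \<rho>)) / (t * \<rho>)) * \<rho>) * \<bar>\<phi> (t *\<^sub>R x)\<bar> ^ N) (at t)"
        by (rule DERIV_mult[OF d1 d2])
      have eqD: "((real N * \<bar>\<phi> (t *\<^sub>R x)\<bar> ^ (N - 2) * \<phi> (t *\<^sub>R x)) * (gradient \<phi> (t *\<^sub>R x) \<bullet> x)) * q (t * \<rho>)
          + ((q (t * \<rho>) * (- real N + c (t * \<rho>)) / (t * \<rho>)) * \<rho>) * \<bar>\<phi> (t *\<^sub>R x)\<bar> ^ N = D (t *\<^sub>R x) / t"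
        unfolding D_def F_def nt using t \<rho> by (simp add: field_simps)
      have "((\<lambda>t. \<bar>\<phi> (t *\<^sub>R x)\<bar> ^ N * q (t * \<rho>)) has_real_derivative (D (t *\<^sub>R x) / t)) (at t)"
        using d12 unfolding eqD .
      then show ?thesis
        by (rule has_field_derivative_transform_within_open[where S = "{0<..}"]) (use t in \<open>auto simp: G_def \<rho>_def\<close>)
    next
      case False
      have "D (t *\<^sub>R x) = 0" using inK[of "t *\<^sub>R x"] False r0 by force
      moreover have "((\<lambda>t. G (t *\<^sub>R x)) has_real_derivative 0) (at t)"
      proof (rule has_field_derivative_transform_within_open[of "\<lambda>_. 0" 0 t "{s. r0 < norm (s *\<^sub>R x)}"])
        show "open {s. r0 < norm (s *\<^sub>R x)}" by (intro open_Collect_less continuous_intros)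
        show "t \<in> {s. r0 < norm (s *\<^sub>R x)}" using False r0(2) by simp
        show "0 = G (s *\<^sub>R x)" if "s \<in> {s. r0 < norm (s *\<^sub>R x)}" for s
          using inK[of "s *\<^sub>R x"] that r0(3)[of "s *\<^sub>R x"] by force
      qed auto
      ultimately show ?thesis by simp
    qed
  qed
  have zero: "G x = 0 \<and> D x = 0" if "norm x > R" for x
    using inK[of x] that r0 by force
  have flow: "(\<integral>x. D x \<partial>lborel) = - real N * (\<integral>x. G x \<partial>lborel)"
    unfolding N_def
    by (rule integral_dilation_eq[where B = "max (B1 ^ N * Bq) BB" and r = R]) (use bounds zero der in auto)
  have Gi: "integrable lborel G" and Di: "integrable lborel D"
    using bounds zero by (auto intro!: integrable_bounded_support[where B = "max (B1 ^ N * Bq) BB" and r = R])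
  have gi: "integrable lborel (\<lambda>x. norm (gradient \<phi> x) ^ N)"
    using K N by (intro integrable_compact_support[OF _ K(1)] continuous_intros smooth_continuous_gradient sm) (auto simp: power_0_left)
  have pt: "norm (A x) ^ N + norm (gradient \<phi> x - A x) ^ N / 2 ^ (N - 1) \<le> norm (gradient \<phi> x) ^ N + k ^ (N - 1) * (D x + real N * G x)" for x
  proof (cases "x \<in> K \<and> x \<noteq> 0")
    case True
    then have x: "x \<in> K" "x \<noteq> 0" by auto
    define r where "r = norm x"
    have r: "0 < r" using x by (simp add: r_def)
    define L where "L = ln (R / r)"
    have L: "L > 0" using Lx[OF x] L0 by (simp add: L_def r_def)
    have p0: "0 \<le> p r" unfolding p_def using \<zeta>[of r] L by (simp add: L_def)
    have q0: "0 \<le> q r" using Bq[OF x] by (simp add: r_def)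
    have A: "A x = (- (k * \<phi> x * p r / r\<^sup>2)) *\<^sub>R x"
      by (simp add: A_def hardy_field_def p_def \<zeta>_def k_def N_def r_def mult.commute)
    have nA: "norm (A x) = k * \<bar>\<phi> x\<bar> * p r / r"
      unfolding A using k p0 r by (simp add: r_def[symmetric] abs_mult power2_eq_square)
    have nAN: "norm (A x) ^ N = k ^ N * \<bar>\<phi> x\<bar> ^ N * q r * p r"
    proof -
      have "p r ^ N = p r ^ (N - 1) * p r" using N by (metis Suc_1 Suc_le_D diff_Suc_1 power_Suc2)
      then show ?thesis unfolding nA q_def by (simp add: power_mult_distrib power_divide)
    qed
    have AG: "real N * norm (A x) ^ (N - 2) * (A x \<bullet> gradient \<phi> x) = - (k ^ (N - 1) * (q r * F x))"
    proof -
      obtain M where M: "N = Suc (Suc M)" using N by (metis add_2_eq_Suc le_Suc_ex)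
      have e: "A x \<bullet> gradient \<phi> x = - (k * \<phi> x * p r / r\<^sup>2) * (gradient \<phi> x \<bullet> x)" unfolding A by (simp add: inner_commute)
      show ?thesis unfolding nA e F_def q_def M using r by (simp add: power_mult_distrib power_divide field_simps power2_eq_square)
    qed
    have AA: "real N * norm (A x) ^ (N - 2) * (A x \<bullet> A x) = real N * norm (A x) ^ N"
    proof -
      have "norm (A x) ^ N = norm (A x) ^ (N - 2) * (norm (A x))\<^sup>2" using N by (metis le_add_diff_inverse2 power_add)
      then show ?thesis by (simp add: power2_norm_eq_inner)
    qed
    have rem: "norm (A x) ^ N + real N * norm (A x) ^ (N - 2) * (A x \<bullet> (gradient \<phi> x - A x)) + norm (gradient \<phi> x - A x) ^ N / 2 ^ (N - 1) \<le> norm (gradient \<phi> x) ^ N"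
      using norm_power_add_ge[OF N, of "A x" "gradient \<phi> x - A x"] by simp
    have "real N * norm (A x) ^ (N - 2) * (A x \<bullet> (gradient \<phi> x - A x)) = - (k ^ (N - 1) * (q r * F x)) - real N * norm (A x) ^ N"
      unfolding inner_diff_right right_diff_distrib AG AA ..
    also have "real N * norm (A x) ^ N = k ^ (N - 1) * (real (N - 1) * \<bar>\<phi> x\<bar> ^ N * q r * p r)"
    proof -
      have "real N * k ^ N = k ^ (N - 1) * real (N - 1)"
        using N k(2) by (metis Suc_1 Suc_le_D diff_Suc_1 mult.commute mult.left_commute power_Suc)
      then show ?thesis unfolding nAN by (simp add: mult.assoc[symmetric])
    qed
    finally have cross: "real N * norm (A x) ^ (N - 2) * (A x \<bullet> (gradient \<phi> x - A x)) = - (k ^ (N - 1) * (q r * F x + real (N - 1) * \<bar>\<phi> x\<bar> ^ N * q r * p r))"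
      by (simp add: algebra_simps)
    \<comment> \<open>The cutoff is increasing and at most \<open>1\<close>, so the regularisation errs in the right direction.\<close>
    have pc: "real (N - 1) * p r \<le> c r"
    proof -
      have "p r \<le> 1 / L" unfolding p_def L_def[symmetric] using \<zeta>[of r] L by (intro divide_right_mono) auto
      then show ?thesis unfolding c_def L_def[symmetric] using \<zeta>[of r] by (intro mult_left_mono) auto
    qed
    have "q r * F x + real (N - 1) * \<bar>\<phi> x\<bar> ^ N * q r * p r \<le> D x + real N * G x"
    proof -
      have "\<bar>\<phi> x\<bar> ^ N * q r * (real (N - 1) * p r) \<le> \<bar>\<phi> x\<bar> ^ N * q r * c r"
        using q0 by (intro mult_left_mono pc) auto
      then show ?thesis by (simp add: D_def G_def r_def[symmetric] algebra_simps)
    qed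
    then have "k ^ (N - 1) * (q r * F x + real (N - 1) * \<bar>\<phi> x\<bar> ^ N * q r * p r) \<le> k ^ (N - 1) * (D x + real N * G x)"
      using k by (intro mult_left_mono) auto
    then show ?thesis using rem unfolding cross by linarith
  next
    case False
    then have "G x = 0" "D x = 0" using inK[of x] by auto
    moreover have "A x = 0" using False K(3)[of x] by (auto simp: A_def hardy_field_def)
    moreover have "norm (gradient \<phi> x) ^ N / 2 ^ (N - 1) \<le> norm (gradient \<phi> x) ^ N / 1"
      by (intro divide_left_mono) auto
    ultimately show ?thesis using N by (simp add: power_0_left)
  qed
  have "(\<integral>\<^sup>+x. ennreal (norm (A x) ^ N + norm (gradient \<phi> x - A x) ^ N / 2 ^ (N - 1)) \<partial>lborel)
    \<le> (\<integral>\<^sup>+x. ennreal (norm (gradient \<phi> x) ^ N + k ^ (N - 1) * (D x + real N * G x)) \<partial>lborel)"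
    by (intro nn_integral_mono ennreal_leI pt)
  also have "\<dots> = ennreal (\<integral>x. norm (gradient \<phi> x) ^ N + k ^ (N - 1) * (D x + real N * G x) \<partial>lborel)"
  proof (rule nn_integral_eq_integral)
    show "integrable lborel (\<lambda>x. norm (gradient \<phi> x) ^ N + k ^ (N - 1) * (D x + real N * G x))"
      by (intro Bochner_Integration.integrable_add integrable_mult_right gi Gi Di)
    have "0 \<le> norm (gradient \<phi> x) ^ N + k ^ (N - 1) * (D x + real N * G x)" for x
      by (rule order_trans[OF _ pt]) simp
    then show "AE x in lborel. 0 \<le> norm (gradient \<phi> x) ^ N + k ^ (N - 1) * (D x + real N * G x)" by simp
  qed
  also have "(\<integral>x. norm (gradient \<phi> x) ^ N + k ^ (N - 1) * (D x + real N * G x) \<partial>lborel) = (\<integral>x. norm (gradient \<phi> x) ^ N \<partial>lborel)"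
    using gi Gi Di flow by simp
  also have "ennreal \<dots> = energy \<phi>"
    unfolding energy_def N_def[symmetric] by (rule nn_integral_eq_integral[symmetric, OF gi]) auto
  finally show ?thesis by (simp add: N_def)
qed

text \<open>The critical Hardy inequality with its sharp constant and a remainder: let \<open>\<epsilon>\<close> tend to zero in the
  regularised version, using Fatou's lemma.\<close>

lemma hardy_remainder:
  assumes \<phi>: "\<phi> \<in> test_functions \<Omega>"
  shows "ennreal (((real DIM('a) - 1) / real DIM('a)) ^ DIM('a)) * (\<integral>\<^sup>+x. ennreal (\<bar>\<phi> x\<bar> ^ DIM('a) * hardy_weight R x) \<partial>lborel)
    + ennreal (1 / 2 ^ (DIM('a) - 1)) * (\<integral>\<^sup>+x. ennreal (norm (gradient \<phi> x - hardy_field R \<phi> x) ^ DIM('a)) \<partial>lborel) \<le> energy \<phi>"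
proof -
  define N where "N = DIM('a)"
  have N: "N \<ge> 2" using dim2 by (simp add: N_def)
  define k where "k = (real N - 1) / real N"
  have k: "k > 0" using N by (simp add: k_def)
  note [measurable] = test_measurable[OF \<phi>]
  have [measurable]: "hardy_field R \<phi> \<in> borel_measurable borel" unfolding hardy_field_def[abs_def] by measurable
  define \<epsilon> where "\<epsilon> n = 1 / real (Suc n)" for n
  have \<epsilon>: "\<epsilon> n > 0" for n by (simp add: \<epsilon>_def)
  have \<epsilon>0: "\<epsilon> \<longlonglongrightarrow> 0" unfolding \<epsilon>_def[abs_def] by (rule LIMSEQ_Suc[OF lim_1_over_n])
  define A where "A n x = ((norm x)\<^sup>2 / ((norm x)\<^sup>2 + \<epsilon> n)) *\<^sub>R hardy_field R \<phi> x" for n x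
  have [measurable]: "A n \<in> borel_measurable borel" for n unfolding A_def[abs_def] by measurable
  have lim: "(\<lambda>n. A n x) \<longlonglongrightarrow> hardy_field R \<phi> x" for x
  proof (cases "x = 0")
    case True then show ?thesis by (simp add: A_def hardy_field_def)
  next
    case False
    then have "(\<lambda>n. A n x) \<longlonglongrightarrow> ((norm x)\<^sup>2 / ((norm x)\<^sup>2 + 0)) *\<^sub>R hardy_field R \<phi> x"
      unfolding A_def by (intro tendsto_intros \<epsilon>0) auto
    then show ?thesis using False by simp
  qed
  define H where "H X x = norm (X x) ^ N + norm (gradient \<phi> x - X x) ^ N / 2 ^ (N - 1)" for X and x :: 'a
  have "(\<integral>\<^sup>+x. ennreal (H (hardy_field R \<phi>) x) \<partial>lborel) = (\<integral>\<^sup>+x. liminf (\<lambda>n. ennreal (H (A n) x)) \<partial>lborel)"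
  proof (rule nn_integral_cong)
    fix x
    have "(\<lambda>n. ennreal (H (A n) x)) \<longlonglongrightarrow> ennreal (H (hardy_field R \<phi>) x)"
      unfolding H_def by (intro tendsto_intros lim) auto
    from lim_imp_Liminf[OF trivial_limit_sequentially this]
    show "ennreal (H (hardy_field R \<phi>) x) = liminf (\<lambda>n. ennreal (H (A n) x))" by simp
  qed
  also have "\<dots> \<le> liminf (\<lambda>n. \<integral>\<^sup>+x. ennreal (H (A n) x) \<partial>lborel)"
    unfolding H_def by (intro nn_integral_liminf) measurable
  also have "\<dots> \<le> energy \<phi>"
    by (intro Liminf_le always_eventually allI) (use hardy_remainder_regularised[OF \<phi> \<epsilon>] in \<open>auto simp: H_def A_def N_def\<close>)
  finally have le: "(\<integral>\<^sup>+x. ennreal (H (hardy_field R \<phi>) x) \<partial>lborel) \<le> energy \<phi>" .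
  have Heq: "ennreal (H (hardy_field R \<phi>) x) = ennreal (k ^ N) * ennreal (\<bar>\<phi> x\<bar> ^ N * hardy_weight R x) + ennreal (1 / 2 ^ (N - 1)) * ennreal (norm (gradient \<phi> x - hardy_field R \<phi> x) ^ N)" for x
  proof -
    have "norm (hardy_field R \<phi> x) ^ N = k ^ N * (\<bar>\<phi> x\<bar> ^ N * hardy_weight R x) \<and> 0 \<le> \<bar>\<phi> x\<bar> ^ N * hardy_weight R x"
    proof (cases "x = 0 \<or> norm x \<ge> R")
      case True
      then show ?thesis using test_zero[OF \<phi>, of x] N by (auto simp: hardy_field_def hardy_weight_def power_0_left N_def[symmetric])
    next
      case False
      then have r: "0 < norm x" "norm x < R" by auto
      then have L: "ln (R / norm x) > 0" by (intro ln_gt_zero) simp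
      have "norm (hardy_field R \<phi> x) = k * \<bar>\<phi> x\<bar> / (norm x * ln (R / norm x))"
        using r L k N by (simp add: hardy_field_def k_def N_def[symmetric] abs_mult power2_eq_square)
      then show ?thesis using r L by (simp add: hardy_weight_def N_def[symmetric] power_divide power_mult_distrib)
    qed
    then show ?thesis using k unfolding H_def
      by (subst ennreal_plus) (auto simp: ennreal_mult[symmetric])
  qed
  have "(\<integral>\<^sup>+x. ennreal (H (hardy_field R \<phi>) x) \<partial>lborel) =
    ennreal (k ^ N) * (\<integral>\<^sup>+x. ennreal (\<bar>\<phi> x\<bar> ^ N * hardy_weight R x) \<partial>lborel) + ennreal (1 / 2 ^ (N - 1)) * (\<integral>\<^sup>+x. ennreal (norm (gradient \<phi> x - hardy_field R \<phi> x) ^ N) \<partial>lborel)"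
    unfolding Heq by (subst nn_integral_add, measurable, subst nn_integral_cmult, measurable, subst nn_integral_cmult, measurable)
  then show ?thesis using le by (simp add: N_def k_def)
qed

end

text \<open>The denominator of the quotient, for functions that vanish outside the domain.\<close>

definition hardy_mass :: "real \<Rightarrow> ('a::euclidean_space \<Rightarrow> real) \<Rightarrow> ennreal" where
  "hardy_mass R \<phi> = (\<integral>\<^sup>+x. ennreal (\<bar>\<phi> x\<bar> ^ DIM('a) * hardy_weight R x) \<partial>lborel)"

text \<open>A line has measure zero from dimension two on.\<close>

lemma AE_line_avoids_origin:
  fixes z :: "'a::euclidean_space"
  assumes "DIM('a) \<ge> 2"
  shows "AE x in lborel. \<forall>t. x + t *\<^sub>R z \<noteq> 0"
proof -
  have "dim (span {z}) \<le> 1" using dim_le_card'[of "{z}"] by (simp add: dim_span)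
  then have "negligible (span {z})" using assms by (intro negligible_lowdim) simp
  then have "span {z} \<in> null_sets lebesgue" by (simp add: negligible_iff_null_sets)
  moreover have "span {z} \<in> sets lborel" by (simp add: closed_span)
  ultimately have "span {z} \<in> null_sets lborel" by (simp add: null_sets_completion_iff)
  then have "AE x in lborel. x \<notin> span {z}" by (rule AE_not_in)
  then show ?thesis
  proof (rule AE_mp, intro AE_I2 impI allI notI)
    fix x t assume "x \<notin> span {z}" "x + t *\<^sub>R z = 0"
    then have "x = (- t) *\<^sub>R z" by (simp add: eq_neg_iff_add_eq_0)
    then have "x \<in> span {z}" by (metis insertI1 span_base span_scale)
    with \<open>x \<notin> span {z}\<close> show False by simp
  qed
qed

context thin_domain
begin

text \<open>Division by the virtual extremal \<open>ln (R / norm y) powr k\<close> turns the remainder of the Hardy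
  inequality into a plain gradient, to which a Poincare inequality applies.\<close>

lemma hardy_field_conjugation_derivative:
  assumes \<phi>: "\<phi> \<in> test_functions \<Omega>" and y: "y \<noteq> 0" "norm y < R"
  defines "k \<equiv> (real DIM('a) - 1) / real DIM('a)"
  shows "((\<lambda>y. \<phi> y * ln (R / norm y) powr (- k)) has_derivative
     (\<lambda>v. (ln (R / norm y) powr (- k) *\<^sub>R (gradient \<phi> y - hardy_field R \<phi> y)) \<bullet> v)) (at y)"
proof -
  define r where "r = norm y"
  have r: "0 < r" "r < R" using y by (auto simp: r_def)
  define L where "L = ln (R / r)"
  have L: "L > 0" unfolding L_def using r by (intro ln_gt_zero) simp
  have "((\<lambda>r. ln (R / r) powr (- k)) has_real_derivative (- k * L powr (- k - 1) * (- 1 / r))) (at r)"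
    using r L by (auto intro!: derivative_eq_intros simp: L_def field_simps power2_eq_square)
  then have "((\<lambda>r. ln (R / r) powr (- k)) has_derivative (\<lambda>h. (- k * L powr (- k - 1) * (- 1 / r)) * h)) (at (norm y))"
    unfolding has_field_derivative_def r_def[symmetric] .
  from has_derivative_compose[OF has_derivative_norm[OF y(1)] this]
  have dh: "((\<lambda>y. ln (R / norm y) powr (- k)) has_derivative (\<lambda>v. (- k * L powr (- k - 1) * (- 1 / r)) * (sgn y \<bullet> v))) (at y)" by (simp only: inner_commute)
  have Lk: "L powr (- k - 1) = L powr (- k) / L" using L by (simp add: powr_diff)
  have "((\<lambda>y. \<phi> y * ln (R / norm y) powr (- k)) has_derivative
     (\<lambda>v. \<phi> y * ((- k * L powr (- k - 1) * (- 1 / r)) * (sgn y \<bullet> v)) + (gradient \<phi> y \<bullet> v) * ln (R / norm y) powr (- k))) (at y)"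
    by (rule has_derivative_mult[OF smooth_has_derivative[OF test_functions_smooth[OF \<phi>]] dh])
  also have "(\<lambda>v. \<phi> y * ((- k * L powr (- k - 1) * (- 1 / r)) * (sgn y \<bullet> v)) + (gradient \<phi> y \<bullet> v) * ln (R / norm y) powr (- k))
    = (\<lambda>v. (ln (R / norm y) powr (- k) *\<^sub>R (gradient \<phi> y - hardy_field R \<phi> y)) \<bullet> v)"
    unfolding hardy_field_def k_def[symmetric] r_def[symmetric] L_def[symmetric] Lk sgn_div_norm
    by (rule ext) (use r L in \<open>simp add: inner_simps r_def[symmetric] field_simps power2_eq_square\<close>)
  finally show ?thesis .
qed

text \<open>The function \<open>\<psi> y = \<phi> y * ln (R / norm y) powr (- k)\<close> vanishes on the hole near the origin, so the
  Poincare inequality on \<open>cball 0 r1\<close> bounds it by its gradient, that is by the remainder. It is smooth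
  except at the origin, which almost no segment meets. Away from the origin and the rim
  \<open>\<bar>\<psi>\<bar> ^ N\<close> and \<open>\<bar>\<phi>\<bar> ^ N * hardy_weight R\<close> are comparable.\<close>

lemma hardy_integral_middle_le:
  assumes e: "0 < \<epsilon>" and r1: "0 < r1" "r1 < R"
  obtains C where "C > 0"
    "\<And>\<phi>. \<phi> \<in> test_functions \<Omega> \<Longrightarrow>
       (\<integral>\<^sup>+x. ennreal (\<bar>\<phi> x\<bar> ^ DIM('a) * hardy_weight R x) * indicator {x. \<epsilon> \<le> norm x \<and> norm x \<le> r1} x \<partial>lborel)
       \<le> ennreal C * (\<integral>\<^sup>+x. ennreal (norm (gradient \<phi> x - hardy_field R \<phi> x) ^ DIM('a)) \<partial>lborel)"
proof -
  define N where "N = DIM('a)"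
  have N: "N \<ge> 2" using dim2 by (simp add: N_def)
  define k where "k = (real N - 1) / real N"
  obtain \<theta> r0 where \<theta>: "\<theta> > 0" "r0 > 0"
    and hole: "\<And>r. 0 < r \<Longrightarrow> r < r0 \<Longrightarrow> ennreal (\<theta> * r ^ N) \<le> emeasure lborel (cball 0 r - \<Omega>)"
    using hole unfolding N_def by blast
  \<comment> \<open>The hole must lie within \<open>cball 0 r1\<close>, where the segments stay away from the rim.\<close>
  define r' where "r' = min r1 (r0 / 2)"
  have r': "0 < r'" "r' \<le> r1" "r' < r0" using r1 \<theta> by (auto simp: r'_def)
  define m where "m = \<theta> * r' ^ N"
  have m: "m > 0" using \<theta> r' by (simp add: m_def)
  define L1 where "L1 = ln (R / r1)"
  have L1: "L1 > 0" unfolding L1_def using r1 by (intro ln_gt_zero) simp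
  have Lge: "L1 \<le> ln (R / norm y)" if "y \<noteq> 0" "norm y \<le> r1" for y :: 'a
    unfolding L1_def using that r1 R by (intro ln_mono divide_left_mono) auto
  define c1 where "c1 = (L1 powr (- k)) ^ N"
  have c1: "c1 > 0" using L1 by (simp add: c1_def)
  define B where "B = cball (0::'a) r1"
  have [measurable]: "B \<in> sets borel" by (simp add: B_def)
  define C1 where "C1 = measure lborel (ball (0::'a) (3 * r1)) * (3 * r1) ^ N / m"
  have C1: "C1 > 0" using r1 m by (simp add: C1_def content_ball)
  define C where "C = 1 / (\<epsilon> ^ N * L1) * (C1 * c1)"
  have C: "C > 0" using C1 c1 e L1 by (simp add: C_def)
  show ?thesis
  proof (rule that[OF C])
    fix \<phi> assume \<phi>: "\<phi> \<in> test_functions \<Omega>"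
    note [measurable] = test_measurable[OF \<phi>]
    have hfm [measurable]: "hardy_field R \<phi> \<in> borel_measurable borel" unfolding hardy_field_def[abs_def] by measurable
    define \<psi> where "\<psi> y = \<phi> y * ln (R / norm y) powr (- k)" for y
    have [measurable]: "\<psi> \<in> borel_measurable borel" unfolding \<psi>_def[abs_def] by measurable
    define g where "g y = ln (R / norm y) powr (- k) *\<^sub>R (gradient \<phi> y - hardy_field R \<phi> y)" for y
    define E where "E y = ennreal (norm (gradient \<phi> y - hardy_field R \<phi> y) ^ N)" for y
    have [measurable]: "E \<in> borel_measurable borel" unfolding E_def[abs_def] by measurable
    define G where "G y = ennreal c1 * E y" for y
    have [measurable]: "G \<in> borel_measurable borel" unfolding G_def[abs_def] by measurable
    have cont: "continuous_on {y. y \<noteq> 0 \<and> norm y < R} g"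
    proof -
      have "ln (R / norm y) \<noteq> 0" if "y \<noteq> 0" "norm y < R" for y :: 'a
        using that ln_gt_zero[of "R / norm y"] by simp
      then show ?thesis unfolding g_def[abs_def] hardy_field_def
        using R by (intro continuous_intros smooth_continuous smooth_continuous_gradient test_functions_smooth[OF \<phi>]) auto
    qed
    have P: "(\<integral>\<^sup>+x. ennreal (\<bar>\<psi> x\<bar> ^ N) * indicator B x \<partial>lborel) \<le> ennreal C1 * (\<integral>\<^sup>+x. G x * indicator B x \<partial>lborel)"
      unfolding C1_def
    proof (rule poincare_zero_set[where Y = B])
      fix z :: 'a assume "z \<noteq> 0"
      show "AE x in lborel. x \<in> B \<and> x + z \<in> B \<longrightarrow> segment_bound N \<psi> G x z"
      proof (rule AE_mp[OF AE_line_avoids_origin[OF dim2, of z]], intro AE_I2 impI)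
        fix x assume av: "\<forall>t. x + t *\<^sub>R z \<noteq> 0" and B: "x \<in> B \<and> x + z \<in> B"
        have seg: "norm (x + t *\<^sub>R z) \<le> r1" if t: "t \<in> {0..1}" for t
        proof -
          have "x + t *\<^sub>R z = (1 - t) *\<^sub>R x + t *\<^sub>R (x + z)" by (simp add: algebra_simps)
          moreover have "(1 - t) *\<^sub>R x + t *\<^sub>R (x + z) \<in> B"
            using B t unfolding B_def by (intro convexD_alt[OF convex_cball]) auto
          ultimately show ?thesis by (simp add: B_def)
        qed
        show "segment_bound N \<psi> G x z"
        proof (rule segment_boundI[where g = g])
          fix t :: real assume t: "t \<in> {0..1}"
          have y: "x + t *\<^sub>R z \<noteq> 0" "norm (x + t *\<^sub>R z) < R" using av seg[OF t] r1 by auto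
          show "(\<psi> has_derivative (\<lambda>v. g (x + t *\<^sub>R z) \<bullet> v)) (at (x + t *\<^sub>R z))"
            unfolding \<psi>_def[abs_def] g_def k_def N_def by (rule hardy_field_conjugation_derivative[OF \<phi> y])
          have "norm (g (x + t *\<^sub>R z)) ^ N = (ln (R / norm (x + t *\<^sub>R z)) powr (- k)) ^ N * norm (gradient \<phi> (x + t *\<^sub>R z) - hardy_field R \<phi> (x + t *\<^sub>R z)) ^ N"
            by (simp add: g_def power_mult_distrib)
          also have "\<dots> \<le> c1 * norm (gradient \<phi> (x + t *\<^sub>R z) - hardy_field R \<phi> (x + t *\<^sub>R z)) ^ N"
            unfolding c1_def using Lge[OF y(1) seg[OF t]] L1 N
            by (intro mult_right_mono power_mono powr_mono2') (auto simp: k_def)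
          finally show "ennreal (norm (g (x + t *\<^sub>R z)) ^ N) \<le> G (x + t *\<^sub>R z)"
            using c1 by (simp add: G_def E_def ennreal_mult[symmetric] ennreal_leI)
        next
          show "continuous_on {0..1} (\<lambda>t. g (x + t *\<^sub>R z))"
          proof (rule continuous_on_compose2[OF cont])
            show "(\<lambda>t. x + t *\<^sub>R z) ` {0..1} \<subseteq> {y. y \<noteq> 0 \<and> norm y < R}"
              using av le_less_trans[OF seg r1(2)] by auto
          qed (intro continuous_intros)
        qed (use N in auto)
      qed
    next
      fix x z :: 'a and t :: real assume B: "x \<in> B" "x + z \<in> B" "t \<in> {0..1}"
      have "x + t *\<^sub>R z = (1 - t) *\<^sub>R x + t *\<^sub>R (x + z)" by (simp add: algebra_simps)
      moreover have "(1 - t) *\<^sub>R x + t *\<^sub>R (x + z) \<in> B"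
        using B unfolding B_def by (intro convexD_alt[OF convex_cball]) auto
      ultimately show "x + t *\<^sub>R z \<in> B" by simp
    next
      fix x assume x: "x \<in> B"
      define Z where "Z = cball (0::'a) r' - \<Omega>"
      have [measurable]: "Z \<in> sets borel" unfolding Z_def using op by auto
      define Q where "Q = ball (0::'a) (3 * r1)"
      have [measurable]: "Q \<in> sets borel" by (simp add: Q_def)
      have "ennreal m \<le> (\<integral>\<^sup>+z. indicator Z z \<partial>lborel)" using hole[OF r'(1,3)] by (simp add: nn_integral_indicator Z_def[symmetric] m_def)
      also have "\<dots> = (\<integral>\<^sup>+z. indicator Z (z + x) \<partial>lborel)" by (rule nn_integral_lborel_translation[symmetric]) measurable
      also have "\<dots> = (\<integral>\<^sup>+z. indicator {z. z + x \<in> Z} z \<partial>lborel)" by (intro nn_integral_cong) (simp add: indicator_def)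
      also have "\<dots> = emeasure lborel {z. z + x \<in> Z}" by (rule nn_integral_indicator) measurable
      also have "\<dots> \<le> emeasure lborel {z \<in> Q. x + z \<in> B \<and> \<psi> (x + z) = 0}"
      proof (rule emeasure_mono)
        show "{z. z + x \<in> Z} \<subseteq> {z \<in> Q. x + z \<in> B \<and> \<psi> (x + z) = 0}"
        proof safe
          fix z assume z: "z + x \<in> Z"
          have "\<phi> (x + z) = 0" by (rule test_functions_gradient_support[OF \<phi>]) (use z in \<open>simp add: Z_def add.commute\<close>)
          then show "\<psi> (x + z) = 0" by (simp add: \<psi>_def)
          show "x + z \<in> B" using z r' by (auto simp: Z_def B_def add.commute)
          have "norm z \<le> norm (z + x) + norm x" using norm_triangle_ineq4[of "z + x" x] by simp
          moreover have "norm x \<le> r1" using x by (simp add: B_def)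
          moreover have "norm (z + x) \<le> r1" using z r' by (auto simp: Z_def)
          ultimately show "z \<in> Q" using r1 by (simp add: Q_def)
        qed
      qed measurable
      finally show "ennreal m \<le> emeasure lborel {z \<in> ball 0 (3 * r1). x + z \<in> B \<and> \<psi> (x + z) = 0}" unfolding Q_def .
    qed (use N r1 m in auto)
    have GE: "(\<integral>\<^sup>+x. G x * indicator B x \<partial>lborel) \<le> ennreal c1 * (\<integral>\<^sup>+x. E x \<partial>lborel)"
    proof -
      have "(\<integral>\<^sup>+x. G x * indicator B x \<partial>lborel) \<le> (\<integral>\<^sup>+x. ennreal c1 * E x \<partial>lborel)"
        by (intro nn_integral_mono) (auto simp: G_def indicator_def)
      also have "\<dots> = ennreal c1 * (\<integral>\<^sup>+x. E x \<partial>lborel)" by (intro nn_integral_cmult) measurable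
      finally show ?thesis .
    qed
    have pt: "ennreal (\<bar>\<phi> x\<bar> ^ N * hardy_weight R x) * indicator {x. \<epsilon> \<le> norm x \<and> norm x \<le> r1} x
      \<le> ennreal (1 / (\<epsilon> ^ N * L1)) * (ennreal (\<bar>\<psi> x\<bar> ^ N) * indicator B x)" for x
    proof (cases "\<epsilon> \<le> norm x \<and> norm x \<le> r1")
      case True
      then have x: "x \<noteq> 0" "norm x \<le> r1" "x \<in> B" using e by (auto simp: B_def)
      define L where "L = ln (R / norm x)"
      have L: "L \<ge> L1" "L > 0" using Lge[OF x(1,2)] L1 by (auto simp: L_def)
      have "\<bar>\<phi> x\<bar> = \<bar>\<psi> x\<bar> * L powr k"
        unfolding \<psi>_def L_def[symmetric] using L by (simp add: abs_mult powr_minus)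
      then have "\<bar>\<phi> x\<bar> ^ N = \<bar>\<psi> x\<bar> ^ N * (L powr k) ^ N" by (simp add: power_mult_distrib)
      also have "(L powr k) ^ N = L ^ (N - 1)"
      proof -
        have "(L powr k) ^ N = L powr (k * real N)" using L by (simp add: powr_realpow[symmetric] powr_powr)
        also have "k * real N = real (N - 1)" using N by (simp add: k_def of_nat_diff)
        finally show ?thesis using L by (simp add: powr_realpow)
      qed
      finally have "\<bar>\<phi> x\<bar> ^ N * hardy_weight R x = \<bar>\<psi> x\<bar> ^ N * (L ^ (N - 1) / (norm x ^ N * L ^ N))"
        by (simp add: hardy_weight_def N_def L_def)
      also have "L ^ (N - 1) / (norm x ^ N * L ^ N) = 1 / (norm x ^ N * L)"
      proof -
        obtain M where M: "N = Suc M" using N by (cases N) auto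
        show ?thesis unfolding M using L x by (simp add: field_simps)
      qed
      also have "\<bar>\<psi> x\<bar> ^ N * (1 / (norm x ^ N * L)) \<le> \<bar>\<psi> x\<bar> ^ N * (1 / (\<epsilon> ^ N * L1))"
        using True e L L1 x by (intro mult_left_mono divide_left_mono mult_mono power_mono mult_pos_pos) auto
      finally have "ennreal (\<bar>\<phi> x\<bar> ^ N * hardy_weight R x) \<le> ennreal (1 / (\<epsilon> ^ N * L1) * \<bar>\<psi> x\<bar> ^ N)"
        by (intro ennreal_leI) (simp only: mult.commute)
      also have "\<dots> = ennreal (1 / (\<epsilon> ^ N * L1)) * ennreal (\<bar>\<psi> x\<bar> ^ N)"
        using e L1 by (intro ennreal_mult) auto
      finally show ?thesis using True x by simp
    qed auto
    have "(\<integral>\<^sup>+x. ennreal (\<bar>\<phi> x\<bar> ^ N * hardy_weight R x) * indicator {x. \<epsilon> \<le> norm x \<and> norm x \<le> r1} x \<partial>lborel)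
      \<le> (\<integral>\<^sup>+x. ennreal (1 / (\<epsilon> ^ N * L1)) * (ennreal (\<bar>\<psi> x\<bar> ^ N) * indicator B x) \<partial>lborel)"
      by (intro nn_integral_mono pt)
    also have "\<dots> = ennreal (1 / (\<epsilon> ^ N * L1)) * (\<integral>\<^sup>+x. ennreal (\<bar>\<psi> x\<bar> ^ N) * indicator B x \<partial>lborel)"
      by (intro nn_integral_cmult) measurable
    also have "\<dots> \<le> ennreal (1 / (\<epsilon> ^ N * L1)) * (ennreal C1 * (ennreal c1 * (\<integral>\<^sup>+x. E x \<partial>lborel)))"
      by (intro mult_left_mono order_trans[OF P] GE) auto
    also have "\<dots> = ennreal C * (\<integral>\<^sup>+x. E x \<partial>lborel)"
      unfolding C_def using C1 c1 e L1
      by (subst ennreal_mult_assoc, simp, simp, subst ennreal_mult_assoc) auto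
    finally show "(\<integral>\<^sup>+x. ennreal (\<bar>\<phi> x\<bar> ^ DIM('a) * hardy_weight R x) * indicator {x. \<epsilon> \<le> norm x \<and> norm x \<le> r1} x \<partial>lborel)
       \<le> ennreal C * (\<integral>\<^sup>+x. ennreal (norm (gradient \<phi> x - hardy_field R \<phi> x) ^ DIM('a)) \<partial>lborel)"
      by (simp add: E_def N_def)
  qed
qed

lemma hardy_mass_split_le:
  assumes \<phi>: "\<phi> \<in> test_functions \<Omega>"
  shows "hardy_mass R \<phi> \<le>
    (\<integral>\<^sup>+x. ennreal (\<bar>\<phi> x\<bar> ^ DIM('a) * hardy_weight R x) * indicator (ball 0 \<epsilon>) x \<partial>lborel) +
    (\<integral>\<^sup>+x. ennreal (\<bar>\<phi> x\<bar> ^ DIM('a) * hardy_weight R x) * indicator {x. \<epsilon> \<le> norm x \<and> norm x \<le> r1} x \<partial>lborel) +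
    (\<integral>\<^sup>+x. ennreal (\<bar>\<phi> x\<bar> ^ DIM('a) * hardy_weight R x) * indicator {x. r1 < norm x} x \<partial>lborel)"
proof -
  note [measurable] = test_measurable[OF \<phi>]
  define F where "F x = ennreal (\<bar>\<phi> x\<bar> ^ DIM('a) * hardy_weight R x)" for x
  have [measurable]: "F \<in> borel_measurable borel" unfolding F_def[abs_def] by measurable
  define B where "B = ball (0::'a) \<epsilon>"
  have [measurable]: "B \<in> sets borel" by (simp add: B_def)
  have "(\<integral>\<^sup>+x. F x \<partial>lborel) \<le> (\<integral>\<^sup>+x. F x * indicator B x + F x * indicator {x. \<epsilon> \<le> norm x \<and> norm x \<le> r1} x + F x * indicator {x. r1 < norm x} x \<partial>lborel)"
    by (intro nn_integral_mono) (auto simp: indicator_def B_def)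
  also have "\<dots> = (\<integral>\<^sup>+x. F x * indicator B x \<partial>lborel) + (\<integral>\<^sup>+x. F x * indicator {x. \<epsilon> \<le> norm x \<and> norm x \<le> r1} x \<partial>lborel) + (\<integral>\<^sup>+x. F x * indicator {x. r1 < norm x} x \<partial>lborel)"
    by (subst nn_integral_add, measurable, subst nn_integral_add, measurable)
  finally show ?thesis by (simp add: hardy_mass_def F_def B_def)
qed

text \<open>A normalised test function with bounded energy has little mass near the origin and near the rim,
  hence at least mass \<open>1 / 2\<close> in between; there the remainder controls the mass, so it is bounded
  below.\<close>

lemma hardy_improvement:
  obtains \<delta> where "\<delta> > 0"
    "\<And>\<phi>. \<phi> \<in> test_functions \<Omega> \<Longrightarrow> hardy_mass R \<phi> = 1 \<Longrightarrow>
       ennreal (((real DIM('a) - 1) / real DIM('a)) ^ DIM('a) + \<delta>) \<le> energy \<phi>"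
proof -
  define N where "N = DIM('a)"
  define c where "c = ((real N - 1) / real N) ^ N"
  have c: "c \<ge> 0" using dim2 by (simp add: c_def N_def)
  \<comment> \<open>Above this energy there is nothing to prove, since \<open>\<delta> \<le> 1\<close>.\<close>
  define M where "M = c + 1"
  have M: "M > 0" using c by (simp add: M_def)
  have \<tau>: "1 / (4 * M) > 0" using M by simp
  obtain \<epsilon> where \<epsilon>: "\<epsilon> > 0" "\<epsilon> < R"
    "\<And>\<phi>. \<phi> \<in> test_functions \<Omega> \<Longrightarrow>
       (\<integral>\<^sup>+x. ennreal (\<bar>\<phi> x\<bar> ^ DIM('a) * hardy_weight R x) * indicator (ball 0 \<epsilon>) x \<partial>lborel) \<le> ennreal (1 / (4 * M)) * energy \<phi>"
    using hardy_integral_near_origin[OF \<tau>] by blast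
  obtain r1 where r1: "0 < r1" "r1 < R"
    "\<And>\<phi>. \<phi> \<in> test_functions \<Omega> \<Longrightarrow>
       (\<integral>\<^sup>+x. ennreal (\<bar>\<phi> x\<bar> ^ DIM('a) * hardy_weight R x) * indicator {x. r1 < norm x} x \<partial>lborel) \<le> ennreal (1 / (4 * M)) * energy \<phi>"
    using hardy_integral_near_rim[OF \<tau>] by blast
  obtain C where C: "C > 0"
    "\<And>\<phi>. \<phi> \<in> test_functions \<Omega> \<Longrightarrow>
       (\<integral>\<^sup>+x. ennreal (\<bar>\<phi> x\<bar> ^ DIM('a) * hardy_weight R x) * indicator {x. \<epsilon> \<le> norm x \<and> norm x \<le> r1} x \<partial>lborel)
       \<le> ennreal C * (\<integral>\<^sup>+x. ennreal (norm (gradient \<phi> x - hardy_field R \<phi> x) ^ DIM('a)) \<partial>lborel)"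
    using hardy_integral_middle_le[OF \<epsilon>(1) r1(1,2)] by blast
  define \<delta> where "\<delta> = min 1 (1 / (2 * C * 2 ^ (N - 1)))"
  have \<delta>: "\<delta> > 0" "\<delta> \<le> 1" "\<delta> \<le> 1 / (2 * C * 2 ^ (N - 1))" using C by (auto simp: \<delta>_def)
  show ?thesis
  proof (rule that[OF \<delta>(1)])
    fix \<phi> assume \<phi>: "\<phi> \<in> test_functions \<Omega>" and mass: "hardy_mass R \<phi> = 1"
    have "ennreal (c + \<delta>) \<le> energy \<phi>"
    proof (cases "energy \<phi> \<le> ennreal M")
      case False
      then have "ennreal M \<le> energy \<phi>" by simp
      moreover have "ennreal (c + \<delta>) \<le> ennreal M" using \<delta> by (intro ennreal_leI) (simp add: M_def)
      ultimately show ?thesis by (rule order_trans[rotated])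
    next
      case True
      then obtain en where en: "en \<ge> 0" "energy \<phi> = ennreal en" "en \<le> M"
        using M by (cases "energy \<phi>" rule: ennreal_cases) (auto simp: top_unique)
      define rm where "rm = (\<integral>\<^sup>+x. ennreal (norm (gradient \<phi> x - hardy_field R \<phi> x) ^ DIM('a)) \<partial>lborel)"
      have H: "ennreal c + ennreal (1 / 2 ^ (N - 1)) * rm \<le> ennreal en"
        using hardy_remainder[OF \<phi>] mass en(2) by (simp add: hardy_mass_def rm_def c_def N_def)
      then have "ennreal (1 / 2 ^ (N - 1)) * rm \<noteq> top" by (auto simp: top_unique)
      then have "rm \<noteq> top" by (auto simp: ennreal_mult_eq_top_iff)
      then obtain t where t: "t \<ge> 0" "rm = ennreal t" by (cases rm rule: ennreal_cases) auto
      have H': "c + 1 / 2 ^ (N - 1) * t \<le> en"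
        using H c t en by (simp add: ennreal_mult[symmetric] ennreal_plus[symmetric] del: ennreal_plus)
      have tail: "ennreal (1 / (4 * M)) * energy \<phi> \<le> ennreal (1 / 4)"
        using en M by (simp add: ennreal_mult[symmetric])
      have "hardy_mass R \<phi> \<le> ennreal (1 / 4) + ennreal C * rm + ennreal (1 / 4)"
        unfolding rm_def
        by (rule order_trans[OF hardy_mass_split_le[OF \<phi>, of \<epsilon> r1]])
           (intro add_mono order_trans[OF \<epsilon>(3)[OF \<phi>] tail] order_trans[OF r1(3)[OF \<phi>] tail] C(2)[OF \<phi>])
      also have "\<dots> = ennreal (1 / 4 + C * t + 1 / 4)"
        using C(1) t by (simp add: ennreal_mult[symmetric] ennreal_plus[symmetric] del: ennreal_plus)
      finally have "ennreal 1 \<le> ennreal (1 / 4 + C * t + 1 / 4)" unfolding mass by (simp only: ennreal_1)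
      then have "1 \<le> 1 / 4 + C * t + 1 / 4" by (rule ennreal_le_iff[THEN iffD1, rotated]) (use C(1) t in auto)
      then have "1 / 2 \<le> C * t" by simp
      then have "1 / (2 * C) \<le> t" using C(1) by (simp add: field_simps)
      then have "1 / 2 ^ (N - 1) * (1 / (2 * C)) \<le> 1 / 2 ^ (N - 1) * t" by (intro mult_left_mono) auto
      then have "\<delta> \<le> 1 / 2 ^ (N - 1) * t" using \<delta>(3) by (simp add: mult.commute)
      then show ?thesis using H' en by (simp add: ennreal_leI)
    qed
    then show "ennreal (((real DIM('a) - 1) / real DIM('a)) ^ DIM('a) + \<delta>) \<le> energy \<phi>" by (simp add: c_def N_def)
  qed
qed

end

section \<open>Minimising sequences\<close>

context thin_domain
begin

lemma energy_diff_le: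
  assumes \<phi>: "\<phi> \<in> test_functions \<Omega>" "\<psi> \<in> test_functions \<Omega>"
    and E: "energy \<phi> \<le> ennreal M" "energy \<psi> \<le> ennreal M" and M: "M \<ge> 0"
  shows "energy (\<lambda>x. \<phi> x - \<psi> x) \<le> ennreal (2 ^ DIM('a) * M)"
proof -
  define D where "D = (2::real) ^ (DIM('a) - 1)"
  have D: "D \<ge> 0" by (simp add: D_def)
  have n: "DIM('a) \<ge> 1" using dim2 by simp
  note [measurable] = test_measurable[OF \<phi>(1)] test_measurable[OF \<phi>(2)]
  note sm = test_functions_smooth[OF \<phi>(1)] test_functions_smooth[OF \<phi>(2)]
  have "energy (\<lambda>x. \<phi> x - \<psi> x) \<le> (\<integral>\<^sup>+x. ennreal D * (ennreal (norm (gradient \<phi> x) ^ DIM('a)) + ennreal (norm (gradient \<psi> x) ^ DIM('a))) \<partial>lborel)"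
    unfolding energy_def
  proof (rule nn_integral_mono)
    fix x
    have "norm (gradient \<phi> x - gradient \<psi> x) ^ DIM('a) \<le> D * (norm (gradient \<phi> x) ^ DIM('a) + norm (gradient \<psi> x) ^ DIM('a))"
      using norm_power_split_half[OF n, of "gradient \<phi> x - gradient \<psi> x" "gradient \<phi> x"] by (simp add: D_def)
    then show "ennreal (norm (gradient (\<lambda>x. \<phi> x - \<psi> x) x) ^ DIM('a)) \<le> ennreal D * (ennreal (norm (gradient \<phi> x) ^ DIM('a)) + ennreal (norm (gradient \<psi> x) ^ DIM('a)))"
      unfolding gradient_diff[OF sm]
      using D by (simp add: ennreal_mult[symmetric] ennreal_plus[symmetric] ennreal_leI del: ennreal_plus)
  qed
  also have "\<dots> = ennreal D * (energy \<phi> + energy \<psi>)"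
    unfolding energy_def by (subst nn_integral_cmult, measurable, subst nn_integral_add, measurable)
  also have "\<dots> \<le> ennreal D * (ennreal M + ennreal M)" by (intro mult_left_mono add_mono E) auto
  also have "\<dots> = ennreal (D * (M + M))" using D M by (simp add: ennreal_mult[symmetric] ennreal_plus[symmetric] del: ennreal_plus)
  also have "D * (M + M) = 2 ^ DIM('a) * M"
  proof -
    have "(2::real) ^ DIM('a) = D * 2" unfolding D_def using n by (metis Suc_diff_1 less_le_trans power_Suc2 zero_less_one)
    then show ?thesis by simp
  qed
  finally show ?thesis .
qed

text \<open>Compactness of the embedding into the weighted space: the ends are uniformly small, and in the
  middle the weight is bounded and Rellich's theorem applies.\<close>

lemma hardy_mass_compact:
  assumes \<phi>: "\<And>k. \<phi> k \<in> test_functions \<Omega>" and E: "\<And>k. energy (\<phi> k) \<le> ennreal M" and M: "M \<ge> 0"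
  obtains s :: "nat \<Rightarrow> nat" where "strict_mono s"
    "\<And>e. e > 0 \<Longrightarrow> \<exists>K. \<forall>j\<ge>K. \<forall>k\<ge>K. hardy_mass R (\<lambda>x. \<phi> (s j) x - \<phi> (s k) x) \<le> ennreal e"
proof -
  define N where "N = DIM('a)"
  have N: "N \<ge> 1" using dim2 by (simp add: N_def)
  have z: "\<phi> k x = 0" if "norm x > R" for k x using test_zero[OF \<phi>[of k], of x] that by simp
  obtain s :: "nat \<Rightarrow> nat" where s: "strict_mono s"
    "\<And>e. e > 0 \<Longrightarrow> \<exists>K. \<forall>j\<ge>K. \<forall>k\<ge>K. (\<integral>\<^sup>+x. ennreal (\<bar>\<phi> (s j) x - \<phi> (s k) x\<bar> ^ N) \<partial>lborel) \<le> ennreal e"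
    using rellich[of \<phi> R N M, OF test_functions_smooth[OF \<phi>] z R N M E[unfolded energy_def, folded N_def]] by blast
  show ?thesis
  proof (rule that[OF s(1)])
    fix e :: real assume e: "e > 0"
    define M2 where "M2 = 2 ^ N * M + 1"
    have M2: "M2 > 0" using M by (simp add: M2_def add_nonneg_pos)
    have \<tau>: "e / (3 * M2) > 0" using e M2 by simp
    obtain \<epsilon> where \<epsilon>: "\<epsilon> > 0" "\<epsilon> < R"
      "\<And>\<phi>. \<phi> \<in> test_functions \<Omega> \<Longrightarrow>
         (\<integral>\<^sup>+x. ennreal (\<bar>\<phi> x\<bar> ^ DIM('a) * hardy_weight R x) * indicator (ball 0 \<epsilon>) x \<partial>lborel) \<le> ennreal (e / (3 * M2)) * energy \<phi>"
      using hardy_integral_near_origin[OF \<tau>] by blast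
    obtain r1 where r1: "0 < r1" "r1 < R"
      "\<And>\<phi>. \<phi> \<in> test_functions \<Omega> \<Longrightarrow>
         (\<integral>\<^sup>+x. ennreal (\<bar>\<phi> x\<bar> ^ DIM('a) * hardy_weight R x) * indicator {x. r1 < norm x} x \<partial>lborel) \<le> ennreal (e / (3 * M2)) * energy \<phi>"
      using hardy_integral_near_rim[OF \<tau>] by blast
    define L1 where "L1 = ln (R / r1)"
    have L1: "L1 > 0" unfolding L1_def using r1 by (intro ln_gt_zero) simp
    define V where "V = 1 / (\<epsilon> ^ N * L1 ^ N)"
    have V: "V > 0" using \<epsilon> L1 by (simp add: V_def)
    obtain K where K: "\<And>j k. j \<ge> K \<Longrightarrow> k \<ge> K \<Longrightarrow> (\<integral>\<^sup>+x. ennreal (\<bar>\<phi> (s j) x - \<phi> (s k) x\<bar> ^ N) \<partial>lborel) \<le> ennreal (e / (3 * V))"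
      using s(2)[of "e / (3 * V)"] e V by auto
    show "\<exists>K. \<forall>j\<ge>K. \<forall>k\<ge>K. hardy_mass R (\<lambda>x. \<phi> (s j) x - \<phi> (s k) x) \<le> ennreal e"
    proof (intro exI allI impI)
      fix j k assume jk: "j \<ge> K" "k \<ge> K"
      define f where "f x = \<phi> (s j) x - \<phi> (s k) x" for x
      have f: "f \<in> test_functions \<Omega>" unfolding f_def[abs_def] by (intro test_functions_diff \<phi>)
      note [measurable] = test_measurable[OF f]
      have "energy f \<le> ennreal M2"
        unfolding f_def[abs_def] by (rule order_trans[OF energy_diff_le[OF \<phi> \<phi> E E M]]) (auto simp: M2_def N_def intro!: ennreal_leI)
      then have "ennreal (e / (3 * M2)) * energy f \<le> ennreal (e / (3 * M2)) * ennreal M2" by (intro mult_left_mono) auto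
      also have "\<dots> = ennreal (e / 3)" using e M2 by (simp add: ennreal_mult[symmetric])
      finally have tail: "ennreal (e / (3 * M2)) * energy f \<le> ennreal (e / 3)" .
      have "(\<integral>\<^sup>+x. ennreal (\<bar>f x\<bar> ^ N * hardy_weight R x) * indicator {x. \<epsilon> \<le> norm x \<and> norm x \<le> r1} x \<partial>lborel)
        \<le> (\<integral>\<^sup>+x. ennreal V * ennreal (\<bar>f x\<bar> ^ N) \<partial>lborel)"
      proof (rule nn_integral_mono)
        fix x
        show "ennreal (\<bar>f x\<bar> ^ N * hardy_weight R x) * indicator {x. \<epsilon> \<le> norm x \<and> norm x \<le> r1} x \<le> ennreal V * ennreal (\<bar>f x\<bar> ^ N)"
        proof (cases "\<epsilon> \<le> norm x \<and> norm x \<le> r1")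
          case True
          then have x: "0 < norm x" using \<epsilon> by linarith
          have "R / r1 \<le> R / norm x" using True x R r1 by (intro divide_left_mono) auto
          then have "L1 \<le> ln (R / norm x)" unfolding L1_def using r1 R by (intro ln_mono) auto
          moreover from this have "0 < ln (R / norm x)" using L1 by linarith
          ultimately have "hardy_weight R x \<le> V"
            unfolding hardy_weight_def V_def N_def[symmetric]
            using True \<epsilon>(1) L1 x by (intro divide_left_mono mult_mono power_mono mult_pos_pos) auto
          then have "ennreal (\<bar>f x\<bar> ^ N * hardy_weight R x) \<le> ennreal (V * \<bar>f x\<bar> ^ N)"
            by (intro ennreal_leI) (simp add: mult.commute mult_right_mono)
          then show ?thesis using True V by (simp add: ennreal_mult)
        qed auto
      qed
      also have "\<dots> = ennreal V * (\<integral>\<^sup>+x. ennreal (\<bar>f x\<bar> ^ N) \<partial>lborel)" by (intro nn_integral_cmult) measurable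
      also have "\<dots> \<le> ennreal V * ennreal (e / (3 * V))" unfolding f_def by (intro mult_left_mono K jk) auto
      also have "\<dots> = ennreal (e / 3)" using e V by (simp add: ennreal_mult[symmetric])
      finally have mid: "(\<integral>\<^sup>+x. ennreal (\<bar>f x\<bar> ^ N * hardy_weight R x) * indicator {x. \<epsilon> \<le> norm x \<and> norm x \<le> r1} x \<partial>lborel) \<le> ennreal (e / 3)" .
      note mid' = mid[unfolded N_def]
      have "hardy_mass R f \<le> ennreal (e / 3) + ennreal (e / 3) + ennreal (e / 3)"
        by (rule order_trans[OF hardy_mass_split_le[OF f, of \<epsilon> r1] add_mono[OF add_mono[OF order_trans[OF \<epsilon>(3)[OF f] tail] mid'] order_trans[OF r1(3)[OF f] tail]]])
      also have "\<dots> = ennreal e" using e by (simp add: ennreal_plus[symmetric] del: ennreal_plus)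
      finally show "hardy_mass R (\<lambda>x. \<phi> (s j) x - \<phi> (s k) x) \<le> ennreal e" by (simp add: f_def[abs_def])
    qed
  qed
qed

end

section \<open>Weak gradients of limits of test functions\<close>

text \<open>Fatou's lemma along a subsequence that converges almost everywhere.\<close>

lemma Lp_limit_integral_le:
  fixes f :: "nat \<Rightarrow> 'x \<Rightarrow> 'b::euclidean_space"
  assumes [measurable]: "\<And>k. f k \<in> borel_measurable M" "g \<in> borel_measurable M" "w \<in> borel_measurable M"
    and n: "n \<ge> 1"
    and lim: "(\<lambda>k. \<integral>\<^sup>+x. ennreal (norm (f k x - g x) ^ n) \<partial>M) \<longlonglongrightarrow> 0"
    and le: "\<And>k. (\<integral>\<^sup>+x. ennreal (norm (f k x) ^ n * w x) \<partial>M) \<le> B k" and B: "B \<longlonglongrightarrow> b"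
  shows "(\<integral>\<^sup>+x. ennreal (norm (g x) ^ n * w x) \<partial>M) \<le> b"
proof -
  obtain s where s: "strict_mono (s :: nat \<Rightarrow> nat)" and ae: "AE x in M. (\<lambda>k. f (s k) x) \<longlonglongrightarrow> g x"
    using AE_convergent_subseq_of_Lp_limit[OF assms(1,2) n lim] by blast
  have "(\<integral>\<^sup>+x. ennreal (norm (g x) ^ n * w x) \<partial>M) = (\<integral>\<^sup>+x. liminf (\<lambda>k. ennreal (norm (f (s k) x) ^ n * w x)) \<partial>M)"
  proof (rule nn_integral_cong_AE, rule AE_mp[OF ae], intro AE_I2 impI)
    fix x assume "(\<lambda>k. f (s k) x) \<longlonglongrightarrow> g x"
    then have "(\<lambda>k. ennreal (norm (f (s k) x) ^ n * w x)) \<longlonglongrightarrow> ennreal (norm (g x) ^ n * w x)"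
      by (intro tendsto_intros)
    from lim_imp_Liminf[OF trivial_limit_sequentially this]
    show "ennreal (norm (g x) ^ n * w x) = liminf (\<lambda>k. ennreal (norm (f (s k) x) ^ n * w x))" by simp
  qed
  also have "\<dots> \<le> liminf (\<lambda>k. \<integral>\<^sup>+x. ennreal (norm (f (s k) x) ^ n * w x) \<partial>M)"
    by (intro nn_integral_liminf) measurable
  also have "\<dots> \<le> liminf (\<lambda>k. B (s k))" by (intro Liminf_mono always_eventually allI le)
  also have "\<dots> = b"
    using LIMSEQ_subseq_LIMSEQ[OF B s] by (intro lim_imp_Liminf) (auto simp: o_def)
  finally show ?thesis .
qed

lemma nn_integral_power_split:
  fixes f g :: "'x \<Rightarrow> 'b::euclidean_space"
  assumes [measurable]: "f \<in> borel_measurable M" "g \<in> borel_measurable M" "w \<in> borel_measurable M"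
    and w: "\<And>x. x \<in> space M \<Longrightarrow> w x \<ge> 0" and t: "0 < t" "t < 1" and n: "n \<ge> 1"
  shows "(\<integral>\<^sup>+x. ennreal (norm (f x) ^ n * w x) \<partial>M) \<le>
    ennreal (1 / t ^ (n - 1)) * (\<integral>\<^sup>+x. ennreal (norm (g x) ^ n * w x) \<partial>M) +
    ennreal (1 / (1 - t) ^ (n - 1)) * (\<integral>\<^sup>+x. ennreal (norm (f x - g x) ^ n * w x) \<partial>M)"
proof -
  have "(\<integral>\<^sup>+x. ennreal (norm (f x) ^ n * w x) \<partial>M) \<le>
    (\<integral>\<^sup>+x. ennreal (1 / t ^ (n - 1)) * ennreal (norm (g x) ^ n * w x) + ennreal (1 / (1 - t) ^ (n - 1)) * ennreal (norm (f x - g x) ^ n * w x) \<partial>M)"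
  proof (rule nn_integral_mono)
    fix x assume x: "x \<in> space M"
    have "norm (f x) ^ n * w x \<le> (norm (g x) ^ n / t ^ (n - 1) + norm (f x - g x) ^ n / (1 - t) ^ (n - 1)) * w x"
      using w[OF x] by (intro mult_right_mono norm_power_split t n)
    also have "\<dots> = 1 / t ^ (n - 1) * (norm (g x) ^ n * w x) + 1 / (1 - t) ^ (n - 1) * (norm (f x - g x) ^ n * w x)"
      by (simp add: algebra_simps)
    finally have le: "norm (f x) ^ n * w x \<le> 1 / t ^ (n - 1) * (norm (g x) ^ n * w x) + 1 / (1 - t) ^ (n - 1) * (norm (f x - g x) ^ n * w x)" .
    show "ennreal (norm (f x) ^ n * w x) \<le> ennreal (1 / t ^ (n - 1)) * ennreal (norm (g x) ^ n * w x) + ennreal (1 / (1 - t) ^ (n - 1)) * ennreal (norm (f x - g x) ^ n * w x)"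
    proof -
      have e: "ennreal (1 / t ^ (n - 1)) * ennreal (norm (g x) ^ n * w x) = ennreal (1 / t ^ (n - 1) * (norm (g x) ^ n * w x))"
        "ennreal (1 / (1 - t) ^ (n - 1)) * ennreal (norm (f x - g x) ^ n * w x) = ennreal (1 / (1 - t) ^ (n - 1) * (norm (f x - g x) ^ n * w x))"
        using t w[OF x] by (intro ennreal_mult[symmetric]; simp)+
      have p: "0 \<le> 1 / t ^ (n - 1) * (norm (g x) ^ n * w x)" "0 \<le> 1 / (1 - t) ^ (n - 1) * (norm (f x - g x) ^ n * w x)"
        using t w[OF x] by auto
      show ?thesis unfolding e ennreal_plus[OF p, symmetric] using le by (rule ennreal_leI)
    qed
  qed
  then show ?thesis
    by (subst (asm) nn_integral_add, measurable, subst (asm) nn_integral_cmult, measurable, subst (asm) nn_integral_cmult, measurable)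
qed

lemma nn_integral_lebesgue_on:
  assumes op: "open \<Omega>" and [measurable]: "f \<in> borel_measurable borel"
  shows "(\<integral>\<^sup>+x. f x \<partial>lebesgue_on \<Omega>) = (\<integral>\<^sup>+x. f x * indicator \<Omega> x \<partial>lborel)"
proof -
  have [measurable]: "\<Omega> \<in> sets borel" using op by auto
  have "(\<integral>\<^sup>+x. f x \<partial>lebesgue_on \<Omega>) = (\<integral>\<^sup>+x. f x * indicator \<Omega> x \<partial>lebesgue)"
    by (rule nn_integral_restrict_space) auto
  also have "\<dots> = (\<integral>\<^sup>+x. f x * indicator \<Omega> x \<partial>lborel)"
    by (rule nn_integral_completion) measurable
  finally show ?thesis .
qed

lemma nn_integral_lebesgue_on_eq:
  assumes "open \<Omega>" "f \<in> borel_measurable borel" "\<And>x. x \<notin> \<Omega> \<Longrightarrow> f x = 0"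
  shows "(\<integral>\<^sup>+x. f x \<partial>lebesgue_on \<Omega>) = (\<integral>\<^sup>+x. f x \<partial>lborel)"
  unfolding nn_integral_lebesgue_on[OF assms(1,2)] by (intro nn_integral_cong) (use assms(3) in \<open>auto simp: indicator_def\<close>)

lemma borel_measurable_lebesgue_on:
  "f \<in> borel_measurable borel \<Longrightarrow> f \<in> borel_measurable (lebesgue_on S)"
  by (intro measurable_restrict_space1 measurable_completion) simp

lemma integral_lebesgue_on_eq:
  fixes f :: "'a::euclidean_space \<Rightarrow> 'b::euclidean_space"
  assumes op: "open \<Omega>" and [measurable]: "f \<in> borel_measurable borel" and z: "\<And>x. x \<notin> \<Omega> \<Longrightarrow> f x = 0"
  shows "(\<integral>x. f x \<partial>lebesgue_on \<Omega>) = (\<integral>x. f x \<partial>lborel)"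
proof -
  have "(\<integral>x. f x \<partial>lebesgue_on \<Omega>) = (\<integral>x. indicator \<Omega> x *\<^sub>R f x \<partial>lebesgue)"
    using op by (subst integral_restrict_space) auto
  also have "\<dots> = (\<integral>x. f x \<partial>lebesgue)" using z by (intro Bochner_Integration.integral_cong) (auto simp: indicator_def)
  also have "\<dots> = (\<integral>x. f x \<partial>lborel)" by (rule integral_completion) simp
  finally show ?thesis .
qed

lemma finite_measure_lebesgue_on_bounded:
  assumes "open \<Omega>" "bounded (\<Omega> :: 'a::euclidean_space set)"
  shows "finite_measure (lebesgue_on \<Omega>)"
proof
  have "emeasure lebesgue \<Omega> = emeasure lborel \<Omega>" using assms(1) by simp
  also have "\<dots> < \<infinity>" using assms(2) by (rule emeasure_bounded_finite)
  finally show "emeasure (lebesgue_on \<Omega>) (space (lebesgue_on \<Omega>)) \<noteq> \<infinity>"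
    using assms(1) by (simp add: emeasure_restrict_space space_restrict_space)
qed

lemma norm_le_power_bound:
  fixes a \<tau> :: real
  assumes "a \<ge> 0" "\<tau> > 0" "n \<ge> 1"
  shows "a \<le> \<tau> + a ^ n / \<tau> ^ (n - 1)"
proof (cases "a \<le> \<tau>")
  case True then show ?thesis using assms by (simp add: add_increasing2)
next
  case False
  then have "\<tau> ^ (n - 1) \<le> a ^ (n - 1)" using assms by (intro power_mono) auto
  then have "a * \<tau> ^ (n - 1) \<le> a * a ^ (n - 1)" using assms by (intro mult_left_mono) auto
  also have "\<dots> = a ^ n" using assms(3) by (cases n) auto
  finally have "a \<le> a ^ n / \<tau> ^ (n - 1)" using assms(2) by (simp add: pos_le_divide_eq)
  then show ?thesis using assms by simp
qed

lemma (in finite_measure) Lp_convergence_imp_integral: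
  fixes f :: "nat \<Rightarrow> 'a \<Rightarrow> 'b::euclidean_space"
  assumes [measurable]: "\<And>k. f k \<in> borel_measurable M" "g \<in> borel_measurable M" and n: "n \<ge> 1"
    and lim: "(\<lambda>k. \<integral>\<^sup>+x. ennreal (norm (f k x - g x) ^ n) \<partial>M) \<longlonglongrightarrow> 0"
  shows "(\<lambda>k. \<integral>\<^sup>+x. ennreal (norm (f k x - g x)) \<partial>M) \<longlonglongrightarrow> 0"
proof (rule order_tendstoI)
  fix a :: ennreal assume a: "0 < a"
  obtain b where b: "0 < b" "ennreal b < a"
    using a by (metis dense ennreal_0 ennreal_less_iff ennreal_cases neq_top_trans less_imp_le order_refl top.not_eq_extremum)
  define V where "V = measure M (space M)"
  have V: "V \<ge> 0" "emeasure M (space M) = ennreal V" by (auto simp: V_def emeasure_eq_measure)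
  define \<tau> where "\<tau> = b / (2 * (V + 1))"
  have \<tau>: "\<tau> > 0" "\<tau> * V \<le> b / 2" using b V by (auto simp: \<tau>_def field_simps)
  define c where "c = 1 / \<tau> ^ (n - 1)"
  have c: "c > 0" using \<tau> by (simp add: c_def)
  have "eventually (\<lambda>k. (\<integral>\<^sup>+x. ennreal (norm (f k x - g x) ^ n) \<partial>M) < ennreal (b / (2 * c))) sequentially"
    by (rule order_tendstoD(2)[OF lim]) (use b c in auto)
  then show "eventually (\<lambda>k. (\<integral>\<^sup>+x. ennreal (norm (f k x - g x)) \<partial>M) < a) sequentially"
  proof eventually_elim
    case (elim k)
    have "(\<integral>\<^sup>+x. ennreal (norm (f k x - g x)) \<partial>M) \<le> (\<integral>\<^sup>+x. ennreal \<tau> + ennreal c * ennreal (norm (f k x - g x) ^ n) \<partial>M)"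
    proof (rule nn_integral_mono)
      fix x
      have "norm (f k x - g x) \<le> \<tau> + c * norm (f k x - g x) ^ n"
        using norm_le_power_bound[OF norm_ge_zero \<tau>(1) n, of "f k x - g x"] by (simp add: c_def)
      then show "ennreal (norm (f k x - g x)) \<le> ennreal \<tau> + ennreal c * ennreal (norm (f k x - g x) ^ n)"
        using \<tau> c by (simp add: ennreal_mult[symmetric] ennreal_plus[symmetric] ennreal_leI del: ennreal_plus)
    qed
    also have "\<dots> = ennreal \<tau> * ennreal V + ennreal c * (\<integral>\<^sup>+x. ennreal (norm (f k x - g x) ^ n) \<partial>M)"
      by (subst nn_integral_add, simp, measurable, subst nn_integral_cmult, measurable) (simp add: V)
    also have "\<dots> \<le> ennreal \<tau> * ennreal V + ennreal c * ennreal (b / (2 * c))"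
      using elim by (intro add_left_mono mult_left_mono) auto
    also have "\<dots> = ennreal (\<tau> * V + c * (b / (2 * c)))"
      using \<tau> c b V by (simp add: ennreal_mult[symmetric] ennreal_plus[symmetric] del: ennreal_plus)
    also have "\<dots> \<le> ennreal b" using \<tau> c by (intro ennreal_leI) simp
    finally show ?case using b(2) by (rule le_less_trans)
  qed
qed auto

lemma integral_limit_against_bounded:
  fixes f :: "nat \<Rightarrow> 'x \<Rightarrow> 'b::euclidean_space" and H :: "'x \<Rightarrow> 'b \<Rightarrow> 'c::euclidean_space"
  assumes fm [measurable]: "\<And>k. f k \<in> borel_measurable M" "g \<in> borel_measurable M"
    and lim: "(\<lambda>k. \<integral>\<^sup>+x. ennreal (norm (f k x - g x)) \<partial>M) \<longlonglongrightarrow> 0"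
    and fi: "\<And>k. integrable M (\<lambda>x. H x (f k x))" and gi: "integrable M (\<lambda>x. H x (g x))"
    and B: "B \<ge> 0" "\<And>x y z. norm (H x y - H x z) \<le> B * norm (y - z)"
  shows "(\<lambda>k. \<integral>x. H x (f k x) \<partial>M) \<longlonglongrightarrow> (\<integral>x. H x (g x) \<partial>M)"
proof (rule tendstoI)
  fix e :: real assume e: "e > 0"
  have "eventually (\<lambda>k. (\<integral>\<^sup>+x. ennreal (norm (f k x - g x)) \<partial>M) < ennreal (e / (B + 1))) sequentially"
    by (rule order_tendstoD(2)[OF lim]) (use e B in auto)
  then show "eventually (\<lambda>k. dist (\<integral>x. H x (f k x) \<partial>M) (\<integral>x. H x (g x) \<partial>M) < e) sequentially"
  proof eventually_elim
    case (elim k)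
    have "ennreal (norm (\<integral>x. H x (f k x) - H x (g x) \<partial>M)) \<le> (\<integral>\<^sup>+x. norm (H x (f k x) - H x (g x)) \<partial>M)"
      by (intro integral_norm_bound_ennreal Bochner_Integration.integrable_diff fi gi)
    also have "\<dots> \<le> (\<integral>\<^sup>+x. ennreal B * ennreal (norm (f k x - g x)) \<partial>M)"
      using B by (intro nn_integral_mono) (simp add: ennreal_mult[symmetric] ennreal_leI)
    also have "\<dots> = ennreal B * (\<integral>\<^sup>+x. ennreal (norm (f k x - g x)) \<partial>M)" by (intro nn_integral_cmult) measurable
    also have "\<dots> \<le> ennreal B * ennreal (e / (B + 1))" using elim by (intro mult_left_mono) auto
    also have "\<dots> = ennreal (B * (e / (B + 1)))" using B e by (simp add: ennreal_mult[symmetric])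
    finally have "norm (\<integral>x. H x (f k x) - H x (g x) \<partial>M) \<le> B * (e / (B + 1))"
      using B e by (subst (asm) ennreal_le_iff) auto
    also have "\<dots> < e" using B e by (simp add: field_simps)
    finally show ?case using Bochner_Integration.integral_diff[OF fi[of k] gi] by (simp add: dist_norm)
  qed
qed

lemma Lp_imp_integrable:
  fixes f :: "'a::euclidean_space \<Rightarrow> 'b::euclidean_space"
  assumes op: "open \<Omega>" "bounded \<Omega>" and f: "f \<in> Lp n \<Omega>" and n: "n \<ge> 1"
  shows "integrable (lebesgue_on \<Omega>) f"
proof -
  interpret finite_measure "lebesgue_on \<Omega>" by (rule finite_measure_lebesgue_on_bounded[OF op])
  have [measurable]: "f \<in> borel_measurable (lebesgue_on \<Omega>)" and fin: "Lp_integral n \<Omega> f < \<infinity>" using f by (auto simp: Lp_def)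
  have "(\<integral>\<^sup>+x. ennreal (norm (f x)) \<partial>lebesgue_on \<Omega>) \<le> (\<integral>\<^sup>+x. 1 + ennreal (norm (f x) ^ n) \<partial>lebesgue_on \<Omega>)"
  proof (rule nn_integral_mono)
    fix x
    have "norm (f x) \<le> 1 + norm (f x) ^ n" using norm_le_power_bound[OF norm_ge_zero, of 1 n "f x"] n by simp
    then have "ennreal (norm (f x)) \<le> ennreal (1 + norm (f x) ^ n)" by (rule ennreal_leI)
    then show "ennreal (norm (f x)) \<le> 1 + ennreal (norm (f x) ^ n)" by simp
  qed
  also have "\<dots> = emeasure (lebesgue_on \<Omega>) (space (lebesgue_on \<Omega>)) + Lp_integral n \<Omega> f"
    unfolding Lp_integral_def by (subst nn_integral_add) auto
  also have "\<dots> < \<infinity>" using fin by (simp add: less_top[symmetric])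
  finally show ?thesis by (intro integrableI_bounded) auto
qed

lemma integrable_lebesgue_on_imp_absolutely:
  fixes f :: "'a::euclidean_space \<Rightarrow> 'b::euclidean_space"
  assumes op: "open \<Omega>" and f: "integrable (lebesgue_on \<Omega>) f" and K: "compact K" "K \<subseteq> \<Omega>"
  shows "f absolutely_integrable_on K"
proof -
  have "set_integrable lebesgue \<Omega> f"
    using f op by (simp add: integrable_restrict_space set_integrable_def)
  then show ?thesis by (rule set_integrable_subset) (use K in \<open>auto simp: compact_imp_closed\<close>)
qed

text \<open>Integration by parts holds for the test functions \<open>\<phi> k\<close>, and both sides pass to the limit. Since \<open>\<Omega>\<close> has
  finite measure, convergence in \<open>L\<^sup>n\<close> implies convergence in \<open>L\<^sup>1\<close>.\<close>

lemma weak_gradient_of_limit: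
  fixes \<phi> :: "nat \<Rightarrow> 'a::euclidean_space \<Rightarrow> real"
  assumes op: "open \<Omega>" "bounded \<Omega>" and \<phi>: "\<And>k. \<phi> k \<in> test_functions \<Omega>" and n: "n \<ge> 1"
    and u: "u \<in> Lp n \<Omega>" and g: "g \<in> Lp n \<Omega>"
    and limu: "(\<lambda>k. Lp_integral n \<Omega> (\<lambda>x. \<phi> k x - u x)) \<longlonglongrightarrow> 0"
    and limg: "(\<lambda>k. Lp_integral n \<Omega> (\<lambda>x. gradient (\<phi> k) x - g x)) \<longlonglongrightarrow> 0"
  shows "has_weak_gradient \<Omega> u g"
proof -
  interpret finite_measure "lebesgue_on \<Omega>" by (rule finite_measure_lebesgue_on_bounded[OF op])
  note sm = test_functions_smooth[OF \<phi>]
  have \<phi>m: "\<phi> k \<in> borel_measurable borel" "gradient (\<phi> k) \<in> borel_measurable borel" for k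
    by (auto intro!: borel_measurable_continuous_onI smooth_continuous smooth_continuous_gradient sm)
  have um: "u \<in> borel_measurable (lebesgue_on \<Omega>)" and gm: "g \<in> borel_measurable (lebesgue_on \<Omega>)" using u g by (auto simp: Lp_def)
  have ui: "integrable (lebesgue_on \<Omega>) u" and gi: "integrable (lebesgue_on \<Omega>) g"
    using Lp_imp_integrable[OF op _ n] u g by auto
  have lu: "(\<lambda>k. \<integral>\<^sup>+x. ennreal (norm (\<phi> k x - u x)) \<partial>lebesgue_on \<Omega>) \<longlonglongrightarrow> 0"
    using limu unfolding Lp_integral_def by (intro Lp_convergence_imp_integral[OF _ um n] borel_measurable_lebesgue_on \<phi>m)
  have lg: "(\<lambda>k. \<integral>\<^sup>+x. ennreal (norm (gradient (\<phi> k) x - g x)) \<partial>lebesgue_on \<Omega>) \<longlonglongrightarrow> 0"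
    using limg unfolding Lp_integral_def by (intro Lp_convergence_imp_integral[OF _ gm n] borel_measurable_lebesgue_on \<phi>m)
  have lb: "integrable (lebesgue_on \<Omega>) f" if f: "continuous_on UNIV f" "compact K" "\<And>x. x \<notin> K \<Longrightarrow> f x = 0" for f :: "'a \<Rightarrow> 'b::euclidean_space" and K
  proof -
    obtain B where "B > 0" "\<And>x. norm (f x) \<le> B" using continuous_support_bounded[OF f] by metis
    then show ?thesis
      by (intro integrable_const_bound[of _ B] borel_measurable_lebesgue_on borel_measurable_continuous_onI f(1)) auto
  qed
  show ?thesis
    unfolding has_weak_gradient_def
  proof (intro conjI allI impI ballI)
    fix K assume K: "compact K \<and> K \<subseteq> \<Omega>"
    show "u absolutely_integrable_on K" "g absolutely_integrable_on K"
      using K by (auto intro!: integrable_lebesgue_on_imp_absolutely[OF op(1)] ui gi)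
  next
    fix \<psi> assume \<psi>: "\<psi> \<in> test_functions \<Omega>"
    obtain K where K: "compact K" "K \<subseteq> \<Omega>" "\<And>x. x \<notin> K \<Longrightarrow> \<psi> x = 0" "\<And>x. x \<notin> K \<Longrightarrow> gradient \<psi> x = 0"
      using test_functions_supportE[OF \<psi>] by metis
    note s\<psi> = test_functions_smooth[OF \<psi>]
    have \<psi>m: "\<psi> \<in> borel_measurable borel" "gradient \<psi> \<in> borel_measurable borel"
      by (auto intro!: borel_measurable_continuous_onI smooth_continuous smooth_continuous_gradient s\<psi>)
    obtain B1 where B1: "B1 > 0" "\<And>x. norm (\<psi> x) \<le> B1"
      using continuous_support_bounded[OF smooth_continuous[OF s\<psi>] K(1,3)] by metis
    obtain B2 where B2: "B2 > 0" "\<And>x. norm (gradient \<psi> x) \<le> B2"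
      using continuous_support_bounded[OF smooth_continuous_gradient[OF s\<psi>] K(1,4)] by metis
    have l1: "(\<lambda>k. \<integral>x. \<phi> k x *\<^sub>R gradient \<psi> x \<partial>lebesgue_on \<Omega>) \<longlonglongrightarrow> (\<integral>x. u x *\<^sub>R gradient \<psi> x \<partial>lebesgue_on \<Omega>)"
    proof (rule integral_limit_against_bounded[where H = "\<lambda>x y. y *\<^sub>R gradient \<psi> x" and B = B2, OF _ um lu])
      show "integrable (lebesgue_on \<Omega>) (\<lambda>x. \<phi> k x *\<^sub>R gradient \<psi> x)" for k
        by (rule lb[OF _ K(1)]) (auto intro!: continuous_intros smooth_continuous smooth_continuous_gradient sm s\<psi> simp: K)
      show "integrable (lebesgue_on \<Omega>) (\<lambda>x. u x *\<^sub>R gradient \<psi> x)"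
      proof (rule Bochner_Integration.integrable_bound[OF integrable_mult_right[OF ui, of B2]])
        show "(\<lambda>x. u x *\<^sub>R gradient \<psi> x) \<in> borel_measurable (lebesgue_on \<Omega>)"
          by (intro borel_measurable_scaleR um borel_measurable_lebesgue_on \<psi>m)
        show "AE x in lebesgue_on \<Omega>. norm (u x *\<^sub>R gradient \<psi> x) \<le> norm (B2 * u x)"
        proof (rule AE_I2)
          fix x
          show "norm (u x *\<^sub>R gradient \<psi> x) \<le> norm (B2 * u x)"
            using mult_left_mono[OF B2(2)[of x] abs_ge_zero[of "u x"]] B2(1) by (simp add: abs_mult mult.commute)
        qed
      qed
      show "norm (y *\<^sub>R gradient \<psi> x - z *\<^sub>R gradient \<psi> x) \<le> B2 * norm (y - z)" for x :: 'a and y z :: real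
        using mult_left_mono[OF B2(2)[of x] abs_ge_zero[of "y - z"]] by (simp add: scaleR_diff_left[symmetric] mult.commute)
    qed (use B2 in \<open>auto intro: borel_measurable_lebesgue_on \<phi>m\<close>)
    have l2: "(\<lambda>k. \<integral>x. \<psi> x *\<^sub>R gradient (\<phi> k) x \<partial>lebesgue_on \<Omega>) \<longlonglongrightarrow> (\<integral>x. \<psi> x *\<^sub>R g x \<partial>lebesgue_on \<Omega>)"
    proof (rule integral_limit_against_bounded[where H = "\<lambda>x y. \<psi> x *\<^sub>R y" and B = B1, OF _ gm lg])
      show "integrable (lebesgue_on \<Omega>) (\<lambda>x. \<psi> x *\<^sub>R gradient (\<phi> k) x)" for k
        by (rule lb[OF _ K(1)]) (auto intro!: continuous_intros smooth_continuous smooth_continuous_gradient sm s\<psi> simp: K)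
      show "integrable (lebesgue_on \<Omega>) (\<lambda>x. \<psi> x *\<^sub>R g x)"
      proof (rule Bochner_Integration.integrable_bound[OF integrable_scaleR_right[OF gi, of B1]])
        show "(\<lambda>x. \<psi> x *\<^sub>R g x) \<in> borel_measurable (lebesgue_on \<Omega>)"
          by (intro borel_measurable_scaleR gm borel_measurable_lebesgue_on \<psi>m)
        show "AE x in lebesgue_on \<Omega>. norm (\<psi> x *\<^sub>R g x) \<le> norm (B1 *\<^sub>R g x)"
          using B1 by (intro AE_I2) (auto intro!: mult_right_mono)
      qed
      show "norm (\<psi> x *\<^sub>R y - \<psi> x *\<^sub>R z) \<le> B1 * norm (y - z)" for x y z :: 'a
        using B1(2)[of x] by (simp add: scaleR_diff_right[symmetric] mult_right_mono)
    qed (use B1 in \<open>auto intro: borel_measurable_lebesgue_on \<phi>m\<close>)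
    have "(\<integral>x. \<phi> k x *\<^sub>R gradient \<psi> x \<partial>lebesgue_on \<Omega>) = - (\<integral>x. \<psi> x *\<^sub>R gradient (\<phi> k) x \<partial>lebesgue_on \<Omega>)" for k
    proof -
      note z = test_functions_gradient_support[OF \<psi>]
      have "(\<integral>x. \<phi> k x *\<^sub>R gradient \<psi> x \<partial>lebesgue_on \<Omega>) = (\<integral>x. \<phi> k x *\<^sub>R gradient \<psi> x \<partial>lborel)"
        using z by (intro integral_lebesgue_on_eq op borel_measurable_scaleR \<phi>m \<psi>m) auto
      also have "\<dots> = - (\<integral>x. \<psi> x *\<^sub>R gradient (\<phi> k) x \<partial>lborel)" by (rule integral_by_parts_test[OF \<psi> \<phi>])
      also have "(\<integral>x. \<psi> x *\<^sub>R gradient (\<phi> k) x \<partial>lborel) = (\<integral>x. \<psi> x *\<^sub>R gradient (\<phi> k) x \<partial>lebesgue_on \<Omega>)"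
        using z by (intro integral_lebesgue_on_eq[symmetric] op borel_measurable_scaleR \<phi>m \<psi>m) auto
      finally show ?thesis .
    qed
    then have "(\<lambda>k. - (\<integral>x. \<psi> x *\<^sub>R gradient (\<phi> k) x \<partial>lebesgue_on \<Omega>)) \<longlonglongrightarrow> (\<integral>x. u x *\<^sub>R gradient \<psi> x \<partial>lebesgue_on \<Omega>)"
      using l1 by simp
    moreover have "(\<lambda>k. - (\<integral>x. \<psi> x *\<^sub>R gradient (\<phi> k) x \<partial>lebesgue_on \<Omega>)) \<longlonglongrightarrow> - (\<integral>x. \<psi> x *\<^sub>R g x \<partial>lebesgue_on \<Omega>)"
      by (rule tendsto_minus[OF l2])
    ultimately show "(\<integral>x. u x *\<^sub>R gradient \<psi> x \<partial>lebesgue_on \<Omega>) = - (\<integral>x. \<psi> x *\<^sub>R g x \<partial>lebesgue_on \<Omega>)"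
      by (rule LIMSEQ_unique)
  qed
qed

text \<open>The fundamental lemma, applied to each component of the difference.\<close>

lemma weak_gradient_unique:
  fixes u :: "'a::euclidean_space \<Rightarrow> real"
  assumes op: "open \<Omega>" and g: "has_weak_gradient \<Omega> u g" and g': "has_weak_gradient \<Omega> u g'"
  shows "AE x in lebesgue_on \<Omega>. g x = g' x"
proof -
  have loc: "g absolutely_integrable_on K" "g' absolutely_integrable_on K" if "compact K" "K \<subseteq> \<Omega>" for K
    using that g g' by (auto simp: has_weak_gradient_def)
  have tst: "integrable (lebesgue_on \<Omega>) (\<lambda>x. \<phi> x *\<^sub>R h x)"
    if \<phi>: "\<phi> \<in> test_functions \<Omega>" and h: "\<And>K. compact K \<Longrightarrow> K \<subseteq> \<Omega> \<Longrightarrow> h absolutely_integrable_on K" for \<phi> :: "'a \<Rightarrow> real" and h :: "'a \<Rightarrow> 'a"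
  proof -
    obtain K where K: "compact K" "K \<subseteq> \<Omega>" "\<And>x. x \<notin> K \<Longrightarrow> \<phi> x = 0" using test_functions_supportE[OF \<phi>] by metis
    note s\<phi> = test_functions_smooth[OF \<phi>]
    obtain B where B: "B > 0" "\<And>x. norm (\<phi> x) \<le> B" using continuous_support_bounded[OF smooth_continuous[OF s\<phi>] K(1,3)] by metis
    have hK: "integrable lebesgue (\<lambda>x. indicator K x *\<^sub>R h x)" using h[OF K(1,2)] by (simp add: set_integrable_def)
    have "integrable lebesgue (\<lambda>x. \<phi> x *\<^sub>R (indicator K x *\<^sub>R h x))"
    proof (rule Bochner_Integration.integrable_bound[OF integrable_scaleR_right[OF hK, of B]])
      show "(\<lambda>x. \<phi> x *\<^sub>R (indicator K x *\<^sub>R h x)) \<in> borel_measurable lebesgue"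
        by (intro borel_measurable_scaleR borel_measurable_integrable[OF hK] measurable_completion) (simp add: borel_measurable_continuous_onI smooth_continuous[OF s\<phi>])
      show "AE x in lebesgue. norm (\<phi> x *\<^sub>R (indicator K x *\<^sub>R h x)) \<le> norm (B *\<^sub>R (indicator K x *\<^sub>R h x))"
        using B by (intro AE_I2) (auto simp: indicator_def intro!: mult_right_mono)
    qed
    also have "(\<lambda>x. \<phi> x *\<^sub>R (indicator K x *\<^sub>R h x)) = (\<lambda>x. indicator \<Omega> x *\<^sub>R (\<phi> x *\<^sub>R h x))"
    proof
      fix x show "\<phi> x *\<^sub>R (indicator K x *\<^sub>R h x) = indicator \<Omega> x *\<^sub>R (\<phi> x *\<^sub>R h x)"
        using K(2) K(3)[of x] by (auto simp: indicator_def)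
    qed
    finally show ?thesis using op by (subst integrable_restrict_space) auto
  qed
  have "negligible {x \<in> \<Omega>. (g x - g' x) \<bullet> b \<noteq> 0}" if "b \<in> Basis" for b
  proof (rule fundamental_lemma_real[OF op])
    show "(\<lambda>x. (g x - g' x) \<bullet> b) absolutely_integrable_on K" if "compact K" "K \<subseteq> \<Omega>" for K
      using loc[OF that] by (intro absolutely_integrable_component set_integral_diff)
    fix \<phi> assume \<phi>: "\<phi> \<in> test_functions \<Omega>"
    note i = tst[OF \<phi> loc(1)] tst[OF \<phi> loc(2)]
    have "(\<integral>x. \<phi> x *\<^sub>R g x \<partial>lebesgue_on \<Omega>) = (\<integral>x. \<phi> x *\<^sub>R g' x \<partial>lebesgue_on \<Omega>)"
      using g g' \<phi> by (auto simp: has_weak_gradient_def)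
    then have "(\<integral>x. \<phi> x *\<^sub>R g x - \<phi> x *\<^sub>R g' x \<partial>lebesgue_on \<Omega>) = 0"
      using Bochner_Integration.integral_diff[OF i] by simp
    then have "(\<integral>x. (\<phi> x *\<^sub>R g x - \<phi> x *\<^sub>R g' x) \<bullet> b \<partial>lebesgue_on \<Omega>) = 0"
      using integral_inner_left[OF Bochner_Integration.integrable_diff[OF i], of b] by simp
    then show "(\<integral>x. \<phi> x * ((g x - g' x) \<bullet> b) \<partial>lebesgue_on \<Omega>) = 0"
      by (simp add: inner_simps algebra_simps)
  qed
  then have "negligible (\<Union>b\<in>Basis. {x \<in> \<Omega>. (g x - g' x) \<bullet> b \<noteq> 0})" by (intro negligible_Union) auto
  then have "(\<Union>b\<in>Basis. {x \<in> \<Omega>. (g x - g' x) \<bullet> b \<noteq> 0}) \<in> null_sets lebesgue"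
    by (simp only: negligible_iff_null_sets)
  then have "AE x in lebesgue. x \<notin> (\<Union>b\<in>Basis. {x \<in> \<Omega>. (g x - g' x) \<bullet> b \<noteq> 0})"
    by (rule AE_not_in)
  then have "AE x in lebesgue. x \<in> \<Omega> \<longrightarrow> g x = g' x"
    by (rule AE_mp) (auto simp: euclidean_eq_iff[where 'a = 'a] inner_diff_left)
  then show ?thesis using op by (subst AE_restrict_space_iff) auto
qed

section \<open>Existence of a minimiser\<close>

lemma hardy_weight_nonneg: "norm x < R \<Longrightarrow> 0 \<le> hardy_weight R x"
  unfolding hardy_weight_def
  by (cases "x = 0") (auto intro!: ln_ge_zero simp: less_imp_le)

lemma hardy_weight_lower:
  fixes x :: "'a::euclidean_space"
  assumes x: "x \<noteq> 0" "norm x < R"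
  shows "1 / R ^ DIM('a) \<le> hardy_weight R x"
proof -
  have nx: "norm x > 0" using x by simp
  have L: "ln (R / norm x) > 0" using x by (intro ln_gt_zero) simp
  have "ln (R / norm x) \<le> R / norm x - 1" using x by (intro ln_le_minus_one) (auto intro: divide_pos_pos le_less_trans[OF norm_ge_zero])
  then have "norm x * ln (R / norm x) \<le> norm x * (R / norm x - 1)" using nx by (intro mult_left_mono) auto
  also have "\<dots> = R - norm x" using nx by (simp add: field_simps)
  also have "\<dots> \<le> R" by simp
  finally have "(norm x * ln (R / norm x)) ^ DIM('a) \<le> R ^ DIM('a)" using L nx by (intro power_mono) auto
  moreover have "0 < (norm x * ln (R / norm x)) ^ DIM('a)" by (rule zero_less_power[OF mult_pos_pos[OF nx L]])
  ultimately show ?thesis unfolding hardy_weight_def power_mult_distrib[symmetric]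
    by (intro divide_left_mono mult_pos_pos) (auto intro: less_le_trans)
qed

context thin_domain
begin

lemma test_gradient_zero: "\<phi> \<in> test_functions \<Omega> \<Longrightarrow> x \<notin> \<Omega> \<Longrightarrow> gradient \<phi> x = 0"
  by (rule test_functions_gradient_support(2))

lemma bounded_domain: "bounded \<Omega>"
  using inside unfolding bounded_iff by (meson less_imp_le)

lemma energy_finite: "\<phi> \<in> test_functions \<Omega> \<Longrightarrow> energy \<phi> < top"
proof -
  assume \<phi>: "\<phi> \<in> test_functions \<Omega>"
  obtain K where K: "compact K" "\<And>x. x \<notin> K \<Longrightarrow> gradient \<phi> x = 0"
    using test_functions_supportE[OF \<phi>] by metis
  have "integrable lborel (\<lambda>x. norm (gradient \<phi> x) ^ DIM('a))"
    using K dim2 by (intro integrable_compact_support[OF _ K(1)] continuous_intros smooth_continuous_gradient test_functions_smooth[OF \<phi>]) (auto simp: power_0_left)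
  then show ?thesis unfolding energy_def by (simp add: nn_integral_eq_integral)
qed

lemma hardy_mass_finite: "\<phi> \<in> test_functions \<Omega> \<Longrightarrow> hardy_mass R \<phi> < top"
proof -
  assume \<phi>: "\<phi> \<in> test_functions \<Omega>"
  have c: "((real DIM('a) - 1) / real DIM('a)) ^ DIM('a) > 0" using dim2 by simp
  have "ennreal (((real DIM('a) - 1) / real DIM('a)) ^ DIM('a)) * hardy_mass R \<phi> \<le> energy \<phi>"
    using hardy_remainder[OF \<phi>] unfolding hardy_mass_def by (rule order_trans[rotated]) simp
  then have "ennreal (((real DIM('a) - 1) / real DIM('a)) ^ DIM('a)) * hardy_mass R \<phi> < top" using energy_finite[OF \<phi>] by (rule le_less_trans)
  then show ?thesis using c by (auto simp: ennreal_mult_less_top)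
qed

lemma energy_cmult:
  assumes "\<phi> \<in> test_functions \<Omega>"
  shows "energy (\<lambda>x. c * \<phi> x) = ennreal (\<bar>c\<bar> ^ DIM('a)) * energy \<phi>"
proof -
  note [measurable] = test_measurable[OF assms]
  show ?thesis unfolding energy_def gradient_cmult[OF test_functions_smooth[OF assms]]
    by (subst nn_integral_cmult[symmetric], measurable) (simp add: power_mult_distrib ennreal_mult)
qed

lemma hardy_mass_cmult:
  assumes "\<phi> \<in> test_functions \<Omega>"
  shows "hardy_mass R (\<lambda>x. c * \<phi> x) = ennreal (\<bar>c\<bar> ^ DIM('a)) * hardy_mass R \<phi>"
proof -
  note [measurable] = test_measurable[OF assms]
  show ?thesis unfolding hardy_mass_def
    by (subst nn_integral_cmult[symmetric], measurable) (simp add: abs_mult power_mult_distrib ennreal_mult' mult.assoc)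
qed

lemma hardy_mass_pos:
  assumes \<phi>: "\<phi> \<in> test_functions \<Omega>" and "\<phi> x0 \<noteq> 0"
  shows "hardy_mass R \<phi> > 0"
proof (rule ccontr)
  assume "\<not> hardy_mass R \<phi> > 0"
  then have "hardy_mass R \<phi> = 0" by (simp add: not_less)
  moreover have [measurable]: "\<phi> \<in> borel_measurable borel" by (rule test_measurable[OF \<phi>])
  ultimately have "AE x in lborel. ennreal (\<bar>\<phi> x\<bar> ^ DIM('a) * hardy_weight R x) = 0"
    unfolding hardy_mass_def by (subst (asm) nn_integral_0_iff_AE) auto
  moreover have "AE x in lborel. x \<noteq> (0::'a)" by (rule AE_lborel_singleton)
  ultimately have ae: "AE x in lborel. \<phi> x = 0"
  proof eventually_elim
    case (elim x)
    show ?case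
    proof (cases "norm x < R")
      case True
      have "0 < 1 / R ^ DIM('a)" using R by simp
      then have "hardy_weight R x > 0" using hardy_weight_lower[OF elim(2) True] by linarith
      moreover have "\<bar>\<phi> x\<bar> ^ DIM('a) * hardy_weight R x \<le> 0" using elim(1) by (simp only: ennreal_eq_0_iff)
      ultimately have "\<bar>\<phi> x\<bar> ^ DIM('a) \<le> 0" by (simp add: mult_le_0_iff)
      then have "\<bar>\<phi> x\<bar> ^ DIM('a) = 0" by (intro antisym) auto
      then show ?thesis by simp
    qed (use test_zero[OF \<phi>] in auto)
  qed
  have "open {x. \<phi> x \<noteq> 0}"
    using smooth_continuous[OF test_functions_smooth[OF \<phi>], of UNIV] by (intro open_Collect_neq continuous_intros)
  then obtain e where e: "e > 0" "ball x0 e \<subseteq> {x. \<phi> x \<noteq> 0}" using assms(2) openE by blast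
  have "AE x in lborel. x \<notin> ball x0 e" using ae by eventually_elim (use e in blast)
  then have "ball x0 e \<in> null_sets lborel" by (subst AE_iff_null_sets) auto
  then have "emeasure lborel (ball x0 e) = 0" by (rule null_setsD1)
  moreover have "emeasure lborel (ball x0 e) = ennreal (unit_ball_vol (real DIM('a)) * e ^ DIM('a))"
    by (rule emeasure_ball) (use e in simp)
  ultimately have "unit_ball_vol (real DIM('a)) * e ^ DIM('a) \<le> 0" by (simp only: ennreal_eq_0_iff)
  moreover have "unit_ball_vol (real DIM('a)) * e ^ DIM('a) > 0" using e(1) by (intro mult_pos_pos) auto
  ultimately show False by linarith
qed

text \<open>The infimum over normalised test functions only. It coincides with the infimum over the Sobolev
  space by \<open>least_quotient_le_sobolev\<close>, and avoids weak gradients in the analytic part of the proof.\<close>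

definition least_quotient :: ennreal where
  "least_quotient = (INF \<phi>\<in>{\<phi> \<in> test_functions \<Omega>. hardy_mass R \<phi> = 1}. energy \<phi>)"

lemma normalised_test_function:
  assumes \<phi>: "\<phi> \<in> test_functions \<Omega>" and m: "hardy_mass R \<phi> = ennreal m" "m > 0"
  defines "c \<equiv> root DIM('a) (1 / m)"
  shows "(\<lambda>x. c * \<phi> x) \<in> test_functions \<Omega>" "hardy_mass R (\<lambda>x. c * \<phi> x) = 1"
    "energy (\<lambda>x. c * \<phi> x) = ennreal (1 / m) * energy \<phi>"
proof -
  have c: "c \<ge> 0" "c ^ DIM('a) = 1 / m" using m by (auto simp: c_def)
  show "(\<lambda>x. c * \<phi> x) \<in> test_functions \<Omega>" by (rule test_functions_cmult[OF \<phi>])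
  show "hardy_mass R (\<lambda>x. c * \<phi> x) = 1"
    unfolding hardy_mass_cmult[OF \<phi>] m(1) using c m by (simp add: ennreal_mult[symmetric])
  show "energy (\<lambda>x. c * \<phi> x) = ennreal (1 / m) * energy \<phi>"
    unfolding energy_cmult[OF \<phi>] using c by simp
qed

lemma least_quotient_real:
  obtains l where "least_quotient = ennreal l" "l > ((real DIM('a) - 1) / real DIM('a)) ^ DIM('a)"
proof -
  obtain \<phi> where \<phi>: "\<phi> \<in> test_functions \<Omega>" "\<exists>x. \<phi> x \<noteq> 0" using exists_nonzero_test_function[OF op ne] by blast
  then have "hardy_mass R \<phi> > 0" "hardy_mass R \<phi> < top" using hardy_mass_pos hardy_mass_finite by auto
  then obtain m where m: "hardy_mass R \<phi> = ennreal m" "m > 0" by (cases "hardy_mass R \<phi>" rule: ennreal_cases) auto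
  have "least_quotient \<le> energy (\<lambda>x. root DIM('a) (1 / m) * \<phi> x)"
    unfolding least_quotient_def by (rule INF_lower) (use normalised_test_function[OF \<phi>(1) m] in auto)
  also have "\<dots> < top" by (rule energy_finite) (rule normalised_test_function[OF \<phi>(1) m])
  finally have fin: "least_quotient < top" .
  obtain \<delta> where \<delta>: "\<delta> > 0"
    "\<And>\<phi>. \<phi> \<in> test_functions \<Omega> \<Longrightarrow> hardy_mass R \<phi> = 1 \<Longrightarrow>
       ennreal (((real DIM('a) - 1) / real DIM('a)) ^ DIM('a) + \<delta>) \<le> energy \<phi>"
    using hardy_improvement by blast
  have ge: "ennreal (((real DIM('a) - 1) / real DIM('a)) ^ DIM('a) + \<delta>) \<le> least_quotient"
    unfolding least_quotient_def by (rule INF_greatest) (use \<delta>(2) in auto)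
  obtain l where l: "least_quotient = ennreal l" "l \<ge> 0" using fin by (cases least_quotient rule: ennreal_cases) auto
  have "((real DIM('a) - 1) / real DIM('a)) ^ DIM('a) + \<delta> \<le> l" using ge l by (simp add: ennreal_le_iff)
  then show ?thesis using that[of l] l \<delta>(1) by simp
qed

lemma least_quotient_le:
  assumes \<phi>: "\<phi> \<in> test_functions \<Omega>"
  shows "least_quotient * hardy_mass R \<phi> \<le> energy \<phi>"
proof (cases "hardy_mass R \<phi> = 0")
  case False
  then obtain m where m: "hardy_mass R \<phi> = ennreal m" "m > 0"
    using hardy_mass_finite[OF \<phi>] by (cases "hardy_mass R \<phi>" rule: ennreal_cases) (auto simp: less_le)
  have "least_quotient \<le> ennreal (1 / m) * energy \<phi>"
    unfolding least_quotient_def by (rule INF_lower2[of "\<lambda>x. root DIM('a) (1 / m) * \<phi> x"])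
      (use normalised_test_function[OF \<phi> m] in auto)
  then have "least_quotient * ennreal m \<le> (ennreal (1 / m) * energy \<phi>) * ennreal m" by (rule mult_right_mono) simp
  also have "\<dots> = (ennreal (1 / m) * ennreal m) * energy \<phi>" by (simp only: mult_ac)
  also have "\<dots> = energy \<phi>" using m by (simp add: ennreal_mult[symmetric])
  finally show ?thesis using m by simp
qed simp

lemma Lp_integral_gradient:
  assumes "\<phi> \<in> test_functions \<Omega>"
  shows "Lp_integral DIM('a) \<Omega> (gradient \<phi>) = energy \<phi>"
  unfolding Lp_integral_def energy_def
  by (rule nn_integral_lebesgue_on_eq[OF op]) (use test_measurable[OF assms] test_gradient_zero[OF assms] dim2 in \<open>auto simp: power_0_left\<close>)

lemma hardy_mass_lebesgue_on:
  assumes "\<phi> \<in> test_functions \<Omega>"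
  shows "(\<integral>\<^sup>+x. ennreal (norm (\<phi> x) ^ DIM('a) * hardy_weight R x) \<partial>lebesgue_on \<Omega>) = hardy_mass R \<phi>"
  unfolding hardy_mass_def real_norm_def
  by (rule nn_integral_lebesgue_on_eq[OF op]) (use test_measurable[OF assms] test_functions_gradient_support(1)[OF assms] dim2 in \<open>auto simp: power_0_left\<close>)

lemma space_weight_nonneg: "x \<in> space (lebesgue_on \<Omega>) \<Longrightarrow> 0 \<le> hardy_weight R x"
  using inside by (auto simp: space_restrict_space intro: hardy_weight_nonneg)

text \<open>Uniform convexity. The midpoint \<open>m\<close> of two late members has mass close to \<open>1\<close>, because the masses of the
  differences are small, hence energy at least about \<open>l\<close>; Clarkson's inequality then leaves no room for
  the energy of the half difference.\<close>

lemma minimising_sequence_gradient_cauchy: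
  assumes l: "least_quotient = ennreal l" "l > 0"
    and \<phi>: "\<And>k. \<phi> k \<in> test_functions \<Omega>" "\<And>k. hardy_mass R (\<phi> k) = 1"
    and E: "\<And>k. energy (\<phi> k) \<le> ennreal (l + 1 / real (Suc k))"
    and C: "\<And>e. e > 0 \<Longrightarrow> \<exists>K. \<forall>j\<ge>K. \<forall>k\<ge>K. hardy_mass R (\<lambda>x. \<phi> j x - \<phi> k x) \<le> ennreal e"
    and e: "e > 0"
  shows "\<exists>K. \<forall>j\<ge>K. \<forall>k\<ge>K. energy (\<lambda>x. \<phi> j x - \<phi> k x) \<le> ennreal e"
proof -
  define N where "N = DIM('a)"
  have N: "N \<ge> 2" "N \<ge> 1" using dim2 by (auto simp: N_def)
  \<comment> \<open>Three errors of size \<open>a\<close> arise for the half difference; doubling it costs \<open>2 ^ N\<close>.\<close>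
  define a where "a = e / (3 * 2 ^ N)"
  have a: "a > 0" using e by (simp add: a_def)
  have "((\<lambda>t. l * (1 - t ^ (N - 1))) \<longlongrightarrow> l * (1 - 1 ^ (N - 1))) (at_left 1)" by (intro tendsto_intros)
  then have "eventually (\<lambda>t. l * (1 - t ^ (N - 1)) < a) (at_left 1)" by (rule order_tendstoD) (use a in simp)
  moreover have "eventually (\<lambda>t::real. t \<in> {0<..<1}) (at_left 1)" by (rule eventually_at_left_real) simp
  ultimately have "eventually (\<lambda>t. l * (1 - t ^ (N - 1)) < a \<and> t \<in> {0<..<1}) (at_left 1)" by eventually_elim auto
  then obtain t where t: "l * (1 - t ^ (N - 1)) < a" "0 < t" "t < 1"
    using eventually_happens[of _ "at_left (1::real)"] trivial_limit_at_left_real[of "1::real"] by auto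
  define s where "s = (1 - t) ^ (N - 1)"
  have s: "s > 0" using t by (simp add: s_def)
  have tp: "0 < t ^ (N - 1)" "t ^ (N - 1) \<le> 1" using t by (auto simp: power_le_one)
  define \<eta> where "\<eta> = a * s / l"
  have \<eta>: "\<eta> > 0" using a s l by (simp add: \<eta>_def)
  obtain K0 where K0: "\<And>j k. j \<ge> K0 \<Longrightarrow> k \<ge> K0 \<Longrightarrow> hardy_mass R (\<lambda>x. \<phi> j x - \<phi> k x) \<le> ennreal \<eta>"
    using C[OF \<eta>] by blast
  obtain K1 where K1: "1 / real (Suc K1) < a" using reals_Archimedean[OF a] by (auto simp: inverse_eq_divide)
  show ?thesis
  proof (intro exI[of _ "max K0 K1"] allI impI)
    fix j k assume jk: "j \<ge> max K0 K1" "k \<ge> max K0 K1"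
    define f where "f x = \<phi> j x - \<phi> k x" for x
    define h where "h x = (1/2) * f x" for x
    define m where "m x = (1/2) * (\<phi> j x + \<phi> k x)" for x
    have f: "f \<in> test_functions \<Omega>" unfolding f_def[abs_def] by (intro test_functions_diff \<phi>)
    have h: "h \<in> test_functions \<Omega>" unfolding h_def[abs_def] by (intro test_functions_cmult f)
    have m: "m \<in> test_functions \<Omega>" unfolding m_def[abs_def] by (intro test_functions_cmult test_functions_add \<phi>)
    note sm = test_functions_smooth[OF \<phi>(1)]
    note [measurable] = test_measurable[OF \<phi>(1)[of j]] test_measurable[OF \<phi>(1)[of k]] test_measurable[OF m] test_measurable[OF h]
    have gm: "gradient m x = (1/2) *\<^sub>R (gradient (\<phi> j) x + gradient (\<phi> k) x)" for x
      unfolding m_def[abs_def] by (simp only: gradient_cmult[OF smooth_intros(3)[OF sm sm]] gradient_add[OF sm sm])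
    have gh: "gradient h x = (1/2) *\<^sub>R (gradient (\<phi> j) x - gradient (\<phi> k) x)" for x
      unfolding h_def[abs_def] f_def[abs_def] by (simp only: gradient_cmult[OF smooth_diff[OF sm sm]] gradient_diff[OF sm sm])
    have "energy m + energy h = (\<integral>\<^sup>+x. ennreal (norm (gradient m x) ^ N) + ennreal (norm (gradient h x) ^ N) \<partial>lborel)"
      unfolding energy_def N_def[symmetric] by (intro nn_integral_add[symmetric]) measurable
    also have "\<dots> \<le> (\<integral>\<^sup>+x. ennreal (1/2) * ennreal (norm (gradient (\<phi> j) x) ^ N) + ennreal (1/2) * ennreal (norm (gradient (\<phi> k) x) ^ N) \<partial>lborel)"
    proof (rule nn_integral_mono)
      fix x
      have "norm (gradient m x) ^ N + norm (gradient h x) ^ N \<le> (norm (gradient (\<phi> j) x) ^ N + norm (gradient (\<phi> k) x) ^ N) / 2"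
        unfolding gm gh by (rule norm_power_clarkson[OF N(1)])
      also have "\<dots> = 1/2 * norm (gradient (\<phi> j) x) ^ N + 1/2 * norm (gradient (\<phi> k) x) ^ N" by (simp add: field_simps)
      finally have "ennreal (norm (gradient m x) ^ N + norm (gradient h x) ^ N) \<le> ennreal (1/2 * norm (gradient (\<phi> j) x) ^ N + 1/2 * norm (gradient (\<phi> k) x) ^ N)"
        by (rule ennreal_leI)
      then show "ennreal (norm (gradient m x) ^ N) + ennreal (norm (gradient h x) ^ N)
        \<le> ennreal (1/2) * ennreal (norm (gradient (\<phi> j) x) ^ N) + ennreal (1/2) * ennreal (norm (gradient (\<phi> k) x) ^ N)"
        by (subst (asm) ennreal_plus, simp, simp, subst (asm) ennreal_plus, simp, simp, subst (asm) ennreal_mult, simp, simp, subst (asm) ennreal_mult, simp, simp)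
    qed
    also have "\<dots> = ennreal (1/2) * energy (\<phi> j) + ennreal (1/2) * energy (\<phi> k)"
      unfolding energy_def N_def[symmetric] by (subst nn_integral_add, measurable, subst nn_integral_cmult, measurable, subst nn_integral_cmult, measurable)
    also have "\<dots> \<le> ennreal (1/2) * ennreal (l + a) + ennreal (1/2) * ennreal (l + a)"
    proof -
      have "energy (\<phi> i) \<le> ennreal (l + a)" if "i \<ge> K1" for i
      proof -
        have "1 / real (Suc i) \<le> 1 / real (Suc K1)" using that by (intro divide_left_mono) auto
        then show ?thesis using K1 by (intro order_trans[OF E] ennreal_leI) linarith
      qed
      then show ?thesis using jk by (intro add_mono mult_left_mono) auto
    qed
    also have "\<dots> = ennreal (l + a)"
    proof -
      have half: "ennreal (1/2) * ennreal (l + a) = ennreal ((l + a) / 2)" using l a by (subst ennreal_mult[symmetric]) auto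
      show ?thesis unfolding half by (subst ennreal_plus[symmetric]) (use l a in auto)
    qed
    finally have cl: "energy m + energy h \<le> ennreal (l + a)" .
    obtain mm where mm: "hardy_mass R m = ennreal mm" "mm \<ge> 0"
      using hardy_mass_finite[OF m] by (cases "hardy_mass R m" rule: ennreal_cases) auto
    have massh: "hardy_mass R h \<le> ennreal \<eta>"
    proof -
      have "hardy_mass R h = ennreal (\<bar>1/2\<bar> ^ N) * hardy_mass R f" unfolding h_def[abs_def] N_def by (rule hardy_mass_cmult[OF f])
      also have "\<dots> \<le> 1 * hardy_mass R f"
        by (intro mult_right_mono) (auto simp: power_le_one)
      also have "\<dots> \<le> ennreal \<eta>" using K0[of j k] jk by (simp add: f_def[abs_def])
      finally show ?thesis .
    qed
    have "1 = (\<integral>\<^sup>+x. ennreal (norm (\<phi> j x) ^ N * hardy_weight R x) \<partial>lebesgue_on \<Omega>)"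
      using hardy_mass_lebesgue_on[OF \<phi>(1)[of j]] \<phi>(2)[of j] by (simp add: N_def)
    also have "\<dots> \<le> ennreal (1 / t ^ (N - 1)) * (\<integral>\<^sup>+x. ennreal (norm (m x) ^ N * hardy_weight R x) \<partial>lebesgue_on \<Omega>) +
      ennreal (1 / (1 - t) ^ (N - 1)) * (\<integral>\<^sup>+x. ennreal (norm (\<phi> j x - m x) ^ N * hardy_weight R x) \<partial>lebesgue_on \<Omega>)"
      by (intro nn_integral_power_split borel_measurable_lebesgue_on space_weight_nonneg t N) measurable
    also have "(\<integral>\<^sup>+x. ennreal (norm (\<phi> j x - m x) ^ N * hardy_weight R x) \<partial>lebesgue_on \<Omega>) = hardy_mass R h"
    proof -
      have "\<phi> j x - m x = h x" for x by (simp add: m_def h_def f_def field_simps)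
      then show ?thesis using hardy_mass_lebesgue_on[OF h] by (simp add: N_def)
    qed
    also have "(\<integral>\<^sup>+x. ennreal (norm (m x) ^ N * hardy_weight R x) \<partial>lebesgue_on \<Omega>) = ennreal mm"
      using hardy_mass_lebesgue_on[OF m] mm(1) by (simp add: N_def)
    also have "ennreal (1 / t ^ (N - 1)) * ennreal mm + ennreal (1 / (1 - t) ^ (N - 1)) * hardy_mass R h
      \<le> ennreal (1 / t ^ (N - 1)) * ennreal mm + ennreal (1 / s) * ennreal \<eta>"
      unfolding s_def[symmetric] by (intro add_left_mono mult_left_mono massh) auto
    also have "\<dots> = ennreal (1 / t ^ (N - 1) * mm + 1 / s * \<eta>)"
      using tp mm s \<eta> by (simp add: ennreal_mult[symmetric] ennreal_plus[symmetric] del: ennreal_plus)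
    finally have "ennreal 1 \<le> ennreal (1 / t ^ (N - 1) * mm + 1 / s * \<eta>)" by (simp only: ennreal_1)
    then have "1 \<le> 1 / t ^ (N - 1) * mm + 1 / s * \<eta>"
      by (rule ennreal_le_iff[THEN iffD1, rotated]) (use tp mm s \<eta> in auto)
    then have "t ^ (N - 1) * 1 \<le> t ^ (N - 1) * (1 / t ^ (N - 1) * mm + 1 / s * \<eta>)" using tp by (intro mult_left_mono) auto
    also have "\<dots> = mm + t ^ (N - 1) * (\<eta> / s)"
    proof -
      have "T * (1 / T * mm + 1 / s * \<eta>) = mm + T * (\<eta> / s)" if "T > 0" for T using that by (simp add: distrib_left)
      then show ?thesis using tp(1) .
    qed
    also have "\<dots> \<le> mm + 1 * (\<eta> / s)" using tp \<eta> s by (intro add_left_mono mult_right_mono) auto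
    finally have "l * t ^ (N - 1) \<le> l * (mm + \<eta> / s)" using l by (intro mult_left_mono) auto
    also have "\<dots> = l * mm + a" using l s by (simp add: \<eta>_def field_simps)
    finally have lmm: "l - 2 * a < l * mm" using t(1) by (simp add: algebra_simps)
    have Em: "ennreal (l * mm) \<le> energy m" using least_quotient_le[OF m] l mm by (simp add: ennreal_mult)
    have "energy h \<noteq> top" using energy_finite[OF h] by simp
    then obtain eh where eh: "energy h = ennreal eh" "eh \<ge> 0" by (cases "energy h" rule: ennreal_cases) auto
    have "ennreal (l * mm) + ennreal eh \<le> ennreal (l + a)" using cl Em unfolding eh(1)[symmetric] by (meson add_right_mono order_trans)
    then have "ennreal (l * mm + eh) \<le> ennreal (l + a)" using l mm eh by simp
    then have "l * mm + eh \<le> l + a" by (rule ennreal_le_iff[THEN iffD1, rotated]) (use l a in auto)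
    then have eha: "eh \<le> 3 * a" using lmm by linarith
    have "f = (\<lambda>x. 2 * h x)" by (auto simp: h_def)
    then have "energy f = ennreal (2 ^ N) * ennreal eh" using energy_cmult[OF h, of 2] eh by (simp add: N_def)
    also have "\<dots> = ennreal (2 ^ N * eh)" using eh by (simp add: ennreal_mult)
    also have "\<dots> \<le> ennreal e"
    proof (rule ennreal_leI)
      have "2 ^ N * eh \<le> 2 ^ N * (3 * a)" using eha by (intro mult_left_mono) auto
      then show "2 ^ N * eh \<le> e" by (simp add: a_def)
    qed
    finally show "energy (\<lambda>x. \<phi> j x - \<phi> k x) \<le> ennreal e" by (simp add: f_def[abs_def])
  qed
qed

text \<open>A minimising sequence has a subsequence that is Cauchy in the weighted norm, and then also its
  gradients are Cauchy. The limits form a function of the Sobolev space with its weak gradient; its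
  energy is at most the infimum, and its mass is at least \<open>1\<close>.\<close>

lemma minimiser_exists:
  obtains u g where "u \<in> W1_0 DIM('a) \<Omega>" "has_weak_gradient \<Omega> u g"
    "Lp_integral DIM('a) \<Omega> g \<le> least_quotient"
    "1 \<le> (\<integral>\<^sup>+x. ennreal (norm (u x) ^ DIM('a) * hardy_weight R x) \<partial>lebesgue_on \<Omega>)"
proof -
  define N where "N = DIM('a)"
  have N: "N \<ge> 1" using dim2 by (simp add: N_def)
  obtain l where l: "least_quotient = ennreal l" "l > ((real DIM('a) - 1) / real DIM('a)) ^ DIM('a)"
    using least_quotient_real by blast
  have "0 \<le> ((real DIM('a) - 1) / real DIM('a)) ^ DIM('a)" using dim2 by simp
  then have l0: "l > 0" using l(2) by linarith
  have "\<exists>\<phi>. \<phi> \<in> test_functions \<Omega> \<and> hardy_mass R \<phi> = 1 \<and> energy \<phi> \<le> ennreal (l + 1 / real (Suc k))" for k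
  proof -
    have "least_quotient < ennreal (l + 1 / real (Suc k))" unfolding l(1) using l0 by (intro ennreal_lessI) (auto intro: add_pos_pos)
    then obtain \<phi> where "\<phi> \<in> {\<phi> \<in> test_functions \<Omega>. hardy_mass R \<phi> = 1}" "energy \<phi> < ennreal (l + 1 / real (Suc k))"
      unfolding least_quotient_def INF_less_iff by blast
    then show ?thesis by (auto intro: less_imp_le)
  qed
  then obtain \<phi>0 where \<phi>0: "\<And>k. \<phi>0 k \<in> test_functions \<Omega>" "\<And>k. hardy_mass R (\<phi>0 k) = 1"
    "\<And>k. energy (\<phi>0 k) \<le> ennreal (l + 1 / real (Suc k))" by metis
  have E0: "energy (\<phi>0 k) \<le> ennreal (l + 1)" for k
    by (rule order_trans[OF \<phi>0(3)]) (intro ennreal_leI, simp)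
  have l1: "0 \<le> l + 1" using l0 by simp
  obtain s :: "nat \<Rightarrow> nat" where s: "strict_mono s"
    "\<And>e. e > 0 \<Longrightarrow> \<exists>K. \<forall>j\<ge>K. \<forall>k\<ge>K. hardy_mass R (\<lambda>x. \<phi>0 (s j) x - \<phi>0 (s k) x) \<le> ennreal e"
  proof (rule hardy_mass_compact[of \<phi>0 "l + 1", OF \<phi>0(1) E0 l1])
    fix s' :: "nat \<Rightarrow> nat"
    assume 1: "strict_mono s'"
      and 2: "\<And>e. e > 0 \<Longrightarrow> \<exists>K. \<forall>j\<ge>K. \<forall>k\<ge>K. hardy_mass R (\<lambda>x. \<phi>0 (s' j) x - \<phi>0 (s' k) x) \<le> ennreal e"
    show thesis by (rule that[OF 1 2])
  qed
  define \<phi> where "\<phi> k = \<phi>0 (s k)" for k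
  have \<phi>: "\<phi> k \<in> test_functions \<Omega>" "hardy_mass R (\<phi> k) = 1" for k by (auto simp: \<phi>_def \<phi>0)
  have C: "\<exists>K. \<forall>j\<ge>K. \<forall>k\<ge>K. hardy_mass R (\<lambda>x. \<phi> j x - \<phi> k x) \<le> ennreal e" if "e > 0" for e
    using s(2)[OF that] by (simp add: \<phi>_def)
  have E: "energy (\<phi> k) \<le> ennreal (l + 1 / real (Suc k))" for k
  proof -
    have "1 / real (Suc (s k)) \<le> 1 / real (Suc k)" using seq_suble[OF s(1), of k] by (intro divide_left_mono) auto
    then show ?thesis unfolding \<phi>_def by (intro order_trans[OF \<phi>0(3)] ennreal_leI) simp
  qed
  note gc = minimising_sequence_gradient_cauchy[OF l(1) l0 \<phi> E C]
  note bm = test_measurable[OF \<phi>(1)]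
  have bml: "\<phi> k \<in> borel_measurable (lebesgue_on \<Omega>)" "gradient (\<phi> k) \<in> borel_measurable (lebesgue_on \<Omega>)" for k
    by (auto intro!: borel_measurable_lebesgue_on bm)
  have RN: "R ^ N > 0" using R by simp
  have massLp: "(\<integral>\<^sup>+x. ennreal (norm (f x) ^ N) \<partial>lebesgue_on \<Omega>) \<le> ennreal (R ^ N) * hardy_mass R f"
    if f: "f \<in> test_functions \<Omega>" for f
  proof -
    note [measurable] = test_measurable[OF f]
    have "(\<integral>\<^sup>+x. ennreal (norm (f x) ^ N) \<partial>lebesgue_on \<Omega>) = (\<integral>\<^sup>+x. ennreal (norm (f x) ^ N) \<partial>lborel)"
      using test_functions_gradient_support(1)[OF f] N by (intro nn_integral_lebesgue_on_eq op) (auto simp: power_0_left)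
    also have "\<dots> \<le> (\<integral>\<^sup>+x. ennreal (R ^ N) * ennreal (\<bar>f x\<bar> ^ N * hardy_weight R x) \<partial>lborel)"
    proof (rule nn_integral_mono_AE, rule AE_mp[OF AE_lborel_singleton[of 0]], intro AE_I2 impI)
      fix x :: 'a assume x: "x \<noteq> 0"
      show "ennreal (norm (f x) ^ N) \<le> ennreal (R ^ N) * ennreal (\<bar>f x\<bar> ^ N * hardy_weight R x)"
      proof (cases "norm x < R")
        case True
        have w: "1 / R ^ N \<le> hardy_weight R x" using hardy_weight_lower[OF x True] by (simp add: N_def)
        have "norm (f x) ^ N = R ^ N * (\<bar>f x\<bar> ^ N * (1 / R ^ N))" using R by (simp)
        also have "\<dots> \<le> R ^ N * (\<bar>f x\<bar> ^ N * hardy_weight R x)" using RN w by (intro mult_left_mono) auto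
        finally have "ennreal (norm (f x) ^ N) \<le> ennreal (R ^ N * (\<bar>f x\<bar> ^ N * hardy_weight R x))" by (rule ennreal_leI)
        then show ?thesis using RN by (simp add: ennreal_mult')
      next
        case False
        then have "f x = 0" using test_zero[OF f, of x] by simp
        then show ?thesis using N by (simp add: power_0_left)
      qed
    qed
    also have "\<dots> = ennreal (R ^ N) * hardy_mass R f"
      unfolding hardy_mass_def N_def[symmetric] by (intro nn_integral_cmult) measurable
    finally show ?thesis .
  qed
  have diffE: "(\<integral>\<^sup>+x. ennreal (norm (gradient (\<phi> j) x - gradient (\<phi> k) x) ^ N) \<partial>lebesgue_on \<Omega>) = energy (\<lambda>x. \<phi> j x - \<phi> k x)" for j k
    using Lp_integral_gradient[OF test_functions_diff[OF \<phi>(1)[of j] \<phi>(1)[of k]]]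
    unfolding Lp_integral_def gradient_diff[OF test_functions_smooth[OF \<phi>(1)] test_functions_smooth[OF \<phi>(1)]] N_def .
  obtain u where u: "u \<in> borel_measurable (lebesgue_on \<Omega>)"
    "(\<lambda>k. \<integral>\<^sup>+x. ennreal (norm (\<phi> k x - u x) ^ N) \<partial>lebesgue_on \<Omega>) \<longlonglongrightarrow> 0"
  proof (rule Lp_complete[of \<phi> "lebesgue_on \<Omega>" N, OF bml(1) N])
    fix e :: real assume e: "e > 0"
    obtain K where K: "\<And>j k. j \<ge> K \<Longrightarrow> k \<ge> K \<Longrightarrow> hardy_mass R (\<lambda>x. \<phi> j x - \<phi> k x) \<le> ennreal (e / R ^ N)"
      using C[of "e / R ^ N"] e RN by (meson divide_pos_pos)
    show "\<exists>K. \<forall>j\<ge>K. \<forall>k\<ge>K. (\<integral>\<^sup>+x. ennreal (norm (\<phi> j x - \<phi> k x) ^ N) \<partial>lebesgue_on \<Omega>) \<le> ennreal e"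
    proof (intro exI allI impI)
      fix j k assume jk: "j \<ge> K" "k \<ge> K"
      have "(\<integral>\<^sup>+x. ennreal (norm (\<phi> j x - \<phi> k x) ^ N) \<partial>lebesgue_on \<Omega>) \<le> ennreal (R ^ N) * hardy_mass R (\<lambda>x. \<phi> j x - \<phi> k x)"
        by (rule massLp[OF test_functions_diff[OF \<phi>(1) \<phi>(1)]])
      also have "\<dots> \<le> ennreal (R ^ N) * ennreal (e / R ^ N)" by (intro mult_left_mono K jk) auto
      also have "\<dots> = ennreal e" using e R by (simp add: ennreal_mult[symmetric])
      finally show "(\<integral>\<^sup>+x. ennreal (norm (\<phi> j x - \<phi> k x) ^ N) \<partial>lebesgue_on \<Omega>) \<le> ennreal e" .
    qed
  qed blast
  obtain g where g: "g \<in> borel_measurable (lebesgue_on \<Omega>)"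
    "(\<lambda>k. \<integral>\<^sup>+x. ennreal (norm (gradient (\<phi> k) x - g x) ^ N) \<partial>lebesgue_on \<Omega>) \<longlonglongrightarrow> 0"
  proof (rule Lp_complete[of "\<lambda>k. gradient (\<phi> k)" "lebesgue_on \<Omega>" N, OF bml(2) N])
    fix e :: real assume e: "e > 0"
    show "\<exists>K. \<forall>j\<ge>K. \<forall>k\<ge>K. (\<integral>\<^sup>+x. ennreal (norm (gradient (\<phi> j) x - gradient (\<phi> k) x) ^ N) \<partial>lebesgue_on \<Omega>) \<le> ennreal e"
      unfolding diffE by (rule gc[OF _ e])
  qed blast
  have one: "(\<lambda>x. 1 :: real) \<in> borel_measurable (lebesgue_on \<Omega>)" by simp
  have uLp: "u \<in> Lp N \<Omega>"
  proof -
    have "(\<integral>\<^sup>+x. ennreal (norm (u x) ^ N * 1) \<partial>lebesgue_on \<Omega>) \<le> ennreal (R ^ N)"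
      by (rule Lp_limit_integral_le[OF bml(1) u(1) one N u(2), of "\<lambda>_. ennreal (R ^ N)"])
         (use massLp[OF \<phi>(1)] \<phi>(2) in simp_all)
    also have "\<dots> < \<infinity>" by simp
    finally show ?thesis using u(1) by (simp add: Lp_def Lp_integral_def)
  qed
  have gl: "Lp_integral N \<Omega> g \<le> ennreal l"
  proof -
    have "(\<lambda>k. ennreal (l + 1 / real (Suc k))) \<longlonglongrightarrow> ennreal (l + 0)"
      by (intro tendsto_intros LIMSEQ_Suc[OF lim_1_over_n])
    then have lim: "(\<lambda>k. ennreal (l + 1 / real (Suc k))) \<longlonglongrightarrow> ennreal l" by simp
    have "(\<integral>\<^sup>+x. ennreal (norm (gradient (\<phi> k) x) ^ N * 1) \<partial>lebesgue_on \<Omega>) \<le> ennreal (l + 1 / real (Suc k))" for k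
      using E[of k] Lp_integral_gradient[OF \<phi>(1)[of k]] by (simp add: Lp_integral_def N_def)
    from Lp_limit_integral_le[OF bml(2) g(1) one N g(2) this lim]
    show ?thesis by (simp add: Lp_integral_def)
  qed
  then have gLp: "g \<in> Lp N \<Omega>" using g(1) by (auto simp: Lp_def intro: le_less_trans)
  have limu: "(\<lambda>k. Lp_integral N \<Omega> (\<lambda>x. \<phi> k x - u x)) \<longlonglongrightarrow> 0" using u(2) by (simp add: Lp_integral_def)
  have limg: "(\<lambda>k. Lp_integral N \<Omega> (\<lambda>x. gradient (\<phi> k) x - g x)) \<longlonglongrightarrow> 0" using g(2) by (simp add: Lp_integral_def)
  have wg: "has_weak_gradient \<Omega> u g"
    by (rule weak_gradient_of_limit[OF op bounded_domain \<phi>(1) N uLp gLp limu limg])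
  have W: "u \<in> W1_0 N \<Omega>"
    unfolding W1_0_def W1_def using uLp gLp wg \<phi>(1) limu limg by blast
  define w where "w x = hardy_weight R x" for x :: 'a
  have wm: "w \<in> borel_measurable (lebesgue_on \<Omega>)" unfolding w_def[abs_def] by (intro borel_measurable_lebesgue_on) measurable
  have wnn: "\<And>x. x \<in> space (lebesgue_on \<Omega>) \<Longrightarrow> 0 \<le> w x" unfolding w_def by (rule space_weight_nonneg)
  define mu where "mu = (\<integral>\<^sup>+x. ennreal (norm (u x) ^ N * w x) \<partial>lebesgue_on \<Omega>)"
  have small: "\<exists>k. (\<integral>\<^sup>+x. ennreal (norm (\<phi> k x - u x) ^ N * w x) \<partial>lebesgue_on \<Omega>) \<le> ennreal \<eta>" if \<eta>: "\<eta> > 0" for \<eta>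
  proof -
    obtain K where K: "\<And>j k. j \<ge> K \<Longrightarrow> k \<ge> K \<Longrightarrow> hardy_mass R (\<lambda>x. \<phi> j x - \<phi> k x) \<le> ennreal \<eta>" using C[OF \<eta>] by blast
    have "(\<integral>\<^sup>+x. ennreal (norm (\<phi> K x - u x) ^ N * w x) \<partial>lebesgue_on \<Omega>) \<le> ennreal \<eta>"
    proof (rule Lp_limit_integral_le[where f = "\<lambda>j x. \<phi> K x - \<phi> (j + K) x" and B = "\<lambda>_. ennreal \<eta>", OF _ _ wm N])
      show "(\<lambda>x. \<phi> K x - \<phi> (j + K) x) \<in> borel_measurable (lebesgue_on \<Omega>)" for j by (intro borel_measurable_diff bml)
      show "(\<lambda>x. \<phi> K x - u x) \<in> borel_measurable (lebesgue_on \<Omega>)" by (intro borel_measurable_diff bml u(1))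
      show "(\<lambda>j. \<integral>\<^sup>+x. ennreal (norm (\<phi> K x - \<phi> (j + K) x - (\<phi> K x - u x)) ^ N) \<partial>lebesgue_on \<Omega>) \<longlonglongrightarrow> 0"
        using LIMSEQ_ignore_initial_segment[OF u(2), of K] by (simp add: abs_minus_commute)
      show "(\<integral>\<^sup>+x. ennreal (norm (\<phi> K x - \<phi> (j + K) x) ^ N * w x) \<partial>lebesgue_on \<Omega>) \<le> ennreal \<eta>" for j
        using hardy_mass_lebesgue_on[OF test_functions_diff[OF \<phi>(1)[of K] \<phi>(1)[of "j + K"]]] K[of K "j + K"]
        by (simp add: N_def w_def)
    qed simp
    then show ?thesis by blast
  qed
  \<comment> \<open>The limit keeps the mass \<open>1\<close>: compare with a late \<open>\<phi> k\<close>, then let \<open>t\<close> tend to \<open>1\<close>.\<close>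
  have mut: "ennreal 1 \<le> ennreal (1 / t ^ (N - 1)) * mu" if t: "0 < t" "t < 1" for t
  proof (rule ennreal_le_epsilon)
    fix e :: real assume e: "e > 0"
    define c where "c = 1 / (1 - t) ^ (N - 1)"
    have c: "c > 0" using t by (simp add: c_def)
    obtain k where k: "(\<integral>\<^sup>+x. ennreal (norm (\<phi> k x - u x) ^ N * w x) \<partial>lebesgue_on \<Omega>) \<le> ennreal (e / c)"
      using small[of "e / c"] e c by auto
    have "ennreal 1 = (\<integral>\<^sup>+x. ennreal (norm (\<phi> k x) ^ N * w x) \<partial>lebesgue_on \<Omega>)"
      using hardy_mass_lebesgue_on[OF \<phi>(1)[of k]] \<phi>(2)[of k] by (simp add: N_def w_def)
    also have "\<dots> \<le> ennreal (1 / t ^ (N - 1)) * mu + ennreal c * (\<integral>\<^sup>+x. ennreal (norm (\<phi> k x - u x) ^ N * w x) \<partial>lebesgue_on \<Omega>)"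
      unfolding mu_def c_def by (rule nn_integral_power_split[OF bml(1) u(1) wm wnn t N])
    also have "\<dots> \<le> ennreal (1 / t ^ (N - 1)) * mu + ennreal c * ennreal (e / c)"
      by (intro add_left_mono mult_left_mono k) simp
    also have "ennreal c * ennreal (e / c) = ennreal e" using c e by (simp add: ennreal_mult[symmetric])
    finally show "ennreal 1 \<le> ennreal (1 / t ^ (N - 1)) * mu + ennreal e" .
  qed
  have "1 \<le> mu"
  proof (cases mu rule: ennreal_cases)
    case (real r)
    have le: "t ^ (N - 1) \<le> r" if t: "0 < t" "t < 1" for t
    proof -
      have T: "0 < t ^ (N - 1)" using t by simp
      have "ennreal 1 \<le> ennreal (1 / t ^ (N - 1) * r)" using mut[OF t] real T by (simp add: ennreal_mult[symmetric])
      then have "1 \<le> 1 / t ^ (N - 1) * r" by (rule ennreal_le_iff[THEN iffD1, rotated]) (use T real in auto)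
      then show ?thesis using T by (simp add: field_simps)
    qed
    have "((\<lambda>t::real. t ^ (N - 1)) \<longlongrightarrow> 1 ^ (N - 1)) (at_left 1)" by (intro tendsto_intros)
    then have lim: "((\<lambda>t::real. t ^ (N - 1)) \<longlongrightarrow> 1) (at_left 1)" by simp
    have "eventually (\<lambda>t::real. t \<in> {0<..<1}) (at_left 1)" by (rule eventually_at_left_real) simp
    then have "eventually (\<lambda>t::real. t ^ (N - 1) \<le> r) (at_left 1)" by eventually_elim (use le in auto)
    from tendsto_upperbound[OF lim this] have "1 \<le> r" by simp
    then show ?thesis using real by (simp add: ennreal_leI[of 1, simplified])
  qed simp
  then show ?thesis
    using that[OF W[unfolded N_def] wg] gl l(1) by (simp add: mu_def w_def N_def)
qed

text \<open>By density of the test functions: the inequality \<open>least_quotient_le\<close> passes to the limit, on the left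
  by Fatou's lemma and on the right by \<open>nn_integral_power_split\<close>. The limit involves one particular
  weak gradient, but any two agree almost everywhere.\<close>

lemma least_quotient_le_sobolev:
  assumes u: "u \<in> W1_0 DIM('a) \<Omega>" and wg: "has_weak_gradient \<Omega> u g"
  shows "least_quotient * (\<integral>\<^sup>+x. ennreal (norm (u x) ^ DIM('a) * hardy_weight R x) \<partial>lebesgue_on \<Omega>) \<le> Lp_integral DIM('a) \<Omega> g"
proof -
  define N where "N = DIM('a)"
  have N: "N \<ge> 1" using dim2 by (simp add: N_def)
  obtain l where l: "least_quotient = ennreal l" "l > ((real DIM('a) - 1) / real DIM('a)) ^ DIM('a)"
    using least_quotient_real by blast
  have "0 \<le> ((real DIM('a) - 1) / real DIM('a)) ^ DIM('a)" using dim2 by simp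
  then have l0: "l > 0" using l(2) by linarith
  obtain h \<phi> where uL: "u \<in> Lp N \<Omega>" and h: "h \<in> Lp N \<Omega>" "has_weak_gradient \<Omega> u h"
    and \<phi>: "\<And>k. \<phi> k \<in> test_functions \<Omega>"
    and lu: "(\<lambda>k. Lp_integral N \<Omega> (\<lambda>x. \<phi> k x - u x)) \<longlonglongrightarrow> 0"
    and lh: "(\<lambda>k. Lp_integral N \<Omega> (\<lambda>x. gradient (\<phi> k) x - h x)) \<longlonglongrightarrow> 0"
    using u unfolding W1_0_def W1_def N_def by blast
  have um: "u \<in> borel_measurable (lebesgue_on \<Omega>)" and hm: "h \<in> borel_measurable (lebesgue_on \<Omega>)" using uL h by (auto simp: Lp_def)
  note bm = test_measurable[OF \<phi>]
  have bml: "\<phi> k \<in> borel_measurable (lebesgue_on \<Omega>)" "gradient (\<phi> k) \<in> borel_measurable (lebesgue_on \<Omega>)" for k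
    by (auto intro!: borel_measurable_lebesgue_on bm)
  have one: "(\<lambda>x. 1 :: real) \<in> borel_measurable (lebesgue_on \<Omega>)" by simp
  have wm: "hardy_weight R \<in> borel_measurable (lebesgue_on \<Omega>)" by (intro borel_measurable_lebesgue_on) measurable
  define I where "I = (\<integral>\<^sup>+x. ennreal (norm (u x) ^ N * hardy_weight R x) \<partial>lebesgue_on \<Omega>)"
  have lI: "ennreal l * I \<le> ennreal (1 / t ^ (N - 1)) * Lp_integral N \<Omega> h" if t: "0 < t" "t < 1" for t
  proof -
    define B where "B k = ennreal (1 / t ^ (N - 1)) * Lp_integral N \<Omega> h + ennreal (1 / (1 - t) ^ (N - 1)) * Lp_integral N \<Omega> (\<lambda>x. gradient (\<phi> k) x - h x)" for k
    have "B \<longlonglongrightarrow> ennreal (1 / t ^ (N - 1)) * Lp_integral N \<Omega> h + ennreal (1 / (1 - t) ^ (N - 1)) * 0"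
      unfolding B_def by (intro tendsto_add tendsto_const ennreal_tendsto_cmult lh) simp
    then have B: "B \<longlonglongrightarrow> ennreal (1 / t ^ (N - 1)) * Lp_integral N \<Omega> h" by simp
    have le: "(\<integral>\<^sup>+x. ennreal (norm (\<phi> k x) ^ N * (l * hardy_weight R x)) \<partial>lebesgue_on \<Omega>) \<le> B k" for k
    proof -
      have "(\<integral>\<^sup>+x. ennreal (norm (\<phi> k x) ^ N * (l * hardy_weight R x)) \<partial>lebesgue_on \<Omega>)
        = (\<integral>\<^sup>+x. ennreal l * ennreal (norm (\<phi> k x) ^ N * hardy_weight R x) \<partial>lebesgue_on \<Omega>)"
        using l0 by (intro nn_integral_cong) (simp add: ennreal_mult'[symmetric] mult_ac)
      also have "\<dots> = ennreal l * (\<integral>\<^sup>+x. ennreal (norm (\<phi> k x) ^ N * hardy_weight R x) \<partial>lebesgue_on \<Omega>)"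
      proof (rule nn_integral_cmult)
        show "(\<lambda>x. ennreal (norm (\<phi> k x) ^ N * hardy_weight R x)) \<in> borel_measurable (lebesgue_on \<Omega>)"
          using bml wm by measurable
      qed
      also have "\<dots> \<le> energy (\<phi> k)"
        using least_quotient_le[OF \<phi>[of k]] hardy_mass_lebesgue_on[OF \<phi>[of k]] l(1) by (simp add: N_def)
      also have "\<dots> = (\<integral>\<^sup>+x. ennreal (norm (gradient (\<phi> k) x) ^ N * 1) \<partial>lebesgue_on \<Omega>)"
        using Lp_integral_gradient[OF \<phi>[of k]] by (simp add: Lp_integral_def N_def)
      also have "\<dots> \<le> ennreal (1 / t ^ (N - 1)) * (\<integral>\<^sup>+x. ennreal (norm (h x) ^ N * 1) \<partial>lebesgue_on \<Omega>) +
        ennreal (1 / (1 - t) ^ (N - 1)) * (\<integral>\<^sup>+x. ennreal (norm (gradient (\<phi> k) x - h x) ^ N * 1) \<partial>lebesgue_on \<Omega>)"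
        by (rule nn_integral_power_split[OF bml(2) hm one _ t N]) simp
      finally show ?thesis by (simp add: B_def Lp_integral_def)
    qed
    have lwm: "(\<lambda>x. l * hardy_weight R x) \<in> borel_measurable (lebesgue_on \<Omega>)" using wm by measurable
    have lu': "(\<lambda>k. \<integral>\<^sup>+x. ennreal (norm (\<phi> k x - u x) ^ N) \<partial>lebesgue_on \<Omega>) \<longlonglongrightarrow> 0" using lu by (simp add: Lp_integral_def)
    have "(\<integral>\<^sup>+x. ennreal (norm (u x) ^ N * (l * hardy_weight R x)) \<partial>lebesgue_on \<Omega>) \<le> ennreal (1 / t ^ (N - 1)) * Lp_integral N \<Omega> h"
      by (rule Lp_limit_integral_le[OF bml(1) um lwm N lu' le B])
    also have "(\<integral>\<^sup>+x. ennreal (norm (u x) ^ N * (l * hardy_weight R x)) \<partial>lebesgue_on \<Omega>)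
      = (\<integral>\<^sup>+x. ennreal l * ennreal (norm (u x) ^ N * hardy_weight R x) \<partial>lebesgue_on \<Omega>)"
      using l0 by (intro nn_integral_cong) (simp add: ennreal_mult'[symmetric] mult_ac)
    also have "\<dots> = ennreal l * I"
      unfolding I_def
    proof (rule nn_integral_cmult)
      show "(\<lambda>x. ennreal (norm (u x) ^ N * hardy_weight R x)) \<in> borel_measurable (lebesgue_on \<Omega>)"
        using um wm by measurable
    qed
    finally show ?thesis .
  qed
  obtain r where r: "Lp_integral N \<Omega> h = ennreal r" "r \<ge> 0"
    using h(1) by (cases "Lp_integral N \<Omega> h" rule: ennreal_cases) (auto simp: Lp_def)
  have "((\<lambda>t::real. ennreal (1 / t ^ (N - 1) * r)) \<longlongrightarrow> ennreal (1 / 1 ^ (N - 1) * r)) (at_left 1)"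
    by (intro tendsto_intros) auto
  then have lim: "((\<lambda>t::real. ennreal (1 / t ^ (N - 1) * r)) \<longlongrightarrow> ennreal r) (at_left 1)" by simp
  have "eventually (\<lambda>t::real. t \<in> {0<..<1}) (at_left 1)" by (rule eventually_at_left_real) simp
  then have "eventually (\<lambda>t::real. ennreal l * I \<le> ennreal (1 / t ^ (N - 1) * r)) (at_left 1)"
  proof eventually_elim
    case (elim t)
    then show ?case using lI[of t] r by (simp add: ennreal_mult[symmetric])
  qed
  from tendsto_lowerbound[OF lim this] have "ennreal l * I \<le> Lp_integral N \<Omega> h" using r by simp
  also have "Lp_integral N \<Omega> h = Lp_integral N \<Omega> g"
    unfolding Lp_integral_def
    by (rule nn_integral_cong_AE, rule AE_mp[OF weak_gradient_unique[OF op h(2) wg]]) (intro AE_I2, simp)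
  finally show ?thesis by (simp add: I_def l(1) N_def)
qed

end

section \<open>From slices to volumes\<close>

lemma ennreal_le_cancel_add:
  assumes "ennreal (c + d) \<le> ennreal c + X" "c \<ge> 0" "d \<ge> 0"
  shows "ennreal d \<le> X"
proof -
  have "ennreal c + ennreal d \<le> ennreal c + X" using assms by simp
  then show ?thesis unfolding ennreal_add_left_cancel_le by auto
qed

text \<open>On small spheres the slice of \<open>\<Omega>\<close> falls short of the whole sphere by a fixed fraction, so by
  subadditivity the complement has slices at least \<open>\<delta> * s ^ (DIM('a) - 1)\<close>; integrating over
  \<open>r / 2 < s < r\<close> by \<open>slices_coarea_le\<close> gives a hole of positive density. All spheres are
  compared with the unit sphere by scaling.\<close>

lemma hole_of_slices:
  fixes \<Omega> :: "'a::euclidean_space set"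
  assumes dim2: "DIM('a) \<ge> 2" and op: "open \<Omega>"
    and lim: "Limsup (at_right 0) (\<lambda>r. hausdorff_measure (DIM('a) - 1) {x \<in> \<Omega>. norm x = r} / ennreal (r ^ (DIM('a) - 1)))
      < hausdorff_measure (DIM('a) - 1) (sphere (0 :: 'a) 1)"
  shows "\<exists>\<theta>>0. \<exists>r0>0. \<forall>r. 0 < r \<and> r < r0 \<longrightarrow> ennreal (\<theta> * r ^ DIM('a)) \<le> emeasure lborel (cball 0 r - \<Omega>)"
proof -
  define d where "d = DIM('a) - 1"
  have DIM: "DIM('a) = Suc d" using dim2 by (simp add: d_def)
  define H where "H r = hausdorff_measure d {x \<in> \<Omega>. norm x = r}" for r
  obtain a1 where a1: "Limsup (at_right 0) (\<lambda>r. H r / ennreal (r ^ d)) < a1" "a1 < hausdorff_measure d (sphere (0::'a) 1)"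
    using lim dense unfolding H_def d_def by blast
  obtain c1 where c1: "a1 < c1" "c1 < hausdorff_measure d (sphere (0::'a) 1)" using a1(2) dense by blast
  obtain a where a: "a1 = ennreal a" "a \<ge> 0" using c1 by (cases a1 rule: ennreal_cases) auto
  obtain c where c: "c1 = ennreal c" "c \<ge> 0" using c1 by (cases c1 rule: ennreal_cases) auto
  have ac: "a < c" using c1(1) a c by (simp add: ennreal_less_iff)
  define \<delta> where "\<delta> = c - a"
  have \<delta>: "\<delta> > 0" using ac by (simp add: \<delta>_def)
  have "eventually (\<lambda>r. H r / ennreal (r ^ d) < ennreal a) (at_right 0)"
    using Limsup_lessD[OF a1(1)] a(1) by simp
  then obtain r0 where r0: "r0 > 0" "\<And>r. 0 < r \<Longrightarrow> r < r0 \<Longrightarrow> H r / ennreal (r ^ d) < ennreal a"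
    by (auto simp: eventually_at_right_field)
  have low: "ennreal (\<delta> * s ^ d) \<le> hausdorff_measure d (sphere (0::'a) s - \<Omega>)" if s: "0 < s" "s < r0" for s
  proof -
    have sd: "s ^ d > 0" using s by simp
    have "H s < ennreal a * ennreal (s ^ d)" using divide_less_ennreal[of "ennreal (s ^ d)" "H s" "ennreal a"] r0(2)[OF s] sd s by simp
    then have Hs: "H s \<le> ennreal (a * s ^ d)" using a sd by (simp add: ennreal_mult)
    have "(*\<^sub>R) (1 / s) ` sphere (0::'a) s = sphere 0 1"
    proof (rule set_eqI)
      fix x :: 'a
      show "x \<in> (*\<^sub>R) (1 / s) ` sphere 0 s \<longleftrightarrow> x \<in> sphere 0 1"
      proof
        assume "x \<in> sphere 0 1"
        then have "x = (1 / s) *\<^sub>R (s *\<^sub>R x)" "s *\<^sub>R x \<in> sphere 0 s" using s by auto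
        then show "x \<in> (*\<^sub>R) (1 / s) ` sphere 0 s" by blast
      qed (use s in auto)
    qed
    then have "hausdorff_measure d (sphere (0::'a) 1) \<le> ennreal ((1 / s) ^ d) * hausdorff_measure d (sphere (0::'a) s)"
      using hausdorff_measure_scale[of "1 / s" d "sphere (0::'a) s"] s by simp
    then have "ennreal c \<le> ennreal ((1 / s) ^ d) * hausdorff_measure d (sphere (0::'a) s)"
      using c1(2) c(1) by (meson less_imp_le order_trans)
    then have "ennreal (s ^ d) * ennreal c \<le> ennreal (s ^ d) * (ennreal ((1 / s) ^ d) * hausdorff_measure d (sphere (0::'a) s))"
      by (rule mult_left_mono) simp
    also have "\<dots> = ennreal (s ^ d * (1 / s) ^ d) * hausdorff_measure d (sphere (0::'a) s)"
      using s by (intro ennreal_mult_assoc) auto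
    also have "s ^ d * (1 / s) ^ d = 1" using s by (simp add: power_mult_distrib[symmetric])
    finally have "ennreal (s ^ d * c) \<le> hausdorff_measure d (sphere (0::'a) s)" using sd c by (simp add: ennreal_mult)
    also have "\<dots> \<le> hausdorff_measure d ({x \<in> \<Omega>. norm x = s} \<union> (sphere 0 s - \<Omega>))"
      by (intro hausdorff_measure_mono) auto
    also have "\<dots> \<le> H s + hausdorff_measure d (sphere 0 s - \<Omega>)" unfolding H_def by (rule hausdorff_measure_Un)
    also have "\<dots> \<le> ennreal (a * s ^ d) + hausdorff_measure d (sphere 0 s - \<Omega>)" by (intro add_right_mono Hs)
    finally have "ennreal (a * s ^ d + \<delta> * s ^ d) \<le> ennreal (a * s ^ d) + hausdorff_measure d (sphere 0 s - \<Omega>)"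
      by (simp add: \<delta>_def algebra_simps)
    then show ?thesis by (rule ennreal_le_cancel_add) (use a sd \<delta> in auto)
  qed
  define K where "K = 10 * 5 ^ (DIM('a) - 1) * unit_ball_vol (real (DIM('a) - 1)) / unit_ball_vol (real DIM('a))"
  have K: "K > 0" by (simp add: K_def)
  define \<theta> where "\<theta> = \<delta> / (2 ^ DIM('a) * K)"
  have \<theta>: "\<theta> > 0" using \<delta> K by (simp add: \<theta>_def)
  show ?thesis
  proof (rule exI[of _ \<theta>], rule conjI[OF \<theta>], rule exI[of _ r0], rule conjI[OF r0(1)], intro allI impI)
    fix r assume "0 < r \<and> r < r0"
    then have r: "0 < r" "r < r0" by auto
    define E where "E = cball (0::'a) r - \<Omega>"
    have "compact E" unfolding E_def using op by (intro compact_diff) auto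
    then have "ennreal (\<delta> * (r / 2) ^ d * (r - r / 2)) \<le> ennreal K * emeasure lborel E"
      unfolding K_def
    proof (rule slices_coarea_le)
      fix s assume s: "r / 2 < s" "s < r"
      have "ennreal (\<delta> * (r / 2) ^ d) \<le> ennreal (\<delta> * s ^ d)"
        using s r \<delta> by (intro ennreal_leI mult_left_mono power_mono) auto
      also have "\<dots> \<le> hausdorff_measure d (sphere (0::'a) s - \<Omega>)" by (rule low) (use s r in auto)
      also have "sphere (0::'a) s - \<Omega> = {x \<in> E. norm x = s}" using s by (auto simp: E_def)
      finally show "ennreal (\<delta> * (r / 2) ^ d) \<le> hausdorff_measure (DIM('a) - 1) {x \<in> E. norm x = s}" by (simp add: d_def)
    qed (use r \<delta> in auto)
    then have "ennreal (1 / K) * ennreal (\<delta> * (r / 2) ^ d * (r - r / 2)) \<le> ennreal (1 / K) * (ennreal K * emeasure lborel E)"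
      by (rule mult_left_mono) simp
    also have "\<dots> = ennreal (1 / K * K) * emeasure lborel E" using K by (intro ennreal_mult_assoc) auto
    also have "\<dots> = emeasure lborel E" using K by simp
    also have "ennreal (1 / K) * ennreal (\<delta> * (r / 2) ^ d * (r - r / 2)) = ennreal (1 / K * (\<delta> * (r / 2) ^ d * (r - r / 2)))"
      using K \<delta> r by (intro ennreal_mult[symmetric]) auto
    also have "1 / K * (\<delta> * (r / 2) ^ d * (r - r / 2)) = \<theta> * r ^ DIM('a)"
      unfolding \<theta>_def DIM using K by (simp add: power_divide field_simps)
    finally show "ennreal (\<theta> * r ^ DIM('a)) \<le> emeasure lborel (cball 0 r - \<Omega>)" by (simp add: E_def)
  qed
qed

lemma rim_of_slices:
  fixes \<Omega> :: "'a::euclidean_space set"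
  assumes lim: "Limsup (at_left R) (\<lambda>r. hausdorff_measure d {x \<in> \<Omega>. norm x = r} / ennreal ((R - r) ^ d)) = 0"
  shows "\<forall>\<eta>>0. \<exists>\<epsilon>>0. \<forall>s. R - \<epsilon> < s \<and> s < R \<longrightarrow>
       hausdorff_measure d {x \<in> \<Omega>. norm x = s} \<le> ennreal (\<eta> * (R - s) ^ d)"
proof (intro allI impI)
  fix \<eta> :: real assume \<eta>: "\<eta> > 0"
  have "Limsup (at_left R) (\<lambda>r. hausdorff_measure d {x \<in> \<Omega>. norm x = r} / ennreal ((R - r) ^ d)) < ennreal \<eta>"
    using lim \<eta> by simp
  from Limsup_lessD[OF this] obtain b where b: "b < R"
    "\<And>r. b < r \<Longrightarrow> r < R \<Longrightarrow> hausdorff_measure d {x \<in> \<Omega>. norm x = r} / ennreal ((R - r) ^ d) < ennreal \<eta>"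
    by (auto simp: eventually_at_left_field)
  have "hausdorff_measure d {x \<in> \<Omega>. norm x = s} \<le> ennreal (\<eta> * (R - s) ^ d)" if s: "b < s" "s < R" for s
  proof -
    have sd: "(R - s) ^ d > 0" using s by simp
    have "hausdorff_measure d {x \<in> \<Omega>. norm x = s} < ennreal \<eta> * ennreal ((R - s) ^ d)"
      using divide_less_ennreal[of "ennreal ((R - s) ^ d)" "hausdorff_measure d {x \<in> \<Omega>. norm x = s}" "ennreal \<eta>"] b(2)[OF s] sd s by simp
    then show ?thesis using \<eta> sd by (simp add: ennreal_mult less_imp_le)
  qed
  then show "\<exists>\<epsilon>>0. \<forall>s. R - \<epsilon> < s \<and> s < R \<longrightarrow> hausdorff_measure d {x \<in> \<Omega>. norm x = s} \<le> ennreal (\<eta> * (R - s) ^ d)"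
    using b(1) by (intro exI[of _ "R - b"]) auto
qed

section \<open>The quotient on the Sobolev space\<close>

context thin_domain
begin

lemma sobolev_mass_pos:
  assumes u: "u \<in> borel_measurable (lebesgue_on \<Omega>)" and nz: "nonzero_on \<Omega> u"
  shows "(\<integral>\<^sup>+x. ennreal (norm (u x) ^ DIM('a) * hardy_weight R x) \<partial>lebesgue_on \<Omega>) \<noteq> 0"
proof
  assume "(\<integral>\<^sup>+x. ennreal (norm (u x) ^ DIM('a) * hardy_weight R x) \<partial>lebesgue_on \<Omega>) = 0"
  moreover have "(\<lambda>x. ennreal (norm (u x) ^ DIM('a) * hardy_weight R x)) \<in> borel_measurable (lebesgue_on \<Omega>)"
  proof -
    note [measurable] = u borel_measurable_lebesgue_on[OF measurable_hardy_weight[of R]]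
    show ?thesis by measurable
  qed
  ultimately have "AE x in lebesgue_on \<Omega>. ennreal (norm (u x) ^ DIM('a) * hardy_weight R x) = 0"
    by (subst (asm) nn_integral_0_iff_AE)
  moreover have "AE x in lebesgue_on \<Omega>. x \<noteq> 0"
  proof -
    have "AE x in lebesgue. x \<in> \<Omega> \<longrightarrow> x \<noteq> (0 :: 'a)"
      by (rule AE_mp[OF AE_completion[OF AE_lborel_singleton[of 0]]]) simp
    then show ?thesis using op by (subst AE_restrict_space_iff) auto
  qed
  ultimately have "AE x in lebesgue_on \<Omega>. u x = 0"
  proof (rule AE_mp[OF AE_conjI, OF _ _ AE_I2, OF _ _ impI])
    fix x :: 'a assume x: "x \<in> space (lebesgue_on \<Omega>)"
      and *: "ennreal (norm (u x) ^ DIM('a) * hardy_weight R x) = 0 \<and> x \<noteq> 0"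
    have "norm x < R" using x by (intro inside) simp
    moreover have "1 / R ^ DIM('a) > 0" using R by simp
    moreover have "1 / R ^ DIM('a) \<le> hardy_weight R x"
      using * \<open>norm x < R\<close> by (intro hardy_weight_lower) auto
    ultimately have w: "hardy_weight R x > 0" by linarith
    have "norm (u x) ^ DIM('a) * hardy_weight R x \<le> 0" using * by (simp add: ennreal_eq_0_iff)
    then have "norm (u x) ^ DIM('a) \<le> 0" using w by (simp add: mult_le_0_iff)
    moreover have "u x \<noteq> 0 \<Longrightarrow> 0 < norm (u x) ^ DIM('a)" by (intro zero_less_power) simp
    ultimately show "u x = 0" by linarith
  qed
  then show False using nz by (simp add: nonzero_on_def)
qed

text \<open>Passage from test functions to quotients on the Sobolev space: the lower bound for every admissible
  pair of a function and a weak gradient, and a pair that meets it.\<close>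

lemma least_quotient_attained:
  obtains l u g where "l > ((real DIM('a) - 1) / real DIM('a)) ^ DIM('a)"
    "\<And>v h. v \<in> W1_0 DIM('a) \<Omega> \<Longrightarrow> nonzero_on \<Omega> v \<Longrightarrow> has_weak_gradient \<Omega> v h \<Longrightarrow>
       ennreal l \<le> Lp_integral DIM('a) \<Omega> h / (\<integral>\<^sup>+x. ennreal (norm (v x) ^ DIM('a) * hardy_weight R x) \<partial>lebesgue_on \<Omega>)"
    "u \<in> W1_0 DIM('a) \<Omega>" "nonzero_on \<Omega> u" "has_weak_gradient \<Omega> u g"
    "Lp_integral DIM('a) \<Omega> g / (\<integral>\<^sup>+x. ennreal (norm (u x) ^ DIM('a) * hardy_weight R x) \<partial>lebesgue_on \<Omega>) \<le> ennreal l"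
proof -
  define I where "I v = (\<integral>\<^sup>+x. ennreal (norm (v x) ^ DIM('a) * hardy_weight R x) \<partial>lebesgue_on \<Omega>)" for v :: "'a \<Rightarrow> real"
  obtain l where l: "least_quotient = ennreal l" "l > ((real DIM('a) - 1) / real DIM('a)) ^ DIM('a)"
    using least_quotient_real by blast
  have "0 \<le> ((real DIM('a) - 1) / real DIM('a)) ^ DIM('a)" using dim2 by simp
  then have l0: "l > 0" using l(2) by linarith
  have lower: "ennreal l \<le> Lp_integral DIM('a) \<Omega> h / I v"
    if v: "v \<in> W1_0 DIM('a) \<Omega>" "nonzero_on \<Omega> v" "has_weak_gradient \<Omega> v h" for v h
  proof -
    have vm: "v \<in> borel_measurable (lebesgue_on \<Omega>)" using v(1) by (simp add: W1_0_def W1_def Lp_def)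
    have I0: "I v \<noteq> 0" unfolding I_def by (rule sobolev_mass_pos[OF vm v(2)])
    obtain k where k: "k \<in> Lp DIM('a) \<Omega>" "has_weak_gradient \<Omega> v k" using v(1) by (auto simp: W1_0_def)
    have "ennreal l * I v \<le> Lp_integral DIM('a) \<Omega> k"
      using least_quotient_le_sobolev[OF v(1) k(2)] by (simp add: I_def l(1))
    also have "\<dots> < \<infinity>" using k(1) by (simp add: Lp_def)
    finally have It: "I v \<noteq> top" using l0 by (auto simp: ennreal_mult_top)
    have "ennreal l = ennreal l * I v / I v" using I0 It by (simp add: ennreal_mult_divide_eq)
    also have "\<dots> \<le> Lp_integral DIM('a) \<Omega> h / I v"
      using least_quotient_le_sobolev[OF v(1,3)] by (intro divide_right_mono_ennreal) (simp add: I_def l(1))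
    finally show ?thesis .
  qed
  obtain u g where u: "u \<in> W1_0 DIM('a) \<Omega>" "has_weak_gradient \<Omega> u g"
    "Lp_integral DIM('a) \<Omega> g \<le> least_quotient" "1 \<le> I u"
  proof (rule minimiser_exists)
    fix u g
    assume *: "u \<in> W1_0 DIM('a) \<Omega>" "has_weak_gradient \<Omega> u g" "Lp_integral DIM('a) \<Omega> g \<le> least_quotient"
      "1 \<le> (\<integral>\<^sup>+x. ennreal (norm (u x) ^ DIM('a) * hardy_weight R x) \<partial>lebesgue_on \<Omega>)"
    show thesis by (rule that[OF *[folded I_def]])
  qed
  have "nonzero_on \<Omega> u"
    unfolding nonzero_on_def
  proof
    assume z: "AE x in lebesgue_on \<Omega>. u x = 0"
    have "I u = (\<integral>\<^sup>+x. 0 \<partial>lebesgue_on \<Omega>)"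
      unfolding I_def
    proof (rule nn_integral_cong_AE, rule AE_mp[OF z], intro AE_I2 impI)
      fix x assume "u x = 0"
      then show "ennreal (norm (u x) ^ DIM('a) * hardy_weight R x) = 0" using dim2 by (simp add: power_0_left)
    qed
    then show False using u(4) by simp
  qed
  moreover have "Lp_integral DIM('a) \<Omega> g / I u \<le> ennreal l"
  proof (rule divide_le_posI_ennreal)
    show "0 < I u" using u(4) by (auto intro: less_le_trans[OF zero_less_one])
    have "Lp_integral DIM('a) \<Omega> g \<le> 1 * ennreal l" using u(3) l(1) by simp
    also have "\<dots> \<le> I u * ennreal l" by (intro mult_right_mono u(4)) simp
    finally show "Lp_integral DIM('a) \<Omega> g \<le> I u * ennreal l" .
  qed
  ultimately show ?thesis by (intro that[OF l(2) lower[unfolded I_def] u(1) _ u(2)]) (simp_all only: I_def)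
qed

end

text \<open>The supremum of the norm is not attained on an open set.\<close>

lemma norm_less_outer_radius:
  fixes \<Omega> :: "'a::euclidean_space set"
  assumes "open \<Omega>" "bounded \<Omega>" "x \<in> \<Omega>"
  shows "norm x < outer_radius \<Omega>"
proof -
  have bdd: "bdd_above (norm ` \<Omega>)" using assms(2) by (auto simp: bounded_iff bdd_above_def)
  obtain e where e: "e > 0" "ball x e \<subseteq> \<Omega>" using assms by (meson openE)
  obtain b :: 'a where b: "b \<in> Basis" using nonempty_Basis by blast
  define v where "v = (if x = 0 then b else x /\<^sub>R norm x)"
  have v: "norm v = 1" "norm (x + (e / 2) *\<^sub>R v) = norm x + e / 2"
  proof -
    show "norm v = 1" using b by (simp add: v_def)
    show "norm (x + (e / 2) *\<^sub>R v) = norm x + e / 2"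
    proof (cases "x = 0")
      case False
      have "(e / 2) *\<^sub>R v = (e / 2 / norm x) *\<^sub>R x"
        unfolding v_def if_not_P[OF False] scaleR_scaleR by (simp only: divide_inverse)
      then have "x + (e / 2) *\<^sub>R v = (1 + e / 2 / norm x) *\<^sub>R x" by (simp only: scaleR_add_left scaleR_one)
      then have "norm (x + (e / 2) *\<^sub>R v) = \<bar>1 + e / 2 / norm x\<bar> * norm x" by (simp only: norm_scaleR)
      also have "\<bar>1 + e / 2 / norm x\<bar> = 1 + e / 2 / norm x" using e(1) by (intro abs_of_nonneg add_nonneg_nonneg) auto
      also have "(1 + e / 2 / norm x) * norm x = norm x + e / 2" using False by (simp add: distrib_right)
      finally show ?thesis .
    qed (use b e in \<open>simp add: v_def\<close>)
  qed
  have "x + (e / 2) *\<^sub>R v \<in> ball x e" using e v(1) by (simp add: dist_norm)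
  then have "norm (x + (e / 2) *\<^sub>R v) \<le> outer_radius \<Omega>"
    unfolding outer_radius_def using e bdd by (intro cSUP_upper) auto
  then show ?thesis using v(2) e by simp
qed

theorem theorem5:
  fixes \<Omega> :: "(real^'n) set" and R :: real
  assumes "CARD('n) \<ge> 2"
    and "open \<Omega>" and "connected \<Omega>" and "\<Omega> \<noteq> {}" and "bounded \<Omega>"
    and "R = outer_radius \<Omega>"
    and "Limsup (at_right 0) (\<lambda>r. slice_measure \<Omega> r / ennreal (r ^ (CARD('n) - 1)))
           < hausdorff_measure (CARD('n) - 1) (sphere (0 :: real^'n) 1)"
    and "Limsup (at_left R) (\<lambda>r. slice_measure \<Omega> r / ennreal ((R - r) ^ (CARD('n) - 1))) = 0"
  shows "hardy_constant \<Omega> > ennreal (((real CARD('n) - 1) / real CARD('n)) ^ CARD('n)) \<and>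
         (\<exists>u \<in> W1_0 CARD('n) \<Omega>. nonzero_on \<Omega> u \<and> hardy_constant_attained_by \<Omega> u)"
proof -
  have DIM: "DIM(real^'n) = CARD('n)" by simp
  have inside: "norm x < R" if "x \<in> \<Omega>" for x
    using norm_less_outer_radius[OF assms(2,5) that] assms(6) by simp
  have R: "R > 0"
  proof -
    obtain x where "x \<in> \<Omega>" using assms(4) by blast
    then show ?thesis using inside[of x] norm_ge_zero[of x] by linarith
  qed
  interpret thin_domain \<Omega> R
  proof
    show "\<exists>\<theta>>0. \<exists>r0>0. \<forall>r. 0 < r \<and> r < r0 \<longrightarrow> ennreal (\<theta> * r ^ DIM(real^'n)) \<le> emeasure lborel (cball 0 r - \<Omega>)"
      by (rule hole_of_slices) (use assms in \<open>simp_all add: slice_measure_def[abs_def]\<close>)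
    show "\<forall>\<eta>>0. \<exists>\<epsilon>>0. \<forall>s. R - \<epsilon> < s \<and> s < R \<longrightarrow>
       hausdorff_measure (DIM(real^'n) - 1) {x \<in> \<Omega>. norm x = s} \<le> ennreal (\<eta> * (R - s) ^ (DIM(real^'n) - 1))"
      by (rule rim_of_slices) (use assms in \<open>simp_all add: slice_measure_def[abs_def]\<close>)
  qed (use assms inside R in auto)
  have I: "hardy_integral \<Omega> u = (\<integral>\<^sup>+x. ennreal (norm (u x) ^ CARD('n) * hardy_weight R x) \<partial>lebesgue_on \<Omega>)" for u
    by (simp add: hardy_integral_def hardy_weight_def assms(6))
  show ?thesis
  proof (rule least_quotient_attained[unfolded DIM])
    fix l u g
    assume l: "l > ((real CARD('n) - 1) / real CARD('n)) ^ CARD('n)"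
      and low: "\<And>v h. v \<in> W1_0 CARD('n) \<Omega> \<Longrightarrow> nonzero_on \<Omega> v \<Longrightarrow> has_weak_gradient \<Omega> v h \<Longrightarrow>
         ennreal l \<le> Lp_integral CARD('n) \<Omega> h / (\<integral>\<^sup>+x. ennreal (norm (v x) ^ CARD('n) * hardy_weight R x) \<partial>lebesgue_on \<Omega>)"
      and u: "u \<in> W1_0 CARD('n) \<Omega>" "nonzero_on \<Omega> u" "has_weak_gradient \<Omega> u g"
      and up: "Lp_integral CARD('n) \<Omega> g / (\<integral>\<^sup>+x. ennreal (norm (u x) ^ CARD('n) * hardy_weight R x) \<partial>lebesgue_on \<Omega>) \<le> ennreal l"
    note lower = low[folded I hardy_quotient_def] and upper = up[folded I hardy_quotient_def]
    have C: "hardy_constant \<Omega> = ennreal l"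
    proof (rule antisym)
      show "ennreal l \<le> hardy_constant \<Omega>"
        unfolding hardy_constant_def by (rule Inf_greatest) (auto intro: lower)
      have "hardy_constant \<Omega> \<le> hardy_quotient \<Omega> u g"
        unfolding hardy_constant_def by (rule Inf_lower) (use u in blast)
      then show "hardy_constant \<Omega> \<le> ennreal l" using upper by (rule order_trans)
    qed
    have "hardy_quotient \<Omega> u g = hardy_constant \<Omega>"
      unfolding C by (rule antisym[OF upper lower[OF u]])
    then have "hardy_constant_attained_by \<Omega> u" using u(3) by (auto simp: hardy_constant_attained_by_def)
    moreover have "hardy_constant \<Omega> > ennreal (((real CARD('n) - 1) / real CARD('n)) ^ CARD('n))"
      unfolding C using l assms(1) by (intro ennreal_lessI) (auto intro: le_less_trans[rotated])
    ultimately show ?thesis using u by blast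
  qed
qed

end
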